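(* Consider the marked Hawkes process $N$ described in the context, with total claim amount $S(t)=\int_{[0,t]\times\mathbb{S}}f(a)\,N(ds,da)$. Assume that $\kappa<1$ and that $X=f(A)$ is regularly varying with index $\alpha\in(0,1)\cup(1,2)$; when $\alpha\in(1,2)$, assume additionally that $Y=X+\kappa_A\mu_D$ is regularly varying with index $\alpha$, where $\mu_D=\mathbb{E}D$. (i) If $\alpha\in(0,1)$ and there exists $\delta>0$ such that $t^{\delta}\,\mathbb{E}[\tilde\mu_A(t,\infty)]\to0$ as $t\to\infty$, then there exist a sequence $(a_n)$ with $a_n\to\infty$ and an $\alpha$-stable random variable $G_\alpha$ such that, as $t\to\infty$, $$\frac{S(t)}{a_{\lfloor\nu t\rfloor}}\ \stackrel{d}{\longrightarrow}\ G_\alpha.$$ (ii) If $\alpha\in(1,2)$ and $t^{1+\delta-1/\alpha}\,\mathbb{E}[\tilde\mu_A(t,\infty)]\to0$ as $t\to\infty$ for some $\delta>0$, then there exist a sequence $(a_n)$ with $a_n\to\infty$ and an $\alpha$-stable random variable $G_\alpha$ such that, as $t\to\infty$, $$\frac{S(t)-t\,\nu\,\mu_D}{a_{\lfloor\nu t\rfloor}}\ \stackrel{d}{\longrightarrow}\ G_\alpha.$$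
   Context: Marked Hawkes process. Let $\mathbb{S}$ be a completely metrizable separable space with Borel $\sigma$-algebra, $Q$ a probability measure on $\mathbb{S}$, $\nu>0$, and $h:[0,\infty)\times\mathbb{S}\to[0,\infty)$ measurable. Let $A\sim Q$ be a generic mark and put $\tilde\mu_A(B)=\int_B h(s,A)\,ds$, $\kappa_A=\int_0^\infty h(s,A)\,ds$, $\tilde\mu_A(t,\infty)=\int_t^\infty h(s,A)\,ds$, and $\kappa=\mathbb{E}\kappa_A$. For a mark $a$, the cascade $G^a$ is the random point measure on $[0,\infty)\times\mathbb{S}$ defined recursively (generation by generation) by $G^a=\sum_{l=1}^{L_a}\big(\delta_{\tau_l^1,A_l^1}+\theta_{\tau_l^1}G^{A_l^1}\big)$, where $\sum_{l=1}^{L_a}\delta_{\tau^1_l,A^1_l}$ is a Poisson process on $[0,\infty)\times\mathbb{S}$ with mean measure $\tilde\mu_a\times Q$, the cascades $G^{A_l^1}$ are, given this Poisson process, independent with laws those of cascades started from the marks $A_l^1$, and $\theta_t$ shifts times by $t$: $\theta_t\sum_j\delta_{t_j,a_j}=\sum_j\delta_{t_j+t,a_j}$. Under $\kappa<1$ cascades are a.s. finite with finite mean size. Let $N^0=\sum_{i\ge1}\delta_{\Gamma_i,A_i}$ be a Poisson process on $[0,\infty)\times\mathbb{S}$ with intensity $(\nu\,\mathrm{Leb})\times Q$; given $N^0$, let $G^{A_i}=\sum_{j=1}^{K_i}\delta_{T_{ij},A_{ij}}$ be independent cascades started from the marks $A_i$, and put $T_{i0}=0$, $A_{i0}=A_i$.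 The marked Hawkes process is $N=\sum_{i}\sum_{j=0}^{K_i}\delta_{\Gamma_i+T_{ij},A_{ij}}$. Let $f:\mathbb{S}\to[0,\infty)$ be measurable; $X=f(A)$ is the generic claim size (with the same mark $A$ as in $\kappa_A$), and $D$ has the law of the cluster total $D_i=\sum_{j=0}^{K_i}f(A_{ij})$. A nonnegative random variable $Z$ is regularly varying with index $\alpha>0$ if $\mathbb{P}(Z>x)=x^{-\alpha}\ell(x)$ with $\ell$ slowly varying at infinity. Stable random variables are understood to be non-degenerate. *)

theory Defs
  imports "HOL-Probability.Probability"
begin

section \<open>Point measures and Poisson processes\<close>

text \<open>The sum of the unit masses at the points \<open>p i\<close>, \<open>i \<in> I\<close>, counted with multiplicity. Point
  measures on $[0,\infty) \times \mathbb{S}$ are represented as measures on \<open>real \<times> 's\<close>.\<close>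

definition dirac_sum :: "'i set \<Rightarrow> ('i \<Rightarrow> real \<times> 's) \<Rightarrow> (real \<times> 's::topological_space) measure"
  where "dirac_sum I p = distr (count_space I) (borel \<Otimes>\<^sub>M borel) p"

text \<open>A Poisson process with \<open>\<sigma>\<close>-finite mean measure \<open>m\<close>. As \<open>m\<close> is \<open>\<sigma>\<close>-finite, it is enough to
  prescribe the joint distribution of the counts of disjoint sets of finite mean.\<close>

definition poisson_process ::
  "'w measure \<Rightarrow> ('w \<Rightarrow> (real \<times> 's::topological_space) measure) \<Rightarrow> (real \<times> 's) measure \<Rightarrow> bool"
  where "poisson_process M \<xi> m \<longleftrightarrow>
    (\<forall>(J::nat set) B. finite J \<longrightarrow> disjoint_family_on B J \<longrightarrow>
        (\<forall>j\<in>J. B j \<in> sets m \<and> emeasure m (B j) < \<infinity>) \<longrightarrow>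
      prob_space.indep_vars M (\<lambda>_. borel) (\<lambda>j \<omega>. emeasure (\<xi> \<omega>) (B j)) J \<and>
      (\<forall>j\<in>J. \<forall>k::nat. measure M {\<omega> \<in> space M. emeasure (\<xi> \<omega>) (B j) = of_nat k}
        = measure m (B j) ^ k / fact k * exp (- measure m (B j))))"

text \<open>Given the random element \<open>W\<close> of \<open>V\<close>, the random elements \<open>X i\<close> of \<open>N\<close>, for those \<open>i\<close> in the
  index set \<open>I W\<close> determined by \<open>W\<close>, are independent, and \<open>X i\<close> has conditional law \<open>\<Lambda> W i\<close>.\<close>

definition indep_given :: "'w measure \<Rightarrow> 'v measure \<Rightarrow> ('w \<Rightarrow> 'v) \<Rightarrow> ('v \<Rightarrow> 'i set) \<Rightarrow>
    'x measure \<Rightarrow> ('i \<Rightarrow> 'w \<Rightarrow> 'x) \<Rightarrow> ('v \<Rightarrow> 'i \<Rightarrow> 'x measure) \<Rightarrow> bool"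
  where "indep_given M V W I N X \<Lambda> \<longleftrightarrow>
    (\<forall>J D C. finite J \<longrightarrow> D \<in> sets V \<longrightarrow> (\<forall>w\<in>D. J \<subseteq> I w) \<longrightarrow> (\<forall>i\<in>J. C i \<in> sets N) \<longrightarrow>
      emeasure M {\<omega> \<in> space M. W \<omega> \<in> D \<and> (\<forall>i\<in>J. X i \<omega> \<in> C i)}
        = (\<integral>\<^sup>+\<omega>. indicator D (W \<omega>) * (\<Prod>i\<in>J. emeasure (\<Lambda> (W \<omega>) i) (C i)) \<partial>M))"


section \<open>Cascades\<close>

definition displ_measure :: "(real \<Rightarrow> 's \<Rightarrow> real) \<Rightarrow> 's \<Rightarrow> real measure"
  where "displ_measure h a = density lborel (\<lambda>s. ennreal (h s a) * indicator {0..} s)"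

definition kappa_mark :: "(real \<Rightarrow> 's \<Rightarrow> real) \<Rightarrow> 's \<Rightarrow> ennreal"
  where "kappa_mark h a = emeasure (displ_measure h a) {0..}"

definition kappa :: "(real \<Rightarrow> 's \<Rightarrow> real) \<Rightarrow> 's measure \<Rightarrow> ennreal"
  where "kappa h Q = (\<integral>\<^sup>+a. kappa_mark h a \<partial>Q)"

definition mean_tail :: "(real \<Rightarrow> 's \<Rightarrow> real) \<Rightarrow> 's measure \<Rightarrow> real \<Rightarrow> ennreal"
  where "mean_tail h Q t = (\<integral>\<^sup>+a. emeasure (displ_measure h a) {t<..} \<partial>Q)"

text \<open>The genealogy of a cascade. An individual is addressed by the list \<open>[l\<^sub>1, \<dots>, l\<^sub>n]\<close> saying that
  it is child number \<open>l\<^sub>n\<close> of \<open>\<dots>\<close> of child number \<open>l\<^sub>1\<close> of the root \<open>[]\<close>. A tree \<open>T\<close> gives for each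
  address \<open>u\<close> the pair \<open>(L, p)\<close> of the number of children and of their displacements (time elapsed
  since the birth of \<open>u\<close>) and marks: the children of \<open>u\<close> are \<open>p 0, p 1, \<dots>\<close> up to \<open>L\<close> excluded.
  Values of \<open>p\<close> from \<open>L\<close> on, and of \<open>T\<close> at addresses that are not alive, are irrelevant.
  The number of children may be infinite if \<open>kappa_mark h a = \<infinity>\<close>.\<close>

type_synonym 's offspring = "enat \<times> (nat \<Rightarrow> real \<times> 's)"
type_synonym 's tree = "nat list \<Rightarrow> 's offspring"

definition offspring_space :: "'s::topological_space offspring measure"
  where "offspring_space = count_space UNIV \<Otimes>\<^sub>M (\<Pi>\<^sub>M l\<in>UNIV. borel \<Otimes>\<^sub>M borel)"

definition tree_space :: "'s::topological_space tree measure"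
  where "tree_space = (\<Pi>\<^sub>M u\<in>UNIV. offspring_space)"

definition children :: "'s offspring \<Rightarrow> nat set"
  where "children w = {l. enat l < fst w}"

definition subtree :: "nat \<Rightarrow> 's tree \<Rightarrow> 's tree"
  where "subtree l T = (\<lambda>u. T (l # u))"

primrec alive :: "nat list \<Rightarrow> 's tree \<Rightarrow> bool" where
  "alive [] T \<longleftrightarrow> True"
| "alive (l # u) T \<longleftrightarrow> l \<in> children (T []) \<and> alive u (subtree l T)"

definition shift :: "real \<Rightarrow> real \<times> 's \<Rightarrow> real \<times> 's"
  where "shift t p = (t + fst p, snd p)"

text \<open>The time (after the birth of the root) and the mark of individual \<open>u\<close>, if the root has
  mark \<open>a\<close>.\<close>

primrec point :: "nat list \<Rightarrow> 's \<Rightarrow> 's tree \<Rightarrow> real \<times> 's" where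
  "point [] a T = (0, a)"
| "point (l # u) a T =
    (let (\<tau>, b) = snd (T []) l in shift \<tau> (point u b (subtree l T)))"

text \<open>The point measure $G^a$ along the genealogy \<open>T\<close>; its recursive description is proved below.\<close>

definition cascade :: "'s::topological_space \<Rightarrow> 's tree \<Rightarrow> (real \<times> 's) measure"
  where "cascade a T = dirac_sum {u. alive u T \<and> u \<noteq> []} (\<lambda>u. point u a T)"

text \<open>\<open>K a\<close> is the law of the genealogy of the cascade started from the mark \<open>a\<close>: the children of
  the root form a Poisson process, and given these, their own genealogies are independent with the
  laws belonging to their marks. Unfolding this generation by generation determines the law of
  the cascade.\<close>

definition cascade_kernel ::
  "(real \<Rightarrow> 's \<Rightarrow> real) \<Rightarrow> 's measure \<Rightarrow> ('s::topological_space \<Rightarrow> 's tree measure) \<Rightarrow> bool"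
  where "cascade_kernel h Q K \<longleftrightarrow>
    K \<in> borel \<rightarrow>\<^sub>M prob_algebra tree_space \<and>
    (\<forall>a. poisson_process (K a) (\<lambda>T. dirac_sum (children (T [])) (snd (T [])))
           (displ_measure h a \<Otimes>\<^sub>M Q) \<and>
         indep_given (K a) offspring_space (\<lambda>T. T []) children
           tree_space subtree (\<lambda>w l. K (snd (snd w l))))"

lemma emeasure_dirac_sum:
  fixes p :: "'i \<Rightarrow> real \<times> 's::topological_space"
  assumes "B \<in> sets (borel \<Otimes>\<^sub>M borel)"
  shows "emeasure (dirac_sum I p) B = (\<integral>\<^sup>+i. indicator B (p i) \<partial>count_space I)"
proof -
  have p: "p \<in> count_space I \<rightarrow>\<^sub>M borel \<Otimes>\<^sub>M borel"
    by (simp add: measurable_def space_pair_measure)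
  have "(\<integral>\<^sup>+i. indicator B (p i) \<partial>count_space I)
      = (\<integral>\<^sup>+i. indicator (p -` B \<inter> I) i \<partial>count_space I)"
    by (intro nn_integral_cong) (auto split: split_indicator)
  also have "\<dots> = emeasure (count_space I) (p -` B \<inter> I)"
    by simp
  finally show ?thesis
    using assms p by (simp add: dirac_sum_def emeasure_distr)
qed

lemma cascade_rec:
  fixes a :: "'s::topological_space"
  assumes B: "B \<in> sets (borel \<Otimes>\<^sub>M borel)"
  shows "emeasure (cascade a T) B =
    (\<integral>\<^sup>+l. (case snd (T []) l of (\<tau>, b) \<Rightarrow>
       indicator B (\<tau>, b) + emeasure (cascade b (subtree l T)) {p. shift \<tau> p \<in> B})
     \<partial>count_space (children (T [])))"
proof -
  let ?L = "children (T [])"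
  let ?U = "\<lambda>l. {u. alive u (subtree l T)}"
  define g where "g l u = (indicator B (point (l # u) a T) :: ennreal)" for l u
  have img: "{u. alive u T \<and> u \<noteq> []} = (\<lambda>(l, u). l # u) ` (SIGMA l:?L. ?U l)" (is "?I = _")
  proof (rule set_eqI)
    fix u show "u \<in> ?I \<longleftrightarrow> u \<in> (\<lambda>(l, u). l # u) ` (SIGMA l:?L. ?U l)"
      by (cases u) auto
  qed
  have inner: "(\<integral>\<^sup>+u. g l u \<partial>count_space (?U l)) = (case snd (T []) l of (\<tau>, b) \<Rightarrow>
      indicator B (\<tau>, b) + emeasure (cascade b (subtree l T)) {p. shift \<tau> p \<in> B})" for l
  proof -
    obtain \<tau> b where tb: "snd (T []) l = (\<tau>, b)" by (cases "snd (T []) l")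
    have sh: "shift \<tau> \<in> (borel \<Otimes>\<^sub>M borel :: (real \<times> 's) measure) \<rightarrow>\<^sub>M borel \<Otimes>\<^sub>M borel"
      unfolding shift_def by measurable
    have S: "{p. shift \<tau> p \<in> B} \<in> sets (borel \<Otimes>\<^sub>M borel)"
      using measurable_sets[OF sh B] by (simp add: vimage_def space_pair_measure)
    have g: "g l u = indicator {p. shift \<tau> p \<in> B} (point u b (subtree l T))" for u
      by (simp add: g_def tb split: split_indicator)
    have "(\<integral>\<^sup>+u. g l u \<partial>count_space (?U l)) = (\<integral>\<^sup>+u. g l u * indicator (?U l) u \<partial>count_space UNIV)"
      by (simp add: nn_integral_count_space_indicator)
    also have "\<dots> = (\<integral>\<^sup>+u. g l u * indicator {[]} u +
        g l u * indicator {u. alive u (subtree l T) \<and> u \<noteq> []} u \<partial>count_space UNIV)"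
      by (intro nn_integral_cong) (auto split: split_indicator)
    also have "\<dots> = g l [] + (\<integral>\<^sup>+u. g l u \<partial>count_space {u. alive u (subtree l T) \<and> u \<noteq> []})"
      by (subst nn_integral_add) (simp_all add: nn_integral_count_space_indicator)
    also have "g l [] = indicator B (\<tau>, b)"
      by (simp add: g_def tb shift_def)
    also have "(\<integral>\<^sup>+u. g l u \<partial>count_space {u. alive u (subtree l T) \<and> u \<noteq> []})
        = emeasure (cascade b (subtree l T)) {p. shift \<tau> p \<in> B}"
      unfolding cascade_def emeasure_dirac_sum[OF S] g ..
    finally show ?thesis by (simp add: tb)
  qed
  have "emeasure (cascade a T) B = (\<integral>\<^sup>+u. indicator B (point u a T) \<partial>count_space ?I)"
    unfolding cascade_def emeasure_dirac_sum[OF B] ..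
  also have "\<dots> = (\<integral>\<^sup>+x. (case x of (l, u) \<Rightarrow> g l u) \<partial>count_space (SIGMA l:?L. ?U l))"
  proof -
    have "bij_betw (\<lambda>(l, u). l # u) (SIGMA l:?L. ?U l) ?I"
      unfolding img by (auto simp: bij_betw_def inj_on_def)
    from nn_integral_bij_count_space[OF this, of "\<lambda>u. indicator B (point u a T)"]
    show ?thesis by (simp add: g_def split_beta del: point.simps)
  qed
  also have "\<dots> = (\<integral>\<^sup>+x. (case x of (l, u) \<Rightarrow> g l u * indicator (?U l) u * indicator ?L l) \<partial>count_space UNIV)"
    by (subst nn_integral_count_space_indicator)
       (auto intro!: nn_integral_cong split: split_indicator)
  also have "\<dots> = (\<integral>\<^sup>+l. \<integral>\<^sup>+u. g l u * indicator (?U l) u * indicator ?L l \<partial>count_space UNIV \<partial>count_space UNIV)"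
    by (subst nn_integral_fst_count_space[symmetric]) simp
  also have "\<dots> = (\<integral>\<^sup>+l. (\<integral>\<^sup>+u. g l u \<partial>count_space (?U l)) \<partial>count_space ?L)"
    by (simp add: nn_integral_count_space_indicator nn_integral_multc)
  finally show ?thesis unfolding inner .
qed


section \<open>The marked Hawkes process\<close>

text \<open>\<open>\<Gamma> i\<close> and \<open>A i\<close> are the time and the mark of the \<open>i\<close>-th immigrant, in order of arrival, and
  \<open>C i\<close> is the genealogy of its cascade. The ordering is what makes the clusters identically
  distributed in \<open>i\<close>; an enumeration depending on the marks could bias the law of \<open>A i\<close>.\<close>

locale marked_hawkes = prob_space M
  for M :: "'w measure" +
  fixes Q :: "'s::polish_space measure"
    and \<nu> :: real
    and h :: "real \<Rightarrow> 's \<Rightarrow> real"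
    and K :: "'s \<Rightarrow> 's tree measure"
    and \<Gamma> :: "nat \<Rightarrow> 'w \<Rightarrow> real"
    and A :: "nat \<Rightarrow> 'w \<Rightarrow> 's"
    and C :: "nat \<Rightarrow> 'w \<Rightarrow> 's tree"
  assumes Q_prob: "prob_space Q"
    and Q_sets: "sets Q = sets borel"
    and nu_pos: "\<nu> > 0"
    and h_measurable:
      "case_prod h \<in> borel_measurable (restrict_space (borel \<Otimes>\<^sub>M borel) ({0..} \<times> UNIV))"
    and h_nonneg: "\<And>s a. s \<ge> 0 \<Longrightarrow> h s a \<ge> 0"
    and kernel: "cascade_kernel h Q K"
    and Gamma_measurable: "\<And>i. \<Gamma> i \<in> borel_measurable M"
    and A_measurable: "\<And>i. A i \<in> M \<rightarrow>\<^sub>M borel"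
    and C_measurable: "\<And>i. C i \<in> M \<rightarrow>\<^sub>M tree_space"
    and arrival_order: "AE \<omega> in M. strict_mono (\<lambda>i. \<Gamma> i \<omega>)"
    and immigrants: "poisson_process M (\<lambda>\<omega>. dirac_sum UNIV (\<lambda>i. (\<Gamma> i \<omega>, A i \<omega>)))
      (density lborel (\<lambda>s. ennreal \<nu> * indicator {0..} s) \<Otimes>\<^sub>M Q)"
    and clusters: "indep_given M (\<Pi>\<^sub>M i\<in>UNIV. borel \<Otimes>\<^sub>M borel) (\<lambda>\<omega> i. (\<Gamma> i \<omega>, A i \<omega>)) (\<lambda>_. UNIV)
      tree_space C (\<lambda>w i. K (snd (w i)))"

text \<open>The members of cluster \<open>i\<close>, including the immigrant itself, are the addresses alive in \<open>C i\<close>.\<close>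

definition hawkes :: "(nat \<Rightarrow> 'w \<Rightarrow> real) \<Rightarrow> (nat \<Rightarrow> 'w \<Rightarrow> 's) \<Rightarrow> (nat \<Rightarrow> 'w \<Rightarrow> 's tree) \<Rightarrow>
    'w \<Rightarrow> (real \<times> 's::topological_space) measure"
  where "hawkes \<Gamma> A C \<omega> = dirac_sum {(i, u). alive u (C i \<omega>)}
    (\<lambda>(i, u). shift (\<Gamma> i \<omega>) (point u (A i \<omega>) (C i \<omega>)))"

definition cluster_total :: "('s \<Rightarrow> real) \<Rightarrow> (nat \<Rightarrow> 'w \<Rightarrow> 's) \<Rightarrow> (nat \<Rightarrow> 'w \<Rightarrow> 's tree) \<Rightarrow>
    nat \<Rightarrow> 'w \<Rightarrow> ennreal"
  where "cluster_total f A C i \<omega> =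
    (\<integral>\<^sup>+u. ennreal (f (snd (point u (A i \<omega>) (C i \<omega>)))) \<partial>count_space {u. alive u (C i \<omega>)})"

text \<open>All clusters have the same law, so \<open>\<mu>\<^sub>D\<close> may be read off from cluster \<open>0\<close>.\<close>

definition mu_D :: "'w measure \<Rightarrow> ('s \<Rightarrow> real) \<Rightarrow> (nat \<Rightarrow> 'w \<Rightarrow> 's) \<Rightarrow> (nat \<Rightarrow> 'w \<Rightarrow> 's tree) \<Rightarrow> ennreal"
  where "mu_D M f A C = (\<integral>\<^sup>+\<omega>. cluster_total f A C 0 \<omega> \<partial>M)"

text \<open>The integral is almost surely finite if \<open>kappa h Q < 1\<close>.\<close>

definition total_claim :: "('s::topological_space \<Rightarrow> real) \<Rightarrow> (nat \<Rightarrow> 'w \<Rightarrow> real) \<Rightarrow> (nat \<Rightarrow> 'w \<Rightarrow> 's) \<Rightarrow>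
    (nat \<Rightarrow> 'w \<Rightarrow> 's tree) \<Rightarrow> real \<Rightarrow> 'w \<Rightarrow> real"
  where "total_claim f \<Gamma> A C t \<omega> = enn2real
    (\<integral>\<^sup>+p. ennreal (f (snd p)) * indicator ({0..t} \<times> UNIV) p \<partial>hawkes \<Gamma> A C \<omega>)"


section \<open>Regular variation, stable laws, convergence in distribution\<close>

definition slowly_varying :: "(real \<Rightarrow> real) \<Rightarrow> bool"
  where "slowly_varying l \<longleftrightarrow>
    (\<exists>x0>0. l \<in> borel_measurable (restrict_space borel {x0..}) \<and> (\<forall>x\<ge>x0. l x > 0)) \<and>
    (\<forall>c>0. ((\<lambda>x. l (c * x) / l x) \<longlongrightarrow> 1) at_top)"

definition regularly_varying_rv :: "'a measure \<Rightarrow> ('a \<Rightarrow> ennreal) \<Rightarrow> real \<Rightarrow> bool"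
  where "regularly_varying_rv M Z \<alpha> \<longleftrightarrow> Z \<in> borel_measurable M \<and>
    (\<exists>l. slowly_varying l \<and>
      (\<forall>x>0. measure M {\<omega> \<in> space M. Z \<omega> > ennreal x} = x powr (-\<alpha>) * l x))"

text \<open>If \<open>Z\<^sub>1, Z\<^sub>2, Z\<close> are independent with the (non-degenerate) law \<open>P\<close>, then for all \<open>a, b > 0\<close>
  the law of \<open>a Z\<^sub>1 + b Z\<^sub>2\<close> is that of \<open>c Z + d\<close> for some real \<open>d\<close>, where \<open>c\<^sup>\<alpha> = a\<^sup>\<alpha> + b\<^sup>\<alpha>\<close>.\<close>

definition stable_law :: "real \<Rightarrow> real measure \<Rightarrow> bool"
  where "stable_law \<alpha> P \<longleftrightarrow> 0 < \<alpha> \<and> \<alpha> \<le> 2 \<and> prob_space P \<and> sets P = sets borel \<and>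
    (\<forall>c. P \<noteq> return borel c) \<and>
    (\<forall>a>0. \<forall>b>0. \<exists>d. distr (P \<Otimes>\<^sub>M P) borel (\<lambda>(x, y). a * x + b * y)
      = distr P borel (\<lambda>x. (a powr \<alpha> + b powr \<alpha>) powr (1 / \<alpha>) * x + d))"

text \<open>The notion \<^const>\<open>weak_conv_m\<close>, for the limit \<open>t \<rightarrow> \<infinity>\<close> over the reals.\<close>

definition conv_in_distr :: "'w measure \<Rightarrow> (real \<Rightarrow> 'w \<Rightarrow> real) \<Rightarrow> real measure \<Rightarrow> bool"
  where "conv_in_distr M Z P \<longleftrightarrow>
    (\<forall>x. isCont (cdf P) x \<longrightarrow> ((\<lambda>t. cdf (distr M borel (Z t)) x) \<longlongrightarrow> cdf P x) at_top)"

end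

theory Submission
  imports Defs
begin

text \<open>The tail of the cluster total is never computed: everything is done with characteristic functions,
for which the branching structure gives a closed equation.

Let \<open>D\<close> be a cluster total and \<open>\<phi>\<close> its characteristic function. Splitting a cluster at its root,
whose offspring is Poisson, gives \<open>\<phi>(v) = E [exp (i v X) exp (- \<kappa>\<^sub>A (1 - \<phi>(v)))]\<close> (\<open>charK_eq\<close>,
\<open>char_total_fixpoint\<close>). Put \<open>Z = X\<close> and \<open>q(v) = 1 - \<phi>(v)\<close> if \<open>\<alpha> < 1\<close>, and
\<open>Z = X + \<kappa>\<^sub>A \<mu>\<^sub>D\<close> and \<open>q(v) = 1 - \<phi>(v) + i v \<mu>\<^sub>D\<close> if \<open>\<alpha> > 1\<close>. Since \<open>E Z = \<mu>\<^sub>D\<close> in the second case,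
the equation becomes
\<open>q(v) = E [k (v Z)] + E [exp (i v Z) (1 - exp (- \<kappa>\<^sub>A q(v)))]\<close>
with \<open>k(y) = 1 - exp (i y)\<close>, plus \<open>i y\<close> if \<open>\<alpha> > 1\<close> (\<open>centred_char_fixpoint\<close>). As \<open>Re q \<ge> 0\<close>,
dominated convergence shows that the last expectation is \<open>(\<kappa> + o(1)) q(v)\<close> for \<open>v \<rightarrow> 0\<close>, so
\<open>q(v)\<close> is asymptotically \<open>E [k (v Z)] / (1 - \<kappa>)\<close> (\<open>fixpoint_transfer\<close>). The hypothesis on \<open>Z\<close>
enters through one limit: \<open>E [k (Z / x)] / P (Z > x)\<close> tends to a constant with positive real part
(\<open>rv_kernel_limit\<close>). Hence \<open>q\<close> is regularly varying at \<open>0\<close>, and if \<open>a\<^sub>n\<close> is chosen with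
\<open>Re q(1 / a\<^sub>n) = 1 / n\<close> for large \<open>n\<close>, then \<open>n q(u / a\<^sub>n)\<close> converges to the exponent of an \<open>\<alpha>\<close>-stable law
(\<open>normalising_sequence\<close>).

Let \<open>R(t)\<close> be the sum of the totals of all clusters whose immigrant has arrived by time \<open>t\<close>. This
is a compound Poisson sum, with characteristic function \<open>exp (- \<nu> t (1 - \<phi>))\<close>
(\<open>char_cluster_sum\<close>). After centring and norming it is \<open>exp (- \<nu> t q(u / a))\<close>, which
converges by the preceding paragraph. The existence of the limit law, with the claimed stability,
comes from tightness and Helly's theorem (\<open>levy_existence\<close>, \<open>stable_law_of_char\<close>).

Finally, \<open>R(t) - S(t)\<close> consists of the claims made after time \<open>t\<close> in clusters that began before.
Let \<open>\<gamma> \<le> 1\<close> and \<open>p < 1\<close>. The indicator of a delay \<open>T > r\<close> is at most \<open>(T / r)\<^sup>p\<close>,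
and \<open>\<gamma>\<close>-th powers are subadditive, so
\<open>E (R(t) - S(t))\<^sup>\<gamma> \<le> C t\<^sup>1\<^sup>-\<^sup>p\<close> as soon as the sum over a cluster of \<open>f(A\<^sub>j)\<^sup>\<gamma> T\<^sub>j\<^sup>p\<close> has finite mean.
This is a statement about means only, which are computed generation by generation
(\<open>mean_timed_finite\<close>). The tail hypothesis on the displacements allows a choice of \<open>\<gamma>\<close> and \<open>p\<close>
with \<open>(1 - p) \<alpha> < \<gamma>\<close>, and then \<open>t\<^sup>1\<^sup>-\<^sup>p\<close> is negligible against \<open>a\<^sup>\<gamma>\<close>; since
\<open>\<bar>exp (i v S) - exp (i v R)\<bar> \<le> 2 (\<bar>v\<bar> (R - S))\<^sup>\<gamma>\<close>, both characteristic functions have the same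
limit (\<open>char_total_claim_close\<close>).

The two Poisson processes involved, the immigrants with their cascades and the children of the root
with theirs, are treated at once in the locale \<open>marked_points\<close>.\<close>

section \<open>Characteristic functions and stable laws\<close>

text \<open>Averaging \<open>1 - cos (u x)\<close> over \<open>u\<close> in an interval of length \<open>\<delta>\<close> gives
  \<open>1 - sin (\<delta> x) / (\<delta> x)\<close>, which is at least \<open>1 / 2\<close> once \<open>\<bar>x\<bar> \<ge> 2 / \<delta>\<close>.\<close>

lemma char_tail_bound:
  assumes "real_distribution \<mu>" and \<delta>: "\<delta> > 0"
  shows "measure \<mu> {x. 2 / \<delta> \<le> \<bar>x\<bar>}
    \<le> 2 / \<delta> * (\<integral>u. indicator {0..\<delta>} u * (1 - Re (char \<mu> u)) \<partial>lborel)"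
proof -
  interpret real_distribution \<mu> by fact
  interpret P: pair_sigma_finite \<mu> lborel ..
  define g :: "real \<Rightarrow> real \<Rightarrow> real" where "g u x = indicator {0..\<delta>} u * (1 - cos (u * x))" for u x
  have g0: "g u x \<ge> 0" for u x by (auto simp: g_def)
  have gm [measurable]: "(\<lambda>(u, x). g u x) \<in> borel_measurable (borel \<Otimes>\<^sub>M borel)"
    unfolding g_def by measurable
  have Re_char: "1 - Re (char \<mu> u) = (\<integral>x. 1 - cos (u * x) \<partial>\<mu>)" for u
  proof -
    have 1: "integrable \<mu> (\<lambda>x. cos (u * x))"
      by (rule integrable_const_bound[of _ 1]) auto
    have "Re (char \<mu> u) = (\<integral>x. Re (iexp (u * x)) \<partial>\<mu>)"
      unfolding char_def by (rule integral_Re[symmetric]) (rule integrable_iexp, auto)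
    also have "\<dots> = (\<integral>x. cos (u * x) \<partial>\<mu>)"
      by (simp add: Re_exp)
    finally show ?thesis using 1 prob_space by (simp add: Bochner_Integration.integral_diff)
  qed
  have char1: "Re (char \<mu> u) \<le> 1" for u
    using cmod_char_le_1[of u] complex_Re_le_cmod[of "char \<mu> u"] by linarith
  have char2: "-1 \<le> Re (char \<mu> u)" for u
    using cmod_char_le_1[of u] abs_Re_le_cmod[of "char \<mu> u"] by linarith
  have inner: "(\<integral>\<^sup>+u. g u x \<partial>lborel) \<ge> ennreal (\<delta> / 2) * indicator {x. 2 / \<delta> \<le> \<bar>x\<bar>} x" for x
  proof (cases "2 / \<delta> \<le> \<bar>x\<bar>")
    case True
    then have x: "x \<noteq> 0" using \<delta> by auto
    have "(\<integral>\<^sup>+u. g u x \<partial>lborel) = (\<integral>\<^sup>+u. ennreal (1 - cos (u * x)) * indicator {0..\<delta>} u \<partial>lborel)"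
      by (intro nn_integral_cong) (auto simp: g_def split: split_indicator)
    also have "\<dots> = ennreal ((\<delta> - sin (\<delta> * x) / x) - (0 - sin (0 * x) / x))"
      using x \<delta> by (intro nn_integral_FTC_Icc) (auto intro!: derivative_eq_intros)
    finally have eq: "(\<integral>\<^sup>+u. g u x \<partial>lborel) = ennreal (\<delta> - sin (\<delta> * x) / x)" by simp
    have "sin (\<delta> * x) / x \<le> 1 / \<bar>x\<bar>"
      by (metis abs_divide abs_ge_self abs_ge_zero abs_sin_le_one divide_right_mono order_trans)
    also have "\<dots> \<le> \<delta> / 2" using True \<delta> x by (simp add: field_simps)
    finally have "\<delta> / 2 \<le> \<delta> - sin (\<delta> * x) / x" by simp
    then show ?thesis using True unfolding eq by (simp add: ennreal_leI)
  qed auto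
  have "ennreal (\<delta> / 2 * measure \<mu> {x. 2 / \<delta> \<le> \<bar>x\<bar>}) = ennreal (\<delta> / 2) * emeasure \<mu> {x. 2 / \<delta> \<le> \<bar>x\<bar>}"
    using \<delta> by (simp add: emeasure_eq_measure ennreal_mult del: times_divide_eq_left)
  also have "\<dots> = (\<integral>\<^sup>+x. ennreal (\<delta> / 2) * indicator {x. 2 / \<delta> \<le> \<bar>x\<bar>} x \<partial>\<mu>)"
    by (subst nn_integral_cmult_indicator) auto
  also have "\<dots> \<le> (\<integral>\<^sup>+x. \<integral>\<^sup>+u. g u x \<partial>lborel \<partial>\<mu>)"
    by (intro nn_integral_mono inner)
  also have "\<dots> = (\<integral>\<^sup>+u. \<integral>\<^sup>+x. g u x \<partial>\<mu> \<partial>lborel)"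
    by (rule P.Fubini'[symmetric]) measurable
  also have "\<dots> = (\<integral>\<^sup>+u. ennreal (indicator {0..\<delta>} u * (1 - Re (char \<mu> u))) \<partial>lborel)"
  proof (rule nn_integral_cong)
    fix u :: real
    have "(\<integral>\<^sup>+x. g u x \<partial>\<mu>) = ennreal (\<integral>x. g u x \<partial>\<mu>)"
      by (intro nn_integral_eq_integral integrable_const_bound[of _ 2])
         (auto simp: g0 g_def split: split_indicator)
    also have "(\<integral>x. g u x \<partial>\<mu>) = indicator {0..\<delta>} u * (1 - Re (char \<mu> u))"
      unfolding Re_char g_def by simp
    finally show "(\<integral>\<^sup>+x. g u x \<partial>\<mu>) = ennreal (indicator {0..\<delta>} u * (1 - Re (char \<mu> u)))" .
  qed
  also have "\<dots> = ennreal (\<integral>u. indicator {0..\<delta>} u * (1 - Re (char \<mu> u)) \<partial>lborel)"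
  proof (rule nn_integral_eq_integral)
    have "integrable lborel (\<lambda>u. indicator {0..\<delta>} u *\<^sub>R (1 - Re (char \<mu> u)))"
    proof (rule integrableI_bounded_set_indicator[where B=2])
      show "AE x in lborel. x \<in> {0..\<delta>} \<longrightarrow> norm (1 - Re (char \<mu> x)) \<le> 2"
        using char1 char2 by (intro AE_I2) (auto simp: abs_le_iff)
    qed (auto simp: emeasure_lborel_Icc_eq)
    then show "integrable lborel (\<lambda>u. indicator {0..\<delta>} u * (1 - Re (char \<mu> u)))" by simp
  qed (use char1 in auto)
  finally have "\<delta> / 2 * measure \<mu> {x. 2 / \<delta> \<le> \<bar>x\<bar>}
      \<le> (\<integral>u. indicator {0..\<delta>} u * (1 - Re (char \<mu> u)) \<partial>lborel)"
    by (subst (asm) ennreal_le_iff) (auto intro!: integral_nonneg_AE AE_I2 mult_nonneg_nonneg simp: char1)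
  then show ?thesis using \<delta> by (simp add: field_simps)
qed

text \<open>The limit is \<open>1\<close> at \<open>0\<close> and continuous there, so the average of \<open>1 - Re \<phi>\<close> over a short
  interval is small; by dominated convergence the same holds for all but finitely many of the
  given characteristic functions, and the preceding bound controls their tails uniformly.\<close>

lemma tight_of_char_limit:
  fixes \<mu> :: "nat \<Rightarrow> real measure"
  assumes rd: "\<And>n. real_distribution (\<mu> n)"
    and conv: "\<And>u. (\<lambda>n. char (\<mu> n) u) \<longlonglongrightarrow> \<phi> u"
    and cont: "isCont \<phi> 0"
  shows "tight \<mu>"
proof -
  interpret \<mu>: real_distribution "\<mu> n" for n by (rule rd)
  have \<phi>0: "\<phi> 0 = 1"
    using conv[of 0] by (simp add: \<mu>.char_zero LIMSEQ_const_iff)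
  have \<phi>m [measurable]: "\<phi> \<in> borel_measurable borel"
    by (rule borel_measurable_LIMSEQ_metric[OF _ conv]) simp
  have bnd: "\<bar>1 - Re (char (\<mu> n) u)\<bar> \<le> 2" for n u
    using \<mu>.cmod_char_le_1[of n u] abs_Re_le_cmod[of "char (\<mu> n) u"] by linarith
  have "\<exists>a b. a < b \<and> (\<forall>n. 1 - \<epsilon> < measure (\<mu> n) {a<..b})" if \<epsilon>: "\<epsilon> > 0" for \<epsilon>
  proof -
    obtain d where d: "d > 0" "\<And>u. \<bar>u\<bar> < d \<Longrightarrow> norm (\<phi> u - \<phi> 0) < \<epsilon> / 4"
      using cont \<epsilon> unfolding continuous_at_eps_delta
      by (metis dist_norm diff_zero real_norm_def zero_less_divide_iff zero_less_numeral)
    define \<delta> where "\<delta> = d / 2"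
    have \<delta>: "\<delta> > 0" using d by (simp add: \<delta>_def)
    let ?I = "\<lambda>\<psi>. \<integral>u. indicator {0..\<delta>} u * (1 - Re (\<psi> u)) \<partial>lborel"
    have lim: "(\<lambda>n. ?I (char (\<mu> n))) \<longlonglongrightarrow> ?I \<phi>"
    proof (rule integral_dominated_convergence[where w="\<lambda>u. indicator {0..\<delta>} u * 2"])
      show "integrable lborel (\<lambda>u. indicat_real {0..\<delta>} u * 2)"
        by (intro integrable_mult_left integrable_real_indicator) (auto simp: emeasure_lborel_Icc_eq)
      show "AE x in lborel. (\<lambda>n. indicat_real {0..\<delta>} x * (1 - Re (char (\<mu> n) x)))
          \<longlonglongrightarrow> indicat_real {0..\<delta>} x * (1 - Re (\<phi> x))"
        by (intro AE_I2 tendsto_intros conv)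
      show "AE x in lborel. norm (indicat_real {0..\<delta>} x * (1 - Re (char (\<mu> n) x)))
          \<le> indicat_real {0..\<delta>} x * 2" for n
        using bnd by (intro AE_I2) (auto split: split_indicator)
    qed auto
    have "?I \<phi> \<le> (\<integral>u. indicator {0..\<delta>} u * (\<epsilon> / 4) \<partial>lborel)"
    proof (rule integral_mono_AE')
      show "integrable lborel (\<lambda>u. indicat_real {0..\<delta>} u * (\<epsilon> / 4))"
        by (intro integrable_mult_left integrable_real_indicator) (auto simp: emeasure_lborel_Icc_eq)
      show "AE x in lborel. indicat_real {0..\<delta>} x * (1 - Re (\<phi> x)) \<le> indicat_real {0..\<delta>} x * (\<epsilon> / 4)"
      proof (intro AE_I2)
        fix x :: real
        show "indicat_real {0..\<delta>} x * (1 - Re (\<phi> x)) \<le> indicat_real {0..\<delta>} x * (\<epsilon> / 4)"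
        proof (cases "x \<in> {0..\<delta>}")
          case True
          then have "\<bar>x\<bar> < d" using d by (auto simp: \<delta>_def)
          from d(2)[OF this] have "1 - Re (\<phi> x) \<le> \<epsilon> / 4"
            using abs_Re_le_cmod[of "\<phi> x - 1"] by (simp add: \<phi>0)
          then show ?thesis using True by simp
        qed auto
      qed
      show "AE x in lborel. 0 \<le> indicat_real {0..\<delta>} x * (\<epsilon> / 4)" using \<epsilon> by auto
    qed
    also have "\<dots> = \<delta> * (\<epsilon> / 4)" using \<delta> by simp
    also have "\<dots> < \<delta> * (\<epsilon> / 2)" using \<delta> \<epsilon> by simp
    finally have "eventually (\<lambda>n. ?I (char (\<mu> n)) < \<delta> * (\<epsilon> / 2)) sequentially"
      by (rule order_tendstoD(2)[OF lim])
    then obtain N where N: "\<And>n. n \<ge> N \<Longrightarrow> ?I (char (\<mu> n)) < \<delta> * (\<epsilon> / 2)"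
      by (auto simp: eventually_sequentially)
    have big: "measure (\<mu> n) {x. 2 / \<delta> \<le> \<bar>x\<bar>} < \<epsilon>" if "n \<ge> N" for n
    proof -
      have "measure (\<mu> n) {x. 2 / \<delta> \<le> \<bar>x\<bar>} \<le> 2 / \<delta> * ?I (char (\<mu> n))"
        by (rule char_tail_bound[OF rd \<delta>])
      also have "\<dots> < 2 / \<delta> * (\<delta> * (\<epsilon> / 2))" using N[OF that] \<delta> by (intro mult_strict_left_mono) auto
      finally show ?thesis using \<delta> by simp
    qed
    have ex: "\<exists>k. measure (\<mu> n) {- real k<..real k} > 1 - \<epsilon>" for n
    proof -
      have *: "(\<Union>k::nat. {- real k<..real k}) = UNIV"
        by (auto, metis leI le_less_trans less_imp_le minus_less_iff reals_Archimedean2)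
      have "(\<lambda>k. measure (\<mu> n) {- real k<..real k}) \<longlonglongrightarrow> measure (\<mu> n) (\<Union>k::nat. {- real k<..real k})"
        by (rule \<mu>.finite_Lim_measure_incseq) (auto simp: incseq_def)
      then have "(\<lambda>k. measure (\<mu> n) {- real k<..real k}) \<longlonglongrightarrow> 1"
        using \<mu>.prob_space[of n] unfolding * by simp
      then have "eventually (\<lambda>k. measure (\<mu> n) {- real k<..real k} > 1 - \<epsilon>) sequentially"
        using \<epsilon> order_tendstoD(1)[of _ 1 sequentially "1 - \<epsilon>"] by simp
      then show ?thesis by (auto simp: eventually_sequentially)
    qed
    obtain k where k: "\<And>n. measure (\<mu> n) {- real (k n)<..real (k n)} > 1 - \<epsilon>" using ex by metis
    define B where "B = Max (insert (2 / \<delta>) ((\<lambda>n. real (k n)) ` {..<N}))"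
    have B1: "2 / \<delta> \<le> B" unfolding B_def by (rule Max_ge) auto
    have B2: "real (k n) \<le> B" if "n < N" for n unfolding B_def using that by (intro Max_ge) auto
    have "1 - \<epsilon> < measure (\<mu> n) {- B<..B}" for n
    proof (cases "n < N")
      case True
      have "measure (\<mu> n) {- real (k n)<..real (k n)} \<le> measure (\<mu> n) {- B<..B}"
        using B2[OF True] by (intro \<mu>.finite_measure_mono) auto
      then show ?thesis using k[of n] by simp
    next
      case False
      have "1 - measure (\<mu> n) {x. 2 / \<delta> \<le> \<bar>x\<bar>} = measure (\<mu> n) (space (\<mu> n) - {x. 2 / \<delta> \<le> \<bar>x\<bar>})"
        by (rule \<mu>.prob_compl[symmetric]) simp
      also have "\<dots> \<le> measure (\<mu> n) {- B<..B}"
        using B1 by (intro \<mu>.finite_measure_mono) auto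
      finally show ?thesis using big[of n] False by simp
    qed
    moreover have "-B < B" using B1 \<delta> by (smt (verit) zero_less_divide_iff)
    ultimately show ?thesis by blast
  qed
  then show ?thesis by (auto simp: tight_def rd)
qed

text \<open>The form of the continuity theorem in which the limit is not known beforehand to be a
  characteristic function.\<close>

lemma levy_existence:
  fixes \<mu> :: "nat \<Rightarrow> real measure"
  assumes rd: "\<And>n. real_distribution (\<mu> n)"
    and conv: "\<And>u. (\<lambda>n. char (\<mu> n) u) \<longlonglongrightarrow> \<phi> u"
    and cont: "isCont \<phi> 0"
  shows "\<exists>P. real_distribution P \<and> char P = \<phi>"
proof -
  obtain r P where r: "strict_mono (r :: nat \<Rightarrow> nat)" and P: "real_distribution P" "weak_conv_m (\<mu> \<circ>
      id \<circ> r) P"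
    using tight_imp_convergent_subsubsequence[OF tight_of_char_limit[OF assms], of id]
    by (auto simp: strict_mono_def)
  have "(\<lambda>n. char ((\<mu> \<circ> r) n) u) \<longlonglongrightarrow> char P u" for u
    using P by (intro levy_continuity1) (auto intro: rd simp: comp_def)
  moreover have "(\<lambda>n. char ((\<mu> \<circ> r) n) u) \<longlonglongrightarrow> \<phi> u" for u
    using LIMSEQ_subseq_LIMSEQ[OF conv r] by (simp add: comp_def)
  ultimately have "char P = \<phi>" using LIMSEQ_unique by blast
  with P show ?thesis by blast
qed

text \<open>Homogeneity of the exponent is stability without a shift. A point mass is excluded because
  its characteristic function has modulus one everywhere.\<close>

lemma stable_law_of_char:
  assumes P: "real_distribution P" and \<alpha>: "0 < \<alpha>" "\<alpha> \<le> 2"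
    and char: "\<And>u. char P u = exp (- L u)"
    and homog: "\<And>c u. c > 0 \<Longrightarrow> L (c * u) = c powr \<alpha> * L u"
    and pos: "Re (L 1) > 0"
  shows "stable_law \<alpha> P"
proof -
  interpret real_distribution P by fact
  have "P \<noteq> return borel c" for c
  proof
    assume eq: "P = return borel c"
    have "char P 1 = iexp c" unfolding char_def by (subst eq, subst integral_return) auto
    then have "norm (exp (- L 1)) = 1" unfolding char[symmetric] by simp
    then show False using pos by simp
  qed
  moreover have "distr (P \<Otimes>\<^sub>M P) borel (\<lambda>(x, y). a * x + b * y)
      = distr P borel (\<lambda>x. (a powr \<alpha> + b powr \<alpha>) powr (1 / \<alpha>) * x + 0)" if ab: "a > 0" "b > 0" for a b
  proof -
    interpret PP: pair_prob_space P P ..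
    define c where "c = (a powr \<alpha> + b powr \<alpha>) powr (1 / \<alpha>)"
    have c: "c > 0" "c powr \<alpha> = a powr \<alpha> + b powr \<alpha>"
      using ab \<alpha> add_pos_pos[of "a powr \<alpha>" "b powr \<alpha>"] by (auto simp: c_def powr_powr)
    have rd1: "real_distribution (distr (P \<Otimes>\<^sub>M P) borel (\<lambda>(x, y). a * x + b * y))"
      by (rule PP.real_distribution_distr) simp
    have rd2: "real_distribution (distr P borel (\<lambda>x. c * x + 0))"
      by (rule real_distribution_distr) simp
    have sc: "(CLINT x|P. iexp (u * (k * x))) = char P (k * u)" for u k
      unfolding char_def by (intro Bochner_Integration.integral_cong) (auto simp: mult_ac)
    have "char (distr (P \<Otimes>\<^sub>M P) borel (\<lambda>(x, y). a * x + b * y)) u = char (distr P borel (\<lambda>x. c * x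
        + 0)) u" for u
    proof -
      have int: "integrable (P \<Otimes>\<^sub>M P) (\<lambda>z. case z of (x, y) \<Rightarrow> iexp (u * (a * x)) * iexp (u * (b * y)))"
        by (rule PP.P.integrable_const_bound[of _ 1]) (auto simp: norm_mult split_beta')
      have "char (distr (P \<Otimes>\<^sub>M P) borel (\<lambda>(x, y). a * x + b * y)) u
          = (CLINT z|P \<Otimes>\<^sub>M P. iexp (u * (a * fst z + b * snd z)))"
        unfolding char_def by (subst integral_distr) (auto simp: split_beta')
      also have "\<dots> = (CLINT z|P \<Otimes>\<^sub>M P. (case z of (x, y) \<Rightarrow> iexp (u * (a * x)) * iexp (u * (b * y))))"
        by (intro Bochner_Integration.integral_cong) (auto simp: exp_add[symmetric] algebra_simps)
      also have "\<dots> = (CLINT x|P. CLINT y|P. iexp (u * (a * x)) * iexp (u * (b * y)))"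
        using PP.integral_fst'[OF int] by simp
      also have "\<dots> = char P (a * u) * char P (b * u)"
        by (simp add: sc del: of_real_mult)
      also have "\<dots> = exp (- L (c * u))"
        unfolding char by (simp add: homog ab c exp_add[symmetric] algebra_simps)
      also have "\<dots> = char P (c * u)" unfolding char ..
      also have "\<dots> = char (distr P borel (\<lambda>x. c * x + 0)) u"
        unfolding char_def[of "distr _ _ _"] by (subst integral_distr) (simp_all add: sc[symmetric])
      finally show ?thesis .
    qed
    then show ?thesis unfolding c_def[symmetric]
      using Levy_uniqueness[OF rd1 rd2] by blast
  qed
  ultimately show ?thesis
    unfolding stable_law_def using \<alpha> prob_space_axioms by (intro conjI allI impI) (simp, simp, simp,
        simp, simp, blast)
qed

text \<open>The general function that is homogeneous of degree \<open>\<alpha>\<close> under positive factors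
    and takes conjugate values at
  opposite points, as the exponent of a real stable law must.\<close>

definition stable_exponent :: "real \<Rightarrow> complex \<Rightarrow> real \<Rightarrow> complex"
  where "stable_exponent \<alpha> C u = of_real (\<bar>u\<bar> powr \<alpha>) * (if u \<ge> 0 then C else cnj C)"

lemma stable_exponent_homog:
  "c > 0 \<Longrightarrow> stable_exponent \<alpha> C (c * u) = of_real (c powr \<alpha>) * stable_exponent \<alpha> C u"
  by (auto simp: stable_exponent_def abs_mult powr_mult zero_le_mult_iff)

lemma stable_exponent_isCont: "\<alpha> > 0 \<Longrightarrow> isCont (stable_exponent \<alpha> C) 0"
proof -
  assume \<alpha>: "\<alpha> > 0"
  have "((\<lambda>u. norm C * \<bar>u\<bar> powr \<alpha>) \<longlongrightarrow> norm C * \<bar>0::real\<bar> powr \<alpha>) (at 0)"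
    using \<alpha> by (intro tendsto_intros tendsto_powr') auto
  have "(stable_exponent \<alpha> C \<longlongrightarrow> 0) (at 0)"
  proof -
    have "norm (stable_exponent \<alpha> C u) = norm C * \<bar>u\<bar> powr \<alpha>" for u
      by (simp add: stable_exponent_def norm_mult)
    then show ?thesis
      using tendsto_norm_zero_cancel[of "stable_exponent \<alpha> C"]
        \<open>((\<lambda>u. norm C * \<bar>u\<bar> powr \<alpha>) \<longlongrightarrow> norm C * \<bar>0::real\<bar> powr \<alpha>) (at 0)\<close> by simp
  qed
  then show ?thesis by (simp add: isCont_def stable_exponent_def)
qed

text \<open>Limits over real \<open>t\<close> reduce to limits along sequences, for which the continuity theorem is
  available.\<close>

lemma conv_in_distr_of_char:
  fixes Z :: "real \<Rightarrow> 'w \<Rightarrow> real"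
  assumes "prob_space M" and Z [measurable]: "\<And>t. Z t \<in> borel_measurable M" and P: "real_distribution P"
    and conv: "\<And>u. ((\<lambda>t. \<integral>\<omega>. iexp (u * Z t \<omega>) \<partial>M) \<longlongrightarrow> char P u) at_top"
  shows "conv_in_distr M Z P"
  unfolding conv_in_distr_def
proof (intro allI impI tendsto_at_topI_sequentially)
  interpret prob_space M by fact
  fix x and X :: "nat \<Rightarrow> real" assume x: "isCont (cdf P) x" and X: "filterlim X at_top sequentially"
  have "weak_conv_m (\<lambda>k. distr M borel (Z (X k))) P"
  proof (rule levy_continuity[OF _ P])
    show "real_distribution (distr M borel (Z (X n)))" for n by (rule real_distribution_distr) simp
    fix u
    have "char (distr M borel (Z t)) u = (\<integral>\<omega>. iexp (u * Z t \<omega>) \<partial>M)" for t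
      unfolding char_def by (subst integral_distr) auto
    then show "(\<lambda>n. char (distr M borel (Z (X n))) u) \<longlonglongrightarrow> char P u"
      using filterlim_compose[OF conv X] by simp
  qed
  then show "(\<lambda>n. cdf (distr M borel (Z (X n))) x) \<longlonglongrightarrow> cdf P x"
    using x by (simp add: weak_conv_m_def weak_conv_def)
qed

lemma stable_limit_of_char:
  fixes Z :: "real \<Rightarrow> 'w \<Rightarrow> real"
  assumes "prob_space M" and Z [measurable]: "\<And>t. Z t \<in> borel_measurable M"
    and \<alpha>: "0 < \<alpha>" "\<alpha> \<le> 2" and C: "Re C > 0"
    and conv: "\<And>u. ((\<lambda>t. \<integral>\<omega>. iexp (u * Z t \<omega>) \<partial>M) \<longlongrightarrow> exp (- stable_exponent \<alpha> C u)) at_top"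
  shows "\<exists>P. stable_law \<alpha> P \<and> conv_in_distr M Z P"
proof -
  interpret prob_space M by fact
  have "\<exists>P. real_distribution P \<and> char P = (\<lambda>u. exp (- stable_exponent \<alpha> C u))"
  proof (rule levy_existence)
    show "real_distribution (distr M borel (Z (real n)))" for n by (rule real_distribution_distr) simp
    have "char (distr M borel (Z t)) u = (\<integral>\<omega>. iexp (u * Z t \<omega>) \<partial>M)" for t u
      unfolding char_def by (subst integral_distr) auto
    then show "(\<lambda>n. char (distr M borel (Z (real n))) u) \<longlonglongrightarrow> exp (- stable_exponent \<alpha> C u)" for u
      using filterlim_compose[OF conv filterlim_real_sequentially] by simp
    show "isCont (\<lambda>u. exp (- stable_exponent \<alpha> C u)) 0"
      unfolding isCont_def
      by (intro tendsto_exp tendsto_minus stable_exponent_isCont[unfolded isCont_def] \<alpha>)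
  qed
  then obtain P where P: "real_distribution P" "char P = (\<lambda>u. exp (- stable_exponent \<alpha> C u))" by blast
  have "stable_law \<alpha> P"
  proof (rule stable_law_of_char[OF P(1) \<alpha>])
    show "char P u = exp (- stable_exponent \<alpha> C u)" for u by (simp add: P(2))
    show "stable_exponent \<alpha> C (c * u) = of_real (c powr \<alpha>) * stable_exponent \<alpha> C u" if "c > 0" for c u
      by (rule stable_exponent_homog[OF that])
    show "Re (stable_exponent \<alpha> C 1) > 0" using C by (simp add: stable_exponent_def)
  qed
  moreover have "conv_in_distr M Z P"
    by (rule conv_in_distr_of_char[OF assms(1) Z P(1)]) (use conv in \<open>simp add: P(2)\<close>)
  ultimately show ?thesis by blast
qed

section \<open>Regularly varying tails and their transforms\<close>

text \<open>The properties of the tail function \<open>x \<mapsto> P (Z > x)\<close> that are used. Monotonicity makes the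
  Potter bounds elementary, which is why it is carried along with the limit of the ratios.\<close>

definition rv_tail :: "real \<Rightarrow> (real \<Rightarrow> real) \<Rightarrow> bool"
  where "rv_tail \<alpha> F \<longleftrightarrow> (\<forall>x>0. F x > 0) \<and> (\<forall>x>0. \<forall>y\<ge>x. F y \<le> F x) \<and>
    (\<forall>c>0. ((\<lambda>x. F (c * x) / F x) \<longlongrightarrow> c powr (-\<alpha>)) at_top)"

text \<open>The slowly varying factor is positive only far out; monotonicity extends positivity of the
  tail to all \<open>x > 0\<close>.\<close>

lemma rv_tail_of_regularly_varying:
  assumes "prob_space M" and Z: "regularly_varying_rv M Z \<alpha>"
  shows "rv_tail \<alpha> (\<lambda>x. measure M {\<omega> \<in> space M. Z \<omega> > ennreal x})"
proof -
  interpret prob_space M by fact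
  let ?F = "\<lambda>x. measure M {\<omega> \<in> space M. Z \<omega> > ennreal x}"
  from Z obtain l where [measurable]: "Z \<in> borel_measurable M" and l: "slowly_varying l"
    and eq: "\<And>x. x > 0 \<Longrightarrow> ?F x = x powr (-\<alpha>) * l x"
    unfolding regularly_varying_rv_def by blast
  from l obtain x0 where x0: "x0 > 0" "\<And>x. x \<ge> x0 \<Longrightarrow> l x > 0"
    and lc: "\<And>c. c > 0 \<Longrightarrow> ((\<lambda>x. l (c * x) / l x) \<longlongrightarrow> 1) at_top"
    unfolding slowly_varying_def by blast
  have mono: "?F y \<le> ?F x" if "x \<le> y" for x y
    using that by (intro finite_measure_mono) (auto intro: order.strict_trans1 ennreal_leI)
  have pos: "?F x > 0" if "x > 0" for x
  proof -
    have "?F (max x x0) > 0" using x0 that by (simp add: eq)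
    also have "?F (max x x0) \<le> ?F x" by (rule mono) simp
    finally show ?thesis .
  qed
  have "((\<lambda>x. ?F (c * x) / ?F x) \<longlongrightarrow> c powr (-\<alpha>)) at_top" if c: "c > 0" for c
  proof (rule Lim_transform_eventually)
    show "((\<lambda>x. c powr (-\<alpha>) * (l (c * x) / l x)) \<longlongrightarrow> c powr (-\<alpha>)) at_top"
      using tendsto_mult_left[OF lc[OF c], of "c powr (-\<alpha>)"] by simp
    show "eventually (\<lambda>x. c powr (-\<alpha>) * (l (c * x) / l x) = ?F (c * x) / ?F x) at_top"
      using eventually_gt_at_top[of 0]
      by eventually_elim (use c in \<open>simp add: eq powr_mult\<close>)
  qed
  then show ?thesis unfolding rv_tail_def using pos mono by blast
qed

lemma rv_tail_cong:
  assumes "\<And>x. x > 0 \<Longrightarrow> F x = G x" and "rv_tail \<alpha> F"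
  shows "rv_tail \<alpha> G"
proof -
  have "((\<lambda>x. G (c * x) / G x) \<longlongrightarrow> c powr (-\<alpha>)) at_top" if c: "c > 0" for c
  proof (rule Lim_transform_eventually)
    show "((\<lambda>x. F (c * x) / F x) \<longlongrightarrow> c powr (-\<alpha>)) at_top"
      using assms(2) c by (simp add: rv_tail_def)
    show "eventually (\<lambda>x. F (c * x) / F x = G (c * x) / G x) at_top"
      using eventually_gt_at_top[of 0] by eventually_elim (use c assms(1) in simp)
  qed
  moreover have "G x > 0" if "x > 0" for x
    using assms that by (simp add: rv_tail_def assms(1)[symmetric])
  moreover have "G y \<le> G x" if "x > 0" "x \<le> y" for x y
    using assms that by (simp add: rv_tail_def assms(1)[symmetric])
  ultimately show ?thesis unfolding rv_tail_def by blast
qed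

text \<open>Potter's bounds. The ratio of the values at \<open>2 x\<close> and \<open>x\<close> is trapped between two powers of
  \<open>2\<close> for large \<open>x\<close>; iterating reaches the points \<open>2\<^sup>k x\<close>, and monotonicity fills the gaps at the
  price of a factor \<open>2\<close> inside the powers.\<close>

lemma rv_tail_potter:
  assumes F: "rv_tail \<alpha> F" and \<epsilon>: "0 < \<epsilon>" "\<epsilon> < \<alpha>"
  obtains x1 where "x1 > 0"
    and "\<And>x r. x \<ge> x1 \<Longrightarrow> r \<ge> 1 \<Longrightarrow> F (r * x) \<le> (r / 2) powr (-(\<alpha> - \<epsilon>)) * F x"
    and "\<And>x r. x \<ge> x1 \<Longrightarrow> r \<ge> 1 \<Longrightarrow> (2 * r) powr (-(\<alpha> + \<epsilon>)) * F x \<le> F (r * x)"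
proof -
  have pos: "\<And>x. x > 0 \<Longrightarrow> F x > 0" and mono: "\<And>x y. x > 0 \<Longrightarrow> x \<le> y \<Longrightarrow> F y \<le> F x"
    and lim: "((\<lambda>x. F (2 * x) / F x) \<longlongrightarrow> 2 powr (-\<alpha>)) at_top"
    using F unfolding rv_tail_def by auto
  have "eventually (\<lambda>x. 2 powr (-(\<alpha> + \<epsilon>)) < F (2 * x) / F x) at_top"
    using \<epsilon> by (intro order_tendstoD[OF lim]) simp
  moreover have "eventually (\<lambda>x. F (2 * x) / F x < 2 powr (-(\<alpha> - \<epsilon>))) at_top"
    using \<epsilon> by (intro order_tendstoD[OF lim]) simp
  ultimately have "eventually (\<lambda>x. x > 0 \<and> 2 powr (-(\<alpha> + \<epsilon>)) < F (2 * x) / F x \<and>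
      F (2 * x) / F x < 2 powr (-(\<alpha> - \<epsilon>))) at_top"
    using eventually_gt_at_top[of 0] by eventually_elim auto
  then obtain x1 where x1: "\<And>x. x \<ge> x1 \<Longrightarrow> x > 0 \<and> 2 powr (-(\<alpha> + \<epsilon>)) < F (2 * x) / F x \<and>
      F (2 * x) / F x < 2 powr (-(\<alpha> - \<epsilon>))"
    by (auto simp: eventually_at_top_linorder)
  have x1pos: "x1 > 0" using x1[of x1] by simp
  have step: "2 powr (-(\<alpha> + \<epsilon>)) * F x \<le> F (2 * x) \<and> F (2 * x) \<le> 2 powr (-(\<alpha> - \<epsilon>)) * F x" if "x \<ge> x1" for x
    using x1[OF that] pos[of x] by (simp add: field_simps)
  have iter: "2 powr (-(\<alpha> + \<epsilon>) * real k) * F x \<le> F (2 ^ k * x) \<and>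
      F (2 ^ k * x) \<le> 2 powr (-(\<alpha> - \<epsilon>) * real k) * F x" if x: "x \<ge> x1" for x k
  proof (induction k)
    case 0
    show ?case by simp
  next
    case (Suc k)
    have "1 * x \<le> 2 ^ k * x" using x x1pos by (intro mult_right_mono) auto
    then have "x1 \<le> 2 ^ k * x" using x by simp
    note s = step[OF this]
    have "2 powr (-(\<alpha> + \<epsilon>) * real (Suc k)) * F x = 2 powr (-(\<alpha> + \<epsilon>)) * (2 powr (-(\<alpha> + \<epsilon>) * real k) * F x)"
      by (simp add: powr_add[symmetric] mult.assoc[symmetric] del: mult.assoc) (simp add: algebra_simps)
    also have "\<dots> \<le> 2 powr (-(\<alpha> + \<epsilon>)) * F (2 ^ k * x)"
      using Suc.IH by (intro mult_left_mono) auto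
    also have "\<dots> \<le> F (2 ^ Suc k * x)" using s by (simp add: mult.assoc)
    finally have 1: "2 powr (-(\<alpha> + \<epsilon>) * real (Suc k)) * F x \<le> F (2 ^ Suc k * x)" .
    have "F (2 ^ Suc k * x) \<le> 2 powr (-(\<alpha> - \<epsilon>)) * F (2 ^ k * x)" using s by (simp add: mult.assoc)
    also have "\<dots> \<le> 2 powr (-(\<alpha> - \<epsilon>)) * (2 powr (-(\<alpha> - \<epsilon>) * real k) * F x)"
      using Suc.IH by (intro mult_left_mono) auto
    also have "\<dots> = 2 powr (-(\<alpha> - \<epsilon>) * real (Suc k)) * F x"
      by (simp add: powr_add[symmetric] mult.assoc[symmetric] del: mult.assoc) (simp add: algebra_simps)
    finally show ?case using 1 by blast
  qed
  have both: "F (r * x) \<le> (r / 2) powr (-(\<alpha> - \<epsilon>)) * F x \<and> (2 * r) powr (-(\<alpha> + \<epsilon>)) * F x \<le> F (r * x)"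
    if x: "x \<ge> x1" and r: "r \<ge> 1" for x r
  proof -
    have xp: "x > 0" using x x1pos by simp
    define k where "k = nat \<lfloor>log 2 r\<rfloor>"
    have "log 2 r \<ge> 0" using r by simp
    then have "real k \<le> log 2 r" "log 2 r < real (Suc k)"
      unfolding k_def by linarith+
    then have k: "2 powr real k \<le> r" "r < 2 powr real (Suc k)"
      using r by (simp_all only: le_log_iff log_less_iff)
    have k': "2 ^ k \<le> r" "r \<le> 2 ^ Suc k" using k by (simp_all add: powr_realpow powr_add)
    have "F (r * x) \<le> F (2 ^ k * x)" using k' xp by (intro mono mult_right_mono) auto
    also have "\<dots> \<le> 2 powr (-(\<alpha> - \<epsilon>) * real k) * F x" using iter[OF x] by blast
    also have "2 powr (-(\<alpha> - \<epsilon>) * real k) = (2 powr real k) powr (-(\<alpha> - \<epsilon>))"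
      by (simp add: powr_powr mult.commute)
    also have "\<dots> * F x \<le> (r / 2) powr (-(\<alpha> - \<epsilon>)) * F x"
      using k \<epsilon> r pos[OF xp] by (intro mult_right_mono powr_mono2') (auto simp: powr_add)
    finally have 1: "F (r * x) \<le> (r / 2) powr (-(\<alpha> - \<epsilon>)) * F x" .
    have "(2 * r) powr (-(\<alpha> + \<epsilon>)) * F x \<le> (2 powr real (Suc k)) powr (-(\<alpha> + \<epsilon>)) * F x"
      using k \<epsilon> r pos[OF xp] by (intro mult_right_mono powr_mono2') (auto simp: powr_add)
    also have "(2 powr real (Suc k)) powr (-(\<alpha> + \<epsilon>)) = 2 powr (-(\<alpha> + \<epsilon>) * real (Suc k))"
      by (simp add: powr_powr mult.commute)
    also have "\<dots> * F x \<le> F (2 ^ Suc k * x)" using iter[OF x] by blast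
    also have "\<dots> \<le> F (r * x)" using k' xp r by (intro mono mult_right_mono) auto
    finally show ?thesis using 1 by blast
  qed
  show ?thesis using both x1pos by (intro that[of x1]) auto
qed

text \<open>The integrable majorant for dominated convergence. It has to hold down to \<open>r = 0\<close>, where
  \<open>r x\<close> leaves the range of Potter's bounds; there the tail is at most \<open>1\<close> and the lower bound for
  \<open>F x\<close> suffices.\<close>

lemma rv_tail_ratio_bound:
  assumes F: "rv_tail \<alpha> F" and le1: "\<And>x. F x \<le> 1" and \<epsilon>: "0 < \<epsilon>" "\<epsilon> < \<alpha>"
  obtains x1 B where "x1 > 0" "B > 0"
    "\<And>x r. x \<ge> x1 \<Longrightarrow> r > 0 \<Longrightarrow> F (r * x) / F x \<le> B * (r powr (-\<alpha> - \<epsilon>) + r powr (-\<alpha> + \<epsilon>))"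
proof -
  obtain x1 where x1: "x1 > 0"
    and up: "\<And>x r. x \<ge> x1 \<Longrightarrow> r \<ge> 1 \<Longrightarrow> F (r * x) \<le> (r / 2) powr (-(\<alpha> - \<epsilon>)) * F x"
    and lo: "\<And>x r. x \<ge> x1 \<Longrightarrow> r \<ge> 1 \<Longrightarrow> (2 * r) powr (-(\<alpha> + \<epsilon>)) * F x \<le> F (r * x)"
    using rv_tail_potter[OF F \<epsilon>] by blast
  have pos: "\<And>x. x > 0 \<Longrightarrow> F x > 0" using F unfolding rv_tail_def by auto
  define B where "B = 2 powr (\<alpha> + \<epsilon>) / F x1 + 2 powr (\<alpha> - \<epsilon>) + 2 powr (\<alpha> + \<epsilon>)"
  have B: "2 powr (\<alpha> + \<epsilon>) / F x1 \<le> B" "2 powr (\<alpha> - \<epsilon>) \<le> B" "2 powr (\<alpha> + \<epsilon>) \<le> B" "B > 0"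
    using pos[OF x1] by (auto simp: B_def add_pos_nonneg intro!: add_nonneg_nonneg add_nonneg_pos)
  have "F (r * x) / F x \<le> B * (r powr (-\<alpha> - \<epsilon>) + r powr (-\<alpha> + \<epsilon>))" if x: "x \<ge> x1" and r: "r > 0" for x r
  proof -
    have xp: "x > 0" using x x1 by simp
    consider "r \<ge> 1" | "r < 1" "r * x \<ge> x1" | "r < 1" "r * x < x1" by linarith
    then show ?thesis
    proof cases
      case 1
      have "F (r * x) / F x \<le> (r / 2) powr (-(\<alpha> - \<epsilon>))"
        using up[OF x 1] pos[OF xp] by (simp add: field_simps)
      also have "\<dots> = 2 powr (\<alpha> - \<epsilon>) * r powr (-\<alpha> + \<epsilon>)"
        using r by (simp add: powr_divide powr_minus_divide field_simps powr_diff powr_add)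
      also have "\<dots> \<le> B * (r powr (-\<alpha> - \<epsilon>) + r powr (-\<alpha> + \<epsilon>))"
        using B by (intro mult_mono) auto
      finally show ?thesis .
    next
      case 2
      have "(2 * (1 / r)) powr (-(\<alpha> + \<epsilon>)) * F (r * x) \<le> F ((1 / r) * (r * x))"
        using 2 r by (intro lo) auto
      also have "(1 / r) * (r * x) = x" using r by simp
      also have "(2 * (1 / r)) powr (-(\<alpha> + \<epsilon>)) = 1 / (2 powr (\<alpha> + \<epsilon>) * r powr (-\<alpha> - \<epsilon>))"
        using r by (simp add: powr_divide powr_minus_divide field_simps powr_diff powr_add)
      finally have "F (r * x) / F x \<le> 2 powr (\<alpha> + \<epsilon>) * r powr (-\<alpha> - \<epsilon>)"
        using r pos[OF xp] by (simp add: field_simps)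
      also have "\<dots> \<le> B * (r powr (-\<alpha> - \<epsilon>) + r powr (-\<alpha> + \<epsilon>))"
        using B by (intro mult_mono) auto
      finally show ?thesis .
    next
      case 3
      have "(2 * (x / x1)) powr (-(\<alpha> + \<epsilon>)) * F x1 \<le> F ((x / x1) * x1)"
        using x x1 by (intro lo) auto
      also have "(x / x1) * x1 = x" using x1 by simp
      finally have *: "(2 * (x / x1)) powr (-(\<alpha> + \<epsilon>)) * F x1 \<le> F x" .
      have "(2 * (1 / r)) powr (-(\<alpha> + \<epsilon>)) * F x1 \<le> (2 * (x / x1)) powr (-(\<alpha> + \<epsilon>)) * F x1"
        using 3 r x1 xp \<epsilon> pos[OF x1] by (intro mult_right_mono powr_mono2') (auto simp: field_simps)
      also note *
      also have "(2 * (1 / r)) powr (-(\<alpha> + \<epsilon>)) = 1 / (2 powr (\<alpha> + \<epsilon>) * r powr (-\<alpha> - \<epsilon>))"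
        using r by (simp add: powr_divide powr_minus_divide field_simps powr_diff powr_add)
      finally have "1 / F x \<le> (2 powr (\<alpha> + \<epsilon>) / F x1) * r powr (-\<alpha> - \<epsilon>)"
        using r pos[OF xp] pos[OF x1] by (simp add: field_simps)
      moreover have "F (r * x) / F x \<le> 1 / F x"
        using le1 pos[OF xp] by (intro divide_right_mono) auto
      ultimately have "F (r * x) / F x \<le> (2 powr (\<alpha> + \<epsilon>) / F x1) * r powr (-\<alpha> - \<epsilon>)" by linarith
      also have "\<dots> \<le> B * (r powr (-\<alpha> - \<epsilon>) + r powr (-\<alpha> + \<epsilon>))"
        using B pos[OF x1] by (intro mult_mono) auto
      finally show ?thesis .
    qed
  qed
  with x1 B show ?thesis by (intro that[of x1 B]) auto
qed

text \<open>Dyadic summation. It serves both for moments of random variables with a regularly varying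
  tail and for the displacement measures, whose total mass is not one.\<close>

lemma moment_finite_of_tail:
  assumes "finite_measure M" and [measurable]: "Z \<in> borel_measurable M"
    and pq: "0 < p" "p < q" and T: "T > 0"
    and tail: "\<And>t. t \<ge> T \<Longrightarrow> emeasure M {\<omega> \<in> space M. Z \<omega> > t} \<le> ennreal (c * t powr (-q))"
  shows "(\<integral>\<^sup>+\<omega>. ennreal (Z \<omega> powr p) * indicator {\<omega>. Z \<omega> \<ge> 0} \<omega> \<partial>M) < \<infinity>"
proof -
  interpret finite_measure M by fact
  let ?A = "\<lambda>k::nat. {\<omega> \<in> space M. Z \<omega> > 2 ^ k * T}"
  let ?b = "\<lambda>k::nat. (2 ^ Suc k * T) powr p"
  have pt: "ennreal (Z \<omega> powr p) * indicator {\<omega>. Z \<omega> \<ge> 0} \<omega>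
      \<le> ennreal (T powr p) + (\<Sum>k. ennreal (?b k) * indicator (?A k) \<omega>)" if \<omega>: "\<omega> \<in> space M" for \<omega>
  proof (cases "Z \<omega> > T")
    case False
    then show ?thesis using pq
      by (auto split: split_indicator intro!: add_increasing2 ennreal_leI powr_mono2)
  next
    case True
    define k where "k = nat \<lceil>log 2 (Z \<omega> / T)\<rceil> - 1"
    have l: "log 2 (Z \<omega> / T) > 0" using True T by simp
    have "real k < log 2 (Z \<omega> / T)" "log 2 (Z \<omega> / T) \<le> real (Suc k)"
      using l unfolding k_def by linarith+
    moreover have "Z \<omega> / T > 0" using True T by simp
    ultimately have "2 powr real k < Z \<omega> / T" "Z \<omega> / T \<le> 2 powr real (Suc k)"
      by (simp_all only: less_log_iff log_le_iff one_less_numeral_iff semiring_norm)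
    then have k: "2 ^ k * T < Z \<omega>" "Z \<omega> \<le> 2 ^ Suc k * T"
      using T by (simp_all only: powr_realpow zero_less_numeral pos_less_divide_eq pos_divide_le_eq)
    have "ennreal (Z \<omega> powr p) * indicator {\<omega>. Z \<omega> \<ge> 0} \<omega> \<le> ennreal (?b k) * indicator (?A k) \<omega>"
      using k \<omega> True T pq by (auto intro!: ennreal_leI powr_mono2)
    also have "\<dots> = (\<Sum>k\<in>{k}. ennreal (?b k) * indicator (?A k) \<omega>)"
      by (simp only: sum.insert finite.emptyI empty_iff not_False_eq_True sum.empty add_0_right)
    also have "\<dots> \<le> (\<Sum>k. ennreal (?b k) * indicator (?A k) \<omega>)"
      by (rule sum_le_suminf) auto
    finally show ?thesis by (rule order_trans) simp
  qed
  define \<rho> where "\<rho> = (2::real) powr (p - q)"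
  have \<rho>: "0 < \<rho>" "\<rho> < 1"
  proof -
    show "0 < \<rho>" by (simp add: \<rho>_def)
    have "\<rho> < 2 powr 0" unfolding \<rho>_def using pq by (intro powr_less_mono) auto
    then show "\<rho> < 1" by simp
  qed
  have bterm: "ennreal (?b k) * emeasure M (?A k) \<le> ennreal (2 powr p * T powr (p - q) * \<bar>c\<bar>
      * \<rho> ^ k)" for k
  proof -
    have "1 * T \<le> 2 ^ k * T" using T by (intro mult_right_mono) auto
    then have "ennreal (?b k) * emeasure M (?A k) \<le> ennreal (?b k) * ennreal (\<bar>c\<bar> * (2 ^ k
        * T) powr (-q))"
      by (intro mult_left_mono order_trans[OF tail] ennreal_leI mult_right_mono) auto
    also have "\<dots> = ennreal (?b k * (\<bar>c\<bar> * (2 ^ k * T) powr (-q)))"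
      by (rule ennreal_mult[symmetric]) auto
    also have "?b k * (\<bar>c\<bar> * (2 ^ k * T) powr (-q)) = 2 powr p * T powr (p - q) * \<bar>c\<bar> * \<rho> ^ k"
    proof -
      have "\<rho> ^ k = (2 ^ k) powr p * (2 ^ k) powr (-q)"
        unfolding \<rho>_def powr_add[symmetric]
        by (simp add: powr_realpow[symmetric] powr_powr mult.commute)
      moreover have "?b k = 2 powr p * (2 ^ k) powr p * T powr p" using T by (simp add: powr_mult)
      moreover have "(2 ^ k * T) powr (-q) = (2 ^ k) powr (-q) * T powr (-q)" using T
          by (simp add: powr_mult)
      moreover have "T powr (p - q) = T powr p * T powr (-q)" by (simp add: powr_add[symmetric])
      ultimately show ?thesis by (simp only: mult_ac)
    qed
    finally show ?thesis .
  qed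
  have sm: "summable (\<lambda>k. 2 powr p * T powr (p - q) * \<bar>c\<bar> * \<rho> ^ k)"
    using \<rho> by (intro summable_mult summable_geometric) auto
  have "(\<integral>\<^sup>+\<omega>. ennreal (Z \<omega> powr p) * indicator {\<omega>. Z \<omega> \<ge> 0} \<omega> \<partial>M)
      \<le> (\<integral>\<^sup>+\<omega>. ennreal (T powr p) + (\<Sum>k. ennreal (?b k) * indicator (?A k) \<omega>) \<partial>M)"
    by (rule nn_integral_mono) (rule pt)
  also have "\<dots> = ennreal (T powr p) * emeasure M (space M) + (\<Sum>k. ennreal (?b k) * emeasure M (?A k))"
    by (simp add: nn_integral_add nn_integral_suminf nn_integral_cmult)
  also have "\<dots> \<le> ennreal (T powr p) * emeasure M (space M)
      + (\<Sum>k. ennreal (2 powr p * T powr (p - q) * \<bar>c\<bar> * \<rho> ^ k))"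
    by (intro add_left_mono suminf_le bterm) auto
  also have "\<dots> = ennreal (T powr p) * emeasure M (space M)
      + ennreal (\<Sum>k. 2 powr p * T powr (p - q) * \<bar>c\<bar> * \<rho> ^ k)"
    using \<rho> sm by (subst suminf_ennreal2) auto
  also have "\<dots> < \<infinity>" by (simp add: ennreal_mult_less_top emeasure_finite less_top[symmetric]
      ennreal_mult_eq_top_iff)
  finally show ?thesis .
qed

text \<open>By Fubini, \<open>E [G (Y / x)]\<close> is the integral of \<open>\<phi> r F (r x)\<close>, where \<open>\<phi>\<close> is the derivative of
  \<open>G\<close>; after division by \<open>F x\<close> the integrand converges pointwise and is dominated by Potter's
  bounds.\<close>

lemma rv_transform_limit:
  fixes \<phi> :: "real \<Rightarrow> complex"
  assumes "prob_space M" and [measurable]: "Y \<in> borel_measurable M"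
    and F: "rv_tail \<alpha> (\<lambda>x. measure M {\<omega> \<in> space M. Y \<omega> > x})"
    and \<epsilon>: "0 < \<epsilon>" "\<epsilon> < \<alpha>" and [measurable]: "\<phi> \<in> borel_measurable borel"
    and int: "integrable lborel (\<lambda>r. indicator {0<..} r * (norm (\<phi> r) * (r powr (-\<alpha> - \<epsilon>)
        + r powr (-\<alpha> + \<epsilon>))))"
  shows "((\<lambda>x. (\<integral>\<omega>. (\<integral>r. indicator {0<..<Y \<omega> / x} r *\<^sub>R \<phi> r \<partial>lborel) \<partial>M)
      / measure M {\<omega> \<in> space M. Y \<omega> > x}) \<longlongrightarrow> (\<integral>r. (indicator {0<..} r
          * r powr (-\<alpha>)) *\<^sub>R \<phi> r \<partial>lborel)) at_top"
proof -
  interpret prob_space M by fact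
  interpret P: pair_sigma_finite lborel M ..
  define F where "F x = measure M {\<omega> \<in> space M. Y \<omega> > x}" for x
  have F': "rv_tail \<alpha> F" using assms(3) unfolding F_def .
  have Fm [measurable]: "F \<in> borel_measurable borel"
    unfolding F_def by measurable
  have pos: "\<And>x. x > 0 \<Longrightarrow> F x > 0"
    and lim: "\<And>c. c > 0 \<Longrightarrow> ((\<lambda>x. F (c * x) / F x) \<longlongrightarrow> c powr (-\<alpha>)) at_top"
    using F' unfolding rv_tail_def by auto
  obtain x1 B where x1: "x1 > 0" and B: "B > 0"
    and bd: "\<And>x r. x \<ge> x1 \<Longrightarrow> r > 0 \<Longrightarrow> F (r * x) / F x \<le> B * (r powr (-\<alpha> - \<epsilon>) + r powr (-\<alpha> + \<epsilon>))"
    by (rule rv_tail_ratio_bound[OF F' _ \<epsilon>]) (auto simp: F_def)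
  let ?w = "\<lambda>r. B * (indicator {0<..} r * (norm (\<phi> r) * (r powr (-\<alpha> - \<epsilon>) + r powr (-\<alpha> + \<epsilon>))))"
  have w: "integrable lborel ?w" by (intro integrable_mult_right int)
  let ?s = "\<lambda>x r. (indicator {0<..} r * (F (r * x) / F x)) *\<^sub>R \<phi> r"
  have bnd: "norm (?s x r) \<le> ?w r" if "x \<ge> x1" for x r
  proof (cases "r > 0")
    case True
    have "x > 0" using that x1 by simp
    then have "0 \<le> F (r * x) / F x" using pos[of x] by (simp add: F_def)
    then have "norm (?s x r) = (F (r * x) / F x) * norm (\<phi> r)" using True by (simp add: F_def)
    also have "\<dots> \<le> B * (r powr (-\<alpha> - \<epsilon>) + r powr (-\<alpha> + \<epsilon>)) * norm (\<phi> r)"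
      using bd[OF that True] by (intro mult_right_mono) auto
    also have "\<dots> = ?w r" using True by simp
    finally show ?thesis .
  qed auto
  have ae0: "AE r::real in lborel. r \<noteq> 0" by (rule AE_lborel_singleton)
  have conv: "((\<lambda>x. \<integral>r. ?s x r \<partial>lborel) \<longlongrightarrow> (\<integral>r. (indicator {0<..} r
      * r powr (-\<alpha>)) *\<^sub>R \<phi> r \<partial>lborel)) at_top"
  proof (rule integral_dominated_convergence_at_top[OF _ _ w])
    show "AE r in lborel. ((\<lambda>x. ?s x r) \<longlongrightarrow> (indicator {0<..} r * r powr (-\<alpha>)) *\<^sub>R \<phi> r) at_top"
    proof (rule AE_I2)
      fix r :: real
      show "((\<lambda>x. ?s x r) \<longlongrightarrow> (indicator {0<..} r * r powr (-\<alpha>)) *\<^sub>R \<phi> r) at_top"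
        by (cases "r > 0") (auto intro!: tendsto_intros lim)
    qed
    show "\<forall>\<^sub>F x in at_top. AE r in lborel. norm (?s x r) \<le> ?w r"
      using eventually_ge_at_top[of x1] by eventually_elim (intro AE_I2 bnd)
  qed measurable
  have eq: "(\<integral>r. ?s x r \<partial>lborel) = (\<integral>\<omega>. (\<integral>r. indicator {0<..<Y \<omega> / x} r *\<^sub>R \<phi> r \<partial>lborel) \<partial>M) / F x"
    if x: "x \<ge> x1" for x
  proof -
    have xp: "x > 0" using x x1 by simp
    let ?f = "\<lambda>r \<omega>. indicator {0<..<Y \<omega> / x} r *\<^sub>R \<phi> r"
    have split: "indicat_real {0<..<Y \<omega> / x} r = indicator {0<..} r * indicator {\<omega>
        \<in> space M. Y \<omega> > r * x} \<omega>"
      if "\<omega> \<in> space M" for r :: real and \<omega>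
      using xp that by (auto simp: field_simps split: split_indicator)
    have fm: "case_prod ?f \<in> borel_measurable (lborel \<Otimes>\<^sub>M M)"
    proof -
      have "case_prod ?f = (\<lambda>z. if 0 < fst z \<and> fst z < Y (snd z) / x then \<phi> (fst z) else 0)"
        by (auto simp: fun_eq_iff)
      also have "\<dots> \<in> borel_measurable (lborel \<Otimes>\<^sub>M M)" by measurable
      finally show ?thesis .
    qed
    have i1: "(\<integral>\<omega>. indicator {0<..<Y \<omega> / x} r *\<^sub>R c \<partial>M) = (indicator {0<..} r * F (r * x)) *\<^sub>R c"
      for r and c :: "'c :: {banach, second_countable_topology}"
    proof -
      have "(\<integral>\<omega>. indicator {0<..<Y \<omega> / x} r *\<^sub>R c \<partial>M)
          = (\<integral>\<omega>. indicator {0<..} r *\<^sub>R (indicator {\<omega> \<in> space M. Y \<omega> > r * x} \<omega> *\<^sub>R c) \<partial>M)"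
        by (intro Bochner_Integration.integral_cong) (auto simp: split)
      also have "\<dots> = indicator {0<..} r *\<^sub>R (F (r * x) *\<^sub>R c)"
        by (simp add: F_def Int_def emeasure_eq_measure conj_commute)
      finally show ?thesis by simp
    qed
    have "integrable (lborel \<Otimes>\<^sub>M M) (case_prod ?f)"
    proof (rule P.Fubini_integrable[OF fm])
      have "(\<lambda>r. \<integral>\<omega>. norm (case_prod ?f (r, \<omega>)) \<partial>M) = (\<lambda>r. F x * norm (?s x r))"
      proof
        fix r
        have "(\<integral>\<omega>. norm (case_prod ?f (r, \<omega>)) \<partial>M) = (\<integral>\<omega>. indicator {0<..<Y \<omega> / x} r *\<^sub>R norm (\<phi> r) \<partial>M)"
          by simp
        also have "\<dots> = F x * norm (?s x r)"
          unfolding i1 using pos[OF xp] by (auto simp: F_def split: split_indicator)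
        finally show "(\<integral>\<omega>. norm (case_prod ?f (r, \<omega>)) \<partial>M) = F x * norm (?s x r)" .
      qed
      moreover have "integrable lborel (\<lambda>r. F x * norm (?s x r))"
      proof (intro integrable_mult_right integrable_norm)
        show "integrable lborel (?s x)"
          by (rule Bochner_Integration.integrable_bound[OF w])
             (use bnd[OF x] B in \<open>auto simp: abs_mult intro!: AE_I2 order_trans[OF bnd[OF x]]\<close>)
      qed
      ultimately show "integrable lborel (\<lambda>r. \<integral>\<omega>. norm (case_prod ?f (r, \<omega>)) \<partial>M)" by simp
      show "AE r in lborel. integrable M (\<lambda>\<omega>. case_prod ?f (r, \<omega>))"
      proof (rule AE_I2)
        fix r
        show "integrable M (\<lambda>\<omega>. case_prod ?f (r, \<omega>))"
          by (rule integrable_const_bound[of _ "norm (\<phi> r)"])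
             (auto simp: split split: split_indicator cong: measurable_cong)
      qed
    qed
    from P.Fubini_integral[OF this]
    have "(\<integral>\<omega>. (\<integral>r. ?f r \<omega> \<partial>lborel) \<partial>M) = (\<integral>r. (\<integral>\<omega>. ?f r \<omega> \<partial>M) \<partial>lborel)" .
    also have "\<dots> = (\<integral>r. F x *\<^sub>R ?s x r \<partial>lborel)"
      unfolding i1 using pos[OF xp] by (intro Bochner_Integration.integral_cong) (auto split:
          split_indicator)
    also have "\<dots> = F x *\<^sub>R (\<integral>r. ?s x r \<partial>lborel)" by (rule integral_scaleR_right)
    finally show ?thesis using pos[OF xp] by (simp add: scaleR_conv_of_real field_simps)
  qed
  show ?thesis unfolding F_def[symmetric]
    by (rule Lim_transform_eventually[OF conv])
       (use eventually_ge_at_top[of x1] in eventually_elim, rule eq)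
qed


lemma integrable_powr_0:
  fixes a b :: real assumes "a > -1" "b \<ge> 0"
  shows "integrable lborel (\<lambda>r. indicator {0<..b} r * r powr a)"
proof (rule integrableI_nonneg)
  have "(\<integral>\<^sup>+r. ennreal (indicator {0<..b} r * r powr a) \<partial>lborel) \<le> (\<integral>\<^sup>+r. ennreal (r powr a)
      * indicator {0..b} r \<partial>lborel)"
    by (intro nn_integral_mono) (auto split: split_indicator)
  also have "\<dots> = ennreal (b powr (a+1) / (a+1))"
    by (rule nn_integral_has_integral_lebesgue'[OF _ has_integral_powr_from_0]) (use assms in auto)
  finally show "(\<integral>\<^sup>+r. ennreal (indicator {0<..b} r * r powr a) \<partial>lborel) < \<infinity>"
    by (simp add: order.strict_trans1)
qed auto

lemma integrable_powr_inf:
  fixes a b :: real assumes "a < -1" "b > 0"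
  shows "integrable lborel (\<lambda>r. indicator {b..} r * r powr a)"
proof (rule integrableI_nonneg)
  have "(\<integral>\<^sup>+r. ennreal (indicator {b..} r * r powr a) \<partial>lborel) = (\<integral>\<^sup>+r. ennreal (r powr a)
      * indicator {b..} r \<partial>lborel)"
    by (intro nn_integral_cong) (auto split: split_indicator)
  also have "\<dots> = ennreal (-(b powr (a+1)) / (a+1))"
    by (rule nn_integral_has_integral_lebesgue'[OF _ has_integral_powr_to_inf]) (use assms in auto)
  finally show "(\<integral>\<^sup>+r. ennreal (indicator {b..} r * r powr a) \<partial>lborel) < \<infinity>"
    by simp
qed auto

text \<open>The form in which the majorant is verified: polynomial growth near \<open>0\<close>, and either bounded
  support or a fast enough decay of the weight at infinity.\<close>

lemma rv_weight_integrable: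
  fixes \<phi> :: "real \<Rightarrow> complex"
  assumes [measurable]: "\<phi> \<in> borel_measurable borel" and b: "b > 0" and \<epsilon>: "\<epsilon> > 0"
    and bound: "\<And>r. r > 0 \<Longrightarrow> norm (\<phi> r) \<le> indicator {0<..b} r * r powr k + D * indicator {b..} r"
    and k: "k - \<alpha> - \<epsilon> > -1" and D: "D = 0 \<or> -\<alpha> + \<epsilon> < -1"
  shows "integrable lborel (\<lambda>r. indicator {0<..} r * (norm (\<phi> r) * (r powr (-\<alpha> - \<epsilon>) + r powr (-\<alpha> + \<epsilon>))))"
proof -
  let ?w = "\<lambda>r. (indicator {0<..b} r * r powr (k - \<alpha> - \<epsilon>) + indicator {0<..b} r * r powr (k - \<alpha> + \<epsilon>))
    + (D * (indicator {b..} r * r powr (-\<alpha> - \<epsilon>)) + D * (indicator {b..} r * r powr (-\<alpha> + \<epsilon>)))"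
  have "integrable lborel (\<lambda>r. D * (indicator {b..} r * r powr (-\<alpha> - \<epsilon>)) + D * (indicator {b..} r
      * r powr (-\<alpha> + \<epsilon>)))"
  proof (cases "D = 0")
    case False
    then show ?thesis using D b \<epsilon>
      by (intro Bochner_Integration.integrable_add integrable_mult_right integrable_powr_inf) auto
  qed auto
  then have w: "integrable lborel ?w"
    using b k \<epsilon>
    by (intro Bochner_Integration.integrable_add[OF Bochner_Integration.integrable_add]
        integrable_powr_0) auto
  have "norm (indicator {0<..} r * (norm (\<phi> r) * (r powr (-\<alpha> - \<epsilon>) + r powr (-\<alpha> + \<epsilon>)))) \<le> ?w r" for r
  proof (cases "r > 0")
    case True
    have "norm (indicator {0<..} r * (norm (\<phi> r) * (r powr (-\<alpha> - \<epsilon>) + r powr (-\<alpha> + \<epsilon>))))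
        = norm (\<phi> r) * (r powr (-\<alpha> - \<epsilon>) + r powr (-\<alpha> + \<epsilon>))"
      using True by simp
    also have "\<dots> \<le> (indicator {0<..b} r * r powr k + D * indicator {b..} r) * (r powr (-\<alpha> - \<epsilon>)
        + r powr (-\<alpha> + \<epsilon>))"
      by (intro mult_right_mono bound True) auto
    also have "\<dots> = ?w r"
      by (simp add: algebra_simps powr_add[symmetric] split: split_indicator)
    finally show ?thesis .
  next
    case False
    then show ?thesis using b by (auto split: split_indicator)
  qed
  then show ?thesis
    by (intro Bochner_Integration.integrable_bound[OF w]) (auto intro!: AE_I2 order_trans[OF _
        abs_ge_self])
qed

lemma integral_open_interval_FTC:
  fixes G \<phi> :: "real \<Rightarrow> complex"
  assumes "0 \<le> y" and "\<And>x. 0 \<le> x \<Longrightarrow> x \<le> y \<Longrightarrow> (G has_vector_derivative \<phi> x) (at x within {0..y})"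
    and "continuous_on {0..y} \<phi>"
  shows "(\<integral>r. indicator {0<..<y} r *\<^sub>R \<phi> r \<partial>lborel) = G y - G 0"
proof -
  have m: "(\<lambda>r. indicator {0..y} r *\<^sub>R \<phi> r) \<in> borel_measurable lborel"
    using borel_integrable_compact[OF compact_Icc assms(3)] by auto
  have e: "(\<lambda>r. indicator {0<..<y} r *\<^sub>R \<phi> r) = (\<lambda>r. indicator {0<..<y} r *\<^sub>R (indicator {0..y} r
      *\<^sub>R \<phi> r))"
    by (auto simp: fun_eq_iff split: split_indicator)
  have m2: "(\<lambda>r. indicator {0<..<y} r *\<^sub>R \<phi> r) \<in> borel_measurable lborel"
    unfolding e by (intro borel_measurable_scaleR m) auto
  have "(\<integral>r. indicator {0<..<y} r *\<^sub>R \<phi> r \<partial>lborel) = (\<integral>r. indicator {0..y} r *\<^sub>R \<phi> r \<partial>lborel)"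
  proof (rule integral_cong_AE[OF m2 m])
    have "AE r in lborel. r \<noteq> (0::real)" "AE r in lborel. r \<noteq> y" by (rule AE_lborel_singleton)+
    then show "AE r in lborel. indicator {0<..<y} r *\<^sub>R \<phi> r = indicator {0..y} r *\<^sub>R \<phi> r"
      by eventually_elim (auto split: split_indicator)
  qed
  also have "\<dots> = G y - G 0"
    by (rule integral_FTC_atLeastAtMost) (use assms in auto)
  finally show ?thesis .
qed

lemma convergent_at_top_if_nearly_constant:
  fixes q :: "real \<Rightarrow> complex"
  assumes near: "\<And>e. e > 0 \<Longrightarrow> \<exists>d. eventually (\<lambda>x. norm (q x - d) \<le> e) at_top"
  shows "\<exists>c. (q \<longlongrightarrow> c) at_top"
proof -
  have ev: "eventually (\<lambda>n. norm (q (real n) - d) \<le> e) sequentially"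
    if "eventually (\<lambda>x. norm (q x - d) \<le> e) at_top" for d e
    using filterlim_real_sequentially that by (rule eventually_compose_filterlim[rotated])
  have "Cauchy (\<lambda>n. q (real n))"
  proof (rule metric_CauchyI)
    fix e :: real assume e: "e > 0"
    then obtain d where "eventually (\<lambda>x. norm (q x - d) \<le> e / 3) at_top" using near[of "e / 3"] by auto
    from ev[OF this] obtain N where N: "\<And>n. n \<ge> N \<Longrightarrow> norm (q (real n) - d) \<le> e / 3"
      by (auto simp: eventually_sequentially)
    have "dist (q (real m)) (q (real n)) < e" if "m \<ge> N" "n \<ge> N" for m n
    proof -
      have "dist (q (real m)) (q (real n)) \<le> norm (q (real m) - d) + norm (q (real n) - d)"
        unfolding dist_norm by (rule norm_diff_triangle_le[of _ d]) (auto simp: norm_minus_commute)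
      then show ?thesis using N[OF that(1)] N[OF that(2)] e by linarith
    qed
    then show "\<exists>M. \<forall>m\<ge>M. \<forall>n\<ge>M. dist (q (real m)) (q (real n)) < e" by blast
  qed
  then obtain c where c: "(\<lambda>n. q (real n)) \<longlonglongrightarrow> c"
    using Cauchy_convergent[of "\<lambda>n. q (real n)"] unfolding convergent_def by blast
  have "(q \<longlongrightarrow> c) at_top"
  proof (rule tendstoI)
    fix e :: real assume e: "e > 0"
    then obtain d where d: "eventually (\<lambda>x. norm (q x - d) \<le> e / 3) at_top" using near[of "e / 3"] by auto
    have "norm (c - d) \<le> e / 3"
    proof (rule tendsto_upperbound)
      show "(\<lambda>n. norm (q (real n) - d)) \<longlonglongrightarrow> norm (c - d)" by (intro tendsto_intros c)
    qed (use ev[OF d] in auto)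
    show "eventually (\<lambda>x. dist (q x) c < e) at_top"
      using d
    proof eventually_elim
      case (elim x)
      have "dist (q x) c \<le> norm (q x - d) + norm (c - d)"
        unfolding dist_norm by (rule norm_diff_triangle_le[of _ d]) (auto simp: norm_minus_commute)
      with elim \<open>norm (c - d) \<le> e / 3\<close> e show ?case by linarith
    qed
  qed
  then show ?thesis by blast
qed

lemma rv_moment:
  assumes "prob_space M" and [measurable]: "Y \<in> borel_measurable M" and Y0: "\<And>\<omega>. Y \<omega> \<ge> 0"
    and F: "rv_tail \<alpha> (\<lambda>x. measure M {\<omega> \<in> space M. Y \<omega> > x})" and p: "0 < p" "p < \<alpha>"
  shows "integrable M (\<lambda>\<omega>. Y \<omega> powr p)"
proof (rule integrableI_nonneg)
  interpret prob_space M by fact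
  define F where "F x = measure M {\<omega> \<in> space M. Y \<omega> > x}" for x
  define \<epsilon> where "\<epsilon> = (\<alpha> - p) / 2"
  have "\<alpha> - p = 2 * \<epsilon>" by (simp add: \<epsilon>_def)
  then have \<epsilon>: "0 < \<epsilon>" "\<epsilon> < \<alpha>" "p < \<alpha> - \<epsilon>" using p by auto
  obtain x1 where x1: "x1 > 0"
    and up: "\<And>x r. x \<ge> x1 \<Longrightarrow> r \<ge> 1 \<Longrightarrow> F (r * x) \<le> (r / 2) powr (-(\<alpha> - \<epsilon>)) * F x"
    and "\<And>x r. x \<ge> x1 \<Longrightarrow> r \<ge> 1 \<Longrightarrow> (2 * r) powr (-(\<alpha> + \<epsilon>)) * F x \<le> F (r * x)"
    by (rule rv_tail_potter[OF F[folded F_def] \<epsilon>(1,2)]) (rule that, assumption+)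
  have "(\<integral>\<^sup>+\<omega>. ennreal (Y \<omega> powr p) * indicator {\<omega>. Y \<omega> \<ge> 0} \<omega> \<partial>M) < \<infinity>"
  proof (rule moment_finite_of_tail[where q="\<alpha> - \<epsilon>" and T=x1 and c="(2 * x1) powr (\<alpha> - \<epsilon>) * F x1"])
    fix t assume t: "t \<ge> x1"
    have "F ((t / x1) * x1) \<le> (t / x1 / 2) powr (-(\<alpha> - \<epsilon>)) * F x1"
      using t x1 by (intro up) auto
    also have "(t / x1 / 2) powr (-(\<alpha> - \<epsilon>)) = (2 * x1) powr (\<alpha> - \<epsilon>) * t powr (-(\<alpha> - \<epsilon>))"
    proof -
      have "(t / x1 / 2) powr (-(\<alpha> - \<epsilon>)) = (t / (2 * x1)) powr (-(\<alpha> - \<epsilon>))" by (simp add: mult.commute)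
      also have "\<dots> = t powr (-(\<alpha> - \<epsilon>)) / (2 * x1) powr (-(\<alpha> - \<epsilon>))"
        by (rule powr_divide)
      also have "\<dots> = t powr (-(\<alpha> - \<epsilon>)) * (2 * x1) powr (\<alpha> - \<epsilon>)"
        using powr_minus[of "2 * x1" "-(\<alpha> - \<epsilon>)"] by (simp add: divide_inverse)
      finally show ?thesis by (simp add: mult.commute)
    qed
    finally have "F t \<le> (2 * x1) powr (\<alpha> - \<epsilon>) * F x1 * t powr - (\<alpha> - \<epsilon>)" using x1 by (simp add: mult_ac)
    then show "emeasure M {\<omega> \<in> space M. t < Y \<omega>} \<le> ennreal ((2 * x1) powr (\<alpha> - \<epsilon>) * F x1
        * t powr - (\<alpha> - \<epsilon>))"
      unfolding emeasure_eq_measure F_def by (rule ennreal_leI)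
  qed (use p \<epsilon> x1 in \<open>auto intro: finite_measure_axioms\<close>)
  then show "(\<integral>\<^sup>+\<omega>. ennreal (Y \<omega> powr p) \<partial>M) < \<infinity>" by (simp add: Y0)
qed auto

text \<open>Bounds the tail from below by a power, hence the norming constants from below.\<close>

lemma rv_tail_lower:
  assumes F: "rv_tail \<alpha> F" and \<epsilon>: "0 < \<epsilon>" "\<epsilon> < \<alpha>"
  shows "\<exists>c>0. eventually (\<lambda>x. c * x powr (-(\<alpha> + \<epsilon>)) \<le> F x) at_top"
proof -
  obtain x1 where x1: "x1 > 0"
    and "\<And>x r. x \<ge> x1 \<Longrightarrow> r \<ge> 1 \<Longrightarrow> F (r * x) \<le> (r / 2) powr (-(\<alpha> - \<epsilon>)) * F x"
    and lo: "\<And>x r. x \<ge> x1 \<Longrightarrow> r \<ge> 1 \<Longrightarrow> (2 * r) powr (-(\<alpha> + \<epsilon>)) * F x \<le> F (r * x)"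
    by (rule rv_tail_potter[OF F \<epsilon>]) (rule that, assumption+)
  have pos: "F x1 > 0" using F x1 unfolding rv_tail_def by auto
  show ?thesis
  proof (intro exI conjI)
    show "(2 / x1) powr (-(\<alpha> + \<epsilon>)) * F x1 > 0" using pos x1 by simp
    show "eventually (\<lambda>x. (2 / x1) powr (-(\<alpha> + \<epsilon>)) * F x1 * x powr (-(\<alpha> + \<epsilon>)) \<le> F x) at_top"
      using eventually_ge_at_top[of x1]
    proof eventually_elim
      case (elim x)
      have "(2 * (x / x1)) powr (-(\<alpha> + \<epsilon>)) * F x1 \<le> F ((x / x1) * x1)"
        using elim x1 by (intro lo) auto
      moreover have "2 * (x / x1) = (2 / x1) * x" by simp
      then have "(2 * (x / x1)) powr (-(\<alpha> + \<epsilon>)) = (2 / x1) powr (-(\<alpha> + \<epsilon>)) * x powr (-(\<alpha> + \<epsilon>))"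
        by (simp only: powr_mult)
      ultimately show ?case using x1 by (simp add: mult_ac)
    qed
  qed
qed

text \<open>The kernel is of order \<open>y\<close> near \<open>0\<close> for \<open>\<alpha> < 1\<close>, and of order \<open>y\<^sup>2\<close> for \<open>\<alpha> > 1\<close>, which is what
  integrability against \<open>y\<^sup>-\<^sup>\<alpha>\<^sup>-\<^sup>1\<close> requires; at infinity it is bounded, respectively linear.\<close>

definition rv_kernel :: "real \<Rightarrow> real \<Rightarrow> complex"
  where "rv_kernel \<alpha> y = 1 - iexp y + (if 1 < \<alpha> then \<i> * y else 0)"

lemma norm_one_minus_iexp: "norm (1 - iexp y) \<le> \<bar>y\<bar>" "norm (1 - iexp y) \<le> 2"
proof -
  show "norm (1 - iexp y) \<le> \<bar>y\<bar>"
    using iexp_approx1[of y 0] by (simp add: norm_minus_commute)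
  show "norm (1 - iexp y) \<le> 2"
    using norm_triangle_ineq4[of 1 "iexp y"] by simp
qed

text \<open>For \<open>\<alpha> > 1\<close> the derivative of the kernel is bounded and of order \<open>r\<close> at \<open>0\<close>, and
  dominated convergence applies directly. For \<open>\<alpha> < 1\<close> the derivative does not decay while
  \<open>r\<^sup>-\<^sup>\<alpha>\<close> is not integrable at infinity. There the kernel is frozen beyond \<open>R\<close>; this changes the
  quotient by at most \<open>2 F (R x) / F x\<close>, which tends to \<open>2 R\<^sup>-\<^sup>\<alpha>\<close>, so the quotient has the Cauchy
  property.\<close>

lemma rv_kernel_limit_exists:
  assumes "prob_space M" and [measurable]: "Y \<in> borel_measurable M" and Y0: "\<And>\<omega>. Y \<omega> \<ge> 0"
    and F: "rv_tail \<alpha> (\<lambda>x. measure M {\<omega> \<in> space M. Y \<omega> > x})"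
    and \<alpha>: "\<alpha> \<in> {0<..<1} \<union> {1<..<2}"
  shows "\<exists>c. ((\<lambda>x. (\<integral>\<omega>. rv_kernel \<alpha> (Y \<omega> / x) \<partial>M) / measure M {\<omega> \<in> space M. Y \<omega> > x}) \<longlongrightarrow> c) at_top"
proof -
  interpret prob_space M by fact
  define F where "F x = measure M {\<omega> \<in> space M. Y \<omega> > x}" for x
  have F': "rv_tail \<alpha> F" using F unfolding F_def .
  have pos: "\<And>x. x > 0 \<Longrightarrow> F x > 0"
    and lim: "\<And>c. c > 0 \<Longrightarrow> ((\<lambda>x. F (c * x) / F x) \<longlongrightarrow> c powr (-\<alpha>)) at_top"
    using F' unfolding rv_tail_def by auto
  show ?thesis
  proof (cases "1 < \<alpha>")
    case True
    define \<epsilon> where "\<epsilon> = min ((2 - \<alpha>) / 2) ((\<alpha> - 1) / 2)"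
    have \<epsilon>: "0 < \<epsilon>" "\<epsilon> < \<alpha>" "1 - \<alpha> - \<epsilon> > -1" "-\<alpha> + \<epsilon> < -1"
      using True \<alpha> by (auto simp: \<epsilon>_def min_def field_simps)
    define \<phi> where "\<phi> r = \<i> * (1 - iexp r)" for r :: real
    have [measurable]: "\<phi> \<in> borel_measurable borel" unfolding \<phi>_def by measurable
    have w: "integrable lborel (\<lambda>r. indicator {0<..} r * (norm (\<phi> r) * (r powr (-\<alpha> - \<epsilon>) + r powr (-\<alpha>
        + \<epsilon>))))"
    proof (rule rv_weight_integrable[where b=1 and k=1 and D=2])
      show "cmod (\<phi> r) \<le> indicat_real {0<..1} r * r powr 1 + 2 * indicat_real {1..} r" if "r > 0" for r
        using norm_one_minus_iexp[of r] that by (auto simp: \<phi>_def norm_mult split: split_indicator)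
    qed (use \<epsilon> in auto)
    have eq: "(\<integral>r. indicator {0<..<Y \<omega> / x} r *\<^sub>R \<phi> r \<partial>lborel) = rv_kernel \<alpha> (Y \<omega> / x)" if "x > 0" for \<omega> x
    proof -
      have "(\<integral>r. indicator {0<..<Y \<omega> / x} r *\<^sub>R \<phi> r \<partial>lborel)
          = (\<i> * (Y \<omega> / x) - iexp (Y \<omega> / x)) - (\<i> * of_real 0 - iexp 0)"
        by (rule integral_open_interval_FTC)
           (use that Y0 in \<open>auto simp: \<phi>_def algebra_simps intro!: derivative_eq_intros
               continuous_intros\<close>)
      then show ?thesis using True by (simp add: rv_kernel_def)
    qed
    have "((\<lambda>x. (\<integral>\<omega>. (\<integral>r. indicator {0<..<Y \<omega> / x} r *\<^sub>R \<phi> r \<partial>lborel) \<partial>M) / F x)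
        \<longlongrightarrow> (\<integral>r. (indicator {0<..} r * r powr (-\<alpha>)) *\<^sub>R \<phi> r \<partial>lborel)) at_top"
      unfolding F_def by (rule rv_transform_limit[OF assms(1,2) F \<epsilon>(1,2) _ w]) simp
    then have "((\<lambda>x. (\<integral>\<omega>. rv_kernel \<alpha> (Y \<omega> / x) \<partial>M) / F x)
        \<longlongrightarrow> (\<integral>r. (indicator {0<..} r * r powr (-\<alpha>)) *\<^sub>R \<phi> r \<partial>lborel)) at_top"
      by (rule Lim_transform_eventually) (use eventually_gt_at_top[of 0] in eventually_elim, simp add: eq)
    then show ?thesis unfolding F_def by blast
  next
    case False
    then have \<alpha>1: "0 < \<alpha>" "\<alpha> < 1" using \<alpha> by auto
    define \<epsilon> where "\<epsilon> = min ((1 - \<alpha>) / 2) (\<alpha> / 2)"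
    have \<epsilon>: "0 < \<epsilon>" "\<epsilon> < \<alpha>" "- \<alpha> - \<epsilon> > -1"
      using \<alpha>1 by (auto simp: \<epsilon>_def min_def field_simps)
    let ?q = "\<lambda>x. (\<integral>\<omega>. rv_kernel \<alpha> (Y \<omega> / x) \<partial>M) / F x"
    have near: "\<exists>d. eventually (\<lambda>x. norm (?q x - d) \<le> e) at_top" if e: "e > 0" for e
    proof -
      have "((\<lambda>R. 2 * R powr (-\<alpha>)) \<longlongrightarrow> 2 * 0) at_top"
        using \<alpha>1 by (intro tendsto_intros tendsto_neg_powr filterlim_ident) auto
      then have "eventually (\<lambda>R. 2 * R powr (-\<alpha>) < e / 2) at_top"
        by (rule order_tendstoD) (use e in simp)
      then have "eventually (\<lambda>R. R > 0 \<and> 2 * R powr (-\<alpha>) < e / 2) at_top"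
        using eventually_gt_at_top[of 0] by eventually_elim auto
      then obtain R :: real where R: "R > 0" "2 * R powr (-\<alpha>) < e / 2"
        by (auto simp: eventually_at_top_linorder)
      define \<phi> where "\<phi> r = indicator {0<..R} r *\<^sub>R (- \<i> * iexp r)" for r :: real
      have [measurable]: "\<phi> \<in> borel_measurable borel" unfolding \<phi>_def by measurable
      have w: "integrable lborel (\<lambda>r. indicator {0<..} r * (norm (\<phi> r) * (r powr (-\<alpha> - \<epsilon>)
          + r powr (-\<alpha> + \<epsilon>))))"
      proof (rule rv_weight_integrable[where b=R and k=0 and D=0])
        show "cmod (\<phi> r) \<le> indicat_real {0<..R} r * r powr 0 + 0 * indicat_real {R..} r" if "r > 0" for r
          using that by (auto simp: \<phi>_def norm_mult split: split_indicator)
      qed (use \<epsilon> R in auto)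
      have eq: "(\<integral>r. indicator {0<..<y} r *\<^sub>R \<phi> r \<partial>lborel) = 1 - iexp (min y R)" if "y \<ge> 0" for y
      proof -
        have ae: "AE r in lborel. r \<noteq> R" by (rule AE_lborel_singleton)
        have "(\<integral>r. indicator {0<..<y} r *\<^sub>R \<phi> r \<partial>lborel) = (\<integral>r. indicator {0<..<min y R} r *\<^sub>R (- \<i>
            * iexp r) \<partial>lborel)"
          by (rule integral_cong_AE) (use ae in \<open>auto simp: \<phi>_def split: split_indicator\<close>)
        also have "\<dots> = - iexp (min y R) - (- iexp 0)"
          by (rule integral_open_interval_FTC)
             (use that R in \<open>auto intro!: derivative_eq_intros continuous_intros\<close>)
        finally show ?thesis by simp
      qed
      let ?d = "(\<integral>r. (indicator {0<..} r * r powr (-\<alpha>)) *\<^sub>R \<phi> r \<partial>lborel)"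
      have lim1: "((\<lambda>x. (\<integral>\<omega>. (\<integral>r. indicator {0<..<Y \<omega> / x} r *\<^sub>R \<phi> r \<partial>lborel) \<partial>M) / F x) \<longlongrightarrow> ?d) at_top"
        unfolding F_def by (rule rv_transform_limit[OF assms(1,2) F \<epsilon>(1,2) _ w]) simp
      have "eventually (\<lambda>x. norm ((\<integral>\<omega>. (\<integral>r. indicator {0<..<Y \<omega> / x} r *\<^sub>R \<phi> r \<partial>lborel) \<partial>M)
          / F x - ?d) < e / 2) at_top"
        using tendstoD[OF lim1, of "e / 2"] e by (simp add: dist_norm)
      moreover have "eventually (\<lambda>x. 2 * (F (R * x) / F x) < e / 2) at_top"
        by (rule order_tendstoD(2)[OF tendsto_mult_left[OF lim[OF R(1)]] R(2)])
      ultimately have "eventually (\<lambda>x. norm (?q x - ?d) \<le> e) at_top"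
        using eventually_gt_at_top[of 0]
      proof eventually_elim
        case (elim x)
        have y0: "Y \<omega> / x \<ge> 0" for \<omega> using elim Y0 by simp
        have int1: "integrable M (\<lambda>\<omega>. rv_kernel \<alpha> (Y \<omega> / x))"
        proof -
          have "integrable M (\<lambda>\<omega>. 1 - iexp (Y \<omega> / x))"
            by (rule integrable_const_bound[of _ 2], intro AE_I2 norm_one_minus_iexp) measurable
          then show ?thesis using False by (simp add: rv_kernel_def del: of_real_divide)
        qed
        have int2: "integrable M (\<lambda>\<omega>. 1 - iexp (min (Y \<omega> / x) R))"
          by (rule integrable_const_bound[of _ 2]) (use norm_one_minus_iexp in auto)
        have "norm ((\<integral>\<omega>. rv_kernel \<alpha> (Y \<omega> / x) \<partial>M) - (\<integral>\<omega>. 1 - iexp (min (Y \<omega> / x) R) \<partial>M))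
            = norm (\<integral>\<omega>. rv_kernel \<alpha> (Y \<omega> / x) - (1 - iexp (min (Y \<omega> / x) R)) \<partial>M)"
          using int1 int2 by simp
        also have "\<dots> \<le> (\<integral>\<omega>. 2 * indicator {\<omega> \<in> space M. Y \<omega> > R * x} \<omega> \<partial>M)"
        proof (rule order_trans[OF integral_norm_bound integral_mono])
          show "integrable M (\<lambda>\<omega>. norm (rv_kernel \<alpha> (Y \<omega> / x) - (1 - iexp (min (Y \<omega> / x) R))))"
            using int1 int2 by (intro integrable_norm) simp
          show "integrable M (\<lambda>\<omega>. 2 * indicat_real {\<omega> \<in> space M. R * x < Y \<omega>} \<omega>)"
            by (intro integrable_mult_right integrable_real_indicator) (auto simp: emeasure_eq_measure)
          fix \<omega> assume \<omega>: "\<omega> \<in> space M"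
          show "norm (rv_kernel \<alpha> (Y \<omega> / x) - (1 - iexp (min (Y \<omega> / x) R)))
              \<le> 2 * indicat_real {\<omega> \<in> space M. R * x < Y \<omega>} \<omega>"
          proof (cases "Y \<omega> > R * x")
            case True
            have "norm (rv_kernel \<alpha> (Y \<omega> / x) - (1 - iexp (min (Y \<omega> / x) R)))
                = norm (iexp (min (Y \<omega> / x) R) - iexp (Y \<omega> / x))"
              using False by (simp add: rv_kernel_def)
            also have "\<dots> \<le> 2" by (rule order_trans[OF norm_triangle_ineq4]) simp
            finally show ?thesis using True \<omega> by simp
          next
            case b: False
            then have "Y \<omega> / x \<le> R" using elim by (simp add: field_simps)
            then show ?thesis using False by (simp add: rv_kernel_def min_absorb1)
          qed
        qed
        also have "\<dots> = 2 * F (R * x)"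
          by (simp add: F_def)
        finally have b1: "norm ((\<integral>\<omega>. rv_kernel \<alpha> (Y \<omega> / x) \<partial>M) - (\<integral>\<omega>. 1 - iexp (min (Y \<omega>
            / x) R) \<partial>M)) \<le> 2 * F (R * x)" .
        have "norm (?q x - (\<integral>\<omega>. 1 - iexp (min (Y \<omega> / x) R) \<partial>M) / F x)
            = norm ((\<integral>\<omega>. rv_kernel \<alpha> (Y \<omega> / x) \<partial>M) - (\<integral>\<omega>. 1 - iexp (min (Y \<omega> / x) R) \<partial>M)) / F x"
          using pos[of x] elim by (simp add: diff_divide_distrib[symmetric] norm_divide)
        also have "\<dots> \<le> 2 * F (R * x) / F x"
          using b1 pos[of x] elim by (intro divide_right_mono) auto
        finally have b2: "norm (?q x - (\<integral>\<omega>. 1 - iexp (min (Y \<omega> / x) R) \<partial>M) / F x) \<le> 2 * F (R * x) / F x" .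
        have "norm (?q x - ?d) \<le> norm (?q x - (\<integral>\<omega>. 1 - iexp (min (Y \<omega> / x) R) \<partial>M) / F x)
            + norm ((\<integral>\<omega>. 1 - iexp (min (Y \<omega> / x) R) \<partial>M) / F x - ?d)"
          by (rule norm_diff_triangle_le[OF order_refl order_refl])
        then show ?case using b2 elim by (simp add: eq[OF y0])
      qed
      then show ?thesis by blast
    qed
    then have "\<exists>c. (?q \<longlongrightarrow> c) at_top" by (rule convergent_at_top_if_nearly_constant)
    then show ?thesis unfolding F_def .
  qed
qed

text \<open>The real part is bounded below by the contribution \<open>1 - cos y \<ge> 1 - cos 1\<close> of the values
  \<open>1 < y \<le> 2\<close>, whose probability is a fixed proportion of the tail in the limit.\<close>

lemma rv_kernel_limit:
  assumes "prob_space M" and [measurable]: "Y \<in> borel_measurable M" and Y0: "\<And>\<omega>. Y \<omega> \<ge> 0"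
    and F: "rv_tail \<alpha> (\<lambda>x. measure M {\<omega> \<in> space M. Y \<omega> > x})"
    and \<alpha>: "\<alpha> \<in> {0<..<1} \<union> {1<..<2}"
  shows "\<exists>c. Re c > 0 \<and>
    ((\<lambda>x. (\<integral>\<omega>. rv_kernel \<alpha> (Y \<omega> / x) \<partial>M) / measure M {\<omega> \<in> space M. Y \<omega> > x}) \<longlongrightarrow> c) at_top"
proof -
  interpret prob_space M by fact
  define F where "F x = measure M {\<omega> \<in> space M. Y \<omega> > x}" for x
  have F': "rv_tail \<alpha> F" using F unfolding F_def .
  have pos: "\<And>x. x > 0 \<Longrightarrow> F x > 0"
    and lim: "\<And>c. c > 0 \<Longrightarrow> ((\<lambda>x. F (c * x) / F x) \<longlongrightarrow> c powr (-\<alpha>)) at_top"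
    using F' unfolding rv_tail_def by auto
  let ?q = "\<lambda>x. (\<integral>\<omega>. rv_kernel \<alpha> (Y \<omega> / x) \<partial>M) / F x"
  obtain c where c: "(?q \<longlongrightarrow> c) at_top"
    using rv_kernel_limit_exists[OF assms] unfolding F_def by blast
  have intY: "integrable M Y" if "1 < \<alpha>"
    using rv_moment[OF assms(1,2) Y0 F, of 1] that Y0 by simp
  have int: "integrable M (\<lambda>\<omega>. rv_kernel \<alpha> (Y \<omega> / x))" for x
  proof -
    have "integrable M (\<lambda>\<omega>. 1 - iexp (Y \<omega> / x))"
      by (rule integrable_const_bound[of _ 2], intro AE_I2 norm_one_minus_iexp) measurable
    moreover have "integrable M (\<lambda>\<omega>. if 1 < \<alpha> then \<i> * (Y \<omega> / x) else 0)"
      using intY by (cases "1 < \<alpha>") (auto simp del: of_real_divide)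
    ultimately show ?thesis unfolding rv_kernel_def by simp
  qed
  \<comment> \<open>The imaginary linear term of the kernel for \<open>\<alpha> > 1\<close> does not affect the real part.\<close>
  have low: "(1 - cos 1) * (1 - F (2 * x) / F x) \<le> Re (?q x)" if x: "x > 0" for x
  proof -
    have Re: "Re (rv_kernel \<alpha> y) = 1 - cos y" for y by (simp add: rv_kernel_def Re_exp)
    have "{\<omega> \<in> space M. Y \<omega> > x} - {\<omega> \<in> space M. Y \<omega> > 2 * x} = {\<omega> \<in> space M. x < Y \<omega> \<and> Y \<omega> \<le> 2 * x}"
      using x by auto
    moreover have "measure M ({\<omega> \<in> space M. Y \<omega> > x} - {\<omega> \<in> space M. Y \<omega> > 2 * x}) = F x - F (2 * x)"
      unfolding F_def using x by (intro finite_measure_Diff) auto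
    ultimately have "(1 - cos 1) * (F x - F (2 * x)) = (1 - cos 1) * measure M {\<omega>
        \<in> space M. x < Y \<omega> \<and> Y \<omega> \<le> 2 * x}"
      by simp
    also have "\<dots> = (\<integral>\<omega>. (1 - cos 1) * indicator {\<omega> \<in> space M. x < Y \<omega> \<and> Y \<omega> \<le> 2 * x} \<omega> \<partial>M)"
      by simp
    also have "\<dots> \<le> (\<integral>\<omega>. Re (rv_kernel \<alpha> (Y \<omega> / x)) \<partial>M)"
    proof (rule integral_mono)
      show "integrable M (\<lambda>\<omega>. (1 - cos 1) * indicat_real {\<omega> \<in> space M. x < Y \<omega> \<and> Y \<omega> \<le> 2 * x} \<omega>)"
        by (intro integrable_mult_right integrable_real_indicator) (auto simp: emeasure_eq_measure)
      show "integrable M (\<lambda>\<omega>. Re (rv_kernel \<alpha> (Y \<omega> / x)))" using int by simp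
      fix \<omega>
      show "(1 - cos 1) * indicat_real {\<omega> \<in> space M. x < Y \<omega> \<and> Y \<omega> \<le> 2 * x} \<omega> \<le> Re (rv_kernel \<alpha> (Y \<omega>
          / x))"
      proof (cases "x < Y \<omega> \<and> Y \<omega> \<le> 2 * x")
        case True
        then have "1 \<le> Y \<omega> / x" "Y \<omega> / x \<le> 2" using x by (auto simp: field_simps)
        then have "cos (Y \<omega> / x) \<le> cos 1" using pi_gt3 by (intro cos_monotone_0_pi_le) auto
        then show ?thesis unfolding Re by (auto split: split_indicator)
      qed (auto simp: Re)
    qed
    also have "\<dots> = Re (\<integral>\<omega>. rv_kernel \<alpha> (Y \<omega> / x) \<partial>M)" using int by simp
    finally have "(1 - cos 1) * (F x - F (2 * x)) / F x \<le> Re (\<integral>\<omega>. rv_kernel \<alpha> (Y \<omega> / x) \<partial>M) / F x"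
      using pos[OF x] by (intro divide_right_mono) auto
    then show ?thesis using pos[OF x] by (simp add: field_simps)
  qed
  have "(1 - cos 1) * (1 - 2 powr (-\<alpha>)) \<le> Re c"
  proof (rule tendsto_le[OF _ tendsto_Re[OF c]])
    show "((\<lambda>x. (1 - cos 1) * (1 - F (2 * x) / F x)) \<longlongrightarrow> (1 - cos 1) * (1 - 2 powr (-\<alpha>))) at_top"
      by (intro tendsto_intros lim) simp
    show "eventually (\<lambda>x. (1 - cos 1) * (1 - F (2 * x) / F x) \<le> Re (?q x)) at_top"
      using eventually_gt_at_top[of 0] by eventually_elim (rule low)
  qed simp
  moreover have "cos 1 < (1::real)" using cos_monotone_0_pi[of 0 1] pi_gt3 by simp
  moreover have "2 powr (-\<alpha>) < 2 powr (0::real)" using \<alpha> by (intro powr_less_mono) auto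
  ultimately have "Re c > 0" by (smt (verit) mult_pos_pos powr_zero_eq_one)
  then show ?thesis using c unfolding F_def by blast
qed

section \<open>The fixed-point equation and the norming constants\<close>

lemma norm_one_minus_exp_le:
  assumes "Re z \<ge> 0" shows "norm (1 - exp (- z)) \<le> norm z"
proof -
  have "norm (exp (- 0) - exp (- z)) \<le> 1 * norm (0 - z)"
  proof (rule field_differentiable_bound[where S="{z. Re z \<ge> 0}" and f'="\<lambda>z. - exp (- z)"])
    show "convex {z. Re z \<ge> 0}" by (rule convex_halfspace_Re_ge)
  qed (use assms in \<open>auto intro!: derivative_eq_intros\<close>)
  then show ?thesis by simp
qed

text \<open>Division of \<open>1 - exp (- k w)\<close> by \<open>w\<close>, with the removable singularity at \<open>w = 0\<close> filled in.\<close>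

definition expquot :: "real \<Rightarrow> complex \<Rightarrow> complex"
  where "expquot k w = (if w = 0 then of_real k else (1 - exp (- (k * w))) / w)"

lemma expquot_mult: "w * expquot k w = 1 - exp (- (k * w))"
  by (simp add: expquot_def)

lemma norm_expquot: "k \<ge> 0 \<Longrightarrow> Re w \<ge> 0 \<Longrightarrow> norm (expquot k w) \<le> k"
  using norm_one_minus_exp_le[of "k * w"] by (auto simp: expquot_def norm_divide norm_mult divide_simps)

lemma expquot_isCont: "isCont (expquot k) 0"
proof -
  have "((\<lambda>w. - exp (- (complex_of_real k * w))) has_field_derivative of_real k) (at 0)"
    by (auto intro!: derivative_eq_intros)
  then have "((\<lambda>w. (1 - exp (- (complex_of_real k * w))) / w) \<longlongrightarrow> of_real k) (at 0)"
    by (simp add: has_field_derivative_iff)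
  then have "(expquot k \<longlongrightarrow> of_real k) (at 0)"
    by (rule Lim_transform_eventually) (auto simp: eventually_at_filter expquot_def)
  then show ?thesis by (simp add: isCont_def expquot_def)
qed

lemma expquot_measurable [measurable]:
  "k \<in> borel_measurable M \<Longrightarrow> (\<lambda>x. expquot (k x) w) \<in> borel_measurable M"
  by (cases "w = 0") (simp_all add: expquot_def divide_inverse)

text \<open>Dividing the last term of the equation by \<open>q v\<close> gives an expectation that is dominated by
  \<open>k\<close>, because \<open>Re q \<ge> 0\<close>, and tends to \<open>E k < 1\<close>. So the equation reads \<open>q (1 - \<rho>) = H\<close> with \<open>\<rho>\<close>
  converging to a limit less than one, and \<open>q\<close> inherits the asymptotics of the transform \<open>H\<close> of
  \<open>Z\<close>.\<close>

lemma fixpoint_transfer: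
  fixes q :: "real \<Rightarrow> complex" and k :: "'a \<Rightarrow> real"
  assumes "prob_space M" and Z [measurable]: "Z \<in> borel_measurable M" and Z0: "\<And>\<omega>. Z \<omega> \<ge> 0"
    and F: "rv_tail \<alpha> (\<lambda>x. measure M {\<omega> \<in> space M. Z \<omega> > x})"
    and \<alpha>: "\<alpha> \<in> {0<..<1} \<union> {1<..<2}"
    and k: "integrable M k" "\<And>\<omega>. k \<omega> \<ge> 0" "(\<integral>\<omega>. k \<omega> \<partial>M) < 1"
    and q0: "(q \<longlongrightarrow> 0) (at 0)" and qRe: "\<And>v. Re (q v) \<ge> 0"
    and fix_eq: "\<And>v. q v = (\<integral>\<omega>. rv_kernel \<alpha> (v * Z \<omega>) \<partial>M)
      + (\<integral>\<omega>. iexp (v * Z \<omega>) * (1 - exp (- (k \<omega> * q v))) \<partial>M)"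
  shows "\<exists>c. Re c > 0 \<and> ((\<lambda>x. q (1 / x) / measure M {\<omega> \<in> space M. Z \<omega> > x}) \<longlongrightarrow> c) at_top"
proof -
  interpret prob_space M by fact
  define F where "F x = measure M {\<omega> \<in> space M. Z \<omega> > x}" for x
  define \<kappa> where "\<kappa> = (\<integral>\<omega>. k \<omega> \<partial>M)"
  have [measurable]: "k \<in> borel_measurable M" using k(1) by auto
  obtain c where c: "Re c > 0" "((\<lambda>x. (\<integral>\<omega>. rv_kernel \<alpha> (Z \<omega> / x) \<partial>M) / F x) \<longlongrightarrow> c) at_top"
    using rv_kernel_limit[OF assms(1) Z Z0 F \<alpha>] unfolding F_def by blast
  define \<rho> where "\<rho> x = (\<integral>\<omega>. iexp (Z \<omega> / x) * expquot (k \<omega>) (q (1 / x)) \<partial>M)" for x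
  have inv: "((\<lambda>x::real. 1 / x) \<longlongrightarrow> 0) at_top"
    using tendsto_inverse_0_at_top[OF filterlim_ident] by (simp add: inverse_eq_divide)
  have inv': "filterlim (\<lambda>x::real. 1 / x) (at 0) at_top"
    using inv by (simp add: filterlim_at eventually_gt_at_top[THEN eventually_mono, of 0])
  have q_inv: "((\<lambda>x. q (1 / x)) \<longlongrightarrow> 0) at_top" by (rule filterlim_compose[OF q0 inv'])
  have "(\<rho> \<longlongrightarrow> (\<integral>\<omega>. complex_of_real (k \<omega>) \<partial>M)) at_top"
    unfolding \<rho>_def
  proof (rule integral_dominated_convergence_at_top[where w=k])
    show "AE \<omega> in M. ((\<lambda>x. iexp (Z \<omega> / x) * expquot (k \<omega>) (q (1 / x))) \<longlongrightarrow> complex_of_real (k \<omega>)) at_top"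
    proof (rule AE_I2)
      fix \<omega>
      have 1: "((\<lambda>x. expquot (k \<omega>) (q (1 / x))) \<longlongrightarrow> expquot (k \<omega>) 0) at_top"
        by (rule isCont_tendsto_compose[OF expquot_isCont q_inv])
      have "((\<lambda>x. Z \<omega> * (1 / x)) \<longlongrightarrow> Z \<omega> * 0) at_top" by (intro tendsto_intros inv)
      then have "((\<lambda>x. iexp (Z \<omega> / x)) \<longlongrightarrow> iexp 0) at_top"
        by (intro tendsto_intros) simp
      from tendsto_mult[OF this 1]
      show "((\<lambda>x. iexp (Z \<omega> / x) * expquot (k \<omega>) (q (1 / x))) \<longlongrightarrow> complex_of_real (k \<omega>)) at_top"
        by (simp add: expquot_def)
    qed
    show "\<forall>\<^sub>F x in at_top. AE \<omega> in M. norm (iexp (Z \<omega> / x) * expquot (k \<omega>) (q (1 / x))) \<le> k \<omega>"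
    proof (intro always_eventually allI AE_I2)
      fix x \<omega>
      have "norm (iexp (Z \<omega> / x)) = 1" by (rule norm_exp_i_times)
      then show "norm (iexp (Z \<omega> / x) * expquot (k \<omega>) (q (1 / x))) \<le> k \<omega>"
        using norm_expquot[OF k(2) qRe] by (simp only: norm_mult mult_1)
    qed
  qed (use k in measurable)
  then have \<rho>: "(\<rho> \<longlongrightarrow> of_real \<kappa>) at_top" by (simp add: \<kappa>_def)
  have eq: "(\<integral>\<omega>. rv_kernel \<alpha> (Z \<omega> / x) \<partial>M) = q (1 / x) * (1 - \<rho> x)" for x
  proof -
    have "(\<integral>\<omega>. iexp (1 / x * Z \<omega>) * (1 - exp (- (k \<omega> * q (1 / x)))) \<partial>M) = (\<integral>\<omega>. q (1 / x)
        * (iexp (Z \<omega> / x) * expquot (k \<omega>) (q (1 / x))) \<partial>M)"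
      unfolding expquot_mult[symmetric] by (intro Bochner_Integration.integral_cong) (auto simp: mult_ac)
    also have "\<dots> = q (1 / x) * \<rho> x" unfolding \<rho>_def by (rule integral_mult_right_zero)
    finally show ?thesis using fix_eq[of "1 / x"] by (simp add: algebra_simps)
  qed
  have \<kappa>1: "1 - complex_of_real \<kappa> \<noteq> 0" using k(3) by (simp add: \<kappa>_def)
  have "((\<lambda>x. ((\<integral>\<omega>. rv_kernel \<alpha> (Z \<omega> / x) \<partial>M) / F x) / (1 - \<rho> x)) \<longlongrightarrow> c / (1 - of_real \<kappa>)) at_top"
    by (intro tendsto_intros c \<rho> \<kappa>1)
  moreover have "eventually (\<lambda>x. 1 - \<rho> x \<noteq> 0) at_top"
    using tendsto_imp_eventually_ne[OF tendsto_diff[OF tendsto_const \<rho>, of 1] \<kappa>1] by simp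
  then have "eventually (\<lambda>x. ((\<integral>\<omega>. rv_kernel \<alpha> (Z \<omega> / x) \<partial>M) / F x) / (1 - \<rho> x) = q (1 / x) / F x) at_top"
    by eventually_elim (simp add: eq)
  ultimately have "((\<lambda>x. q (1 / x) / F x) \<longlongrightarrow> c / (1 - of_real \<kappa>)) at_top"
    by (rule Lim_transform_eventually)
  moreover have "c / (1 - complex_of_real \<kappa>) = of_real (1 / (1 - \<kappa>)) * c"
    using \<kappa>1 by simp
  then have "Re (c / (1 - complex_of_real \<kappa>)) > 0"
    using c(1) k(3) by (simp add: \<kappa>_def)
  ultimately show ?thesis unfolding F_def by blast
qed

text \<open>The norming constants are reciprocals of solutions of \<open>Re (q s) = 1 / n\<close>. The real part is
  continuous and positive on some \<open>(0, s0]\<close>, so solutions exist by the intermediate value theorem,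
  and any choice of them tends to \<open>0\<close>. The values at \<open>u > 0\<close> follow from the regular variation of
  \<open>F\<close>, those at \<open>u < 0\<close> by conjugation. The last claim says that \<open>a n\<close> grows almost as fast as
  \<open>n\<^sup>1\<^sup>/\<^sup>\<alpha>\<close>.\<close>

lemma normalising_sequence:
  fixes q :: "real \<Rightarrow> complex"
  assumes F: "rv_tail \<alpha> F" and \<alpha>: "\<alpha> > 0"
    and cont: "\<And>v. isCont q v" and q0: "q 0 = 0" and qcnj: "\<And>v. q (- v) = cnj (q v)"
    and c: "Re c > 0" "((\<lambda>x. q (1 / x) / F x) \<longlongrightarrow> c) at_top"
  obtains a :: "nat \<Rightarrow> real" and C :: complex where "filterlim a at_top sequentially" "Re C > 0"
    "\<And>u. (\<lambda>n. of_nat n * q (u / a n)) \<longlonglongrightarrow> stable_exponent \<alpha> C u"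
    "\<And>b g. b \<ge> 0 \<Longrightarrow> b * \<alpha> < g \<Longrightarrow> (\<lambda>n. real n powr b / a n powr g) \<longlonglongrightarrow> 0"
proof -
  have pos: "\<And>x. x > 0 \<Longrightarrow> F x > 0"
    and lim: "\<And>c. c > 0 \<Longrightarrow> ((\<lambda>x. F (c * x) / F x) \<longlongrightarrow> c powr (-\<alpha>)) at_top"
    using F unfolding rv_tail_def by auto
  have reF: "((\<lambda>x. Re (q (1 / x)) / F x) \<longlongrightarrow> Re c) at_top"
    using tendsto_Re[OF c(2)] by simp
  have "eventually (\<lambda>x. Re c / 2 < Re (q (1 / x)) / F x) at_top"
    using c(1) by (intro order_tendstoD(1)[OF reF]) simp
  then have ev: "eventually (\<lambda>x. x > 0 \<and> Re c / 2 * F x < Re (q (1 / x))) at_top"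
    using eventually_gt_at_top[of 0] by eventually_elim (use pos in \<open>auto simp: field_simps\<close>)
  then obtain x0 where x0: "\<And>x. x \<ge> x0 \<Longrightarrow> x > 0 \<and> Re c / 2 * F x < Re (q (1 / x))"
    by (auto simp: eventually_at_top_linorder)
  define s0 where "s0 = 1 / x0"
  have s0: "s0 > 0" using x0[of x0] by (simp add: s0_def)
  have Gpos: "Re (q s) > 0" if "0 < s" "s \<le> s0" for s
  proof -
    have "x0 \<le> 1 / s" using that x0[of x0] by (simp add: s0_def field_simps)
    from x0[OF this] have "0 < 1 / s" "Re c / 2 * F (1 / s) < Re (q s)" by auto
    moreover have "0 < Re c / 2 * F (1 / s)" using c(1) pos[of "1 / s"] that by simp
    ultimately show ?thesis by linarith
  qed
  have contG: "isCont (\<lambda>v. Re (q v)) v" for v 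
    unfolding isCont_def by (intro tendsto_Re cont[unfolded isCont_def])
  have ex: "\<exists>s. 0 < s \<and> s \<le> s0 \<and> Re (q s) = 1 / real n" if "0 < n" "1 / real n \<le> Re (q s0)" for n
  proof -
    have "\<exists>s\<ge>0. s \<le> s0 \<and> Re (q s) = 1 / real n"
      by (rule IVT[of "\<lambda>v. Re (q v)"]) (use that s0 q0 contG in auto)
    then obtain s where s: "0 \<le> s" "s \<le> s0" "Re (q s) = 1 / real n" by blast
    moreover have "s \<noteq> 0" using s(3) q0 that by (intro notI) simp
    ultimately show ?thesis by (intro exI[of _ s]) auto
  qed
  define s where "s n = (if 0 < n \<and> 1 / real n \<le> Re (q s0)
    then SOME s. 0 < s \<and> s \<le> s0 \<and> Re (q s) = 1 / real n else s0)" for n :: nat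
  have sn: "0 < s n \<and> s n \<le> s0 \<and> Re (q (s n)) = 1 / real n" if "0 < n" "1 / real n \<le> Re (q s0)" for n
    using someI_ex[OF ex[OF that]] that by (simp add: s_def)
  have sn0: "0 < s n" for n using sn[of n] s0 by (cases "0 < n \<and> 1 / real n
      \<le> Re (q s0)") (auto simp: s_def)
  have inv_n: "(\<lambda>n. 1 / real n) \<longlonglongrightarrow> 0" by (rule lim_1_over_n)
  have ev_n: "eventually (\<lambda>n. 0 < n \<and> 1 / real n \<le> Re (q s0)) sequentially"
    using order_tendstoD(2)[OF inv_n Gpos[OF s0 order_refl]] eventually_gt_at_top[of 0]
    by eventually_elim auto
  have s_lim: "s \<longlonglongrightarrow> 0"
  proof (rule order_tendstoI)
    fix e :: real assume e: "0 < e"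
    show "eventually (\<lambda>n. s n < e) sequentially"
    proof (cases "e \<le> s0")
      case True
      have "\<exists>x\<in>{e..s0}. \<forall>y\<in>{e..s0}. Re (q x) \<le> Re (q y)"
        by (rule continuous_attains_inf) (use True contG in \<open>auto intro!:
            continuous_at_imp_continuous_on\<close>)
      then obtain m where m: "e \<le> m" "m \<le> s0" "\<And>y. e \<le> y \<Longrightarrow> y \<le> s0 \<Longrightarrow> Re (q m) \<le> Re (q y)" by auto
      have "Re (q m) > 0" using m e by (intro Gpos) auto
      from order_tendstoD(2)[OF inv_n this] ev_n show ?thesis
      proof eventually_elim
        case (elim n)
        show ?case
        proof (rule ccontr)
          assume "\<not> s n < e"
          then have "Re (q m) \<le> Re (q (s n))" using sn[of n] elim by (intro m(3)) auto
          then show False using sn[of n] elim by auto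
        qed
      qed
    next
      case False
      from ev_n show ?thesis
      proof eventually_elim
        case (elim n)
        then show ?case using sn[of n] False by auto
      qed
    qed
  next
    fix e :: real assume "e < 0"
    then show "eventually (\<lambda>n. e < s n) sequentially"
      using sn0 by (intro always_eventually allI) (rule less_trans)
  qed
  define a where "a n = 1 / s n" for n
  have a0: "a n > 0" for n using sn0 by (simp add: a_def)
  have "filterlim s (at_right 0) sequentially"
    using s_lim sn0 by (auto simp: filterlim_at less_imp_neq[THEN not_sym])
  from filterlim_compose[OF filterlim_inverse_at_top_right this]
  have a_lim: "filterlim a at_top sequentially"
    by (simp add: a_def[abs_def] inverse_eq_divide)
  define C where "C = c / Re c"
  have ReC: "Re C = 1" using c(1) by (simp add: C_def)
  have q_a: "eventually (\<lambda>n. Re (q (1 / a n)) = 1 / real n \<and> 0 < n) sequentially"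
    using ev_n by eventually_elim (use sn in \<open>simp add: a_def\<close>)
  have up: "(\<lambda>n. of_nat n * q (u / a n)) \<longlonglongrightarrow> of_real (u powr \<alpha>) * C" if u: "u > 0" for u
  proof -
    have A: "((\<lambda>x. (q (1 / (1 / u * x)) / F (1 / u * x)) * of_real (F (1 / u * x) / F x)
        / of_real (Re (q (1 / x)) / F x))
        \<longlongrightarrow> c * of_real ((1 / u) powr (-\<alpha>)) / of_real (Re c)) at_top"
    proof (intro tendsto_intros lim reF)
      show "((\<lambda>x. q (1 / (1 / u * x)) / F (1 / u * x)) \<longlongrightarrow> c) at_top"
        by (rule filterlim_compose[OF c(2)], rule filterlim_tendsto_pos_mult_at_top[OF tendsto_const])
           (use u in \<open>auto simp: filterlim_ident\<close>)
    qed (use u c in auto)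
    have "(1 / u) powr (-\<alpha>) = u powr \<alpha>" using u by (simp add: powr_divide powr_minus)
    then have "c * of_real ((1 / u) powr (-\<alpha>)) / of_real (Re c) = of_real (u powr \<alpha>) * C"
        by (simp add: C_def)
    then have B: "(\<lambda>n. (q (1 / (1 / u * a n)) / F (1 / u * a n)) * of_real (F (1 / u * a n)
        / F (a n)) / of_real (Re (q (1 / a n)) / F (a n)))
        \<longlonglongrightarrow> of_real (u powr \<alpha>) * C"
      using filterlim_compose[OF A a_lim] by simp
    show ?thesis
    proof (rule Lim_transform_eventually[OF B])
      show "eventually (\<lambda>n. (q (1 / (1 / u * a n)) / F (1 / u * a n)) * of_real (F (1 / u * a n)
          / F (a n)) / of_real (Re (q (1 / a n)) / F (a n))
          = of_nat n * q (u / a n)) sequentially"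
        using q_a
      proof eventually_elim
        case (elim n)
        have "F (1 / u * a n) \<noteq> 0" "F (a n) \<noteq> 0" using pos[of "1 / u
            * a n"] pos[of "a n"] u a0[of n] by auto
        then show ?case using elim by (simp add: field_simps)
      qed
    qed
  qed
  have conv: "(\<lambda>n. of_nat n * q (u / a n)) \<longlonglongrightarrow> stable_exponent \<alpha> C u" for u
  proof -
    consider "u > 0" | "u = 0" | "u < 0" by linarith
    then show ?thesis
    proof cases
      case 1
      then show ?thesis using up[of u] by (simp add: stable_exponent_def)
    next
      case 2
      then show ?thesis by (simp add: stable_exponent_def q0)
    next
      case 3
      have "(\<lambda>n. cnj (of_nat n * q ((- u) / a n))) \<longlonglongrightarrow> cnj (of_real ((- u) powr \<alpha>) * C)"
        using 3 by (intro tendsto_cnj up) auto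
      moreover have "cnj (q ((- u) / a n)) = q (u / a n)" for n
        using qcnj[of "u / a n"] by simp
      ultimately show ?thesis using 3 by (simp add: stable_exponent_def)
    qed
  qed
  have growth: "(\<lambda>n. real n powr b / a n powr g) \<longlonglongrightarrow> 0" if b: "b \<ge> 0" "b * \<alpha> < g" for b g
  proof -
    define \<epsilon> where "\<epsilon> = min (\<alpha> / 2) ((g - b * \<alpha>) / (2 * (b + 1)))"
    have "0 < \<epsilon>" using \<alpha> b by (simp add: \<epsilon>_def)
    moreover have "\<epsilon> \<le> \<alpha> / 2" unfolding \<epsilon>_def by (rule min.cobounded1)
    ultimately have \<epsilon>: "0 < \<epsilon>" "\<epsilon> < \<alpha>" using \<alpha> by auto
    have "b * \<epsilon> \<le> (b + 1) * ((g - b * \<alpha>) / (2 * (b + 1)))"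
      using b \<epsilon> by (intro mult_mono) (auto simp only: \<epsilon>_def min.cobounded2)
    also have "\<dots> = (g - b * \<alpha>) / 2" using b by (simp add: field_simps)
    also have "\<dots> < g - b * \<alpha>"
    proof -
      have half: "x / 2 < x" if "x > 0" for x :: real using that by simp
      have "0 < g - b * \<alpha>" using b(2) by (simp only: diff_gt_0_iff_gt)
      then show ?thesis by (rule half)
    qed
    finally have bg: "b * (\<alpha> + \<epsilon>) - g < 0" by (simp add: algebra_simps)
    obtain d where d: "d > 0" "eventually (\<lambda>x. d * x powr (-(\<alpha> + \<epsilon>)) \<le> F x) at_top"
      using rv_tail_lower[OF F \<epsilon>] by blast
    define D where "D = Re c / 2 * d"
    have D: "D > 0" using c(1) d(1) by (simp add: D_def)
    have "eventually (\<lambda>x. x > 0 \<and> D * x powr (-(\<alpha> + \<epsilon>)) \<le> Re (q (1 / x))) at_top"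
      using d(2) ev
    proof eventually_elim
      case (elim x)
      have "D * x powr (-(\<alpha> + \<epsilon>)) \<le> Re c / 2 * F x"
        unfolding D_def using elim c(1) by (simp add: mult.assoc)
      then show ?case using elim by auto
    qed
    from eventually_compose_filterlim[OF this a_lim]
    have "eventually (\<lambda>n. norm (real n powr b / a n powr g) \<le> (1 / D) powr b * a n powr (b * (\<alpha>
        + \<epsilon>) - g)) sequentially"
      using q_a
    proof eventually_elim
      case (elim n)
      have an: "a n > 0" using elim by simp
      have "D * a n powr (-(\<alpha> + \<epsilon>)) \<le> 1 / real n" using elim by simp
      then have "D * (1 / a n powr (\<alpha> + \<epsilon>)) \<le> 1 / real n" by (simp only: powr_minus_divide)
      moreover have "x \<le> (1 / D) * P" if "D * (1 / P) \<le> 1 / x" "0 < x" "0 < P" for x P :: real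
        using that D by (simp add: field_simps)
      moreover have "0 < a n powr (\<alpha> + \<epsilon>)" using an by simp
      ultimately have "real n \<le> (1 / D) * a n powr (\<alpha> + \<epsilon>)"
        using elim by simp
      then have "real n powr b \<le> ((1 / D) * a n powr (\<alpha> + \<epsilon>)) powr b"
        using b by (intro powr_mono2) auto
      also have "\<dots> = (1 / D) powr b * a n powr (b * (\<alpha> + \<epsilon>))"
        by (simp only: powr_mult powr_powr mult.commute[of b])
      finally have "real n powr b / a n powr g \<le> (1 / D) powr b * a n powr (b * (\<alpha> + \<epsilon>)) / a n powr g"
        by (intro divide_right_mono) auto
      then show ?case by (simp add: powr_diff)
    qed
    moreover have "(\<lambda>n. (1 / D) powr b * a n powr (b * (\<alpha> + \<epsilon>) - g)) \<longlonglongrightarrow> 0"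
      using tendsto_mult_left[OF tendsto_neg_powr[OF bg a_lim], of "(1 / D) powr b"] by simp
    ultimately show ?thesis by (rule Lim_null_comparison)
  qed
  have "Re C > 0" by (simp add: ReC)
  then show ?thesis using that[OF a_lim _ conv growth] by blast
qed

section \<open>Poisson processes with conditionally independent marks\<close>

lemma poisson_weights_sums: "(\<lambda>k. l ^ k / fact k * exp (- l :: real)) sums 1"
  using sums_mult2[OF exp_converges[of l], of "exp (- l)"]
  by (simp add: exp_add[symmetric] divide_inverse scaleR_conv_of_real mult_ac)

lemma poisson_gf_sums: "(\<lambda>k. complex_of_real (l ^ k / fact k * exp (- l))
    * c ^ k) sums exp (of_real l * (c - 1))"
proof -
  have "(\<lambda>k. (of_real l * c) ^ k /\<^sub>R fact k * exp (- of_real l)) sums (exp (of_real l * c)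
      * exp (- of_real l))"
    by (rule sums_mult2[OF exp_converges])
  then show ?thesis
    by (simp add: exp_add[symmetric] algebra_simps power_mult_distrib scaleR_conv_of_real
        divide_inverse exp_of_real[symmetric])
qed

lemma poisson_mean_sums: "(\<lambda>k. real k * (l ^ k / fact k * exp (- l))) sums l"
proof -
  have "(\<lambda>k. l * (l ^ k / fact k * exp (- l))) sums (l * 1)"
    by (rule sums_mult[OF poisson_weights_sums])
  moreover have "l * (l ^ k / fact k * exp (- l)) = real (Suc k) * (l ^ Suc k / fact (Suc k)
      * exp (- l))" for k
    by (simp add: field_simps del: of_nat_Suc)
  ultimately have "(\<lambda>k. real (Suc k) * (l ^ Suc k / fact (Suc k) * exp (- l))) sums l"
    by (simp only: mult_1_right)
  from sums_Suc[OF this] show ?thesis by simp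
qed

text \<open>The nonnegative coefficients in \<open>z = c\<^sub>0 + c\<^sub>1 i - c\<^sub>2 - c\<^sub>3 i\<close>. Expanding a product of complex
  factors along them reduces identities between expectations to the nonnegative case, where no
  integrability is at stake.\<close>

definition cpart :: "nat \<Rightarrow> complex \<Rightarrow> real"
  where "cpart k z = (if k = 0 then max 0 (Re z) else if k = 1 then max 0 (Im z)
    else if k = 2 then max 0 (- Re z) else max 0 (- Im z))"

lemma cpart_sum: "(\<Sum>k<4. \<i> ^ k * complex_of_real (cpart k z)) = z"
  by (auto simp: cpart_def eval_nat_numeral complex_eq_iff max_def)

lemma cpart_bounds: "0 \<le> cpart k z" "cpart k z \<le> norm z"
  using abs_Re_le_cmod[of z] abs_Im_le_cmod[of z] by (auto simp: cpart_def)

lemma cpart_measurable [measurable]: "cpart k \<in> borel_measurable borel"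
  unfolding cpart_def by measurable

text \<open>A random element \<open>W\<close> determines a Poisson process of points \<open>p W i\<close>, \<open>i \<in> I W\<close>, with mean measure
  \<open>m \<times> Q\<close>; given \<open>W\<close>, the point \<open>i\<close> carries a further random element \<open>X i\<close>, independent of the
  others, whose law depends on the mark of the point.\<close>

locale marked_points = prob_space M
  for M :: "'w measure" +
  fixes V :: "'v measure" and W :: "'w \<Rightarrow> 'v" and I :: "'v \<Rightarrow> nat set"
    and p :: "'v \<Rightarrow> nat \<Rightarrow> real \<times> 's::topological_space"
    and N :: "'x measure" and X :: "nat \<Rightarrow> 'w \<Rightarrow> 'x" and K :: "'s \<Rightarrow> 'x measure"
    and m :: "real measure" and Q :: "'s measure"
  assumes W_measurable [measurable]: "W \<in> M \<rightarrow>\<^sub>M V"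
    and I_measurable: "\<And>i. {w \<in> space V. i \<in> I w} \<in> sets V"
    and p_measurable [measurable]: "\<And>i. (\<lambda>w. p w i) \<in> V \<rightarrow>\<^sub>M borel \<Otimes>\<^sub>M borel"
    and X_measurable [measurable]: "\<And>i. X i \<in> M \<rightarrow>\<^sub>M N"
    and K_measurable: "K \<in> borel \<rightarrow>\<^sub>M prob_algebra N"
    and sets_m: "sets m = sets borel" and sigma_finite_m: "sigma_finite_measure m"
    and Q_prob: "prob_space Q" and Q_sets: "sets Q = sets borel"
    and poisson: "poisson_process M (\<lambda>\<omega>. dirac_sum (I (W \<omega>)) (p (W \<omega>))) (m \<Otimes>\<^sub>M Q)"
    and indep: "indep_given M V W I N X (\<lambda>w i. K (snd (p w i)))"
begin

sublocale Q: prob_space Q by (rule Q_prob)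
sublocale m: sigma_finite_measure m by (rule sigma_finite_m)
sublocale mQ: pair_sigma_finite m Q ..

lemma sets_mQ [measurable_cong]: "sets (m \<Otimes>\<^sub>M Q) = sets (borel \<Otimes>\<^sub>M borel)"
  by (intro sets_pair_measure_cong sets_m Q_sets)

lemma I_pred [measurable]: "Measurable.pred V (\<lambda>w. i \<in> I w)"
  using I_measurable by (simp add: Measurable.pred_def)

lemma K_prob: "prob_space (K a)" and sets_K [simp, measurable_cong]: "sets (K a) = sets N"
  using measurable_space[OF K_measurable, of a] by (auto simp: space_prob_algebra)

lemma K_subprob [measurable]: "K \<in> borel \<rightarrow>\<^sub>M subprob_algebra N"
  by (rule measurable_prob_algebraD[OF K_measurable])

lemma K_mark [measurable]: "(\<lambda>w. K (snd (p w i))) \<in> V \<rightarrow>\<^sub>M subprob_algebra N"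
  by (rule measurable_compose[OF _ K_subprob]) measurable

lemma K_mark_W [measurable]: "(\<lambda>\<omega>. K (snd (p (W \<omega>) i))) \<in> M \<rightarrow>\<^sub>M subprob_algebra N"
  by (rule measurable_compose[OF W_measurable K_mark])

lemma nn_integral_K_measurable [measurable]:
  "F \<in> borel_measurable N \<Longrightarrow> (\<lambda>a. \<integral>\<^sup>+x. F x \<partial>K a) \<in> borel_measurable borel"
  by (rule measurable_compose[OF K_subprob nn_integral_measurable_subprob_algebra])

lemma integral_K_measurable [measurable]:
  fixes F :: "'x \<Rightarrow> 'b::{banach, second_countable_topology}"
  shows "F \<in> borel_measurable N \<Longrightarrow> (\<lambda>a. \<integral>x. F x \<partial>K a) \<in> borel_measurable borel"
  by (rule measurable_compose[OF K_subprob integral_measurable_subprob_algebra])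

text \<open>The defining property of conditional independence, with a weight depending on \<open>W\<close>: two image
  measures on \<open>V\<close> agree on all sets, hence integrate \<open>H\<close> to the same value.\<close>

lemma cond_prod_indicator:
  assumes J: "finite J" and D: "D \<in> sets V" "\<And>w. w \<in> D \<Longrightarrow> J \<subseteq> I w"
    and C: "\<And>i. i \<in> J \<Longrightarrow> C i \<in> sets N" and [measurable]: "H \<in> borel_measurable V"
  shows "(\<integral>\<^sup>+\<omega>. indicator D (W \<omega>) * H (W \<omega>) * (\<Prod>i\<in>J. indicator (C i) (X i \<omega>)) \<partial>M)
    = (\<integral>\<^sup>+\<omega>. indicator D (W \<omega>) * H (W \<omega>) * (\<Prod>i\<in>J. emeasure (K (snd (p (W \<omega>) i))) (C i)) \<partial>M)"
proof -
  note [measurable] = D(1)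
  have Km: "(\<lambda>\<omega>. \<Prod>i\<in>J. emeasure (K (snd (p (W \<omega>) i))) (C i)) \<in> borel_measurable M"
    by (intro borel_measurable_prod_ennreal measurable_emeasure_kernel[OF K_mark_W] C)
  have Xm: "(\<lambda>\<omega>. \<Prod>i\<in>J. indicator (C i) (X i \<omega>) :: ennreal) \<in> borel_measurable M"
    by (intro borel_measurable_prod_ennreal measurable_compose[OF X_measurable]
        borel_measurable_indicator C)
  define z1 where "z1 \<omega> = indicator D (W \<omega>) * (\<Prod>i\<in>J. indicator (C i) (X i \<omega>) :: ennreal)" for \<omega>
  define z2 where "z2 \<omega> = indicator D (W \<omega>) * (\<Prod>i\<in>J. emeasure (K (snd (p (W \<omega>) i))) (C i))" for \<omega>
  have [measurable]: "z1 \<in> borel_measurable M" "z2 \<in> borel_measurable M"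
    unfolding z1_def z2_def using Km Xm by measurable
  have "distr (density M z1) V W = distr (density M z2) V W"
  proof (rule measure_eqI)
    fix B assume "B \<in> sets (distr (density M z1) V W)"
    then have B [measurable]: "B \<in> sets V" by simp
    have "emeasure (distr (density M z1) V W) B = (\<integral>\<^sup>+\<omega>. z1 \<omega> * indicator (W -` B \<inter> space M) \<omega> \<partial>M)"
      by (simp add: emeasure_distr emeasure_density)
    also have "\<dots> = (\<integral>\<^sup>+\<omega>. indicator {\<omega> \<in> space M. W \<omega> \<in> D \<inter> B \<and> (\<forall>i\<in>J. X i \<omega> \<in> C i)} \<omega> \<partial>M)"
    proof (rule nn_integral_cong)
      fix \<omega> assume "\<omega> \<in> space M"
      show "z1 \<omega> * indicator (W -` B \<inter> space M) \<omega>
          = indicator {\<omega> \<in> space M. W \<omega> \<in> D \<inter> B \<and> (\<forall>i\<in>J. X i \<omega> \<in> C i)} \<omega>"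
      proof (cases "\<forall>i\<in>J. X i \<omega> \<in> C i")
        case True
        then have "(\<Prod>i\<in>J. indicator (C i) (X i \<omega>)) = (1::ennreal)" by (intro prod.neutral) auto
        then show ?thesis using True by (auto simp: z1_def split: split_indicator)
      next
        case False
        then have "(\<Prod>i\<in>J. indicator (C i) (X i \<omega>)) = (0::ennreal)" using J
            by (intro prod_zero) (auto intro!: bexI simp: indicator_def)
        then show ?thesis using False by (auto simp: z1_def split: split_indicator)
      qed
    qed
    also have "\<dots> = emeasure M {\<omega> \<in> space M. W \<omega> \<in> D \<inter> B \<and> (\<forall>i\<in>J. X i \<omega> \<in> C i)}"
    proof (rule nn_integral_indicator)
      have "Measurable.pred M (\<lambda>\<omega>. X i \<omega> \<in> C i)" if "i \<in> J" for i
        using C[OF that] by measurable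
      then have "Measurable.pred M (\<lambda>\<omega>. \<forall>i\<in>J. X i \<omega> \<in> C i)"
        using J by (intro pred_intros_finite)
      then show "{\<omega> \<in> space M. W \<omega> \<in> D \<inter> B \<and> (\<forall>i\<in>J. X i \<omega> \<in> C i)} \<in> sets M" by measurable
    qed
    also have "\<dots> = (\<integral>\<^sup>+\<omega>. indicator (D \<inter> B) (W \<omega>) * (\<Prod>i\<in>J. emeasure (K (snd (p (W \<omega>) i))) (C i)) \<partial>M)"
      using indep J C B D unfolding indep_given_def by blast
    also have "\<dots> = (\<integral>\<^sup>+\<omega>. z2 \<omega> * indicator (W -` B \<inter> space M) \<omega> \<partial>M)"
      by (intro nn_integral_cong) (auto simp: z2_def split: split_indicator)
    also have "\<dots> = emeasure (distr (density M z2) V W) B"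
      by (simp add: emeasure_distr emeasure_density)
    finally show "emeasure (distr (density M z1) V W) B = emeasure (distr (density M z2) V W) B" .
  qed simp
  then have "(\<integral>\<^sup>+w. H w \<partial>distr (density M z1) V W) = (\<integral>\<^sup>+w. H w \<partial>distr (density M z2) V W)" by simp
  then have "(\<integral>\<^sup>+\<omega>. z1 \<omega> * H (W \<omega>) \<partial>M) = (\<integral>\<^sup>+\<omega>. z2 \<omega> * H (W \<omega>) \<partial>M)"
    by (simp add: nn_integral_distr nn_integral_density)
  then show ?thesis unfolding z1_def z2_def by (simp add: mult_ac)
qed

text \<open>One factor at a time is upgraded from an indicator to a general function. With the other
  factors fixed, both sides are integrals of that factor against measures on \<open>N\<close>, which agree on
  sets by the induction hypothesis.\<close>

lemma cond_prod_nn: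
  assumes J: "finite J" and D: "D \<in> sets V" "\<And>w. w \<in> D \<Longrightarrow> J \<subseteq> I w"
    and F: "\<And>i. i \<in> J \<Longrightarrow> F i \<in> borel_measurable N" and H [measurable]: "H \<in> borel_measurable V"
  shows "(\<integral>\<^sup>+\<omega>. indicator D (W \<omega>) * H (W \<omega>) * (\<Prod>i\<in>J. F i (X i \<omega>)) \<partial>M)
    = (\<integral>\<^sup>+\<omega>. indicator D (W \<omega>) * H (W \<omega>) * (\<Prod>i\<in>J. \<integral>\<^sup>+x. F i x \<partial>K (snd (p (W \<omega>) i))) \<partial>M)"
proof -
  note [measurable] = D(1)
  have "\<forall>F. (\<forall>i\<in>J. F i \<in> borel_measurable N) \<and> (\<forall>i\<in>J - J'. \<exists>C\<in>sets N. F i = indicator C) \<longrightarrow>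
      (\<integral>\<^sup>+\<omega>. indicator D (W \<omega>) * H (W \<omega>) * (\<Prod>i\<in>J. F i (X i \<omega>)) \<partial>M)
    = (\<integral>\<^sup>+\<omega>. indicator D (W \<omega>) * H (W \<omega>) * (\<Prod>i\<in>J. \<integral>\<^sup>+x. F i x \<partial>K (snd (p (W \<omega>) i))) \<partial>M)"
    if "J' \<subseteq> J" for J'
    using finite_subset[OF that J] that
  proof (induction J' rule: finite_induct)
    case empty
    show ?case
    proof (intro allI impI)
      fix F :: "nat \<Rightarrow> 'x \<Rightarrow> ennreal"
      assume "(\<forall>i\<in>J. F i \<in> borel_measurable N) \<and> (\<forall>i\<in>J - {}. \<exists>C\<in>sets N. F i = indicator C)"
      then obtain C where C: "\<And>i. i \<in> J \<Longrightarrow> C i \<in> sets N" "\<And>i. i \<in> J \<Longrightarrow> F i = indicator (C i)"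
        by (metis Diff_empty)
      have "(\<Prod>i\<in>J. F i (X i \<omega>)) = (\<Prod>i\<in>J. indicator (C i) (X i \<omega>))" for \<omega>
        by (intro prod.cong refl) (simp add: C)
      moreover have "(\<Prod>i\<in>J. \<integral>\<^sup>+x. F i x \<partial>K (snd (p (W \<omega>) i)))
          = (\<Prod>i\<in>J. emeasure (K (snd (p (W \<omega>) i))) (C i))" for \<omega>
        by (intro prod.cong refl) (simp add: C)
      ultimately show "(\<integral>\<^sup>+\<omega>. indicator D (W \<omega>) * H (W \<omega>) * (\<Prod>i\<in>J. F i (X i \<omega>)) \<partial>M)
          = (\<integral>\<^sup>+\<omega>. indicator D (W \<omega>) * H (W \<omega>) * (\<Prod>i\<in>J. \<integral>\<^sup>+x. F i x \<partial>K (snd (p (W \<omega>) i))) \<partial>M)"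
        using cond_prod_indicator[OF J D C(1) H] by simp
    qed
  next
    case (insert j J')
    show ?case
    proof (intro allI impI)
      fix F :: "nat \<Rightarrow> 'x \<Rightarrow> ennreal"
      assume F': "(\<forall>i\<in>J. F i \<in> borel_measurable N) \<and> (\<forall>i\<in>J - insert j J'. \<exists>C\<in>sets N. F i = indicator C)"
      then have Fm: "\<And>i. i \<in> J \<Longrightarrow> F i \<in> borel_measurable N" by blast
      have jJ: "j \<in> J" using insert by auto
      note [measurable] = Fm[OF jJ]
      have Xm: "(\<lambda>\<omega>. \<Prod>i\<in>J - {j}. F i (X i \<omega>)) \<in> borel_measurable M"
        by (intro borel_measurable_prod_ennreal measurable_compose[OF X_measurable] Fm) auto
      have Km: "(\<lambda>\<omega>. \<Prod>i\<in>J - {j}. \<integral>\<^sup>+x. F i x \<partial>K (snd (p (W \<omega>) i))) \<in> borel_measurable M"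
        by (intro borel_measurable_prod_ennreal measurable_compose[OF K_mark_W
            nn_integral_measurable_subprob_algebra] Fm) auto
      define z1 where "z1 \<omega> = indicator D (W \<omega>) * H (W \<omega>) * (\<Prod>i\<in>J - {j}. F i (X i \<omega>))" for \<omega>
      define z2 where "z2 \<omega> = indicator D (W \<omega>) * H (W \<omega>)
          * (\<Prod>i\<in>J - {j}. \<integral>\<^sup>+x. F i x \<partial>K (snd (p (W \<omega>) i)))" for \<omega>
      have [measurable]: "z1 \<in> borel_measurable M" "z2 \<in> borel_measurable M"
        unfolding z1_def z2_def using Km Xm by measurable
      let ?K = "\<lambda>\<omega>. K (snd (p (W \<omega>) j))"
      let ?L2 = "density M z2 \<bind> ?K"
      have Km2 [measurable]: "?K \<in> density M z2 \<rightarrow>\<^sub>M subprob_algebra N" by simp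
      have ne: "space (density M z2) \<noteq> {}" using not_empty by simp
      have sL2 [measurable_cong]: "sets ?L2 = sets N"
        by (rule sets_bind[OF _ ne]) simp
      have "distr (density M z1) N (X j) = ?L2"
      proof (rule measure_eqI)
        fix B assume "B \<in> sets (distr (density M z1) N (X j))"
        then have B [measurable]: "B \<in> sets N" by simp
        define G where "G = F(j := indicator B)"
        have "(\<forall>i\<in>J. G i \<in> borel_measurable N) \<and> (\<forall>i\<in>J - J'. \<exists>C\<in>sets N. G i = indicator C)"
          using F' B by (auto simp: G_def)
        then have IH: "(\<integral>\<^sup>+\<omega>. indicator D (W \<omega>) * H (W \<omega>) * (\<Prod>i\<in>J. G i (X i \<omega>)) \<partial>M)
          = (\<integral>\<^sup>+\<omega>. indicator D (W \<omega>) * H (W \<omega>) * (\<Prod>i\<in>J. \<integral>\<^sup>+x. G i x \<partial>K (snd (p (W \<omega>) i))) \<partial>M)"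
          using insert.IH insert.prems by blast
        have e1: "(\<Prod>i\<in>J. G i (X i \<omega>)) = (\<Prod>i\<in>J - {j}. F i (X i \<omega>)) * indicator B (X j \<omega>)" for \<omega>
          unfolding prod.remove[OF J jJ] by (simp add: G_def mult.commute)
        have e2: "(\<Prod>i\<in>J. \<integral>\<^sup>+x. G i x \<partial>K (snd (p (W \<omega>) i)))
            = (\<Prod>i\<in>J - {j}. \<integral>\<^sup>+x. F i x \<partial>K (snd (p (W \<omega>) i))) * emeasure (?K \<omega>) B" for \<omega>
          unfolding prod.remove[OF J jJ] by (simp add: G_def mult.commute)
        have "emeasure (distr (density M z1) N (X j)) B = (\<integral>\<^sup>+\<omega>. z1 \<omega>
            * indicator (X j -` B \<inter> space M) \<omega> \<partial>M)"
          by (simp add: emeasure_distr emeasure_density)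
        also have "\<dots> = (\<integral>\<^sup>+\<omega>. z1 \<omega> * indicator B (X j \<omega>) \<partial>M)"
          by (intro nn_integral_cong) (auto split: split_indicator)
        also have "\<dots> = (\<integral>\<^sup>+\<omega>. z2 \<omega> * emeasure (?K \<omega>) B \<partial>M)"
          using IH unfolding e1 e2 z1_def z2_def by (simp add: mult_ac)
        also have "\<dots> = (\<integral>\<^sup>+\<omega>. emeasure (?K \<omega>) B \<partial>density M z2)"
          by (subst nn_integral_density) (auto intro!: measurable_emeasure_kernel[OF K_mark_W])
        also have "\<dots> = emeasure ?L2 B"
          by (rule emeasure_bind[symmetric, OF ne Km2 B])
        finally show "emeasure (distr (density M z1) N (X j)) B = emeasure ?L2 B" .
      qed (simp add: sL2)
      then have "(\<integral>\<^sup>+x. F j x \<partial>distr (density M z1) N (X j)) = (\<integral>\<^sup>+x. F j x \<partial>?L2)" by simp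
      also have "\<dots> = (\<integral>\<^sup>+\<omega>. \<integral>\<^sup>+x. F j x \<partial>?K \<omega> \<partial>density M z2)"
        by (rule nn_integral_bind[OF _ Km2]) simp
      finally have "(\<integral>\<^sup>+\<omega>. z1 \<omega> * F j (X j \<omega>) \<partial>M) = (\<integral>\<^sup>+\<omega>. z2 \<omega> * (\<integral>\<^sup>+x. F j x \<partial>?K \<omega>) \<partial>M)"
        by (simp add: nn_integral_distr nn_integral_density measurable_compose[OF K_mark_W
            nn_integral_measurable_subprob_algebra])
      then show "(\<integral>\<^sup>+\<omega>. indicator D (W \<omega>) * H (W \<omega>) * (\<Prod>i\<in>J. F i (X i \<omega>)) \<partial>M)
          = (\<integral>\<^sup>+\<omega>. indicator D (W \<omega>) * H (W \<omega>) * (\<Prod>i\<in>J. \<integral>\<^sup>+x. F i x \<partial>K (snd (p (W \<omega>) i))) \<partial>M)"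
        unfolding prod.remove[OF J jJ] z1_def z2_def by (simp add: mult_ac)
    qed
  qed
  from this[OF order_refl] show ?thesis using F by blast
qed

lemma cond_prod_complex:
  fixes F :: "'x \<Rightarrow> complex" and H :: "'v \<Rightarrow> complex"
  assumes J: "finite J" and D: "D \<in> sets V" "\<And>w. w \<in> D \<Longrightarrow> J \<subseteq> I w"
    and [measurable]: "F \<in> borel_measurable N" and F1: "\<And>x. norm (F x) \<le> 1"
    and [measurable]: "H \<in> borel_measurable V" and H1: "\<And>w. norm (H w) \<le> 1"
  shows "(\<integral>\<omega>. indicator D (W \<omega>) *\<^sub>R (H (W \<omega>) * (\<Prod>i\<in>J. F (X i \<omega>))) \<partial>M)
    = (\<integral>\<omega>. indicator D (W \<omega>) *\<^sub>R (H (W \<omega>) * (\<Prod>i\<in>J. \<integral>x. F x \<partial>K (snd (p (W \<omega>) i)))) \<partial>M)"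
proof -
  note [measurable] = D(1)
  let ?S = "PiE J (\<lambda>_. {..<4::nat})"
  have finS: "finite ?S" using J by (intro finite_PiE) auto
  define K' where "K' \<omega> i = K (snd (p (W \<omega>) i))" for \<omega> i
  interpret K': prob_space "K' \<omega> i" for \<omega> i unfolding K'_def by (rule K_prob)
  have sK' [measurable_cong]: "sets (K' \<omega> i) = sets N" for \<omega> i by (simp add: K'_def)
  have cp1: "cpart k (F x) \<le> 1" for k x using cpart_bounds(2)[of k "F x"] F1[of x] by linarith
  have ch1: "cpart k (H x) \<le> 1" for k x using cpart_bounds(2)[of k "H x"] H1[of x] by linarith
  have intK: "integrable (K' \<omega> i) (\<lambda>x. cpart k (F x))" for \<omega> i k
    by (rule K'.integrable_const_bound[of _ 1]) (auto simp: cpart_bounds cp1)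
  have IK1: "0 \<le> (\<integral>x. cpart k (F x) \<partial>K' \<omega> i)" "(\<integral>x. cpart k (F x) \<partial>K' \<omega> i) \<le> 1" for k \<omega> i
    by (auto intro!: integral_nonneg_AE K'.integral_le_const intK simp: cpart_bounds cp1)
  have Kmeas [measurable]: "(\<lambda>\<omega>. \<integral>x. cpart k (F x) \<partial>K' \<omega> i) \<in> borel_measurable M" for k i
    unfolding K'_def by (rule measurable_compose[OF K_mark_W integral_measurable_subprob_algebra])
        measurable
  have pw: "indicator D (W \<omega>) *\<^sub>R (H (W \<omega>) * (\<Prod>i\<in>J. F (X i \<omega>)))
     = (\<Sum>k<4. \<Sum>\<sigma>\<in>?S. (\<i> ^ k * (\<Prod>i\<in>J. \<i> ^ \<sigma> i)) *
        of_real (indicator D (W \<omega>) * cpart k (H (W \<omega>)) * (\<Prod>i\<in>J. cpart (\<sigma> i) (F (X i \<omega>)))))" for \<omega>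
  proof -
    have "(\<Prod>i\<in>J. F (X i \<omega>)) = (\<Prod>i\<in>J. \<Sum>k<4. \<i> ^ k * of_real (cpart k (F (X i \<omega>))))"
      unfolding cpart_sum ..
    also have "\<dots> = (\<Sum>\<sigma>\<in>?S. \<Prod>i\<in>J. \<i> ^ \<sigma> i * of_real (cpart (\<sigma> i) (F (X i \<omega>))))"
      by (rule prod_sum_PiE) (use J in auto)
    finally have "H (W \<omega>) * (\<Prod>i\<in>J. F (X i \<omega>)) = (\<Sum>k<4. \<i> ^ k * of_real (cpart k (H (W \<omega>)))) *
        (\<Sum>\<sigma>\<in>?S. \<Prod>i\<in>J. \<i> ^ \<sigma> i * of_real (cpart (\<sigma> i) (F (X i \<omega>))))"
      unfolding cpart_sum by simp
    then show ?thesis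
      by (simp add: scaleR_conv_of_real sum_product sum_distrib_left prod.distrib mult_ac
          sum.swap[of _ "{..<4::nat}" ?S])
  qed
  have pw2: "indicator D (W \<omega>) *\<^sub>R (H (W \<omega>) * (\<Prod>i\<in>J. \<integral>x. F x \<partial>K' \<omega> i))
     = (\<Sum>k<4. \<Sum>\<sigma>\<in>?S. (\<i> ^ k * (\<Prod>i\<in>J. \<i> ^ \<sigma> i)) *
        of_real (indicator D (W \<omega>) * cpart k (H (W \<omega>)) * (\<Prod>i\<in>J. \<integral>x. cpart (\<sigma> i) (F x) \<partial>K' \<omega> i)))" for \<omega>
  proof -
    have "(\<integral>x. F x \<partial>K' \<omega> i) = (\<integral>x. (\<Sum>k<4. \<i> ^ k * of_real (cpart k (F x))) \<partial>K' \<omega> i)" for i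
      unfolding cpart_sum ..
    also have "\<dots> i = (\<Sum>k<4. \<i> ^ k * of_real (\<integral>x. cpart k (F x) \<partial>K' \<omega> i))" for i
      using intK by (subst Bochner_Integration.integral_sum) auto
    finally have "(\<Prod>i\<in>J. \<integral>x. F x \<partial>K' \<omega> i) = (\<Prod>i\<in>J. \<Sum>k<4. \<i> ^ k * of_real (\<integral>x. cpart k (F x) \<partial>K' \<omega> i))"
      by simp
    also have "\<dots> = (\<Sum>\<sigma>\<in>?S. \<Prod>i\<in>J. \<i> ^ \<sigma> i * of_real (\<integral>x. cpart (\<sigma> i) (F x) \<partial>K' \<omega> i))"
      by (rule prod_sum_PiE) (use J in auto)
    finally have "H (W \<omega>) * (\<Prod>i\<in>J. \<integral>x. F x \<partial>K' \<omega> i) = (\<Sum>k<4. \<i> ^ k * of_real (cpart k (H (W \<omega>)))) *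
        (\<Sum>\<sigma>\<in>?S. \<Prod>i\<in>J. \<i> ^ \<sigma> i * of_real (\<integral>x. cpart (\<sigma> i) (F x) \<partial>K' \<omega> i))"
      unfolding cpart_sum by simp
    then show ?thesis
      by (simp add: scaleR_conv_of_real sum_product sum_distrib_left prod.distrib mult_ac
          sum.swap[of _ "{..<4::nat}" ?S])
  qed
  have real_eq: "(\<integral>\<omega>. indicator D (W \<omega>) * cpart k (H (W \<omega>)) * (\<Prod>i\<in>J. cpart (\<sigma> i) (F (X i \<omega>))) \<partial>M)
     = (\<integral>\<omega>. indicator D (W \<omega>) * cpart k (H (W \<omega>)) * (\<Prod>i\<in>J. \<integral>x. cpart (\<sigma> i) (F x) \<partial>K' \<omega> i) \<partial>M)"
    (is "integral\<^sup>L M ?l = integral\<^sup>L M ?r") for k and \<sigma> :: "nat \<Rightarrow> nat"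
  proof -
    have "(\<integral>\<^sup>+\<omega>. ennreal (?l \<omega>) \<partial>M) = (\<integral>\<^sup>+\<omega>. indicator D (W \<omega>) * ennreal (cpart k (H (W \<omega>))) *
        (\<Prod>i\<in>J. ennreal (cpart (\<sigma> i) (F (X i \<omega>)))) \<partial>M)"
      by (intro nn_integral_cong)
         (auto simp: ennreal_mult prod_ennreal prod_nonneg cpart_bounds split: split_indicator)
    also have "\<dots> = (\<integral>\<^sup>+\<omega>. indicator D (W \<omega>) * ennreal (cpart k (H (W \<omega>))) *
        (\<Prod>i\<in>J. \<integral>\<^sup>+x. ennreal (cpart (\<sigma> i) (F x)) \<partial>K' \<omega> i) \<partial>M)"
      unfolding K'_def by (rule cond_prod_nn[OF J D]) measurable
    also have "\<dots> = (\<integral>\<^sup>+\<omega>. ennreal (?r \<omega>) \<partial>M)"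
    proof (intro nn_integral_cong)
      fix \<omega>
      have "(\<Prod>i\<in>J. \<integral>\<^sup>+x. ennreal (cpart (\<sigma> i) (F x)) \<partial>K' \<omega> i)
          = (\<Prod>i\<in>J. ennreal (\<integral>x. cpart (\<sigma> i) (F x) \<partial>K' \<omega> i))"
        by (intro prod.cong refl nn_integral_eq_integral intK) (auto simp: cpart_bounds)
      then show "indicator D (W \<omega>) * ennreal (cpart k (H (W \<omega>))) *
          (\<Prod>i\<in>J. \<integral>\<^sup>+x. ennreal (cpart (\<sigma> i) (F x)) \<partial>K' \<omega> i) = ennreal (?r \<omega>)"
        by (auto simp: ennreal_mult prod_ennreal prod_nonneg cpart_bounds IK1 split: split_indicator)
    qed
    finally have nn: "(\<integral>\<^sup>+\<omega>. ennreal (?l \<omega>) \<partial>M) = (\<integral>\<^sup>+\<omega>. ennreal (?r \<omega>) \<partial>M)" .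
    have "integral\<^sup>L M ?l = enn2real (\<integral>\<^sup>+\<omega>. ennreal (?l \<omega>) \<partial>M)"
      by (rule integral_eq_nn_integral) (auto intro!: mult_nonneg_nonneg prod_nonneg simp: cpart_bounds)
    also have "\<dots> = integral\<^sup>L M ?r"
      unfolding nn
      by (rule integral_eq_nn_integral[symmetric]) (auto intro!: mult_nonneg_nonneg prod_nonneg
          simp: cpart_bounds IK1)
    finally show ?thesis .
  qed
  have i1: "integrable M (\<lambda>\<omega>. indicator D (W \<omega>) * cpart k (H (W \<omega>)) * (\<Prod>i\<in>J. cpart (\<sigma> i) (F (X i \<omega>))))"
    for k and \<sigma> :: "nat \<Rightarrow> nat"
    by (rule integrable_const_bound[of _ 1])
       (auto intro!: AE_I2 mult_le_one prod_le_1 prod_nonneg simp: abs_mult abs_prod cpart_bounds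
           cp1 ch1 split: split_indicator)
  have i2: "integrable M (\<lambda>\<omega>. indicator D (W \<omega>) * cpart k (H (W \<omega>))
      * (\<Prod>i\<in>J. \<integral>x. cpart (\<sigma> i) (F x) \<partial>K' \<omega> i))"
    for k and \<sigma> :: "nat \<Rightarrow> nat"
    by (rule integrable_const_bound[of _ 1])
       (auto intro!: AE_I2 mult_le_one prod_le_1 prod_nonneg simp: abs_mult abs_prod cpart_bounds
           cp1 ch1 IK1 split: split_indicator)
  show ?thesis
    unfolding K'_def[symmetric] pw pw2
    using i1 i2 finS
    by (simp add: Bochner_Integration.integral_sum Bochner_Integration.integrable_sum real_eq del:
        of_real_mult of_real_prod)
qed

text \<open>Zero if there are infinitely many points in \<open>B\<close>, which happens with probability zero for sets of
  finite mean.\<close>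

definition cnt :: "(real \<times> 's) set \<Rightarrow> 'w \<Rightarrow> nat"
  where "cnt B \<omega> = card {i \<in> I (W \<omega>). p (W \<omega>) i \<in> B}"

abbreviation \<xi> :: "'w \<Rightarrow> (real \<times> 's) measure"
  where "\<xi> \<omega> \<equiv> dirac_sum (I (W \<omega>)) (p (W \<omega>))"

lemma emeasure_points:
  assumes "B \<in> sets (borel \<Otimes>\<^sub>M borel)"
  shows "emeasure (\<xi> \<omega>) B = (\<Sum>i. indicator {w. i \<in> I w} (W \<omega>) * indicator B (p (W \<omega>) i))"
  unfolding emeasure_dirac_sum[OF assms]
  by (auto simp: nn_integral_count_space_indicator nn_integral_count_space_nat intro!: suminf_cong
      split: split_indicator)

lemma emeasure_points_measurable [measurable]:
  assumes [measurable]: "B \<in> sets (borel \<Otimes>\<^sub>M borel)"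
  shows "(\<lambda>\<omega>. emeasure (\<xi> \<omega>) B) \<in> borel_measurable M"
  unfolding emeasure_points[OF assms] by measurable

lemma emeasure_points_card:
  assumes "B \<in> sets (borel \<Otimes>\<^sub>M borel)"
  shows "emeasure (\<xi> \<omega>) B = (if finite {i \<in> I (W \<omega>). p (W \<omega>) i \<in> B} then of_nat (cnt B \<omega>) else \<infinity>)"
proof -
  have "emeasure (\<xi> \<omega>) B = (\<integral>\<^sup>+i. indicator {i \<in> I (W \<omega>). p (W \<omega>) i \<in> B} i \<partial>count_space (I (W \<omega>)))"
    unfolding emeasure_dirac_sum[OF assms] by (intro nn_integral_cong) (auto split: split_indicator)
  also have "\<dots> = emeasure (count_space (I (W \<omega>))) {i \<in> I (W \<omega>). p (W \<omega>) i \<in> B}"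
    by (rule nn_integral_indicator) auto
  finally show ?thesis by (auto simp: cnt_def emeasure_count_space)
qed

lemma cnt_eq:
  assumes "B \<in> sets (borel \<Otimes>\<^sub>M borel)"
  shows "cnt B \<omega> = nat \<lfloor>enn2real (emeasure (\<xi> \<omega>) B)\<rfloor>"
  unfolding emeasure_points_card[OF assms] by (simp add: cnt_def ennreal_of_nat_eq_real_of_nat)

lemma cnt_measurable [measurable]:
  assumes [measurable]: "B \<in> sets (borel \<Otimes>\<^sub>M borel)"
  shows "cnt B \<in> M \<rightarrow>\<^sub>M count_space UNIV"
  unfolding cnt_eq[OF assms] by measurable

lemma poisson_prob:
  assumes B: "B \<in> sets (m \<Otimes>\<^sub>M Q)" "emeasure (m \<Otimes>\<^sub>M Q) B < \<infinity>"
  shows "prob {\<omega> \<in> space M. emeasure (\<xi> \<omega>) B = of_nat k}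
    = measure (m \<Otimes>\<^sub>M Q) B ^ k / fact k * exp (- measure (m \<Otimes>\<^sub>M Q) B)"
  using poisson[unfolded poisson_process_def, rule_format, of "{0}" "\<lambda>_. B"] B
  by (simp add: disjoint_family_on_def)

lemma AE_points_finite:
  assumes B: "B \<in> sets (m \<Otimes>\<^sub>M Q)" "emeasure (m \<Otimes>\<^sub>M Q) B < \<infinity>"
  shows "AE \<omega> in M. finite {i \<in> I (W \<omega>). p (W \<omega>) i \<in> B}"
proof -
  have B' [measurable]: "B \<in> sets (borel \<Otimes>\<^sub>M borel)" using B(1) sets_mQ by simp
  let ?E = "\<lambda>k::nat. {\<omega> \<in> space M. emeasure (\<xi> \<omega>) B = of_nat k}"
  have "(\<lambda>k. prob (?E k)) sums prob (\<Union>k. ?E k)"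
    by (rule finite_measure_UNION) (auto simp: disjoint_family_on_def)
  moreover have "(\<lambda>k. prob (?E k)) sums 1"
    unfolding poisson_prob[OF B] by (rule poisson_weights_sums)
  ultimately have "prob (\<Union>k. ?E k) = 1" by (rule sums_unique2)
  then have "AE \<omega> in M. \<omega> \<in> (\<Union>k. ?E k)" by (subst (asm) prob_eq_1) auto
  then show ?thesis
    by eventually_elim (auto simp: emeasure_points_card[OF B'] split: if_splits)
qed

lemma distr_cnt:
  assumes B: "B \<in> sets (m \<Otimes>\<^sub>M Q)" "emeasure (m \<Otimes>\<^sub>M Q) B < \<infinity>"
  shows "distr M (count_space UNIV) (cnt B) = density (count_space UNIV)
    (\<lambda>k. ennreal (measure (m \<Otimes>\<^sub>M Q) B ^ k / fact k * exp (- measure (m \<Otimes>\<^sub>M Q) B)))"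
proof (rule measure_eqI_countable[where A=UNIV])
  have B' [measurable]: "B \<in> sets (borel \<Otimes>\<^sub>M borel)" using B(1) sets_mQ by simp
  fix k :: nat
  have "emeasure (distr M (count_space UNIV) (cnt B)) {k} = emeasure M {\<omega> \<in> space M. cnt B \<omega> = k}"
    by (subst emeasure_distr) (auto intro!: arg_cong[where f="emeasure M"])
  also have "\<dots> = emeasure M {\<omega> \<in> space M. emeasure (\<xi> \<omega>) B = of_nat k}"
  proof (rule emeasure_eq_AE)
    show "AE \<omega> in M. \<omega> \<in> {\<omega> \<in> space M. cnt B \<omega> = k} \<longleftrightarrow> \<omega> \<in> {\<omega> \<in> space M. emeasure (\<xi> \<omega>) B = of_nat k}"
      using AE_points_finite[OF B] by eventually_elim (auto simp: emeasure_points_card[OF B'])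
  qed measurable
  also have "\<dots> = ennreal (measure (m \<Otimes>\<^sub>M Q) B ^ k / fact k * exp (- measure (m \<Otimes>\<^sub>M Q) B))"
    unfolding emeasure_eq_measure poisson_prob[OF B] ..
  also have "\<dots> = emeasure (density (count_space UNIV)
      (\<lambda>k. ennreal (measure (m \<Otimes>\<^sub>M Q) B ^ k / fact k * exp (- measure (m \<Otimes>\<^sub>M Q) B)))) {k}"
    by (subst emeasure_density) (auto simp: nn_integral_indicator_singleton)
  finally show "emeasure (distr M (count_space UNIV) (cnt B)) {k} = emeasure (density (count_space UNIV)
      (\<lambda>k. ennreal (measure (m \<Otimes>\<^sub>M Q) B ^ k / fact k * exp (- measure (m \<Otimes>\<^sub>M Q) B)))) {k}" .
qed auto

lemma expectation_cnt_power:
  fixes c :: complex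
  assumes B: "B \<in> sets (m \<Otimes>\<^sub>M Q)" "emeasure (m \<Otimes>\<^sub>M Q) B < \<infinity>" and c: "norm c \<le> 1"
  shows "(\<integral>\<omega>. c ^ cnt B \<omega> \<partial>M) = exp (of_real (measure (m \<Otimes>\<^sub>M Q) B) * (c - 1))"
proof -
  have B' [measurable]: "B \<in> sets (borel \<Otimes>\<^sub>M borel)" using B(1) sets_mQ by simp
  define l where "l = measure (m \<Otimes>\<^sub>M Q) B"
  have l: "l \<ge> 0" by (simp add: l_def)
  let ?w = "\<lambda>k. l ^ k / fact k * exp (- l)"
  have "(\<integral>\<omega>. c ^ cnt B \<omega> \<partial>M) = (\<integral>k. c ^ k \<partial>distr M (count_space UNIV) (cnt B))"
    by (subst integral_distr) auto
  also have "\<dots> = (\<integral>k. ?w k *\<^sub>R c ^ k \<partial>count_space UNIV)"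
    unfolding distr_cnt[OF B] l_def[symmetric] using l by (subst integral_density) auto
  also have "\<dots> = (\<Sum>k. ?w k *\<^sub>R c ^ k)"
  proof (rule integral_count_space_nat)
    have "summable (\<lambda>k. norm (?w k *\<^sub>R c ^ k))"
    proof (rule summable_comparison_test_ev)
      show "eventually (\<lambda>k. norm (norm (?w k *\<^sub>R c ^ k)) \<le> ?w k) sequentially"
      proof (intro always_eventually allI)
        fix k
        have "norm (norm (?w k *\<^sub>R c ^ k)) = ?w k * norm c ^ k" using l by (simp add: norm_power)
        also have "\<dots> \<le> ?w k * 1" using l c by (intro mult_left_mono power_le_one) auto
        finally show "norm (norm (?w k *\<^sub>R c ^ k)) \<le> ?w k" by simp
      qed
      show "summable ?w" using poisson_weights_sums by (rule sums_summable)
    qed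
    then show "integrable (count_space UNIV) (\<lambda>k. ?w k *\<^sub>R c ^ k)"
      by (simp add: integrable_count_space_nat_iff)
  qed
  also have "\<dots> = exp (of_real l * (c - 1))"
    using sums_unique[OF poisson_gf_sums[of l c]] by (simp add: scaleR_conv_of_real)
  finally show ?thesis unfolding l_def .
qed

lemma mean_points_finite:
  assumes B: "B \<in> sets (m \<Otimes>\<^sub>M Q)" "emeasure (m \<Otimes>\<^sub>M Q) B < \<infinity>"
  shows "(\<integral>\<^sup>+\<omega>. emeasure (\<xi> \<omega>) B \<partial>M) = emeasure (m \<Otimes>\<^sub>M Q) B"
proof -
  have B' [measurable]: "B \<in> sets (borel \<Otimes>\<^sub>M borel)" using B(1) sets_mQ by simp
  define l where "l = measure (m \<Otimes>\<^sub>M Q) B"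
  have l: "l \<ge> 0" by (simp add: l_def)
  let ?w = "\<lambda>k. l ^ k / fact k * exp (- l)"
  have "(\<integral>\<^sup>+\<omega>. emeasure (\<xi> \<omega>) B \<partial>M) = (\<integral>\<^sup>+\<omega>. of_nat (cnt B \<omega>) \<partial>M)"
    by (rule nn_integral_cong_AE)
       (use AE_points_finite[OF B] in eventually_elim, simp add: emeasure_points_card[OF B'])
  also have "\<dots> = (\<integral>\<^sup>+k. of_nat k \<partial>distr M (count_space UNIV) (cnt B))"
    by (subst nn_integral_distr) auto
  also have "\<dots> = (\<integral>\<^sup>+k. ennreal (?w k) * of_nat k \<partial>count_space UNIV)"
    unfolding distr_cnt[OF B] l_def[symmetric] using l by (subst nn_integral_density) auto
  also have "\<dots> = (\<Sum>k. ennreal (real k * ?w k))"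
  proof -
    have "ennreal (?w k) * of_nat k = ennreal (real k * ?w k)" for k
      unfolding ennreal_of_nat_eq_real_of_nat using l by (subst mult.commute, subst ennreal_mult) auto
    then show ?thesis unfolding nn_integral_count_space_nat by simp
  qed
  also have "\<dots> = ennreal l"
    using poisson_mean_sums[of l] l by (intro suminf_ennreal_eq) auto
  also have "\<dots> = emeasure (m \<Otimes>\<^sub>M Q) B"
    unfolding l_def using B by (simp add: emeasure_eq_ennreal_measure)
  finally show ?thesis .
qed

text \<open>The intensity measure of the points, realised as an image so that integrals against it are sums
  over the points.\<close>

definition mean_measure :: "(real \<times> 's) measure"
  where "mean_measure = distr (density (count_space UNIV \<Otimes>\<^sub>M M) (\<lambda>z. indicator {w. fst z
      \<in> I w} (W (snd z))))
    (borel \<Otimes>\<^sub>M borel) (\<lambda>z. p (W (snd z)) (fst z))"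

lemma nn_integral_mean_measure:
  assumes [measurable]: "g \<in> borel_measurable (borel \<Otimes>\<^sub>M borel)"
  shows "(\<integral>\<^sup>+z. g z \<partial>mean_measure) = (\<Sum>i. \<integral>\<^sup>+\<omega>. indicator {w. i \<in> I w} (W \<omega>) * g (p (W \<omega>) i) \<partial>M)"
proof -
  have 1 [measurable]: "(\<lambda>z. indicator {w. fst z \<in> I w} (W (snd z)) :: ennreal)
      \<in> borel_measurable (count_space UNIV \<Otimes>\<^sub>M M)"
    by (rule measurable_pair_measure_countable1) (auto, measurable)
  have 2 [measurable]: "(\<lambda>z. p (W (snd z)) (fst z)) \<in> count_space UNIV \<Otimes>\<^sub>M M \<rightarrow>\<^sub>M borel \<Otimes>\<^sub>M borel"
    by (rule measurable_pair_measure_countable1) (auto, measurable)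
  have "(\<integral>\<^sup>+z. g z \<partial>mean_measure)
      = (\<integral>\<^sup>+z. indicator {w. fst z \<in> I w} (W (snd z)) * g (p (W (snd z)) (fst z)) \<partial>(count_space UNIV
          \<Otimes>\<^sub>M M))"
    unfolding mean_measure_def by (simp add: nn_integral_distr nn_integral_density)
  also have "\<dots> = (\<integral>\<^sup>+i. \<integral>\<^sup>+\<omega>. indicator {w. i \<in> I w} (W \<omega>) * g (p (W \<omega>) i) \<partial>M \<partial>count_space UNIV)"
    by (subst nn_integral_fst[symmetric]) auto
  finally show ?thesis by (simp add: nn_integral_count_space_nat)
qed

lemma sets_mean_measure [simp, measurable_cong]: "sets mean_measure = sets (borel \<Otimes>\<^sub>M borel)"
  by (simp add: mean_measure_def)

lemma emeasure_mean_measure: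
  assumes [measurable]: "B \<in> sets (borel \<Otimes>\<^sub>M borel)"
  shows "emeasure mean_measure B = (\<integral>\<^sup>+\<omega>. emeasure (\<xi> \<omega>) B \<partial>M)"
proof -
  have "emeasure mean_measure B = (\<integral>\<^sup>+z. indicator B z \<partial>mean_measure)" by simp
  also have "\<dots> = (\<integral>\<^sup>+\<omega>. emeasure (\<xi> \<omega>) B \<partial>M)"
    unfolding emeasure_points[OF assms] by (subst nn_integral_mean_measure) (auto simp:
        nn_integral_suminf)
  finally show ?thesis .
qed

text \<open>The counts of sets of finite mean are Poisson and so have the right mean; both measures
  being countably additive, \<open>\<sigma>\<close>-finiteness extends the equality to all sets.\<close>

lemma mean_measure_eq: "mean_measure = m \<Otimes>\<^sub>M Q"
proof (rule measure_eqI)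
  show "sets mean_measure = sets (m \<Otimes>\<^sub>M Q)" by (simp add: sets_mQ)
  fix B assume "B \<in> sets mean_measure"
  then have B: "B \<in> sets (borel \<Otimes>\<^sub>M borel)" by simp
  obtain R :: "nat \<Rightarrow> (real \<times> 's) set" where R: "disjoint_family R" "range R \<subseteq> sets (m \<Otimes>\<^sub>M Q)"
    "(\<Union>i. R i) = space (m \<Otimes>\<^sub>M Q)" "\<And>i. emeasure (m \<Otimes>\<^sub>M Q) (R i) \<noteq> \<infinity>"
    by (rule mQ.sigma_finite_disjoint) blast
  have Rs: "B \<inter> R i \<in> sets (m \<Otimes>\<^sub>M Q)" for i using R(2) B by (auto simp: sets_mQ)
  have "emeasure (m \<Otimes>\<^sub>M Q) (B \<inter> R i) \<le> emeasure (m \<Otimes>\<^sub>M Q) (R i)" for i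
    using R(2) by (intro emeasure_mono) auto
  then have fin: "emeasure (m \<Otimes>\<^sub>M Q) (B \<inter> R i) < \<infinity>" for i
    using R(4)[of i] by (simp add: less_top[symmetric] top_unique[symmetric]) (metis top.extremum_uniqueI)
  have disj: "disjoint_family (\<lambda>i. B \<inter> R i)" using R(1) by (auto simp: disjoint_family_on_def)
  have un: "(\<Union>i. B \<inter> R i) = B"
    using R(3) sets.sets_into_space[of B "m \<Otimes>\<^sub>M Q"] B by (auto simp: sets_mQ)
  have "emeasure mean_measure B = (\<Sum>i. emeasure mean_measure (B \<inter> R i))"
    by (rule suminf_emeasure[of "\<lambda>i. B \<inter> R i" mean_measure, unfolded un, OF _ disj, symmetric])
       (use Rs in \<open>auto simp: sets_mQ\<close>)
  also have "\<dots> = (\<Sum>i. emeasure (m \<Otimes>\<^sub>M Q) (B \<inter> R i))"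
    using Rs by (simp add: emeasure_mean_measure mean_points_finite[OF Rs fin] sets_mQ)
  also have "\<dots> = emeasure (m \<Otimes>\<^sub>M Q) B"
    by (rule suminf_emeasure[of "\<lambda>i. B \<inter> R i" "m \<Otimes>\<^sub>M Q", unfolded un, OF _ disj])
       (use Rs in auto)
  finally show "emeasure mean_measure B = emeasure (m \<Otimes>\<^sub>M Q) B" .
qed

text \<open>Campbell's formula, after the marks have been integrated out point by point.\<close>

lemma campbell:
  assumes [measurable]: "g \<in> borel_measurable (borel \<Otimes>\<^sub>M borel)" "G \<in> borel_measurable N"
  shows "(\<integral>\<^sup>+\<omega>. (\<integral>\<^sup>+i. g (p (W \<omega>) i) * G (X i \<omega>) \<partial>count_space (I (W \<omega>))) \<partial>M)
    = (\<integral>\<^sup>+z. g z * (\<integral>\<^sup>+x. G x \<partial>K (snd z)) \<partial>(m \<Otimes>\<^sub>M Q))"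
proof -
  have "(\<integral>\<^sup>+\<omega>. (\<integral>\<^sup>+i. g (p (W \<omega>) i) * G (X i \<omega>) \<partial>count_space (I (W \<omega>))) \<partial>M)
      = (\<integral>\<^sup>+\<omega>. (\<Sum>i. indicator {w \<in> space V. i \<in> I w} (W \<omega>) * g (p (W \<omega>) i) * (\<Prod>i\<in>{i}. G (X i \<omega>))) \<partial>M)"
    using measurable_space[OF W_measurable]
    by (intro nn_integral_cong)
       (auto simp: nn_integral_count_space_indicator nn_integral_count_space_nat intro!: suminf_cong
           split: split_indicator)
  also have "\<dots> = (\<Sum>i. \<integral>\<^sup>+\<omega>. indicator {w \<in> space V. i \<in> I w} (W \<omega>) * g (p (W \<omega>) i)
      * (\<Prod>i\<in>{i}. G (X i \<omega>)) \<partial>M)"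
    by (intro nn_integral_suminf) measurable
  also have "\<dots> = (\<Sum>i. \<integral>\<^sup>+\<omega>. indicator {w \<in> space V. i \<in> I w} (W \<omega>) * g (p (W \<omega>) i)
      * (\<Prod>i\<in>{i}. \<integral>\<^sup>+x. G x \<partial>K (snd (p (W \<omega>) i))) \<partial>M)"
    by (intro suminf_cong cond_prod_nn) (auto intro: I_measurable)
  also have "\<dots> = (\<Sum>i. \<integral>\<^sup>+\<omega>. indicator {w. i \<in> I w} (W \<omega>)
      * (g (p (W \<omega>) i) * (\<integral>\<^sup>+x. G x \<partial>K (snd (p (W \<omega>) i)))) \<partial>M)"
    using measurable_space[OF W_measurable]
    by (intro suminf_cong nn_integral_cong) (auto split: split_indicator)
  also have "\<dots> = (\<integral>\<^sup>+z. g z * (\<integral>\<^sup>+x. G x \<partial>K (snd z)) \<partial>mean_measure)"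
    by (subst nn_integral_mean_measure) auto
  finally show ?thesis unfolding mean_measure_eq .
qed

lemma AE_points:
  assumes "AE z in m \<Otimes>\<^sub>M Q. P z"
  shows "AE \<omega> in M. \<forall>i\<in>I (W \<omega>). P (p (W \<omega>) i)"
proof -
  obtain B where B: "B \<in> sets (m \<Otimes>\<^sub>M Q)" "{z \<in> space (m \<Otimes>\<^sub>M Q). \<not> P z} \<subseteq> B" "emeasure (m \<Otimes>\<^sub>M Q) B = 0"
    using assms by (auto elim!: AE_E)
  have B' [measurable]: "B \<in> sets (borel \<Otimes>\<^sub>M borel)" using B(1) sets_mQ by simp
  have "(\<integral>\<^sup>+\<omega>. emeasure (\<xi> \<omega>) B \<partial>M) = 0"
    using mean_points_finite[OF B(1)] B(3) by simp
  then have "AE \<omega> in M. emeasure (\<xi> \<omega>) B = 0"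
    by (subst (asm) nn_integral_0_iff_AE) auto
  then show ?thesis
  proof eventually_elim
    case (elim \<omega>)
    then have "{i \<in> I (W \<omega>). p (W \<omega>) i \<in> B} = {}"
      by (auto simp: emeasure_points_card[OF B'] cnt_def split: if_splits)
    moreover have "space (m \<Otimes>\<^sub>M Q) = UNIV"
      using sets_eq_imp_space_eq[OF sets_mQ] by (simp add: space_pair_measure)
    ultimately show ?case using B(2) by auto
  qed
qed

lemma AE_marks:
  assumes [measurable]: "Measurable.pred N P" and "AE a in Q. AE x in K a. P x"
  shows "AE \<omega> in M. \<forall>i\<in>I (W \<omega>). P (X i \<omega>)"
proof -
  let ?G = "indicator {x \<in> space N. \<not> P x} :: 'x \<Rightarrow> ennreal"
  have Gm: "?G \<in> borel_measurable N" by measurable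
  have nul: "AE a in Q. (\<integral>\<^sup>+x. ?G x \<partial>K a) = 0"
    using assms(2)
  proof eventually_elim
    case (elim a)
    have "space (K a) = space N" by (rule sets_eq_imp_space_eq) simp
    then show ?case using elim by (subst nn_integral_0_iff_AE) (auto elim!: eventually_mono)
  qed
  have "AE z in m \<Otimes>\<^sub>M Q. (\<integral>\<^sup>+x. ?G x \<partial>K (snd z)) = 0"
  proof (rule mQ.AE_pair_measure)
    show "{z \<in> space (m \<Otimes>\<^sub>M Q). (\<integral>\<^sup>+x. ?G x \<partial>K (snd z)) = 0} \<in> sets (m \<Otimes>\<^sub>M Q)"
      by measurable
    show "AE x in m. AE y in Q. (\<integral>\<^sup>+x. ?G x \<partial>K (snd (x, y))) = 0" using nul by simp
  qed
  then have "(\<integral>\<^sup>+z. 1 * (\<integral>\<^sup>+x. ?G x \<partial>K (snd z)) \<partial>(m \<Otimes>\<^sub>M Q)) = 0"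
    by (subst nn_integral_0_iff_AE) auto
  then have "(\<integral>\<^sup>+\<omega>. (\<integral>\<^sup>+i. 1 * ?G (X i \<omega>) \<partial>count_space (I (W \<omega>))) \<partial>M) = 0"
    by (subst campbell) auto
  then have "AE \<omega> in M. (\<integral>\<^sup>+i. ?G (X i \<omega>) \<partial>count_space (I (W \<omega>))) = 0"
    by (subst (asm) nn_integral_0_iff_AE) (auto simp: nn_integral_count_space_indicator
        nn_integral_count_space_nat)
  then show ?thesis
  proof (rule AE_mp, intro AE_I2 impI ballI)
    fix \<omega> i assume "\<omega> \<in> space M" "(\<integral>\<^sup>+i. ?G (X i \<omega>) \<partial>count_space (I (W \<omega>))) = 0" "i \<in> I (W \<omega>)"
    then show "P (X i \<omega>)"
      using measurable_space[OF X_measurable, of \<omega> i]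
      by (subst (asm) nn_integral_0_iff_AE) (auto simp: AE_count_space split: split_indicator_asm)
  qed
qed


text \<open>Independence of the counts of disjoint sets enters here.\<close>

lemma expectation_prod_cnt:
  fixes c :: "nat \<Rightarrow> complex"
  assumes disj: "disjoint_family_on B {..<n}"
    and B: "\<And>j. j < n \<Longrightarrow> B j \<in> sets (m \<Otimes>\<^sub>M Q)" "\<And>j. j < n \<Longrightarrow> emeasure (m \<Otimes>\<^sub>M Q) (B j) < \<infinity>"
    and c: "\<And>j. norm (c j) \<le> 1"
  shows "(\<integral>\<omega>. (\<Prod>j<n. c j ^ cnt (B j) \<omega>) \<partial>M)
    = exp (\<Sum>j<n. of_real (measure (m \<Otimes>\<^sub>M Q) (B j)) * (c j - 1))"
proof -
  have B' [measurable]: "B j \<in> sets (borel \<Otimes>\<^sub>M borel)" if "j < n" for j using B(1)[OF that] sets_mQ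
      by simp
  have "indep_vars (\<lambda>_. borel) (\<lambda>j \<omega>. emeasure (\<xi> \<omega>) (B j)) {..<n}"
    using poisson[unfolded poisson_process_def, rule_format, of "{..<n}" B] B disj by auto
  then have "indep_vars (\<lambda>_. borel) (\<lambda>j \<omega>. c j ^ nat \<lfloor>enn2real (emeasure (\<xi> \<omega>) (B j))\<rfloor>) {..<n}"
    by (rule indep_vars_compose2) measurable
  moreover have "indep_vars (\<lambda>_. borel) (\<lambda>j \<omega>. c j ^ nat \<lfloor>enn2real (emeasure (\<xi> \<omega>) (B j))\<rfloor>) {..<n}
      = indep_vars (\<lambda>_. borel) (\<lambda>j \<omega>. c j ^ cnt (B j) \<omega>) {..<n}"
    by (rule indep_vars_cong) (auto simp: cnt_eq B')
  ultimately have iv: "indep_vars (\<lambda>_. borel) (\<lambda>j \<omega>. c j ^ cnt (B j) \<omega>) {..<n}" by simp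
  have "(\<integral>\<omega>. (\<Prod>j\<in>{..<n}. c j ^ cnt (B j) \<omega>) \<partial>M) = (\<Prod>j\<in>{..<n}. \<integral>\<omega>. c j ^ cnt (B j) \<omega> \<partial>M)"
  proof (rule indep_vars_lebesgue_integral[OF _ iv])
    show "integrable M (\<lambda>\<omega>. c j ^ cnt (B j) \<omega>)" if "j \<in> {..<n}" for j
      using that B' c by (intro integrable_const_bound[of _ 1]) (auto simp: norm_power power_le_one)
  qed simp
  also have "\<dots> = (\<Prod>j\<in>{..<n}. exp (of_real (measure (m \<Otimes>\<^sub>M Q) (B j)) * (c j - 1)))"
    by (intro prod.cong refl expectation_cnt_power B c) auto
  finally show ?thesis by (simp add: exp_sum)
qed

abbreviation pts :: "real set \<Rightarrow> 'v \<Rightarrow> nat set"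
  where "pts R w \<equiv> {i \<in> I w. fst (p w i) \<in> R}"

lemma emeasure_strip: "R \<in> sets borel \<Longrightarrow> emeasure (m \<Otimes>\<^sub>M Q) (R \<times> UNIV) = emeasure m R"
  using Q.emeasure_space_1 sets_eq_imp_space_eq[OF Q_sets]
  by (subst Q.emeasure_pair_measure_Times) (auto simp: sets_m Q_sets)

lemma sets_strip [measurable]: "R \<in> sets borel \<Longrightarrow> R \<times> UNIV \<in> sets (borel \<Otimes>\<^sub>M borel)"
  by simp

lemma AE_pts_finite:
  assumes "R \<in> sets borel" "emeasure m R < \<infinity>"
  shows "AE \<omega> in M. finite (pts R (W \<omega>))"
proof -
  have "AE \<omega> in M. finite {i \<in> I (W \<omega>). p (W \<omega>) i \<in> R \<times> UNIV}"
    by (rule AE_points_finite) (use assms in \<open>auto simp: emeasure_strip sets_mQ\<close>)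
  then show ?thesis
    by eventually_elim (auto simp: mem_Times_iff)
qed

text \<open>The index set is random, but on the event that its elements are all below \<open>n\<close> the product is a
  finite one. If it is infinite, the product has the default value one.\<close>

lemma prod_pts_measurable:
  assumes [measurable]: "R \<in> sets borel"
    and [measurable]: "\<And>i. h i \<in> borel_measurable M"
  shows "(\<lambda>\<omega>. \<Prod>i\<in>pts R (W \<omega>). h i \<omega> :: complex) \<in> borel_measurable M"
proof (rule borel_measurable_LIMSEQ_metric)
  let ?f = "\<lambda>\<omega>. \<Prod>i\<in>pts R (W \<omega>). h i \<omega>"
  let ?g = "\<lambda>n \<omega>. if \<forall>i\<ge>n. \<not> (i \<in> I (W \<omega>) \<and> fst (p (W \<omega>) i) \<in> R)
    then \<Prod>i<n. if i \<in> I (W \<omega>) \<and> fst (p (W \<omega>) i) \<in> R then h i \<omega> else 1 else 1"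
  show "?g n \<in> borel_measurable M" for n by measurable
  fix \<omega>
  show "(\<lambda>n. ?g n \<omega>) \<longlonglongrightarrow> ?f \<omega>"
  proof (cases "finite (pts R (W \<omega>))")
    case True
    then obtain n0 where n0: "pts R (W \<omega>) \<subseteq> {..<n0}" by (meson finite_nat_iff_bounded)
    have "?g n \<omega> = ?f \<omega>" if "n \<ge> n0" for n
    proof -
      have "(\<Prod>i<n. if i \<in> I (W \<omega>) \<and> fst (p (W \<omega>) i) \<in> R then h i \<omega> else 1) = (\<Prod>i\<in>pts R (W \<omega>). h i \<omega>)"
        using n0 that by (intro prod.mono_neutral_cong_right) auto
      moreover have "\<forall>i\<ge>n. \<not> (i \<in> I (W \<omega>) \<and> fst (p (W \<omega>) i) \<in> R)"
        using n0 that by force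
      ultimately show ?thesis using True by simp
    qed
    then show ?thesis
      by (intro tendsto_eventually eventually_sequentiallyI[of n0])
  next
    case False
    have "\<not> (\<forall>i\<ge>n. \<not> (i \<in> I (W \<omega>) \<and> fst (p (W \<omega>) i) \<in> R))" for n
    proof
      assume "\<forall>i\<ge>n. \<not> (i \<in> I (W \<omega>) \<and> fst (p (W \<omega>) i) \<in> R)"
      then have "pts R (W \<omega>) \<subseteq> {..<n}" by (auto simp: not_less[symmetric])
      then show False using False finite_subset by blast
    qed
    then show ?thesis using False by (simp only: if_False prod.infinite) simp
  qed
qed


lemma integrable_prod_pts:
  assumes "R \<in> sets borel" "\<And>i. h i \<in> borel_measurable M" "\<And>i \<omega>. norm (h i \<omega> :: complex) \<le> 1"
  shows "integrable M (\<lambda>\<omega>. \<Prod>i\<in>pts R (W \<omega>). h i \<omega>)"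
  by (rule integrable_const_bound[of _ 1])
     (use assms in \<open>auto intro!: AE_I2 prod_pts_measurable prod_le_1 simp: prod_norm[symmetric]\<close>)

text \<open>Grouping the points according to the value of \<open>g\<close> turns the product into powers of the counts of
  the level sets.\<close>

lemma gf_points_simple:
  fixes g :: "real \<times> 's \<Rightarrow> complex"
  assumes R [measurable]: "R \<in> sets borel" and fin: "emeasure m R < \<infinity>"
    and sf: "simple_function (borel \<Otimes>\<^sub>M borel) g" and g1: "\<And>z. norm (g z) \<le> 1"
  shows "(\<integral>\<omega>. (\<Prod>i\<in>pts R (W \<omega>). g (p (W \<omega>) i)) \<partial>M)
    = exp (\<integral>z. indicator (R \<times> UNIV) z *\<^sub>R (g z - 1) \<partial>(m \<Otimes>\<^sub>M Q))"
proof -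
  have sp: "space (borel \<Otimes>\<^sub>M borel :: (real \<times> 's) measure) = UNIV" by (simp add: space_pair_measure)
  have "finite (range g)" using sf sp by (auto simp: simple_function_def)
  then obtain e where e: "bij_betw e {..<card (range g)} (range g)"
    using ex_bij_betw_nat_finite[of "range g"] by (auto simp: atLeast0LessThan)
  define n where "n = card (range g)"
  define c where "c j = (if j < n then e j else 0)" for j
  have en: "bij_betw c {..<n} (range g)"
    by (rule bij_betw_cong[THEN iffD1, OF _ e[folded n_def]]) (auto simp: c_def)
  have c1: "norm (c j) \<le> 1" for j
  proof (cases "j < n")
    case True
    then have "c j \<in> range g" using en by (auto simp: bij_betw_def)
    then show ?thesis using g1 by auto
  qed (simp add: c_def)
  define B where "B j = (R \<times> UNIV) \<inter> g -` {c j}" for j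
  have gm [measurable]: "g \<in> borel_measurable (borel \<Otimes>\<^sub>M borel)" using sf
      by (rule borel_measurable_simple_function)
  have Bm' [measurable]: "B j \<in> sets (borel \<Otimes>\<^sub>M borel)" for j
  proof -
    have "g -` {c j} \<inter> space (borel \<Otimes>\<^sub>M borel) \<in> sets (borel \<Otimes>\<^sub>M borel)"
      by (rule measurable_sets[OF gm]) simp
    then show ?thesis unfolding B_def sp by auto
  qed
  then have Bm: "B j \<in> sets (m \<Otimes>\<^sub>M Q)" for j by (simp add: sets_mQ)
  have Bf: "emeasure (m \<Otimes>\<^sub>M Q) (B j) < \<infinity>" for j
  proof -
    have "emeasure (m \<Otimes>\<^sub>M Q) (B j) \<le> emeasure (m \<Otimes>\<^sub>M Q) (R \<times> UNIV)"
      by (rule emeasure_mono) (auto simp: B_def sets_mQ)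
    then show ?thesis using fin by (simp add: emeasure_strip order.strict_trans1)
  qed
  have disj: "disjoint_family_on B {..<n}"
    using en by (auto simp: disjoint_family_on_def B_def bij_betw_def inj_on_def)
  have "(\<integral>\<omega>. (\<Prod>i\<in>pts R (W \<omega>). g (p (W \<omega>) i)) \<partial>M) = (\<integral>\<omega>. (\<Prod>j<n. c j ^ cnt (B j) \<omega>) \<partial>M)"
  proof (rule integral_cong_AE)
    show "(\<lambda>\<omega>. \<Prod>i\<in>pts R (W \<omega>). g (p (W \<omega>) i)) \<in> borel_measurable M"
      by (rule prod_pts_measurable) measurable
    show "AE \<omega> in M. (\<Prod>i\<in>pts R (W \<omega>). g (p (W \<omega>) i)) = (\<Prod>j<n. c j ^ cnt (B j) \<omega>)"
      using AE_pts_finite[OF R fin]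
    proof eventually_elim
      case (elim \<omega>)
      have "(\<Prod>i\<in>pts R (W \<omega>). g (p (W \<omega>) i)) = (\<Prod>z\<in>range g. \<Prod>i\<in>{i \<in> pts R (W \<omega>). g (p (W \<omega>) i)
          = z}. g (p (W \<omega>) i))"
        by (rule prod.group[symmetric]) (use elim \<open>finite (range g)\<close> in auto)
      also have "\<dots> = (\<Prod>z\<in>range g. z ^ card {i \<in> pts R (W \<omega>). g (p (W \<omega>) i) = z})"
        by (intro prod.cong refl) simp
      also have "\<dots> = (\<Prod>j<n. c j ^ card {i \<in> pts R (W \<omega>). g (p (W \<omega>) i) = c j})"
        by (rule prod.reindex_bij_betw[OF en, symmetric])
      also have "\<dots> = (\<Prod>j<n. c j ^ cnt (B j) \<omega>)"
        unfolding cnt_def B_def by (intro prod.cong refl arg_cong2[where f="(^)"] arg_cong[where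
            f=card]) (auto simp: mem_Times_iff)
      finally show ?case .
    qed
  qed measurable
  also have "\<dots> = exp (\<Sum>j<n. of_real (measure (m \<Otimes>\<^sub>M Q) (B j)) * (c j - 1))"
    by (rule expectation_prod_cnt[OF disj Bm Bf c1])
  also have "(\<Sum>j<n. of_real (measure (m \<Otimes>\<^sub>M Q) (B j)) * (c j - 1))
      = (\<Sum>j<n. \<integral>z. indicator (B j) z *\<^sub>R (c j - 1) \<partial>(m \<Otimes>\<^sub>M Q))"
    using Bm Bf by (intro sum.cong refl) (simp add: scaleR_conv_of_real)
  also have "\<dots> = (\<integral>z. (\<Sum>j<n. indicator (B j) z *\<^sub>R (c j - 1)) \<partial>(m \<Otimes>\<^sub>M Q))"
    using Bm Bf by (intro Bochner_Integration.integral_sum[symmetric]) simp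
  also have "\<dots> = (\<integral>z. indicator (R \<times> UNIV) z *\<^sub>R (g z - 1) \<partial>(m \<Otimes>\<^sub>M Q))"
  proof (rule Bochner_Integration.integral_cong[OF refl])
    fix z
    obtain j where j: "j < n" "c j = g z"
      using en by (metis bij_betw_iff_bijections lessThan_iff rangeI)
    have "(\<Sum>k<n. indicator (B k) z *\<^sub>R (c k - 1)) = (\<Sum>k\<in>{j}. indicator (B k) z *\<^sub>R (c k - 1))"
    proof (rule sum.mono_neutral_right)
      show "\<forall>k\<in>{..<n} - {j}. indicator (B k) z *\<^sub>R (c k - 1) = 0"
        using en j by (auto simp: B_def bij_betw_def inj_on_def split: split_indicator)
    qed (use j in auto)
    then show "(\<Sum>k<n. indicator (B k) z *\<^sub>R (c k - 1)) = indicator (R \<times> UNIV) z *\<^sub>R (g z - 1)"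
      using j by (auto simp: B_def split: split_indicator)
  qed
  finally show ?thesis .
qed

text \<open>Simple functions approximate \<open>g\<close> pointwise; rescaled to modulus at most one, they keep both sides
  dominated.\<close>

lemma gf_points:
  fixes g :: "real \<times> 's \<Rightarrow> complex"
  assumes R [measurable]: "R \<in> sets borel" and fin: "emeasure m R < \<infinity>"
    and gm [measurable]: "g \<in> borel_measurable (borel \<Otimes>\<^sub>M borel)" and g1: "\<And>z. norm (g z) \<le> 1"
  shows "(\<integral>\<omega>. (\<Prod>i\<in>pts R (W \<omega>). g (p (W \<omega>) i)) \<partial>M)
    = exp (\<integral>z. indicator (R \<times> UNIV) z *\<^sub>R (g z - 1) \<partial>(m \<Otimes>\<^sub>M Q))"
proof -
  have sp: "space (borel \<Otimes>\<^sub>M borel :: (real \<times> 's) measure) = UNIV" by (simp add: space_pair_measure)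
  obtain f where f: "\<And>k. simple_function (borel \<Otimes>\<^sub>M borel) (f k)" "\<And>z. (\<lambda>k. f k z) \<longlonglongrightarrow> g z"
    using borel_measurable_implies_sequence_metric[OF gm, of 0] unfolding sp by auto
  \<comment> \<open>Dividing by \<open>max 1 \<bar>f\<bar>\<close> leaves the limit unchanged, as the limit has modulus at most one.\<close>
  define s where "s k z = f k z /\<^sub>R max 1 (norm (f k z))" for k z
  have s_sf: "simple_function (borel \<Otimes>\<^sub>M borel) (s k)" for k
    unfolding s_def by (rule simple_function_compose1[OF f(1), of "\<lambda>x. x /\<^sub>R max 1 (norm x)"])
  have s1: "norm (s k z) \<le> 1" for k z
    by (auto simp: s_def field_simps max_def)
  have s_lim: "(\<lambda>k. s k z) \<longlonglongrightarrow> g z" for z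
  proof -
    have "(\<lambda>k. s k z) \<longlonglongrightarrow> g z /\<^sub>R max 1 (norm (g z))"
      unfolding s_def by (intro tendsto_intros f) auto
    then show ?thesis using g1[of z] by (simp add: max_absorb1)
  qed
  note [measurable] = borel_measurable_simple_function[OF s_sf]
  have "(\<lambda>k. \<integral>\<omega>. (\<Prod>i\<in>pts R (W \<omega>). s k (p (W \<omega>) i)) \<partial>M)
      \<longlonglongrightarrow> (\<integral>\<omega>. (\<Prod>i\<in>pts R (W \<omega>). g (p (W \<omega>) i)) \<partial>M)"
  proof (rule integral_dominated_convergence[where w="\<lambda>_. 1"])
    show "(\<lambda>\<omega>. \<Prod>i\<in>pts R (W \<omega>). g (p (W \<omega>) i)) \<in> borel_measurable M"
      by (rule prod_pts_measurable) measurable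
    show "(\<lambda>\<omega>. \<Prod>i\<in>pts R (W \<omega>). s k (p (W \<omega>) i)) \<in> borel_measurable M" for k
      by (rule prod_pts_measurable) measurable
    show "AE \<omega> in M. (\<lambda>k. \<Prod>i\<in>pts R (W \<omega>). s k (p (W \<omega>) i)) \<longlonglongrightarrow> (\<Prod>i\<in>pts R (W \<omega>). g (p (W \<omega>) i))"
      by (intro AE_I2 tendsto_prod s_lim)
    show "AE \<omega> in M. norm (\<Prod>i\<in>pts R (W \<omega>). s k (p (W \<omega>) i)) \<le> 1" for k
      by (auto intro!: AE_I2 prod_le_1 simp: prod_norm[symmetric] s1)
  qed auto
  moreover have "(\<lambda>k. exp (\<integral>z. indicator (R \<times> UNIV) z *\<^sub>R (s k z - 1) \<partial>(m \<Otimes>\<^sub>M Q)))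
      \<longlonglongrightarrow> exp (\<integral>z. indicator (R \<times> UNIV) z *\<^sub>R (g z - 1) \<partial>(m \<Otimes>\<^sub>M Q))"
  proof (intro tendsto_exp integral_dominated_convergence[where w="\<lambda>z. 2 * indicator (R \<times> UNIV) z"])
    show "integrable (m \<Otimes>\<^sub>M Q) (\<lambda>z. 2 * indicat_real (R \<times> UNIV) z)"
      using fin by (intro integrable_mult_right integrable_real_indicator) (auto simp:
          emeasure_strip sets_mQ)
    show "AE z in m \<Otimes>\<^sub>M Q. (\<lambda>k. indicat_real (R \<times> UNIV) z *\<^sub>R (s k z - 1))
        \<longlonglongrightarrow> indicat_real (R \<times> UNIV) z *\<^sub>R (g z - 1)"
      by (intro AE_I2 tendsto_intros s_lim)
    show "AE z in m \<Otimes>\<^sub>M Q. norm (indicat_real (R \<times> UNIV) z *\<^sub>R (s k z - 1)) \<le> 2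
        * indicat_real (R \<times> UNIV) z" for k
    proof (rule AE_I2)
      fix z
      have "norm (s k z - 1) \<le> 2" using norm_triangle_ineq4[of "s k z" 1] s1[of k z] by simp
      then show "norm (indicat_real (R \<times> UNIV) z *\<^sub>R (s k z - 1)) \<le> 2 * indicat_real (R \<times> UNIV) z"
        by (auto split: split_indicator)
    qed
  qed measurable
  ultimately show ?thesis
    unfolding gf_points_simple[OF R fin s_sf s1] by (rule LIMSEQ_unique)
qed

text \<open>Given the set of indices of the points in the region, the conditional product formula applies.
  There are only finitely many possible sets below a bound \<open>n\<close>, and \<open>n\<close> is then let go to
  infinity.\<close>

lemma cond_prod_points:
  fixes g :: "real \<times> 's \<Rightarrow> complex" and F :: "'x \<Rightarrow> complex"
  assumes R [measurable]: "R \<in> sets borel" and fin: "emeasure m R < \<infinity>"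
    and [measurable]: "g \<in> borel_measurable (borel \<Otimes>\<^sub>M borel)" and g1: "\<And>z. norm (g z) \<le> 1"
    and [measurable]: "F \<in> borel_measurable N" and F1: "\<And>x. norm (F x) \<le> 1"
  shows "(\<integral>\<omega>. (\<Prod>i\<in>pts R (W \<omega>). g (p (W \<omega>) i) * F (X i \<omega>)) \<partial>M)
    = (\<integral>\<omega>. (\<Prod>i\<in>pts R (W \<omega>). g (p (W \<omega>) i) * (\<integral>x. F x \<partial>K (snd (p (W \<omega>) i)))) \<partial>M)"
proof -
  interpret K: prob_space "K a" for a by (rule K_prob)
  define F' where "F' a = (\<integral>x. F x \<partial>K a)" for a
  have [measurable]: "F' \<in> borel_measurable borel" unfolding F'_def by measurable
  have F'1: "norm (F' a) \<le> 1" for a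
  proof -
    have "norm (F' a) \<le> (\<integral>x. norm (F x) \<partial>K a)" unfolding F'_def by (rule integral_norm_bound)
    also have "\<dots> \<le> 1"
      by (rule K.integral_le_const) (auto intro!: K.integrable_const_bound[of _ 1] simp: F1)
    finally show ?thesis .
  qed
  define D where "D S = {w \<in> space V. pts R w = S}" for S
  have Dm: "D S \<in> sets V" for S
  proof -
    have "D S = {w \<in> space V. \<forall>i. (i \<in> I w \<and> fst (p w i) \<in> R) = (i \<in> S)}"
      by (auto simp: D_def set_eq_iff)
    also have "\<dots> \<in> sets V" by measurable
    finally show ?thesis .
  qed
  have WV: "\<omega> \<in> space M \<Longrightarrow> W \<omega> \<in> space V" for \<omega> using measurable_space[OF W_measurable] by simp
  define H where "H S w = (\<Prod>i\<in>S. g (p w i))" for S w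
  have Hm [measurable]: "H S \<in> borel_measurable V" for S unfolding H_def by measurable
  have H1: "norm (H S w) \<le> 1" for S w by (auto simp: H_def prod_norm[symmetric] g1 intro!: prod_le_1)
  \<comment> \<open>Both sides are compared on the events that all points of the region have an index below \<open>n\<close>.\<close>
  have eq: "(\<integral>\<omega>. (\<Sum>S\<in>Pow {..<n}. indicator (D S) (W \<omega>) *\<^sub>R (H S (W \<omega>) * (\<Prod>i\<in>S. F (X i \<omega>)))) \<partial>M)
      = (\<integral>\<omega>. (\<Sum>S\<in>Pow {..<n}. indicator (D S) (W \<omega>) *\<^sub>R (H S (W \<omega>) * (\<Prod>i\<in>S. F' (snd (p (W \<omega>) i))))) \<partial>M)"
    for n :: nat
  proof -
    have i1: "integrable M (\<lambda>\<omega>. indicator (D S) (W \<omega>) *\<^sub>R (H S (W \<omega>) * (\<Prod>i\<in>S. F (X i \<omega>))))" for S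
      by (rule integrable_const_bound[of _ 1])
         (use Dm H1 F1 in \<open>auto intro!: AE_I2 mult_le_one prod_le_1 simp: norm_mult
             prod_norm[symmetric] prod_nonneg split: split_indicator\<close>)
    have i2: "integrable M (\<lambda>\<omega>. indicator (D S) (W \<omega>) *\<^sub>R (H S (W \<omega>)
        * (\<Prod>i\<in>S. F' (snd (p (W \<omega>) i)))))" for S
      by (rule integrable_const_bound[of _ 1])
         (use Dm H1 F'1 in \<open>auto intro!: AE_I2 mult_le_one prod_le_1 simp: norm_mult
             prod_norm[symmetric] prod_nonneg split: split_indicator\<close>)
    have "(\<integral>\<omega>. indicator (D S) (W \<omega>) *\<^sub>R (H S (W \<omega>) * (\<Prod>i\<in>S. F (X i \<omega>))) \<partial>M)
        = (\<integral>\<omega>. indicator (D S) (W \<omega>) *\<^sub>R (H S (W \<omega>) * (\<Prod>i\<in>S. F' (snd (p (W \<omega>) i)))) \<partial>M)" if "S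
            \<in> Pow {..<n}" for S
      unfolding F'_def using that
      by (intro cond_prod_complex Dm F1 H1) (auto simp: D_def intro: finite_subset)
    then show ?thesis
      unfolding Bochner_Integration.integral_sum[OF i1] Bochner_Integration.integral_sum[OF i2]
      by (intro sum.cong refl)
  qed
  have pw: "(\<lambda>n. \<Sum>S\<in>Pow {..<n}. indicator (D S) (W \<omega>) *\<^sub>R Z S) \<longlonglongrightarrow> Z (pts R (W \<omega>))"
    if pf: "finite (pts R (W \<omega>))" and "\<omega> \<in> space M" for \<omega> and Z :: "nat set \<Rightarrow> complex"
  proof -
    obtain n0 where n0: "pts R (W \<omega>) \<subseteq> {..<n0}" using pf by (meson finite_nat_iff_bounded)
    have "(\<Sum>S\<in>Pow {..<n}. indicator (D S) (W \<omega>) *\<^sub>R Z S) = Z (pts R (W \<omega>))" if "n \<ge> n0" for n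
    proof -
      have "(\<Sum>S\<in>Pow {..<n}. indicator (D S) (W \<omega>) *\<^sub>R Z S)
          = (\<Sum>S\<in>{pts R (W \<omega>)}. indicator (D S) (W \<omega>) *\<^sub>R Z S)"
        using n0 \<open>n \<ge> n0\<close> by (intro sum.mono_neutral_right) (auto simp: D_def split: split_indicator)
      then show ?thesis using WV[OF \<open>\<omega> \<in> space M\<close>] by (simp add: D_def)
    qed
    then show ?thesis by (intro tendsto_eventually eventually_sequentiallyI[of n0])
  qed
  have bd: "norm (\<Sum>S\<in>Pow {..<n}. indicator (D S) w *\<^sub>R Z S) \<le> 1" if "\<And>S. norm (Z S :: complex) \<le> 1"
      for Z and n :: nat and w
  proof (cases "pts R w \<in> Pow {..<n}")
    case True
    have "(\<Sum>S\<in>Pow {..<n}. indicator (D S) w *\<^sub>R Z S) = (\<Sum>S\<in>{pts R w}. indicator (D S) w *\<^sub>R Z S)"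
      using True by (intro sum.mono_neutral_right) (auto simp: D_def split: split_indicator)
    also have "\<dots> = indicator (D (pts R w)) w *\<^sub>R Z (pts R w)"
      by (simp only: sum.insert finite.emptyI empty_iff not_False_eq_True sum.empty add_0_right)
    finally show ?thesis using that by (auto split: split_indicator)
  next
    case False
    then have "(\<Sum>S\<in>Pow {..<n}. indicator (D S) w *\<^sub>R Z S) = 0"
      by (intro sum.neutral) (auto simp: D_def split: split_indicator)
    then show ?thesis by simp
  qed
  have lim1: "(\<lambda>n. \<integral>\<omega>. (\<Sum>S\<in>Pow {..<n}. indicator (D S) (W \<omega>) *\<^sub>R (H S (W \<omega>) * (\<Prod>i\<in>S. F (X i \<omega>)))) \<partial>M)
      \<longlonglongrightarrow> (\<integral>\<omega>. (\<Prod>i\<in>pts R (W \<omega>). g (p (W \<omega>) i) * F (X i \<omega>)) \<partial>M)"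
  proof (rule integral_dominated_convergence[where w="\<lambda>_. 1"])
    show "(\<lambda>\<omega>. \<Prod>i\<in>pts R (W \<omega>). g (p (W \<omega>) i) * F (X i \<omega>)) \<in> borel_measurable M"
      by (rule prod_pts_measurable) measurable
    show "(\<lambda>\<omega>. \<Sum>S\<in>Pow {..<n}. indicator (D S) (W \<omega>) *\<^sub>R (H S (W \<omega>) * (\<Prod>i\<in>S. F (X i \<omega>))))
        \<in> borel_measurable M" for n
      using Dm by measurable
    show "AE \<omega> in M. (\<lambda>n. \<Sum>S\<in>Pow {..<n}. indicator (D S) (W \<omega>) *\<^sub>R (H S (W \<omega>) * (\<Prod>i\<in>S. F (X i \<omega>))))
        \<longlonglongrightarrow> (\<Prod>i\<in>pts R (W \<omega>). g (p (W \<omega>) i) * F (X i \<omega>))"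
      using AE_pts_finite[OF R fin] AE_space
      by eventually_elim (drule pw, assumption, simp add: H_def prod.distrib[symmetric])
    show "AE \<omega> in M. norm (\<Sum>S\<in>Pow {..<n}. indicator (D S) (W \<omega>) *\<^sub>R (H S (W \<omega>) * (\<Prod>i\<in>S. F (X i \<omega>))))
        \<le> 1" for n
      by (intro AE_I2 bd) (auto simp: norm_mult prod_norm[symmetric] F1 H1 intro!: mult_le_one
          prod_le_1 prod_nonneg)
  qed auto
  have lim2: "(\<lambda>n. \<integral>\<omega>. (\<Sum>S\<in>Pow {..<n}. indicator (D S) (W \<omega>) *\<^sub>R (H S (W \<omega>)
      * (\<Prod>i\<in>S. F' (snd (p (W \<omega>) i))))) \<partial>M)
      \<longlonglongrightarrow> (\<integral>\<omega>. (\<Prod>i\<in>pts R (W \<omega>). g (p (W \<omega>) i) * F' (snd (p (W \<omega>) i))) \<partial>M)"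
  proof (rule integral_dominated_convergence[where w="\<lambda>_. 1"])
    show "(\<lambda>\<omega>. \<Prod>i\<in>pts R (W \<omega>). g (p (W \<omega>) i) * F' (snd (p (W \<omega>) i))) \<in> borel_measurable M"
      by (rule prod_pts_measurable) measurable
    show "(\<lambda>\<omega>. \<Sum>S\<in>Pow {..<n}. indicator (D S) (W \<omega>) *\<^sub>R (H S (W \<omega>) * (\<Prod>i\<in>S. F' (snd (p (W \<omega>) i)))))
        \<in> borel_measurable M" for n
      using Dm by measurable
    show "AE \<omega> in M. (\<lambda>n. \<Sum>S\<in>Pow {..<n}. indicator (D S) (W \<omega>) *\<^sub>R (H S (W \<omega>)
        * (\<Prod>i\<in>S. F' (snd (p (W \<omega>) i)))))
        \<longlonglongrightarrow> (\<Prod>i\<in>pts R (W \<omega>). g (p (W \<omega>) i) * F' (snd (p (W \<omega>) i)))"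
      using AE_pts_finite[OF R fin] AE_space
      by eventually_elim (drule pw, assumption, simp add: H_def prod.distrib[symmetric])
    show "AE \<omega> in M. norm (\<Sum>S\<in>Pow {..<n}. indicator (D S) (W \<omega>) *\<^sub>R (H S (W \<omega>)
        * (\<Prod>i\<in>S. F' (snd (p (W \<omega>) i))))) \<le> 1" for n
      by (intro AE_I2 bd) (auto simp: norm_mult prod_norm[symmetric] F'1 H1 intro!: mult_le_one
          prod_le_1 prod_nonneg)
  qed auto
  show ?thesis
    unfolding F'_def[symmetric] using lim1 lim2 unfolding eq by (rule LIMSEQ_unique)
qed

text \<open>The characteristic functional of the marked process. With one point for each child of the root it
  gives the fixed-point equation, with one for each immigrant the compound Poisson law.\<close>

lemma gf_marked_points:
  fixes g :: "real \<times> 's \<Rightarrow> complex" and F :: "'x \<Rightarrow> complex"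
  assumes R [measurable]: "R \<in> sets borel" and fin: "emeasure m R < \<infinity>"
    and [measurable]: "g \<in> borel_measurable (borel \<Otimes>\<^sub>M borel)" and g1: "\<And>z. norm (g z) \<le> 1"
    and [measurable]: "F \<in> borel_measurable N" and F1: "\<And>x. norm (F x) \<le> 1"
  shows "(\<integral>\<omega>. (\<Prod>i\<in>pts R (W \<omega>). g (p (W \<omega>) i) * F (X i \<omega>)) \<partial>M)
    = exp (\<integral>z. indicator (R \<times> UNIV) z *\<^sub>R (g z * (\<integral>x. F x \<partial>K (snd z)) - 1) \<partial>(m \<Otimes>\<^sub>M Q))"
proof -
  interpret K: prob_space "K a" for a by (rule K_prob)
  have F'1: "norm (\<integral>x. F x \<partial>K a) \<le> 1" for a
  proof -
    have "norm (\<integral>x. F x \<partial>K a) \<le> (\<integral>x. norm (F x) \<partial>K a)" by (rule integral_norm_bound)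
    also have "\<dots> \<le> 1"
      by (rule K.integral_le_const) (auto intro!: K.integrable_const_bound[of _ 1] simp: F1)
    finally show ?thesis .
  qed
  show ?thesis
    unfolding cond_prod_points[OF assms]
    by (rule gf_points[OF R fin]) (auto simp: norm_mult g1 F'1 intro!: mult_le_one)
qed

end

section \<open>Cascades\<close>

lemma nn_integral_countable_measurable:
  assumes "countable A" "\<And>u. u \<in> A \<Longrightarrow> f u \<in> borel_measurable M"
  shows "(\<lambda>x. \<integral>\<^sup>+u. f u x \<partial>count_space A) \<in> borel_measurable M"
proof -
  interpret sigma_finite_measure "count_space A" by (rule
      sigma_finite_measure_count_space_countable[OF assms(1)])
  have "case_prod f \<in> borel_measurable (count_space A \<Otimes>\<^sub>M M)"
    by (rule measurable_pair_measure_countable1) (use assms in auto)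
  then have "(\<lambda>(x, u). f u x) \<in> borel_measurable (M \<Otimes>\<^sub>M count_space A)"
    by (subst measurable_pair_swap_iff) (simp add: split_beta')
  then show ?thesis by (rule borel_measurable_nn_integral)
qed

lemma point_indep: "u \<noteq> [] \<Longrightarrow> point u a T = point u b T"
  by (cases u) auto

lemma subtree_measurable [measurable]: "subtree l \<in> tree_space \<rightarrow>\<^sub>M tree_space"
  unfolding subtree_def tree_space_def by (intro measurable_PiM_single') (auto simp: space_PiM)

lemma tree_component_measurable [measurable]: "(\<lambda>T. T u) \<in> tree_space \<rightarrow>\<^sub>M offspring_space"
  unfolding tree_space_def by measurable

lemma offspring_fst_measurable [measurable]: "fst \<in> offspring_space \<rightarrow>\<^sub>M count_space UNIV"
  unfolding offspring_space_def by measurable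

lemma offspring_point_measurable [measurable]: "(\<lambda>w. snd w l) \<in> offspring_space \<rightarrow>\<^sub>M borel \<Otimes>\<^sub>M borel"
  unfolding offspring_space_def by measurable

lemma children_measurable [measurable]: "Measurable.pred offspring_space (\<lambda>w. l \<in> children w)"
  unfolding children_def by measurable

lemma alive_measurable [measurable]:
  "Measurable.pred (tree_space :: 's::topological_space tree measure) (alive u)"
proof (induction u)
  case Nil
  then show ?case by simp
next
  case (Cons l u)
  have [measurable]: "Measurable.pred (tree_space :: 's tree measure) (\<lambda>T. alive u (subtree l T))"
    by (rule measurable_compose[OF subtree_measurable Cons])
  have [measurable]: "Measurable.pred (tree_space :: 's tree measure) (\<lambda>T. l \<in> children (T []))"
    by (rule measurable_compose[OF tree_component_measurable children_measurable])
  have "Measurable.pred (tree_space :: 's tree measure) (\<lambda>T. l \<in> children (T []) \<and> alive u (subtree l T))"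
    by measurable
  then show ?case by simp
qed

lemma shift_measurable [measurable]:
  "f \<in> borel_measurable M \<Longrightarrow> g \<in> M \<rightarrow>\<^sub>M borel \<Otimes>\<^sub>M borel \<Longrightarrow>
    (\<lambda>x. shift (f x) (g x)) \<in> M \<rightarrow>\<^sub>M borel \<Otimes>\<^sub>M borel"
  unfolding shift_def
  by (intro measurable_Pair borel_measurable_add measurable_compose[OF _ measurable_fst]
      measurable_compose[OF _ measurable_snd])

text \<open>Measurability in the mark and the genealogy jointly, since the recursion changes both.\<close>

lemma point_measurable_aux:
  "(\<lambda>(a, T). point u a T) \<in> (borel :: 's::topological_space measure) \<Otimes>\<^sub>M tree_space \<rightarrow>\<^sub>M borel \<Otimes>\<^sub>M borel"
proof (induction u)
  case Nil
  then show ?case by simp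
next
  case (Cons l u)
  have P: "(\<lambda>z. snd (snd z []) l) \<in> (borel :: 's measure) \<Otimes>\<^sub>M (tree_space :: 's tree measure) \<rightarrow>\<^sub>M
      borel \<Otimes>\<^sub>M borel"
    by (rule measurable_compose[OF measurable_snd
          measurable_compose[OF tree_component_measurable offspring_point_measurable]])
  have "(\<lambda>z. (snd (snd (snd z []) l), subtree l (snd z)))
      \<in> (borel :: 's measure) \<Otimes>\<^sub>M (tree_space :: 's tree measure) \<rightarrow>\<^sub>M borel \<Otimes>\<^sub>M tree_space"
    by (intro measurable_Pair measurable_compose[OF P measurable_snd]
        measurable_compose[OF measurable_snd subtree_measurable])
  note C = measurable_compose[OF this Cons]
  have "(\<lambda>z. shift (fst (snd (snd z []) l)) ((\<lambda>(a, T). point u a T) (snd (snd (snd z []) l), subtree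
      l (snd z))))
      \<in> (borel :: 's measure) \<Otimes>\<^sub>M (tree_space :: 's tree measure) \<rightarrow>\<^sub>M borel \<Otimes>\<^sub>M borel"
    by (rule shift_measurable[OF measurable_compose[OF P measurable_fst] C])
  then show ?case by (simp add: split_beta' Let_def)
qed

lemma point_measurable [measurable]: "point u a \<in> tree_space \<rightarrow>\<^sub>M borel \<Otimes>\<^sub>M borel"
  using measurable_compose[OF _ point_measurable_aux[of u], of "\<lambda>T. (a, T)" tree_space] by simp

text \<open>The bound on the generation makes recursions for means into inequalities between finite
  quantities; the value \<open>\<infinity>\<close> stands for the whole cascade.\<close>

definition descendants :: "enat \<Rightarrow> 's tree \<Rightarrow> nat list set"
  where "descendants n T = {u. alive u T \<and> u \<noteq> [] \<and> enat (length u) \<le> n}"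

definition dsum :: "(real \<times> 's \<Rightarrow> ennreal) \<Rightarrow> enat \<Rightarrow> 's \<Rightarrow> 's tree \<Rightarrow> ennreal"
  where "dsum w n a T = (\<integral>\<^sup>+u. w (point u a T) \<partial>count_space (descendants n T))"

lemma dsum_indicator: "dsum w n a T = (\<integral>\<^sup>+u. w (point u a T)
    * indicator (descendants n T) u \<partial>count_space UNIV)"
  unfolding dsum_def by (simp add: nn_integral_count_space_indicator)

lemma dsum_measurable [measurable]:
  assumes [measurable]: "w \<in> borel_measurable (borel \<Otimes>\<^sub>M borel)"
  shows "dsum w n a \<in> borel_measurable tree_space"
  unfolding dsum_indicator descendants_def
  by (rule nn_integral_countable_measurable) auto

lemma dsum_0 [simp]: "dsum w 0 a T = 0"
  by (simp add: dsum_def descendants_def zero_enat_def nn_integral_count_space_finite)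

lemma dsum_indep: "dsum w n a T = dsum w n b T"
  unfolding dsum_def
  by (intro nn_integral_cong arg_cong[where f=w] point_indep) (auto simp: descendants_def)

lemma dsum_SUP: "dsum w \<infinity> a T = (SUP n::nat. dsum w (enat n) a T)"
proof -
  have "(\<lambda>u. w (point u a T) * indicator (descendants \<infinity> T) u)
      = (\<lambda>u. SUP n::nat. w (point u a T) * indicator (descendants (enat n) T) u)"
  proof
    fix u
    have "(SUP n::nat. w (point u a T) * indicator (descendants (enat n) T) u) = w (point u a T)
        * indicator (descendants \<infinity> T) u"
    proof (rule antisym)
      show "(SUP n::nat. w (point u a T) * indicator (descendants (enat n) T) u) \<le> w (point u a T)
          * indicator (descendants \<infinity> T) u"
        by (intro SUP_least) (auto simp: descendants_def split: split_indicator)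
      show "w (point u a T) * indicator (descendants \<infinity> T) u \<le> (SUP n::nat. w (point u a T)
          * indicator (descendants (enat n) T) u)"
        by (rule SUP_upper2[of "length u"]) (auto simp: descendants_def split: split_indicator)
    qed
    then show "w (point u a T) * indicator (descendants \<infinity> T) u = (SUP n::nat. w (point u a T)
        * indicator (descendants (enat n) T) u)" by simp
  qed
  then show ?thesis
    unfolding dsum_indicator
    by (simp only:) (rule nn_integral_monotone_convergence_SUP,
      auto simp: incseq_def le_fun_def descendants_def split: split_indicator)
qed

lemma dsum_add: 
  "dsum (\<lambda>z. w1 z + w2 z) n a T = dsum w1 n a T + dsum w2 n a T"
  unfolding dsum_def by (rule nn_integral_add) auto

lemma dsum_mono: "(\<And>z. w1 z \<le> w2 z) \<Longrightarrow> dsum w1 n a T \<le> dsum w2 n a T"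
  unfolding dsum_def by (rule nn_integral_mono) auto

lemma dsum_cmult: "dsum (\<lambda>z. c * w z) n a T = c * dsum w n a T"
  unfolding dsum_def by (rule nn_integral_cmult) auto

text \<open>Splitting at the first generation. The descendants of child \<open>l\<close> see the weight with their times
  shifted by the displacement of \<open>l\<close>.\<close>

lemma dsum_rec:
  "dsum w (eSuc n) a T = (\<integral>\<^sup>+l. w (snd (T []) l) + dsum (\<lambda>z. w (shift (fst (snd (T []) l)) z)) n
      (snd (snd (T []) l)) (subtree l T)
     \<partial>count_space (children (T [])))"
proof -
  let ?L = "children (T [])"
  let ?U = "\<lambda>l. {u. alive u (subtree l T) \<and> enat (length u) \<le> n}"
  define g where "g l u = w (point (l # u) a T)" for l u
  have le: "enat (Suc k) \<le> eSuc n \<longleftrightarrow> enat k \<le> n" for k by (simp add: eSuc_enat[symmetric])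
  have img: "descendants (eSuc n) T = (\<lambda>(l, u). l # u) ` (SIGMA l:?L. ?U l)" (is "?I = _")
  proof (rule set_eqI)
    fix u show "u \<in> ?I \<longleftrightarrow> u \<in> (\<lambda>(l, u). l # u) ` (SIGMA l:?L. ?U l)"
      by (cases u) (auto simp: descendants_def le)
  qed
  have inner: "(\<integral>\<^sup>+u. g l u \<partial>count_space (?U l)) = w (snd (T []) l)
      + dsum (\<lambda>z. w (shift (fst (snd (T []) l)) z)) n (snd (snd (T []) l)) (subtree l T)" for l
  proof -
    have g: "g l u = w (shift (fst (snd (T []) l)) (point u (snd (snd (T []) l)) (subtree l T)))" for u
      by (simp add: g_def split_beta Let_def)
    have "(\<integral>\<^sup>+u. g l u \<partial>count_space (?U l)) = (\<integral>\<^sup>+u. g l u * indicator (?U l) u \<partial>count_space UNIV)"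
      by (simp add: nn_integral_count_space_indicator)
    also have "\<dots> = (\<integral>\<^sup>+u. g l u * indicator {[]} u +
        g l u * indicator (descendants n (subtree l T)) u \<partial>count_space UNIV)"
      by (intro nn_integral_cong) (auto simp: descendants_def zero_enat_def[symmetric] split:
          split_indicator)
    also have "\<dots> = g l [] + (\<integral>\<^sup>+u. g l u \<partial>count_space (descendants n (subtree l T)))"
      by (subst nn_integral_add) (simp_all add: nn_integral_count_space_indicator)
    also have "g l [] = w (snd (T []) l)" by (simp add: g shift_def)
    finally show ?thesis by (simp add: g dsum_def)
  qed
  have "dsum w (eSuc n) a T = (\<integral>\<^sup>+x. (case x of (l, u) \<Rightarrow> g l u) \<partial>count_space (SIGMA l:?L. ?U l))"
  proof -
    have "bij_betw (\<lambda>(l, u). l # u) (SIGMA l:?L. ?U l) ?I"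
      unfolding img by (auto simp: bij_betw_def inj_on_def)
    from nn_integral_bij_count_space[OF this, of "\<lambda>u. w (point u a T)"]
    show ?thesis by (simp add: g_def split_beta dsum_def del: point.simps)
  qed
  also have "\<dots> = (\<integral>\<^sup>+x. (case x of (l, u) \<Rightarrow> g l u * indicator (?U l) u
      * indicator ?L l) \<partial>count_space UNIV)"
    by (subst nn_integral_count_space_indicator)
       (auto intro!: nn_integral_cong split: split_indicator)
  also have "\<dots> = (\<integral>\<^sup>+l. \<integral>\<^sup>+u. g l u * indicator (?U l) u
      * indicator ?L l \<partial>count_space UNIV \<partial>count_space UNIV)"
    by (subst nn_integral_fst_count_space[symmetric]) simp
  also have "\<dots> = (\<integral>\<^sup>+l. (\<integral>\<^sup>+u. g l u \<partial>count_space (?U l)) \<partial>count_space ?L)"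
    by (simp add: nn_integral_count_space_indicator nn_integral_multc)
  finally show ?thesis unfolding inner .
qed

text \<open>Weights of the marks alone do not notice the shift.\<close>

lemma dsum_mark_rec:
  "dsum (\<lambda>z. v (snd z)) (eSuc n) a T
    = (\<integral>\<^sup>+l. v (snd (snd (T []) l)) + dsum (\<lambda>z. v (snd z)) n a (subtree l T) \<partial>count_space (children
        (T [])))"
proof -
  have "dsum (\<lambda>z. v (snd (shift t z))) n b T' = dsum (\<lambda>z. v (snd z)) n a T'" for t b T'
    using dsum_indep[of "\<lambda>z. v (snd z)" n b T' a] by (simp add: shift_def)
  then show ?thesis unfolding dsum_rec by simp
qed

lemma powr_subadditive:
  assumes "0 < p" "p \<le> 1" "0 \<le> x" "0 \<le> (y::real)"
  shows "(x + y) powr p \<le> x powr p + y powr p"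
proof (cases "x + y = 0")
  case False
  then have s: "x + y > 0" using assms by linarith
  have le: "z / (x + y) \<le> (z / (x + y)) powr p" if "0 \<le> z" "z \<le> x + y" for z
  proof (cases "z = 0")
    case False
    have "(z / (x + y)) powr 1 \<le> (z / (x + y)) powr p"
      using that s assms False by (intro powr_mono') auto
    then show ?thesis using that s by simp
  qed auto
  have "1 = x / (x + y) + y / (x + y)" using s by (simp add: add_divide_distrib[symmetric])
  also have "\<dots> \<le> (x / (x + y)) powr p + (y / (x + y)) powr p"
    using assms by (intro add_mono le) auto
  also have "\<dots> = (x powr p + y powr p) / (x + y) powr p"
    using assms s by (simp add: powr_divide add_divide_distrib)
  finally show ?thesis using s by (simp add: field_simps)
qed (use assms in auto)

text \<open>Means over the first \<open>n\<close> generations are finite and satisfy such a recursion. Passing to the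
  limit first would be useless, as the equation for the limit is also solved by \<open>\<infinity>\<close>.\<close>

lemma bounded_of_affine_recursion:
  fixes e :: "nat \<Rightarrow> ennreal"
  assumes e0: "e 0 = 0" and rec: "\<And>n. e (Suc n) \<le> b + k * e n" and k: "k < 1" and b: "b < \<infinity>"
  shows "(SUP n. e n) < \<infinity>"
proof -
  obtain k' where k': "k = ennreal k'" "0 \<le> k'" "k' < 1"
    using k by (cases k) (auto simp: ennreal_less_one_iff)
  obtain b' where b': "b = ennreal b'" "0 \<le> b'" using b by (cases b) auto
  have "e n \<le> ennreal (b' / (1 - k'))" for n
  proof (induction n)
    case (Suc n)
    have "e (Suc n) \<le> b + k * e n" by (rule rec)
    also have "\<dots> \<le> b + k * ennreal (b' / (1 - k'))" using Suc by (intro add_left_mono mult_left_mono) auto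
    also have "\<dots> = ennreal (b' + k' * (b' / (1 - k')))"
      using k' b' by (simp add: ennreal_plus ennreal_mult del: times_divide_eq_right)
    also have "b' + k' * (b' / (1 - k')) = b' / (1 - k')" using k' by (simp add: field_simps)
    finally show ?case .
  qed (simp add: e0)
  then have "(SUP n. e n) \<le> ennreal (b' / (1 - k'))" by (rule SUP_least)
  then show ?thesis by (simp add: order.strict_trans1)
qed

text \<open>The marks and times of descendants do not depend on the mark of the root, so any value will do.\<close>

abbreviation dtotal :: "(real \<times> 's \<Rightarrow> ennreal) \<Rightarrow> enat \<Rightarrow> 's tree \<Rightarrow> ennreal"
  where "dtotal w n T \<equiv> dsum w n undefined T"

text \<open>The part of the setting that concerns the law of a single cascade.\<close>

locale cascade_law =
  fixes Q :: "'s::topological_space measure" and h :: "real \<Rightarrow> 's \<Rightarrow> real" and K :: "'s \<Rightarrow> 's tree measure"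
  assumes Q_prob: "prob_space Q"
    and Q_sets: "sets Q = sets borel"
    and h_measurable:
      "case_prod h \<in> borel_measurable (restrict_space (borel \<Otimes>\<^sub>M borel) ({0..} \<times> UNIV))"
    and kernel: "cascade_kernel h Q K"
    and subcritical: "kappa h Q < 1"
begin

sublocale Q: prob_space Q by (rule Q_prob)
sublocale lQ: pair_sigma_finite lborel Q ..

lemma sets_Q [measurable_cong]: "sets Q = sets borel" by (rule Q_sets)

abbreviation "\<mu> \<equiv> displ_measure h"
abbreviation "kap \<equiv> kappa_mark h"

lemma K_measurable: "K \<in> borel \<rightarrow>\<^sub>M prob_algebra tree_space"
  using kernel by (simp add: cascade_kernel_def)

lemma K_prob: "prob_space (K a)" and sets_K [simp, measurable_cong]: "sets (K a) = sets tree_space"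
  using measurable_space[OF K_measurable, of a] by (auto simp: space_prob_algebra)

lemma K_subprob [measurable]: "K \<in> borel \<rightarrow>\<^sub>M subprob_algebra tree_space"
  by (rule measurable_prob_algebraD[OF K_measurable])

lemma nn_integral_K_measurable [measurable]:
  "F \<in> borel_measurable tree_space \<Longrightarrow> (\<lambda>a. \<integral>\<^sup>+x. F x \<partial>K a) \<in> borel_measurable borel"
  by (rule measurable_compose[OF K_subprob nn_integral_measurable_subprob_algebra])

lemma integral_K_measurable [measurable]:
  fixes F :: "'s tree \<Rightarrow> 'b::{banach, second_countable_topology}"
  shows "F \<in> borel_measurable tree_space \<Longrightarrow> (\<lambda>a. \<integral>x. F x \<partial>K a) \<in> borel_measurable borel"
  by (rule measurable_compose[OF K_subprob integral_measurable_subprob_algebra])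

text \<open>The density of the displacement measure, measurable on the whole line although \<open>h\<close> is constrained
  only on the half-line.\<close>

definition rate :: "real \<Rightarrow> 's \<Rightarrow> ennreal"
  where "rate s a = ennreal (h s a) * indicator {0..} s"

lemma rate_measurable [measurable]: "(\<lambda>(s, a). rate s a) \<in> borel_measurable (borel \<Otimes>\<^sub>M borel)"
proof -
  have "(\<lambda>z. ennreal (case_prod h z)) \<in> borel_measurable (restrict_space (borel \<Otimes>\<^sub>M borel) ({0..} \<times>
      UNIV))"
    using h_measurable by measurable
  then have "(\<lambda>z. ennreal (case_prod h z) * indicator ({0..} \<times> UNIV) z)
      \<in> borel_measurable (borel \<Otimes>\<^sub>M borel)"
    by (subst (asm) borel_measurable_restrict_space_iff_ennreal) (auto simp: space_pair_measure)
  moreover have "(\<lambda>z. ennreal (case_prod h z) * indicator ({0..} \<times> UNIV) z) = (\<lambda>(s, a). rate s a)"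
    by (auto simp: fun_eq_iff rate_def split: split_indicator)
  ultimately show ?thesis by simp
qed

lemma rate_measurable1 [measurable]: "(\<lambda>s. rate s a) \<in> borel_measurable borel"
  using measurable_compose[OF _ rate_measurable, of "\<lambda>s. (s, a)" borel] by simp

lemma mu_density: "\<mu> a = density lborel (\<lambda>s. rate s a)"
  by (simp add: displ_measure_def rate_def)

lemma sets_mu [simp, measurable_cong]: "sets (\<mu> a) = sets borel"
  by (simp add: mu_density)

lemma space_displ [simp]: "space (\<mu> a) = UNIV"
  by (simp add: mu_density)

lemma emeasure_mu: "B \<in> sets borel \<Longrightarrow> emeasure (\<mu> a) B = (\<integral>\<^sup>+s. rate s a * indicator B s \<partial>lborel)"
  unfolding mu_density by (simp add: emeasure_density)

lemma emeasure_mu_UNIV: "emeasure (\<mu> a) UNIV = kap a"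
  unfolding kappa_mark_def by (simp add: emeasure_mu) (auto intro!: nn_integral_cong simp: rate_def
      split: split_indicator)

lemma nn_integral_mu_measurable [measurable]:
  assumes [measurable]: "g \<in> borel_measurable borel"
  shows "(\<lambda>a. \<integral>\<^sup>+s. g s \<partial>\<mu> a) \<in> borel_measurable borel"
proof -
  have "(\<lambda>(a, s). rate s a * g s) \<in> borel_measurable (borel \<Otimes>\<^sub>M lborel)"
    using measurable_compose[OF _ rate_measurable, of "\<lambda>(a, s). (s, a)" "borel \<Otimes>\<^sub>M lborel"]
    by (simp add: split_beta')
  then have "(\<lambda>a. \<integral>\<^sup>+s. rate s a * g s \<partial>lborel) \<in> borel_measurable borel"
    by (rule lborel.borel_measurable_nn_integral)
  then show ?thesis unfolding mu_density by (simp add: nn_integral_density)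
qed

lemma kap_measurable [measurable]: "kap \<in> borel_measurable borel"
proof -
  have "(\<lambda>a. \<integral>\<^sup>+s. 1 \<partial>\<mu> a) \<in> borel_measurable borel" by (rule nn_integral_mu_measurable) simp
  then have "(\<lambda>a. kap a) \<in> borel_measurable borel" by (simp add: emeasure_mu_UNIV)
  then show ?thesis by simp
qed

lemma kap_finite: "AE a in Q. kap a < \<infinity>"
proof -
  have "(\<integral>\<^sup>+a. kap a \<partial>Q) \<noteq> \<infinity>"
    using subcritical unfolding kappa_def by (auto simp: top_unique)
  then have "AE a in Q. kap a \<noteq> \<infinity>" by (intro nn_integral_PInf_AE) auto
  then show ?thesis by (simp add: less_top)
qed

text \<open>The children of the root and their cascades.\<close>

lemma marked_points_K:
  assumes "kap a < \<infinity>"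
  shows "marked_points (K a) offspring_space (\<lambda>T. T []) children snd tree_space subtree K (\<mu> a) Q"
proof -
  interpret P: prob_space "K a" by (rule K_prob)
  interpret finite_measure "\<mu> a"
    by (rule finite_measureI) (use assms in \<open>simp add: mu_density emeasure_mu_UNIV[unfolded mu_density]\<close>)
  show ?thesis
  proof
    show "{w \<in> space offspring_space. i \<in> children w} \<in> sets offspring_space" for i by measurable
    show "poisson_process (K a) (\<lambda>\<omega>. dirac_sum (children (\<omega> [])) (snd (\<omega> []))) (\<mu> a \<Otimes>\<^sub>M Q)"
      using kernel by (simp add: cascade_kernel_def)
    show "indep_given (K a) offspring_space (\<lambda>T. T []) children tree_space subtree (\<lambda>w i. K (snd
        (snd w i)))"
      using kernel by (simp add: cascade_kernel_def)
    show "K \<in> borel \<rightarrow>\<^sub>M prob_algebra tree_space" by (rule K_measurable)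
  qed (auto simp: Q_sets)
qed

lemma children_sum_measurable:
  assumes "\<And>l. f l \<in> borel_measurable tree_space"
  shows "(\<lambda>T. \<integral>\<^sup>+l. f l T \<partial>count_space (children (T []))) \<in> borel_measurable tree_space"
proof -
  have [measurable]: "Measurable.pred (tree_space :: 's tree measure) (\<lambda>T. l \<in> children (T []))" for l
    by (rule measurable_compose[OF tree_component_measurable children_measurable])
  note [measurable] = assms
  have "(\<lambda>T. \<integral>\<^sup>+l. f l T * indicator (children (T [])) l \<partial>count_space UNIV) \<in> borel_measurable tree_space"
    by (rule nn_integral_countable_measurable) (auto simp: indicator_def, measurable)
  then show ?thesis by (simp add: nn_integral_count_space_indicator)
qed

text \<open>The root mark is averaged over \<open>Q\<close>, so that the offspring of a child can be described by the same
  quantity. The contribution of the root itself is left out.\<close>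

definition mean_total :: "(real \<times> 's \<Rightarrow> ennreal) \<Rightarrow> enat \<Rightarrow> ennreal"
  where "mean_total w n = (\<integral>\<^sup>+a. \<integral>\<^sup>+T. dtotal w n T \<partial>K a \<partial>Q)"

lemma mean_total_SUP:
  assumes [measurable]: "w \<in> borel_measurable (borel \<Otimes>\<^sub>M borel)"
  shows "mean_total w \<infinity> = (SUP n::nat. mean_total w (enat n))"
proof -
  have inc: "incseq (\<lambda>n T. dtotal w (enat n) T)"
    unfolding dsum_indicator
    by (auto simp: incseq_def le_fun_def descendants_def intro!: nn_integral_mono split: split_indicator)
  have 1: "(\<integral>\<^sup>+T. dtotal w \<infinity> T \<partial>K a) = (SUP n::nat. \<integral>\<^sup>+T. dtotal w (enat n) T \<partial>K a)" for a
    unfolding dsum_SUP by (rule nn_integral_monotone_convergence_SUP[OF inc]) simp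
  show ?thesis
    unfolding mean_total_def 1
    by (rule nn_integral_monotone_convergence_SUP)
       (use inc in \<open>auto simp: incseq_def le_fun_def intro!: nn_integral_mono\<close>)
qed

text \<open>Campbell's formula for the first generation.\<close>

lemma nn_integral_children:
  assumes "kap a < \<infinity>" and [measurable]: "g \<in> borel_measurable (borel \<Otimes>\<^sub>M borel)" "G
      \<in> borel_measurable tree_space"
  shows "(\<integral>\<^sup>+T. \<integral>\<^sup>+l. g (snd (T []) l) * G (subtree l T) \<partial>count_space (children (T [])) \<partial>K a)
    = (\<integral>\<^sup>+s. \<integral>\<^sup>+b. g (s, b) * (\<integral>\<^sup>+T. G T \<partial>K b) \<partial>Q \<partial>\<mu> a)"
proof -
  interpret P: marked_points "K a" offspring_space "\<lambda>T. T []" children snd tree_space subtree K "\<mu> a" Q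
    by (rule marked_points_K) fact
  have "(\<integral>\<^sup>+T. \<integral>\<^sup>+l. g (snd (T []) l) * G (subtree l T) \<partial>count_space (children (T [])) \<partial>K a)
    = (\<integral>\<^sup>+z. g z * (\<integral>\<^sup>+T. G T \<partial>K (snd z)) \<partial>(\<mu> a \<Otimes>\<^sub>M Q))"
    by (rule P.campbell) measurable
  also have "\<dots> = (\<integral>\<^sup>+s. \<integral>\<^sup>+b. g (s, b) * (\<integral>\<^sup>+T. G T \<partial>K (snd (s, b))) \<partial>Q \<partial>\<mu> a)"
    by (rule Q.nn_integral_fst[symmetric]) measurable
  finally show ?thesis by simp
qed

lemma emeasure_K_space [simp]: "emeasure (K a) (space (K a)) = 1"
  by (rule prob_space.emeasure_space_1[OF K_prob])

lemma mean_marks_rec_K: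
  assumes kap: "kap a < \<infinity>" and v [measurable]: "v \<in> borel_measurable borel"
  shows "(\<integral>\<^sup>+T. dtotal (\<lambda>z. v (snd z)) (eSuc n) T \<partial>K a)
    = kap a * ((\<integral>\<^sup>+b. v b \<partial>Q) + mean_total (\<lambda>z. v (snd z)) n)"
proof -
  let ?d = "dtotal (\<lambda>z. v (snd z)) n"
  have m1: "(\<lambda>T. v (snd (snd (T []) l)) * 1) \<in> borel_measurable tree_space" for l
  proof -
    have "(\<lambda>T. snd (T []) l) \<in> tree_space \<rightarrow>\<^sub>M borel \<Otimes>\<^sub>M borel"
      by (rule measurable_compose[OF tree_component_measurable offspring_point_measurable])
    from measurable_compose[OF measurable_compose[OF this measurable_snd] v]
    show ?thesis by simp
  qed
  have m2: "(\<lambda>T. 1 * ?d (subtree l T)) \<in> borel_measurable tree_space" for l by simp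
  have "(\<integral>\<^sup>+T. dtotal (\<lambda>z. v (snd z)) (eSuc n) T \<partial>K a)
      = (\<integral>\<^sup>+T. (\<integral>\<^sup>+l. v (snd (snd (T []) l)) * 1 \<partial>count_space (children (T [])))
        + (\<integral>\<^sup>+l. 1 * ?d (subtree l T) \<partial>count_space (children (T []))) \<partial>K a)"
    unfolding dsum_mark_rec by (simp add: nn_integral_add)
  also have "\<dots> = (\<integral>\<^sup>+T. (\<integral>\<^sup>+l. v (snd (snd (T []) l)) * 1 \<partial>count_space (children (T []))) \<partial>K a)
      + (\<integral>\<^sup>+T. (\<integral>\<^sup>+l. 1 * ?d (subtree l T) \<partial>count_space (children (T []))) \<partial>K a)"
    by (intro nn_integral_add) (simp_all only: measurable_cong_sets[OF sets_K refl]
        children_sum_measurable[OF m1] children_sum_measurable[OF m2])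
  also have "(\<integral>\<^sup>+T. (\<integral>\<^sup>+l. v (snd (snd (T []) l)) * 1 \<partial>count_space (children (T []))) \<partial>K a)
      = (\<integral>\<^sup>+s. \<integral>\<^sup>+b. v b \<partial>Q \<partial>\<mu> a)"
    using nn_integral_children[OF kap, of "\<lambda>z. v (snd z)" "\<lambda>_. 1"] by simp
  also have "(\<integral>\<^sup>+T. (\<integral>\<^sup>+l. 1 * ?d (subtree l T) \<partial>count_space (children (T []))) \<partial>K a)
      = (\<integral>\<^sup>+s. mean_total (\<lambda>z. v (snd z)) n \<partial>\<mu> a)"
    using nn_integral_children[OF kap, of "\<lambda>_. 1" ?d] by (simp add: mean_total_def)
  finally show ?thesis by (simp add: emeasure_mu_UNIV distrib_left mult.commute)
qed

lemma mean_marks_rec: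
  assumes v [measurable]: "v \<in> borel_measurable borel"
  shows "mean_total (\<lambda>z. v (snd z)) (eSuc n) = kappa h Q * ((\<integral>\<^sup>+b. v b \<partial>Q)
      + mean_total (\<lambda>z. v (snd z)) n)"
proof -
  have "mean_total (\<lambda>z. v (snd z)) (eSuc n)
      = (\<integral>\<^sup>+a. kap a * ((\<integral>\<^sup>+b. v b \<partial>Q) + mean_total (\<lambda>z. v (snd z)) n) \<partial>Q)"
    unfolding mean_total_def[of _ "eSuc n"]
    by (rule nn_integral_cong_AE) (use kap_finite in eventually_elim, rule mean_marks_rec_K[OF _ v])
  then show ?thesis unfolding kappa_def by (simp add: nn_integral_multc)
qed

lemma mean_total_0 [simp]: "mean_total w 0 = 0"
  by (simp add: mean_total_def)

lemma mean_marks_finite: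
  assumes v [measurable]: "v \<in> borel_measurable borel" and fin: "(\<integral>\<^sup>+b. v b \<partial>Q) < \<infinity>"
  shows "mean_total (\<lambda>z. v (snd z)) \<infinity> < \<infinity>"
proof -
  have "(SUP n. mean_total (\<lambda>z. v (snd z)) (enat n)) < \<infinity>"
  proof (rule bounded_of_affine_recursion[where k="kappa h Q"])
    show "mean_total (\<lambda>z. v (snd z)) (enat (Suc n))
        \<le> kappa h Q * (\<integral>\<^sup>+b. v b \<partial>Q) + kappa h Q * mean_total (\<lambda>z. v (snd z)) (enat n)" for n
      unfolding eSuc_enat[symmetric] mean_marks_rec[OF v] by (simp add: distrib_left)
    show "kappa h Q * (\<integral>\<^sup>+b. v b \<partial>Q) < \<infinity>"
      using subcritical fin by (auto simp: ennreal_mult_eq_top_iff less_top[symmetric])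
  qed (use subcritical in \<open>auto simp: zero_enat_def[symmetric]\<close>)
  then show ?thesis by (subst mean_total_SUP) auto
qed

text \<open>The truncation at zero keeps the subadditivity valid for all real times, before it is known that
  times are nonnegative.\<close>

definition timew :: "real \<Rightarrow> real \<Rightarrow> ennreal"
  where "timew p s = ennreal (max 0 s powr p)"

lemma timew_measurable [measurable]: "timew p \<in> borel_measurable borel"
  unfolding timew_def by measurable

lemma timew_add: "0 < p \<Longrightarrow> p \<le> 1 \<Longrightarrow> timew p (s + t) \<le> timew p s + timew p t"
proof -
  assume p: "0 < p" "p \<le> 1"
  have "max 0 (s + t) powr p \<le> (max 0 s + max 0 t) powr p"
    using p by (intro powr_mono2) auto
  also have "\<dots> \<le> max 0 s powr p + max 0 t powr p"
    using p by (intro powr_subadditive) auto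
  finally show ?thesis by (simp add: timew_def ennreal_plus[symmetric] ennreal_leI del: ennreal_plus)
qed

text \<open>The delay of a descendant of child \<open>l\<close> is the displacement of \<open>l\<close> plus its delay after the birth
  of \<open>l\<close>. For \<open>p \<le> 1\<close> the \<open>p\<close>-th power of the sum is at most the sum of the powers; the first of
  these multiplies the untimed sum of the subtree, the second leads back to the same quantity.\<close>

lemma mean_timed_rec:
  assumes p: "0 < p" "p \<le> 1" and v [measurable]: "v \<in> borel_measurable borel"
  shows "mean_total (\<lambda>z. timew p (fst z) * v (snd z)) (eSuc n)
    \<le> (\<integral>\<^sup>+a. \<integral>\<^sup>+s. timew p s \<partial>\<mu> a \<partial>Q) * ((\<integral>\<^sup>+b. v b \<partial>Q) + mean_total (\<lambda>z. v (snd z)) n)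
      + kappa h Q * mean_total (\<lambda>z. timew p (fst z) * v (snd z)) n"
proof -
  let ?w = "\<lambda>z. timew p (fst z) * v (snd z)"
  let ?d = "dtotal (\<lambda>z. v (snd z)) n"
  let ?dw = "dtotal ?w n"
  have P: "(\<lambda>T. snd (T []) l) \<in> tree_space \<rightarrow>\<^sub>M (borel \<Otimes>\<^sub>M borel :: (real \<times> 's) measure)" for l
    by (rule measurable_compose[OF tree_component_measurable offspring_point_measurable])
  note [measurable] = measurable_compose[OF P measurable_fst] measurable_compose[OF P measurable_snd]
  have m1: "(\<lambda>T. ?w (snd (T []) l) * 1) \<in> borel_measurable tree_space" for l by measurable
  have m2: "(\<lambda>T. timew p (fst (snd (T []) l)) * ?d (subtree l T)) \<in> borel_measurable tree_space"
      for l by measurable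
  have m3: "(\<lambda>T. 1 * ?dw (subtree l T)) \<in> borel_measurable tree_space" for l by measurable
  let ?b = "(\<integral>\<^sup>+b. v b \<partial>Q)"
  have K: "(\<integral>\<^sup>+T. dtotal ?w (eSuc n) T \<partial>K a)
      \<le> (\<integral>\<^sup>+s. timew p s \<partial>\<mu> a) * (?b + mean_total (\<lambda>z. v (snd z)) n) + kap a * mean_total ?w n"
    if kap: "kap a < \<infinity>" for a
  proof -
    have pt: "dtotal ?w (eSuc n) T \<le> ((\<integral>\<^sup>+l. ?w (snd (T []) l) * 1 \<partial>count_space (children (T [])))
        + (\<integral>\<^sup>+l. timew p (fst (snd (T []) l)) * ?d (subtree l T) \<partial>count_space (children (T []))))
        + (\<integral>\<^sup>+l. 1 * ?dw (subtree l T) \<partial>count_space (children (T [])))" for T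
    proof -
      have le: "dsum (\<lambda>z. ?w (shift t z)) n b T' \<le> timew p t * ?d T' + ?dw T'" for t b T'
      proof -
        have "dsum (\<lambda>z. ?w (shift t z)) n b T' = dtotal (\<lambda>z. ?w (shift t z)) n T'" by (rule dsum_indep)
        also have "\<dots> \<le> dtotal (\<lambda>z. timew p t * v (snd z) + ?w z) n T'"
          using timew_add[OF p] by (intro dsum_mono) (auto simp: shift_def distrib_right[symmetric]
              intro!: mult_right_mono)
        also have "\<dots> = timew p t * ?d T' + ?dw T'" by (simp add: dsum_add dsum_cmult)
        finally show ?thesis .
      qed
      have "dtotal ?w (eSuc n) T \<le> (\<integral>\<^sup>+l. (?w (snd (T []) l) * 1 + timew p (fst (snd (T []) l))
          * ?d (subtree l T))
          + 1 * ?dw (subtree l T) \<partial>count_space (children (T [])))"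
        unfolding dsum_rec using le by (intro nn_integral_mono) (simp add: add.assoc add_left_mono)
      also have "\<dots> = ((\<integral>\<^sup>+l. ?w (snd (T []) l) * 1 \<partial>count_space (children (T [])))
        + (\<integral>\<^sup>+l. timew p (fst (snd (T []) l)) * ?d (subtree l T) \<partial>count_space (children (T []))))
        + (\<integral>\<^sup>+l. 1 * ?dw (subtree l T) \<partial>count_space (children (T [])))"
        by (subst nn_integral_add, simp, simp, subst nn_integral_add) simp_all
      finally show ?thesis .
    qed
    have "(\<integral>\<^sup>+T. dtotal ?w (eSuc n) T \<partial>K a) \<le> (\<integral>\<^sup>+T. ((\<integral>\<^sup>+l. ?w (snd (T []) l)
        * 1 \<partial>count_space (children (T [])))
        + (\<integral>\<^sup>+l. timew p (fst (snd (T []) l)) * ?d (subtree l T) \<partial>count_space (children (T []))))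
        + (\<integral>\<^sup>+l. 1 * ?dw (subtree l T) \<partial>count_space (children (T []))) \<partial>K a)"
      by (rule nn_integral_mono) (rule pt)
    also have "\<dots> = ((\<integral>\<^sup>+T. (\<integral>\<^sup>+l. ?w (snd (T []) l) * 1 \<partial>count_space (children (T []))) \<partial>K a)
        + (\<integral>\<^sup>+T. (\<integral>\<^sup>+l. timew p (fst (snd (T []) l)) * ?d (subtree l T) \<partial>count_space (children (T
            []))) \<partial>K a))
        + (\<integral>\<^sup>+T. (\<integral>\<^sup>+l. 1 * ?dw (subtree l T) \<partial>count_space (children (T []))) \<partial>K a)"
      using children_sum_measurable[OF m1] children_sum_measurable[OF m2] children_sum_measurable[OF m3]
      by (subst nn_integral_add, simp only: measurable_cong_sets[OF sets_K refl] borel_measurable_add,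
          simp only: measurable_cong_sets[OF sets_K refl], subst nn_integral_add)
         (simp_all only: measurable_cong_sets[OF sets_K refl])
    also have "(\<integral>\<^sup>+T. (\<integral>\<^sup>+l. ?w (snd (T []) l) * 1 \<partial>count_space (children (T []))) \<partial>K a)
        = (\<integral>\<^sup>+s. timew p s \<partial>\<mu> a) * ?b"
      using nn_integral_children[OF kap, of ?w "\<lambda>_. 1"] by (simp add: nn_integral_cmult nn_integral_multc)
    also have "(\<integral>\<^sup>+T. (\<integral>\<^sup>+l. timew p (fst (snd (T []) l))
        * ?d (subtree l T) \<partial>count_space (children (T []))) \<partial>K a)
        = (\<integral>\<^sup>+s. timew p s \<partial>\<mu> a) * mean_total (\<lambda>z. v (snd z)) n"
      using nn_integral_children[OF kap, of "\<lambda>z. timew p (fst z)" ?d]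
      by (simp add: nn_integral_cmult nn_integral_multc mean_total_def)
    also have "(\<integral>\<^sup>+T. (\<integral>\<^sup>+l. 1 * ?dw (subtree l T) \<partial>count_space (children (T []))) \<partial>K a) = kap a
        * mean_total ?w n"
      using nn_integral_children[OF kap, of "\<lambda>_. 1" ?dw]
          by (simp add: mean_total_def emeasure_mu_UNIV mult.commute)
    finally show ?thesis by (simp add: distrib_left)
  qed
  have "mean_total ?w (eSuc n) \<le> (\<integral>\<^sup>+a. (\<integral>\<^sup>+s. timew p s \<partial>\<mu> a) * (?b + mean_total (\<lambda>z. v (snd z)) n)
      + kap a * mean_total ?w n \<partial>Q)"
    unfolding mean_total_def[of _ "eSuc n"]
    by (rule nn_integral_mono_AE) (use kap_finite in eventually_elim, rule K)
  also have "\<dots> = (\<integral>\<^sup>+a. \<integral>\<^sup>+s. timew p s \<partial>\<mu> a \<partial>Q) * (?b + mean_total (\<lambda>z. v (snd z)) n) + kappa h Q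
      * mean_total ?w n"
    unfolding kappa_def by (simp add: nn_integral_add nn_integral_multc)
  finally show ?thesis .
qed

lemma mean_timed_finite:
  assumes p: "0 < p" "p \<le> 1" and v [measurable]: "v \<in> borel_measurable borel"
    and fin: "(\<integral>\<^sup>+b. v b \<partial>Q) < \<infinity>" and mom: "(\<integral>\<^sup>+a. \<integral>\<^sup>+s. timew p s \<partial>\<mu> a \<partial>Q) < \<infinity>"
  shows "mean_total (\<lambda>z. timew p (fst z) * v (snd z)) \<infinity> < \<infinity>"
proof -
  let ?w = "\<lambda>z. timew p (fst z) * v (snd z)"
  have "(SUP n. mean_total ?w (enat n)) < \<infinity>"
  proof (rule bounded_of_affine_recursion[where k="kappa h Q"])
    fix n
    have "mean_total (\<lambda>z. v (snd z)) (enat n) \<le> mean_total (\<lambda>z. v (snd z)) \<infinity>"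
      by (subst mean_total_SUP) (auto intro: SUP_upper)
    then show "mean_total ?w (enat (Suc n)) \<le> (\<integral>\<^sup>+a. \<integral>\<^sup>+s. timew p s \<partial>\<mu> a \<partial>Q) *
        ((\<integral>\<^sup>+b. v b \<partial>Q) + mean_total (\<lambda>z. v (snd z)) \<infinity>) + kappa h Q * mean_total ?w (enat n)"
      unfolding eSuc_enat[symmetric]
      by (intro order_trans[OF mean_timed_rec[OF p v]] add_right_mono mult_left_mono add_left_mono) auto
    show "(\<integral>\<^sup>+a. \<integral>\<^sup>+s. timew p s \<partial>\<mu> a \<partial>Q) * ((\<integral>\<^sup>+b. v b \<partial>Q) + mean_total (\<lambda>z. v (snd z)) \<infinity>) < \<infinity>"
      using fin mom mean_marks_finite[OF v fin] by (auto simp: ennreal_mult_eq_top_iff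
          less_top[symmetric])
  qed (use subcritical in \<open>auto simp: zero_enat_def[symmetric]\<close>)
  then show ?thesis by (subst mean_total_SUP) auto
qed

lemma AE_K_finite:
  assumes [measurable]: "w \<in> borel_measurable (borel \<Otimes>\<^sub>M borel)" and "mean_total w \<infinity> < \<infinity>"
  shows "AE a in Q. AE T in K a. dtotal w \<infinity> T < \<infinity>"
proof -
  have "AE a in Q. (\<integral>\<^sup>+T. dtotal w \<infinity> T \<partial>K a) \<noteq> \<infinity>"
    using assms(2) unfolding mean_total_def by (intro nn_integral_PInf_AE) auto
  then show ?thesis
  proof eventually_elim
    case (elim a)
    have "AE T in K a. dtotal w \<infinity> T \<noteq> \<infinity>" using elim by (intro nn_integral_PInf_AE) auto
    then show ?case by (simp add: less_top)
  qed
qed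

lemma descendants_finite_iff: "finite (descendants \<infinity> T) \<longleftrightarrow> dtotal (\<lambda>_. 1) \<infinity> T < \<infinity>"
  by (simp add: dsum_def emeasure_count_space less_top[symmetric])

lemma finite_descendants_measurable: "Measurable.pred (tree_space :: 's tree measure) (\<lambda>T. finite
    (descendants \<infinity> T))"
  unfolding descendants_finite_iff by measurable

text \<open>A subcritical cascade has finite mean size.\<close>

lemma AE_K_finite_descendants: "AE a in Q. AE T in K a. finite (descendants \<infinity> T)"
  unfolding descendants_finite_iff
proof (rule AE_K_finite)
  show "mean_total (\<lambda>_. 1) \<infinity> < \<infinity>"
    using mean_marks_finite[of "\<lambda>_. 1"] Q.emeasure_space_1 by simp
qed simp

text \<open>Expressed by a sum that vanishes, so that measurability comes from that of descendant sums.\<close>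

definition nonneg_times :: "enat \<Rightarrow> 's tree \<Rightarrow> bool"
  where "nonneg_times n T \<longleftrightarrow> dtotal (\<lambda>z. indicator {..<0} (fst z)) n T = 0"

lemma nonneg_times_measurable [measurable]: "Measurable.pred tree_space (nonneg_times n)"
  unfolding nonneg_times_def by measurable

lemma nonneg_times_iff: "nonneg_times n T \<longleftrightarrow> (\<forall>u\<in>descendants n T. fst (point u undefined T) \<ge> 0)"
  unfolding nonneg_times_def dsum_def
  by (subst nn_integral_0_iff_AE) (auto simp: AE_count_space indicator_eq_0_iff not_less)

text \<open>Displacement measures live on the half-line, so this holds along every line of descent; the
  induction is on the generation.\<close>

lemma AE_K_nonneg_times_nat: "AE a in Q. AE T in K a. nonneg_times (enat n) T"
proof (induction n)
  case 0
  then show ?case by (simp add: nonneg_times_def zero_enat_def[symmetric])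
next
  case (Suc n)
  show ?case
    using kap_finite
  proof eventually_elim
    case (elim a)
    interpret P: marked_points "K a" offspring_space "\<lambda>T. T []" children snd tree_space subtree K "\<mu> a" Q
      by (rule marked_points_K) fact
    have 1: "AE T in K a. \<forall>l\<in>children (T []). fst (snd (T []) l) \<ge> 0"
    proof (rule P.AE_points)
      have "AE s in \<mu> a. s \<ge> 0"
        unfolding mu_density by (subst AE_density) (simp, auto simp: rate_def split: split_indicator_asm)
      then show "AE z in \<mu> a \<Otimes>\<^sub>M Q. fst z \<ge> 0"
        by (intro P.mQ.AE_pair_measure) (auto simp: space_pair_measure)
    qed
    have 2: "AE T in K a. \<forall>l\<in>children (T []). nonneg_times (enat n) (subtree l T)"
      by (rule P.AE_marks[OF _ Suc]) simp
    show ?case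
      using 1 2
    proof eventually_elim
      case (elim T)
      show ?case unfolding nonneg_times_iff
      proof
        fix u assume u: "u \<in> descendants (enat (Suc n)) T"
        then obtain l u' where u': "u = l # u'" by (auto simp: descendants_def neq_Nil_conv)
        have l: "l \<in> children (T [])" and al: "alive u' (subtree l T)" "length u' \<le> n"
          using u u' by (auto simp: descendants_def)
        have eq: "point u undefined T = shift (fst (snd (T []) l)) (point u' (snd (snd (T []) l))
            (subtree l T))"
          by (simp add: u' split_beta Let_def)
        have "fst (point u' (snd (snd (T []) l)) (subtree l T)) \<ge> 0"
        proof (cases "u' = []")
          case False
          then show ?thesis
            using elim(2) l al point_indep[OF False, of "snd (snd (T []) l)" "subtree l T" undefined]
            by (auto simp: nonneg_times_iff descendants_def)
        qed simp
        then show "fst (point u undefined T) \<ge> 0" unfolding eq using elim(1) l by (auto simp: shift_def)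
      qed
    qed
  qed
qed

lemma AE_K_nonneg_times: "AE a in Q. AE T in K a. nonneg_times \<infinity> T"
proof -
  have "AE a in Q. \<forall>n::nat. AE T in K a. nonneg_times (enat n) T"
    using AE_K_nonneg_times_nat by (simp add: AE_all_countable)
  then show ?thesis
  proof eventually_elim
    case (elim a)
    then have "AE T in K a. \<forall>n::nat. nonneg_times (enat n) T" by (simp add: AE_all_countable)
    then show ?case by eventually_elim (auto simp: nonneg_times_iff descendants_def)
  qed
qed

text \<open>The cluster total without the claim of the root.\<close>

definition desc :: "('s \<Rightarrow> real) \<Rightarrow> 's tree \<Rightarrow> real"
  where "desc f T = enn2real (dtotal (\<lambda>z. ennreal (f (snd z))) \<infinity> T)"

definition charK :: "('s \<Rightarrow> real) \<Rightarrow> 's \<Rightarrow> real \<Rightarrow> complex"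
  where "charK f a v = (\<integral>T. iexp (v * desc f T) \<partial>K a)"

text \<open>The characteristic function of the cluster total of a root with mark distributed as \<open>Q\<close>.\<close>

definition char_total :: "('s \<Rightarrow> real) \<Rightarrow> real \<Rightarrow> complex"
  where "char_total f v = (\<integral>a. iexp (v * f a) * charK f a v \<partial>Q)"

lemma desc_measurable [measurable]:
  assumes [measurable]: "f \<in> borel_measurable borel"
  shows "desc f \<in> borel_measurable tree_space"
  unfolding desc_def by measurable

lemma charK_measurable [measurable]:
  assumes [measurable]: "f \<in> borel_measurable borel"
  shows "(\<lambda>a. charK f a v) \<in> borel_measurable borel"
  unfolding charK_def by measurable

lemma charK_le_1: "norm (charK f a v) \<le> 1" if [measurable]: "f \<in> borel_measurable borel"
proof -
  interpret P: prob_space "K a" by (rule K_prob)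
  have "norm (charK f a v) \<le> (\<integral>T. norm (iexp (v * desc f T)) \<partial>K a)"
    unfolding charK_def by (rule integral_norm_bound)
  then show ?thesis using P.prob_space by simp
qed

lemma integrable_char_total:
  assumes [measurable]: "f \<in> borel_measurable borel"
  shows "integrable Q (\<lambda>a. iexp (v * f a) * charK f a v)"
  by (rule Q.integrable_const_bound[of _ 1]) (auto simp: norm_mult charK_le_1)

lemma char_total_le_1:
  assumes [measurable]: "f \<in> borel_measurable borel"
  shows "norm (char_total f v) \<le> 1"
proof -
  have "norm (char_total f v) \<le> (\<integral>a. norm (iexp (v * f a) * charK f a v) \<partial>Q)"
    unfolding char_total_def by (rule integral_norm_bound)
  also have "\<dots> \<le> 1"
    by (rule Q.integral_le_const[OF integrable_norm[OF integrable_char_total]])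
       (auto simp: norm_mult charK_le_1)
  finally show ?thesis .
qed

lemma char_total_0: "char_total f 0 = 1"
proof -
  have "charK f a 0 = 1" for a
  proof -
    interpret P: prob_space "K a" by (rule K_prob)
    show ?thesis using P.prob_space by (simp add: charK_def)
  qed
  then show ?thesis using Q.prob_space by (simp add: char_total_def)
qed

lemma char_total_minus: "char_total f (- v) = cnj (char_total f v)"
proof -
  have "charK f a (- v) = cnj (charK f a v)" for a
  proof -
    have "cnj (charK f a v) = (\<integral>T. cnj (iexp (v * desc f T)) \<partial>K a)"
      unfolding charK_def by (rule Bochner_Integration.integral_cnj[symmetric])
    then show ?thesis by (simp add: charK_def exp_cnj)
  qed
  moreover have "cnj (char_total f v) = (\<integral>a. cnj (iexp (v * f a) * charK f a v) \<partial>Q)"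
    unfolding char_total_def by (rule Bochner_Integration.integral_cnj[symmetric])
  ultimately show ?thesis by (simp add: char_total_def exp_cnj)
qed

lemma char_total_isCont:
  assumes [measurable]: "f \<in> borel_measurable borel"
  shows "isCont (char_total f) v"
  unfolding continuous_at_sequentially
proof (intro allI impI)
  fix x assume x: "x \<longlonglongrightarrow> v"
  have inner: "(\<lambda>n. charK f a (x n)) \<longlonglongrightarrow> charK f a v" for a
  proof -
    interpret P: prob_space "K a" by (rule K_prob)
    show ?thesis unfolding charK_def
      by (rule integral_dominated_convergence[where w="\<lambda>_. 1"])
         (use x in \<open>auto intro!: AE_I2 tendsto_intros\<close>)
  qed
  show "(char_total f \<circ> x) \<longlonglongrightarrow> char_total f v"
    unfolding char_total_def comp_def
    by (rule integral_dominated_convergence[where w="\<lambda>_. 1"])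
       (use x inner in \<open>auto intro!: AE_I2 tendsto_intros simp: norm_mult charK_le_1\<close>)
qed

lemma dtotal_finite:
  assumes "finite (descendants \<infinity> T)" shows "dtotal (\<lambda>z. ennreal (f (snd z))) \<infinity> T < \<infinity>"
  using assms by (simp add: dsum_def nn_integral_count_space_finite less_top[symmetric])

lemma desc_rec:
  assumes f0: "\<And>a. f a \<ge> 0" and fin: "finite (children (T []))"
    and sub: "\<And>l. l \<in> children (T []) \<Longrightarrow> finite (descendants \<infinity> (subtree l T))"
  shows "desc f T = (\<Sum>l\<in>children (T []). f (snd (snd (T []) l)) + desc f (subtree l T))"
proof -
  let ?w = "\<lambda>z. ennreal (f (snd z))"
  have "dtotal ?w \<infinity> T = (\<integral>\<^sup>+l. ennreal (f (snd (snd (T []) l)))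
      + dtotal ?w \<infinity> (subtree l T) \<partial>count_space (children (T [])))"
    using dsum_mark_rec[of "\<lambda>b. ennreal (f b)" \<infinity> undefined T] by simp
  also have "\<dots> = (\<Sum>l\<in>children (T []). ennreal (f (snd (snd (T []) l))) + dtotal ?w \<infinity> (subtree l T))"
    using fin by (simp add: nn_integral_count_space_finite)
  also have "\<dots> = (\<Sum>l\<in>children (T []). ennreal (f (snd (snd (T []) l)) + desc f (subtree l T)))"
  proof (rule sum.cong[OF refl])
    fix l assume "l \<in> children (T [])"
    then have "ennreal (desc f (subtree l T)) = dtotal ?w \<infinity> (subtree l T)"
      unfolding desc_def using dtotal_finite[OF sub] by simp
    then show "ennreal (f (snd (snd (T []) l))) + dtotal ?w \<infinity> (subtree l T)
        = ennreal (f (snd (snd (T []) l)) + desc f (subtree l T))"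
      by (simp add: ennreal_plus[OF f0] desc_def)
  qed
  also have "\<dots> = ennreal (\<Sum>l\<in>children (T []). f (snd (snd (T []) l)) + desc f (subtree l T))"
    by (rule sum_ennreal) (auto simp: f0 desc_def intro!: add_nonneg_nonneg)
  finally have e: "dtotal ?w \<infinity> T = ennreal (\<Sum>l\<in>children (T []). f (snd (snd (T []) l))
      + desc f (subtree l T))" .
  show ?thesis unfolding desc_def[of f T] e
    by (rule enn2real_ennreal) (auto simp: f0 desc_def intro!: sum_nonneg add_nonneg_nonneg)
qed

text \<open>The total of the descendants is the sum over the children of their own claim and the total of their
  descendants. The characteristic functional of the first generation evaluates its characteristic
  function, and only the mass of the displacement measure remains of the displacements.\<close>

lemma charK_eq:
  assumes [measurable]: "f \<in> borel_measurable borel" and f0: "\<And>a. f a \<ge> 0" and kap: "kap a < \<infinity>"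
  shows "charK f a v = exp (- (enn2real (kap a) * (1 - char_total f v)))"
proof -
  interpret P: marked_points "K a" offspring_space "\<lambda>T. T []" children snd tree_space subtree K "\<mu> a" Q
    by (rule marked_points_K) fact
  interpret mu: finite_measure "\<mu> a"
    by (rule finite_measureI) (use kap in \<open>simp add: emeasure_mu_UNIV\<close>)
  interpret muQ: finite_measure "\<mu> a \<Otimes>\<^sub>M Q" by (rule finite_measure_pair_measure) unfold_locales
  let ?g = "\<lambda>z. iexp (v * f (snd z))" and ?F = "\<lambda>T. iexp (v * desc f T)"
  have mUNIV: "emeasure (\<mu> a) UNIV < \<infinity>" using kap by (simp add: emeasure_mu_UNIV)
  have A1: "AE T in K a. finite (P.pts UNIV (T []))"
    by (rule P.AE_pts_finite) (use mUNIV in auto)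
  have "charK f a v = (\<integral>T. (\<Prod>l\<in>P.pts UNIV (T []). ?g (snd (T []) l) * ?F (subtree l T)) \<partial>K a)"
    unfolding charK_def
  proof (rule integral_cong_AE)
    show "(\<lambda>T. \<Prod>l\<in>P.pts UNIV (T []). ?g (snd (T []) l) * ?F (subtree l T)) \<in> borel_measurable (K a)"
    proof (rule P.prod_pts_measurable)
      fix i
      have "(\<lambda>T. snd (T []) i) \<in> tree_space \<rightarrow>\<^sub>M (borel \<Otimes>\<^sub>M borel :: (real \<times> 's) measure)"
        by (rule measurable_compose[OF tree_component_measurable offspring_point_measurable])
      note [measurable] = measurable_compose[OF this measurable_snd]
      show "(\<lambda>T. ?g (snd (T []) i) * ?F (subtree i T)) \<in> borel_measurable (K a)" by measurable
    qed simp
    show "AE T in K a. ?F T = (\<Prod>l\<in>P.pts UNIV (T []). ?g (snd (T []) l) * ?F (subtree l T))"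
      using A1 P.AE_marks[OF finite_descendants_measurable AE_K_finite_descendants]
    proof eventually_elim
      case (elim T)
      then have fin: "finite (children (T []))" by simp
      have d: "desc f T = (\<Sum>l\<in>children (T []). f (snd (snd (T []) l)) + desc f (subtree l T))"
        by (rule desc_rec[of f T, OF f0]) (use fin elim(2) in auto)
      have "?F T = exp (\<Sum>l\<in>children (T []). \<i> * (v * f (snd (snd (T []) l))) + \<i> * (v
          * desc f (subtree l T)))"
        unfolding d
        by (simp add: sum_distrib_left distrib_left)
      also have "\<dots> = (\<Prod>l\<in>children (T []). ?g (snd (T []) l) * ?F (subtree l T))"
        using fin by (simp add: exp_sum exp_add)
      finally show ?case by simp
    qed
  qed measurable
  also have "\<dots> = exp (\<integral>z. indicator (UNIV \<times> UNIV) z *\<^sub>R (?g z * (\<integral>T. ?F T \<partial>K (snd z)) - 1) \<partial>(\<mu> a \<Otimes>\<^sub>M Q))"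
    by (rule P.gf_marked_points) (use mUNIV in auto)
  also have "(\<integral>z. indicator (UNIV \<times> UNIV) z *\<^sub>R (?g z * (\<integral>T. ?F T \<partial>K (snd z)) - 1) \<partial>(\<mu> a \<Otimes>\<^sub>M Q))
      = (\<integral>z. ?g z * charK f (snd z) v - 1 \<partial>(\<mu> a \<Otimes>\<^sub>M Q))"
    by (simp add: charK_def)
  also have "\<dots> = (\<integral>s. (\<integral>b. ?g (s, b) * charK f (snd (s, b)) v - 1 \<partial>Q) \<partial>\<mu> a)"
  proof (rule P.mQ.integral_fst'[symmetric])
    show "integrable (\<mu> a \<Otimes>\<^sub>M Q) (\<lambda>z. ?g z * charK f (snd z) v - 1)"
    proof (rule muQ.integrable_const_bound[of _ 2])
      show "AE z in \<mu> a \<Otimes>\<^sub>M Q. norm (?g z * charK f (snd z) v - 1) \<le> 2"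
      proof (rule AE_I2)
        fix z :: "real \<times> 's"
        have "norm (?g z * charK f (snd z) v) \<le> 1" by (simp add: norm_mult charK_le_1)
        then show "norm (?g z * charK f (snd z) v - 1) \<le> 2"
          using norm_triangle_ineq4[of "?g z * charK f (snd z) v" 1] by simp
      qed
    qed measurable
  qed
  also have "\<dots> = (\<integral>s. char_total f v - 1 \<partial>\<mu> a)"
    using integrable_char_total[of f v] Q.prob_space by (simp add: char_total_def)
  also have "\<dots> = - (enn2real (kap a) * (1 - char_total f v))"
    using kap by (simp add: measure_def emeasure_mu_UNIV scaleR_conv_of_real algebra_simps)
  finally show ?thesis .
qed

lemma char_total_fixpoint:
  assumes [measurable]: "f \<in> borel_measurable borel" and f0: "\<And>a. f a \<ge> 0"
  shows "char_total f v = (\<integral>a. iexp (v * f a) * exp (- (enn2real (kap a) * (1 - char_total f v))) \<partial>Q)"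
proof -
  have "char_total f v = (\<integral>a. iexp (v * f a) * charK f a v \<partial>Q)" by (rule char_total_def)
  also have "\<dots> = (\<integral>a. iexp (v * f a) * exp (- (enn2real (kap a) * (1 - char_total f v))) \<partial>Q)"
    by (rule integral_cong_AE) (use kap_finite in \<open>auto simp: charK_eq[OF assms] elim!: eventually_mono\<close>)
  finally show ?thesis .
qed

text \<open>Averaged over the marks, the displacement measures form a single finite measure whose tail is
  \<open>mean_tail\<close>.\<close>

lemma kap_moment_finite:
  assumes lim: "((\<lambda>t. ennreal (t powr q) * mean_tail h Q t) \<longlongrightarrow> 0) at_top" and p: "0 < p" "p < q"
  shows "(\<integral>\<^sup>+a. \<integral>\<^sup>+s. timew p s \<partial>\<mu> a \<partial>Q) < \<infinity>"
proof -
  define \<rho> where "\<rho> = density lborel (\<lambda>s. \<integral>\<^sup>+a. rate s a \<partial>Q)"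
  have [measurable]: "(\<lambda>s. \<integral>\<^sup>+a. rate s a \<partial>Q) \<in> borel_measurable borel"
    by (rule Q.borel_measurable_nn_integral) measurable
  have fub: "(\<integral>\<^sup>+a. \<integral>\<^sup>+s. g s \<partial>\<mu> a \<partial>Q) = (\<integral>\<^sup>+s. g s \<partial>\<rho>)" if [measurable]: "g
      \<in> borel_measurable borel" for g
  proof -
    have "(\<integral>\<^sup>+a. \<integral>\<^sup>+s. g s \<partial>\<mu> a \<partial>Q) = (\<integral>\<^sup>+a. \<integral>\<^sup>+s. rate s a * g s \<partial>lborel \<partial>Q)"
      unfolding mu_density by (simp add: nn_integral_density)
    also have "\<dots> = (\<integral>\<^sup>+s. \<integral>\<^sup>+a. rate s a * g s \<partial>Q \<partial>lborel)"
      by (rule lQ.Fubini') measurable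
    also have "\<dots> = (\<integral>\<^sup>+s. g s \<partial>\<rho>)"
      unfolding \<rho>_def by (simp add: nn_integral_density nn_integral_multc)
    finally show ?thesis .
  qed
  have tail: "emeasure \<rho> {t<..} = mean_tail h Q t" for t
    using fub[of "indicator {t<..}"] by (simp add: mean_tail_def \<rho>_def)
  have "emeasure \<rho> (space \<rho>) = kappa h Q"
    using fub[of "\<lambda>_. 1"] by (simp add: kappa_def emeasure_mu_UNIV \<rho>_def)
  then have fin: "finite_measure \<rho>"
    using subcritical by (intro finite_measureI) auto
  have "eventually (\<lambda>t. ennreal (t powr q) * mean_tail h Q t < 1) at_top"
    by (rule order_tendstoD(2)[OF lim]) simp
  then have "eventually (\<lambda>t. t > 0 \<and> ennreal (t powr q) * mean_tail h Q t < 1) at_top"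
    using eventually_gt_at_top[of 0] by eventually_elim auto
  then obtain T where T: "\<And>t. t \<ge> T \<Longrightarrow> t > 0 \<and> ennreal (t powr q) * mean_tail h Q t < 1"
    by (auto simp: eventually_at_top_linorder)
  have "(\<integral>\<^sup>+s. ennreal (s powr p) * indicator {s. s \<ge> 0} s \<partial>\<rho>) < \<infinity>"
  proof (rule moment_finite_of_tail[OF fin _ p])
    show "T > 0" using T[of T] by simp
    fix t assume t: "t \<ge> T"
    have "mean_tail h Q t = ennreal (t powr (-q)) * (ennreal (t powr q) * mean_tail h Q t)"
      using T[OF t] by (simp add: mult.assoc[symmetric] ennreal_mult[symmetric] powr_add[symmetric]
          del: ennreal_mult)
    also have "\<dots> \<le> ennreal (t powr (-q)) * 1"
      using T[OF t] by (intro mult_left_mono) auto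
    finally show "emeasure \<rho> {\<omega> \<in> space \<rho>. t < \<omega>} \<le> ennreal (1 * t powr - q)"
      using tail[of t] by (simp add: \<rho>_def greaterThan_def)
  qed (simp add: \<rho>_def)
  moreover have "(\<integral>\<^sup>+s. timew p s \<partial>\<rho>) = (\<integral>\<^sup>+s. ennreal (s powr p) * indicator {s. s \<ge> 0} s \<partial>\<rho>)"
    using p by (intro nn_integral_cong) (auto simp: timew_def max_def split: split_indicator)
  ultimately show ?thesis by (subst fub) auto
qed

end

section \<open>The marked Hawkes process\<close>

lemma powr_sum_le:
  fixes x :: "'i \<Rightarrow> real"
  assumes \<gamma>: "0 < \<gamma>" "\<gamma> \<le> 1" and x: "\<And>i. x i \<ge> 0"
  shows "(\<Sum>i\<in>A. x i) powr \<gamma> \<le> (\<Sum>i\<in>A. x i powr \<gamma>)"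
proof (induction A rule: infinite_finite_induct)
  case (insert i A)
  have "(\<Sum>i\<in>insert i A. x i) powr \<gamma> \<le> x i powr \<gamma> + (\<Sum>i\<in>A. x i) powr \<gamma>"
    using insert by (simp add: powr_subadditive[OF \<gamma>] x sum_nonneg)
  also have "\<dots> \<le> (\<Sum>i\<in>insert i A. x i powr \<gamma>)" using insert by simp
  finally show ?case .
qed auto

lemma dsum_powr_le:
  assumes fin: "finite (descendants n T)" and \<gamma>: "0 < \<gamma>" "\<gamma> \<le> 1" and v: "\<And>z. v z \<ge> 0"
  shows "ennreal (enn2real (dsum (\<lambda>z. ennreal (v z)) n a T) powr \<gamma>)
      \<le> dsum (\<lambda>z. ennreal (v z powr \<gamma>)) n a T"
proof -
  have "dsum (\<lambda>z. ennreal (v z)) n a T = ennreal (\<Sum>u\<in>descendants n T. v (point u a T))"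
    using fin v by (simp add: dsum_def nn_integral_count_space_finite sum_ennreal)
  then have "enn2real (dsum (\<lambda>z. ennreal (v z)) n a T) powr \<gamma>
      = (\<Sum>u\<in>descendants n T. v (point u a T)) powr \<gamma>"
    using v by (simp add: sum_nonneg)
  also have "\<dots> \<le> (\<Sum>u\<in>descendants n T. v (point u a T) powr \<gamma>)"
    by (rule powr_sum_le[OF \<gamma> v])
  finally have "ennreal (enn2real (dsum (\<lambda>z. ennreal (v z)) n a T) powr \<gamma>)
      \<le> ennreal (\<Sum>u\<in>descendants n T. v (point u a T) powr \<gamma>)" by (rule ennreal_leI)
  also have "\<dots> = dsum (\<lambda>z. ennreal (v z powr \<gamma>)) n a T"
    using fin v by (simp add: dsum_def nn_integral_count_space_finite sum_ennreal)
  finally show ?thesis .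
qed

lemma nn_integral_alive:
  "(\<integral>\<^sup>+u. w (point u a T) \<partial>count_space {u. alive u T}) = w (0, a) + dsum w \<infinity> a T"
proof -
  have "(\<integral>\<^sup>+u. w (point u a T) \<partial>count_space {u. alive u T})
      = (\<integral>\<^sup>+u. w (point u a T) * indicator {[]} u + w (point u a T)
          * indicator (descendants \<infinity> T) u \<partial>count_space UNIV)"
    by (subst nn_integral_count_space_indicator)
       (auto simp: descendants_def intro!: nn_integral_cong split: split_indicator)
  also have "\<dots> = w (0, a) + dsum w \<infinity> a T"
    unfolding dsum_indicator by (subst nn_integral_add) simp_all
  finally show ?thesis .
qed

lemma nn_integral_hawkes:
  assumes [measurable]: "g \<in> borel_measurable (borel \<Otimes>\<^sub>M borel)"
  shows "(\<integral>\<^sup>+z. g z \<partial>hawkes \<Gamma> A C \<omega>)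
    = (\<integral>\<^sup>+i. (g (\<Gamma> i \<omega>, A i \<omega>) + dsum (\<lambda>z. g (shift (\<Gamma> i \<omega>) z)) \<infinity> (A i \<omega>) (C i \<omega>)) \<partial>count_space UNIV)"
proof -
  let ?I = "{(i, u). alive u (C i \<omega>)}"
  let ?p = "\<lambda>(i, u). shift (\<Gamma> i \<omega>) (point u (A i \<omega>) (C i \<omega>))"
  have "?p \<in> count_space ?I \<rightarrow>\<^sub>M borel \<Otimes>\<^sub>M borel"
    by (simp add: measurable_def space_pair_measure)
  then have "(\<integral>\<^sup>+z. g z \<partial>hawkes \<Gamma> A C \<omega>) = (\<integral>\<^sup>+x. g (?p x) \<partial>count_space ?I)"
    unfolding hawkes_def dirac_sum_def by (rule nn_integral_distr) simp
  also have "\<dots> = (\<integral>\<^sup>+x. (case x of (i, u) \<Rightarrow> g (shift (\<Gamma> i \<omega>) (point u (A i \<omega>) (C i \<omega>)))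
      * indicator {u. alive u (C i \<omega>)} u) \<partial>count_space UNIV)"
    by (subst nn_integral_count_space_indicator) (auto intro!: nn_integral_cong split: split_indicator)
  also have "\<dots> = (\<integral>\<^sup>+i. \<integral>\<^sup>+u. g (shift (\<Gamma> i \<omega>) (point u (A i \<omega>) (C i \<omega>)))
      * indicator {u. alive u (C i \<omega>)} u \<partial>count_space UNIV \<partial>count_space UNIV)"
    by (subst nn_integral_fst_count_space[symmetric]) simp
  also have "\<dots> = (\<integral>\<^sup>+i. \<integral>\<^sup>+u. g (shift (\<Gamma> i \<omega>) (point u (A i \<omega>) (C i \<omega>))) \<partial>count_space {u. alive u
      (C i \<omega>)} \<partial>count_space UNIV)"
    by (simp add: nn_integral_count_space_indicator)
  also have "\<dots> = (\<integral>\<^sup>+i. (g (\<Gamma> i \<omega>, A i \<omega>) + dsum (\<lambda>z. g (shift (\<Gamma> i \<omega>) z)) \<infinity> (A i \<omega>) (C i \<omega>))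
      \<partial>count_space UNIV)"
    using nn_integral_alive[where w="\<lambda>z. g (shift _ z)"] by (simp add: shift_def)
  finally show ?thesis .
qed

locale subcritical_hawkes = marked_hawkes M Q \<nu> h K \<Gamma> A C
  for M :: "'w measure" and Q :: "'s::polish_space measure" and \<nu> h K \<Gamma> A C +
  assumes kappa_less_1: "kappa h Q < 1"
begin

sublocale L: cascade_law Q h K
  by (rule cascade_law.intro) (rule Q_prob Q_sets h_measurable kernel kappa_less_1)+

definition arrivals :: "real measure"
  where "arrivals = density lborel (\<lambda>s. ennreal \<nu> * indicator {0..} s)"

lemma sets_arrivals [simp, measurable_cong]: "sets arrivals = sets borel"
  by (simp add: arrivals_def)

lemma nn_integral_arrivals:
  "g \<in> borel_measurable borel \<Longrightarrow> (\<integral>\<^sup>+s. g s \<partial>arrivals) = (\<integral>\<^sup>+s. ennreal \<nu> * indicator {0..} s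
      * g s \<partial>lborel)"
  unfolding arrivals_def by (subst nn_integral_density) auto

lemma emeasure_arrivals: "B \<in> sets borel \<Longrightarrow> emeasure arrivals B = ennreal \<nu> * emeasure lborel (B \<inter> {0..})"
proof -
  assume B: "B \<in> sets borel"
  have "emeasure arrivals B = (\<integral>\<^sup>+s. ennreal \<nu> * indicator (B \<inter> {0..}) s \<partial>lborel)"
    unfolding arrivals_def using B
    by (subst emeasure_density) (auto intro!: nn_integral_cong split: split_indicator)
  then show ?thesis using B by (simp add: nn_integral_cmult_indicator)
qed

lemma sigma_finite_arrivals: "sigma_finite_measure arrivals"
  unfolding arrivals_def
  by (subst sigma_finite_measure.sigma_finite_iff_density_finite[OF
      lborel.sigma_finite_measure_axioms]) (auto simp: ennreal_mult_eq_top_iff split: split_indicator)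

abbreviation immigrant :: "'w \<Rightarrow> nat \<Rightarrow> real \<times> 's"
  where "immigrant \<omega> \<equiv> (\<lambda>i. (\<Gamma> i \<omega>, A i \<omega>))"

sublocale P: marked_points M "\<Pi>\<^sub>M i\<in>UNIV. borel \<Otimes>\<^sub>M borel" immigrant "\<lambda>_. UNIV" "\<lambda>w i. w i"
    tree_space C K arrivals Q
proof (intro marked_points.intro marked_points_axioms.intro)
  show "immigrant \<in> M \<rightarrow>\<^sub>M (\<Pi>\<^sub>M i\<in>UNIV. borel \<Otimes>\<^sub>M borel)"
    using Gamma_measurable A_measurable
    by (intro measurable_PiM_single') (auto simp: space_PiM space_pair_measure)
  show "(\<lambda>w. w i) \<in> (\<Pi>\<^sub>M i\<in>UNIV. borel \<Otimes>\<^sub>M borel) \<rightarrow>\<^sub>M (borel \<Otimes>\<^sub>M borel :: (real \<times> 's) measure)"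
      for i :: nat
    by measurable
  show "prob_space Q" by (rule Q_prob)
  show "sigma_finite_measure arrivals" by (rule sigma_finite_arrivals)
  show "poisson_process M (\<lambda>\<omega>. dirac_sum UNIV (\<lambda>i. immigrant \<omega> i)) (arrivals \<Otimes>\<^sub>M Q)"
    using immigrants unfolding arrivals_def .
  show "indep_given M (\<Pi>\<^sub>M i\<in>UNIV. borel \<Otimes>\<^sub>M borel) immigrant (\<lambda>_. UNIV) tree_space C (\<lambda>w i. K (snd
      (w i)))"
    by (rule clusters)
qed (use C_measurable L.K_measurable Q_sets prob_space_axioms in auto)

lemmas [measurable] = Gamma_measurable A_measurable C_measurable

text \<open>Void probabilities suffice to identify the law of the mark of the first immigrant.\<close>

lemma void_prob:
  assumes "U \<in> sets (arrivals \<Otimes>\<^sub>M Q)" "emeasure (arrivals \<Otimes>\<^sub>M Q) U < \<infinity>"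
  shows "prob {\<omega> \<in> space M. \<forall>i. immigrant \<omega> i \<notin> U} = exp (- measure (arrivals \<Otimes>\<^sub>M Q) U)"
proof -
  have U: "U \<in> sets (borel \<Otimes>\<^sub>M borel)" using assms(1) P.sets_mQ by simp
  have "{\<omega> \<in> space M. \<forall>i. immigrant \<omega> i \<notin> U} = {\<omega> \<in> space M. emeasure (P.\<xi> \<omega>) U = of_nat 0}"
    by (auto simp: P.emeasure_points_card[OF U] P.cnt_def split: if_splits)
  then show ?thesis using P.poisson_prob[OF assms, of 0] by simp
qed

text \<open>Time is cut into intervals of length \<open>\<delta>\<close>. If there is no point before the \<open>k\<close>-th interval
    and none in
  it with a mark outside \<open>B\<close>, but there is some point in it, then the first point has its mark in \<open>B\<close>.
  The probability of this event is a difference of two void probabilities, and the sum over the disjoint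
  events for all \<open>k\<close> tends to \<open>Q B\<close> as \<open>\<delta>\<close> tends to zero.\<close>

lemma first_mark_lower:
  assumes B: "B \<in> sets borel"
  shows "measure Q B \<le> prob {\<omega> \<in> space M. A 0 \<omega> \<in> B}"
proof -
  define b where "b = measure Q B"
  have b: "0 \<le> b" "b \<le> 1" by (auto simp: b_def)
  let ?P = "prob {\<omega> \<in> space M. A 0 \<omega> \<in> B}"
  have main: "b \<le> ?P * ((exp x - 1) / x)" if x: "x > 0" for x
  proof -
    define \<delta> where "\<delta> = x / \<nu>"
    have \<delta>: "\<delta> > 0" "\<nu> * \<delta> = x" using x nu_pos by (auto simp: \<delta>_def)
    define I where "I k = {real k * \<delta>..<real (Suc k) * \<delta>}" for k
    define U where "U k = {..<real k * \<delta>} \<times> UNIV \<union> I k \<times> (- B)" for k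
    define U' where "U' k = {..<real (Suc k) * \<delta>} \<times> (UNIV :: 's set)" for k
    have spQ: "space Q = UNIV" using sets_eq_imp_space_eq[OF Q_sets] by simp
    have cB: "measure Q (- B) = 1 - b"
      using L.Q.prob_compl[of B] B by (simp add: Q_sets spQ Compl_eq_Diff_UNIV b_def)
    have Bs [simp]: "B \<in> sets Q" "- B \<in> sets Q" "UNIV \<in> sets Q" using B by (auto simp: Q_sets)
    have eQ: "emeasure Q UNIV = 1" using L.Q.emeasure_space_1 by (simp add: spQ)
    have e1: "emeasure arrivals {..<real k * \<delta>} = ennreal (x * real k)" for k
    proof -
      have "{..<real k * \<delta>} \<inter> {0..} = {0..<real k * \<delta>}" by auto
      then show ?thesis using \<delta>(1) nu_pos
        by (simp add: emeasure_arrivals ennreal_mult[symmetric] \<delta>(2)[symmetric] mult_ac)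
    qed
    have e2: "emeasure arrivals (I k) = ennreal x" for k
    proof -
      have "0 \<le> real k * \<delta>" using \<delta> by simp
      then have "I k \<inter> {0..} = I k" by (auto simp: I_def intro: order_trans)
      moreover have "emeasure lborel (I k) = ennreal \<delta>" using \<delta> by (simp add: I_def field_simps)
      ultimately show ?thesis using \<delta> nu_pos
        by (simp add: emeasure_arrivals ennreal_mult[symmetric] I_def)
    qed
    have eU: "emeasure (arrivals \<Otimes>\<^sub>M Q) (U k) = ennreal (x * real k + x * (1 - b))" for k
    proof -
      have [simp]: "I k \<in> sets borel" by (simp add: I_def)
      have em1: "emeasure (arrivals \<Otimes>\<^sub>M Q) ({..<real k * \<delta>} \<times> UNIV) = ennreal (x * real k)"
        by (subst L.Q.emeasure_pair_measure_Times) (simp_all add: e1 eQ)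
      have em2: "emeasure (arrivals \<Otimes>\<^sub>M Q) (I k \<times> (- B)) = ennreal x * ennreal (1 - b)"
        by (subst L.Q.emeasure_pair_measure_Times) (simp_all add: e2 cB[symmetric]
            L.Q.emeasure_eq_measure)
      have "emeasure (arrivals \<Otimes>\<^sub>M Q) (U k) = emeasure (arrivals \<Otimes>\<^sub>M Q) ({..<real k * \<delta>} \<times> UNIV)
          + emeasure (arrivals \<Otimes>\<^sub>M Q) (I k \<times> (- B))"
        unfolding U_def by (rule plus_emeasure[symmetric]) (auto simp: I_def)
      also have "\<dots> = ennreal (x * real k) + ennreal x * ennreal (1 - b)"
        by (simp only: em1 em2)
      finally show ?thesis using x b by (simp add: ennreal_mult[symmetric] ennreal_plus[symmetric]
          del: ennreal_plus)
    qed
    have eU': "emeasure (arrivals \<Otimes>\<^sub>M Q) (U' k) = ennreal (x * real (Suc k))" for k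
      unfolding U'_def by (simp add: L.Q.emeasure_pair_measure_Times e1 eQ del: of_nat_Suc)
    have sU: "U k \<in> sets (arrivals \<Otimes>\<^sub>M Q)" "U' k \<in> sets (arrivals \<Otimes>\<^sub>M Q)" for k
      unfolding U_def U'_def I_def by (auto intro!: sets.Un pair_measureI)
    have sU' [measurable]: "U k \<in> sets (borel \<Otimes>\<^sub>M borel)" "U' k \<in> sets (borel \<Otimes>\<^sub>M borel)" for k
      using sU P.sets_mQ by simp_all
    define V where "V k = {\<omega> \<in> space M. \<forall>i. immigrant \<omega> i \<notin> U k}" for k
    define V' where "V' k = {\<omega> \<in> space M. \<forall>i. immigrant \<omega> i \<notin> U' k}" for k
    have Vm [measurable]: "V k \<in> events" "V' k \<in> events" for k
      unfolding V_def V'_def by measurable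
    have pV: "prob (V k) = exp (- (x * real k + x * (1 - b)))" for k
      unfolding V_def using sU eU x b by (subst void_prob) (auto simp: measure_def simp del: ennreal_plus)
    have pV': "prob (V' k) = exp (- (x * real (Suc k)))" for k
      unfolding V'_def using sU eU' x by (subst void_prob) (auto simp: measure_def simp del: of_nat_Suc)
    have UU': "U k \<subseteq> U' k" for k
      using \<delta> by (auto simp: U_def U'_def I_def intro: less_le_trans)
    have pE: "prob (V k - V' k) = exp (- x) ^ k * (exp (- (x * (1 - b))) - exp (- x))" for k
    proof -
      have "prob (V k - V' k) = prob (V k) - prob (V' k)"
        using UU' by (intro finite_measure_Diff) (auto simp: V_def V'_def)
      also have "\<dots> = exp (- x) ^ k * (exp (- (x * (1 - b))) - exp (- x))"
        unfolding pV pV' by (simp add: exp_of_nat_mult[symmetric] exp_add[symmetric] algebra_simps)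
      finally show ?thesis .
    qed
    \<comment> \<open>For \<open>j < k\<close> the region of the \<open>j\<close>-th interval and the time before it lies in \<open>U k\<close>.\<close>
    have disj: "disjoint_family (\<lambda>k. V k - V' k)"
    proof -
      have "(V j - V' j) \<inter> (V k - V' k) = {}" if "j < k" for j k
      proof -
        have "real (Suc j) * \<delta> \<le> real k * \<delta>" using that \<delta> by (intro mult_right_mono) auto
        then have "U' j \<subseteq> U k" by (auto simp: U_def U'_def)
        then show ?thesis by (auto simp: V_def V'_def)
      qed
      then show ?thesis unfolding disjoint_family_on_def by (metis Int_commute linorder_neqE_nat)
    qed
    have "(\<lambda>k. prob (V k - V' k)) sums prob (\<Union>k. V k - V' k)"
      by (rule finite_measure_UNION) (use disj in auto)
    moreover have "(\<lambda>k. prob (V k - V' k)) sums (1 / (1 - exp (- x)) * (exp (- (x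
        * (1 - b))) - exp (- x)))"
      unfolding pE using x by (intro sums_mult2 geometric_sums) auto
    ultimately have "1 / (1 - exp (- x)) * (exp (- (x * (1 - b))) - exp (- x)) = prob (\<Union>k. V k - V' k)"
      using sums_unique2 by blast
    also have "\<dots> \<le> ?P"
    proof (rule finite_measure_mono_AE)
      show "AE \<omega> in M. \<omega> \<in> (\<Union>k. V k - V' k) \<longrightarrow> \<omega> \<in> {\<omega> \<in> space M. A 0 \<omega> \<in> B}"
        using arrival_order
      proof (eventually_elim, intro impI)
        fix \<omega> assume mono: "strict_mono (\<lambda>i. \<Gamma> i \<omega>)" and "\<omega> \<in> (\<Union>k. V k - V' k)"
        then obtain k i where k: "\<omega> \<in> V k" "\<omega> \<in> space M" "immigrant \<omega> i \<in> U' k"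
            by (auto simp: V_def V'_def)
        have "\<Gamma> 0 \<omega> \<le> \<Gamma> i \<omega>" using strict_mono_less_eq[OF mono, of 0 i] by simp
        then have "\<Gamma> 0 \<omega> < real (Suc k) * \<delta>" using k(3) by (auto simp: U'_def)
        moreover have "immigrant \<omega> 0 \<notin> U k" using k(1) by (auto simp: V_def)
        ultimately show "\<omega> \<in> {\<omega> \<in> space M. A 0 \<omega> \<in> B}"
          using k(2) by (auto simp: U_def I_def not_less)
      qed
      show "{\<omega> \<in> space M. A 0 \<omega> \<in> B} \<in> events" using B by measurable
    qed
    finally have le: "1 / (1 - exp (- x)) * (exp (- (x * (1 - b))) - exp (- x)) \<le> ?P" .
    have ex: "exp x > 1" using x by simp
    have "1 / (1 - exp (- x)) * (exp (- (x * (1 - b))) - exp (- x)) = (exp (x * b) - 1) / (exp x - 1)"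
    proof -
      have "- (x * (1 - b)) = - x + x * b" by (simp add: algebra_simps)
      then have e: "exp (- (x * (1 - b))) = 1 / exp x * exp (x * b)"
        by (simp only: exp_add) (simp add: exp_minus inverse_eq_divide)
      have i: "exp (- x) = 1 / exp x" by (simp add: exp_minus inverse_eq_divide)
      have "1 / (1 - 1 / E) * (1 / E * F - 1 / E) = (F - 1) / (E - 1)" if "E > 1" for E F :: real
        using that by (simp add: field_simps)
      from this[OF ex] show ?thesis unfolding e i .
    qed
    with le have "exp (x * b) - 1 \<le> ?P * (exp x - 1)" using ex by (simp add: field_simps)
    moreover have "x * b \<le> exp (x * b) - 1" using exp_ge_add_one_self[of "x * b"] by linarith
    ultimately have "x * b \<le> ?P * (exp x - 1)" by linarith
    then show ?thesis using x by (simp only: times_divide_eq_right pos_le_divide_eq mult.commute[of b])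
  qed
  have d0: "((\<lambda>x. (exp x - 1) / x) \<longlongrightarrow> 1) (at (0::real))"
    using DERIV_exp[of "0::real"] by (simp add: DERIV_def)
  have "((\<lambda>x. (exp x - 1) / x) \<longlongrightarrow> 1) (at_right (0::real))"
    by (rule tendsto_mono[OF at_le[OF subset_UNIV] d0])
  from tendsto_mult_left[OF this, of ?P]
  have d: "((\<lambda>x. ?P * ((exp x - 1) / x)) \<longlongrightarrow> ?P) (at_right (0::real))" by (simp only: mult_1_right)
  have ev: "eventually (\<lambda>x. b \<le> ?P * ((exp x - 1) / x)) (at_right (0::real))"
    unfolding eventually_at_filter by (intro always_eventually allI impI main) simp
  have "b \<le> ?P"
    by (rule tendsto_lowerbound[OF d ev]) simp
  then show ?thesis by (simp add: b_def)
qed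

text \<open>The lower bound for \<open>B\<close> and for its complement add up to one, so both are equalities.\<close>

lemma distr_first_mark: "distr M Q (A 0) = Q"
proof (rule measure_eqI)
  have Am: "A 0 \<in> M \<rightarrow>\<^sub>M Q" using A_measurable[of 0] by (simp add: measurable_cong_sets[OF refl Q_sets])
  fix B assume "B \<in> sets (distr M Q (A 0))"
  then have B: "B \<in> sets Q" by simp
  have B' [measurable]: "B \<in> sets borel" using B by (simp add: Q_sets)
  let ?E = "\<lambda>B. {\<omega> \<in> space M. A 0 \<omega> \<in> B}"
  have "prob (space M - ?E B) = 1 - prob (?E B)" by (rule prob_compl) simp
  moreover have "space M - ?E B = ?E (- B)" by auto
  moreover have "measure Q (- B) = 1 - measure Q B"
    using L.Q.prob_compl[OF B] sets_eq_imp_space_eq[OF Q_sets] by (simp add: Compl_eq_Diff_UNIV)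
  ultimately have "prob (?E B) = measure Q B"
    using first_mark_lower[OF B'] first_mark_lower[of "- B"] B' by simp
  moreover have "emeasure (distr M Q (A 0)) B = emeasure M (?E B)"
    using Am B by (subst emeasure_distr) (auto intro!: arg_cong[where f="emeasure M"])
  ultimately show "emeasure (distr M Q (A 0)) B = emeasure Q B"
    by (simp add: emeasure_eq_measure L.Q.emeasure_eq_measure)
qed simp

text \<open>Identifies \<open>\<mu>\<^sub>D\<close>, which is defined through cluster \<open>0\<close>, with the mean total of a cluster whose root
  mark has law \<open>Q\<close>.\<close>

lemma mu_D_eq:
  assumes [measurable]: "f \<in> borel_measurable borel"
  shows "mu_D M f A C = (\<integral>\<^sup>+a. ennreal (f a) \<partial>Q) + L.mean_total (\<lambda>z. ennreal (f (snd z))) \<infinity>"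
proof -
  let ?d = "dtotal (\<lambda>z. ennreal (f (snd z))) \<infinity>"
  have Am: "A 0 \<in> M \<rightarrow>\<^sub>M Q" using A_measurable[of 0] by (simp add: measurable_cong_sets[OF refl Q_sets])
  have int: "(\<integral>\<^sup>+\<omega>. g (A 0 \<omega>) \<partial>M) = (\<integral>\<^sup>+a. g a \<partial>Q)" if "g \<in> borel_measurable borel" for g
  proof -
    have gQ: "g \<in> borel_measurable Q" using that by (simp add: measurable_cong_sets[OF Q_sets refl])
    have "(\<integral>\<^sup>+a. g a \<partial>Q) = (\<integral>\<^sup>+a. g a \<partial>distr M Q (A 0))" unfolding distr_first_mark ..
    also have "\<dots> = (\<integral>\<^sup>+\<omega>. g (A 0 \<omega>) \<partial>M)" 
      using Am gQ by (intro nn_integral_distr) simp_all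
    finally show ?thesis ..
  qed
  have "cluster_total f A C 0 = (\<lambda>\<omega>. ennreal (f (A 0 \<omega>)) + ?d (C 0 \<omega>))"
  proof
    fix \<omega>
    show "cluster_total f A C 0 \<omega> = ennreal (f (A 0 \<omega>)) + ?d (C 0 \<omega>)"
      unfolding cluster_total_def nn_integral_alive[where w="\<lambda>z. ennreal (f (snd z))"]
      using dsum_indep[of "\<lambda>z. ennreal (f (snd z))" \<infinity> "A 0 \<omega>" "C 0 \<omega>" undefined] by simp
  qed
  then have "mu_D M f A C = (\<integral>\<^sup>+\<omega>. ennreal (f (A 0 \<omega>)) \<partial>M) + (\<integral>\<^sup>+\<omega>. ?d (C 0 \<omega>) \<partial>M)"
    unfolding mu_D_def by (simp add: nn_integral_add)
  also have "(\<integral>\<^sup>+\<omega>. ennreal (f (A 0 \<omega>)) \<partial>M) = (\<integral>\<^sup>+a. ennreal (f a) \<partial>Q)" by (rule int) measurable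
  also have "(\<integral>\<^sup>+\<omega>. ?d (C 0 \<omega>) \<partial>M) = (\<integral>\<^sup>+\<omega>. (\<integral>\<^sup>+T. ?d T \<partial>K (A 0 \<omega>)) \<partial>M)"
  proof -
    have sp: "immigrant \<omega> \<in> space (\<Pi>\<^sub>M i\<in>UNIV. borel \<Otimes>\<^sub>M borel)" for \<omega>
      by (simp add: space_PiM space_pair_measure)
    have "(\<integral>\<^sup>+\<omega>. indicator (space (\<Pi>\<^sub>M i\<in>UNIV. borel \<Otimes>\<^sub>M borel)) (immigrant \<omega>) * 1
        * (\<Prod>i\<in>{0}. ?d (C i \<omega>)) \<partial>M)
      = (\<integral>\<^sup>+\<omega>. indicator (space (\<Pi>\<^sub>M i\<in>UNIV. borel \<Otimes>\<^sub>M borel)) (immigrant \<omega>) * 1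
        * (\<Prod>i\<in>{0}. \<integral>\<^sup>+T. ?d T \<partial>K (snd (immigrant \<omega> i))) \<partial>M)"
      by (rule P.cond_prod_nn) auto
    then show ?thesis by (simp add: sp)
  qed
  also have "\<dots> = L.mean_total (\<lambda>z. ennreal (f (snd z))) \<infinity>"
    unfolding L.mean_total_def by (rule int) measurable
  finally show ?thesis .
qed

text \<open>The clusters that began by time \<open>t\<close> are counted completely, including what they contribute
  later.\<close>

definition cluster_sum :: "('s \<Rightarrow> real) \<Rightarrow> real \<Rightarrow> 'w \<Rightarrow> real"
  where "cluster_sum f t \<omega> = (\<Sum>i\<in>P.pts {..t} (immigrant \<omega>). f (A i \<omega>) + L.desc f (C i \<omega>))"

lemma arrivals_upto: "t \<ge> 0 \<Longrightarrow> emeasure arrivals {..t} = ennreal (\<nu> * t)"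
proof -
  assume t: "t \<ge> 0"
  have "{..t} \<inter> {0..} = {0..t}" by auto
  then show ?thesis using t nu_pos by (simp add: emeasure_arrivals ennreal_mult)
qed

lemma iexp_cluster_sum:
  "iexp (v * cluster_sum f t \<omega>)
    = (\<Prod>i\<in>P.pts {..t} (immigrant \<omega>). iexp (v * f (snd (immigrant \<omega> i))) * iexp (v * L.desc f (C i \<omega>)))"
proof (cases "finite (P.pts {..t} (immigrant \<omega>))")
  case True
  then show ?thesis
    by (simp add: cluster_sum_def sum_distrib_left distrib_left exp_sum exp_add)
qed (simp only: cluster_sum_def sum.infinite prod.infinite, simp)

lemma integrable_iexp_cluster_sum:
  assumes [measurable]: "f \<in> borel_measurable borel"
  shows "integrable M (\<lambda>\<omega>. iexp (v * cluster_sum f t \<omega>))"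
  unfolding iexp_cluster_sum by (rule P.integrable_prod_pts) (auto simp: norm_mult)

text \<open>A compound Poisson sum with \<open>\<nu> t\<close> expected clusters.\<close>

lemma char_cluster_sum:
  assumes [measurable]: "f \<in> borel_measurable borel" and t: "t \<ge> 0"
  shows "(\<integral>\<omega>. iexp (v * cluster_sum f t \<omega>) \<partial>M) = exp (- (of_real (\<nu> * t) * (1 - L.char_total f v)))"
proof -
  let ?g = "\<lambda>z. iexp (v * f (snd z))" and ?F = "\<lambda>T. iexp (v * L.desc f T)"
  define k where "k b = iexp (v * f b) * L.charK f b v - 1" for b
  have [measurable]: "k \<in> borel_measurable borel" unfolding k_def by measurable
  have k2: "norm (k b) \<le> 2" for b
  proof -
    have "norm (iexp (v * f b) * L.charK f b v) \<le> 1" by (simp add: norm_mult L.charK_le_1)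
    then show ?thesis unfolding k_def
      using norm_triangle_ineq4[of "iexp (v * f b) * L.charK f b v" 1] by simp
  qed
  have fin: "emeasure arrivals {..t} < \<infinity>" using t by (simp add: arrivals_upto)
  have "(\<integral>\<omega>. iexp (v * cluster_sum f t \<omega>) \<partial>M)
      = exp (\<integral>z. indicator ({..t} \<times> UNIV) z *\<^sub>R (?g z * (\<integral>T. ?F T \<partial>K (snd z)) - 1) \<partial>(arrivals \<Otimes>\<^sub>M Q))"
    unfolding iexp_cluster_sum by (rule P.gf_marked_points) (use fin in auto)
  also have "(\<integral>z. indicator ({..t} \<times> UNIV) z *\<^sub>R (?g z * (\<integral>T. ?F T \<partial>K (snd z)) - 1) \<partial>(arrivals \<Otimes>\<^sub>M Q))
      = (\<integral>z. indicator {..t} (fst z) *\<^sub>R k (snd z) \<partial>(arrivals \<Otimes>\<^sub>M Q))"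
    by (intro Bochner_Integration.integral_cong) (auto simp: k_def L.charK_def indicator_def
        mem_Times_iff)
  also have "\<dots> = (\<integral>s. (\<integral>b. indicator {..t} (fst (s, b)) *\<^sub>R k (snd (s, b)) \<partial>Q) \<partial>arrivals)"
  proof (rule P.mQ.integral_fst'[symmetric])
    have "integrable (arrivals \<Otimes>\<^sub>M Q) (\<lambda>z. 2 * indicat_real ({..t} \<times> UNIV) z)"
      using fin by (intro integrable_mult_right integrable_real_indicator) (auto simp:
          P.emeasure_strip P.sets_mQ)
    then show "integrable (arrivals \<Otimes>\<^sub>M Q) (\<lambda>z. indicator {..t} (fst z) *\<^sub>R k (snd z))"
    proof (rule Bochner_Integration.integrable_bound)
      show "(\<lambda>z. indicator {..t} (fst z) *\<^sub>R k (snd z)) \<in> borel_measurable (arrivals \<Otimes>\<^sub>M Q)"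
        unfolding measurable_cong_sets[OF P.sets_mQ refl] by measurable
    qed (auto intro!: AE_I2 simp: k2 indicator_def mem_Times_iff)
  qed
  also have "\<dots> = (\<integral>s. indicator {..t} s *\<^sub>R (L.char_total f v - 1) \<partial>arrivals)"
  proof -
    have "(\<integral>b. k b \<partial>Q) = L.char_total f v - 1"
      using L.integrable_char_total[of f v] L.Q.prob_space by (simp add: k_def L.char_total_def)
    then show ?thesis by simp
  qed
  also have "\<dots> = - (of_real (\<nu> * t) * (1 - L.char_total f v))"
    using t nu_pos fin by (simp add: measure_def arrivals_upto scaleR_conv_of_real algebra_simps)
  finally show ?thesis .
qed

lemma total_claim_measurable:
  assumes [measurable]: "f \<in> borel_measurable borel"
  shows "total_claim f \<Gamma> A C t \<in> borel_measurable M"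
proof -
  define g where "g z = ennreal (f (snd z)) * indicator ({0..t} \<times> UNIV) z" for z :: "real \<times> 's"
  have gm [measurable]: "g \<in> borel_measurable (borel \<Otimes>\<^sub>M borel)" unfolding g_def by measurable
  have "(\<lambda>\<omega>. dsum (\<lambda>z. g (shift (\<Gamma> i \<omega>) z)) \<infinity> (A i \<omega>) (C i \<omega>)) \<in> borel_measurable M" for i
    unfolding dsum_indicator
  proof (rule nn_integral_countable_measurable)
    fix u :: "nat list"
    have "(\<lambda>\<omega>. point u (A i \<omega>) (C i \<omega>)) \<in> M \<rightarrow>\<^sub>M borel \<Otimes>\<^sub>M borel"
      using measurable_compose[OF measurable_Pair[OF A_measurable[of i] C_measurable[of i]]
          point_measurable_aux[of u]]
      by simp
    then have "(\<lambda>\<omega>. g (shift (\<Gamma> i \<omega>) (point u (A i \<omega>) (C i \<omega>)))) \<in> borel_measurable M"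
      by (intro measurable_compose[OF _ gm] shift_measurable) auto
    moreover have "(\<lambda>\<omega>. indicator (descendants \<infinity> (C i \<omega>)) u :: ennreal) \<in> borel_measurable M"
    proof -
      have "Measurable.pred M (\<lambda>\<omega>. alive u (C i \<omega>))"
        by (rule measurable_compose[OF C_measurable alive_measurable])
      then show ?thesis unfolding indicator_def descendants_def by measurable
    qed
    ultimately show "(\<lambda>\<omega>. g (shift (\<Gamma> i \<omega>) (point u (A i \<omega>) (C i \<omega>)))
        * indicator (descendants \<infinity> (C i \<omega>)) u) \<in> borel_measurable M"
      by (rule borel_measurable_times_ennreal)
  qed simp
  then have "(\<lambda>\<omega>. \<integral>\<^sup>+i. (g (\<Gamma> i \<omega>, A i \<omega>) + dsum (\<lambda>z. g (shift (\<Gamma> i \<omega>) z)) \<infinity> (A i \<omega>) (C i \<omega>))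
      \<partial>count_space UNIV) \<in> borel_measurable M"
    by (intro nn_integral_countable_measurable borel_measurable_add) auto
  then have "(\<lambda>\<omega>. enn2real (\<integral>\<^sup>+z. g z \<partial>hawkes \<Gamma> A C \<omega>)) \<in> borel_measurable M"
    unfolding nn_integral_hawkes[OF gm] by measurable
  then show ?thesis unfolding total_claim_def[abs_def] g_def .
qed

text \<open>The delay needed to exceed \<open>t\<close> enters only as the factor \<open>(t - \<Gamma>)\<^sup>-\<^sup>p\<close>, so that the bound is a sum
  over the points of products of a function of the point and a function of its cascade, to which
  Campbell's formula applies.\<close>

definition overshoot_bound :: "('s \<Rightarrow> real) \<Rightarrow> real \<Rightarrow> real \<Rightarrow> real \<Rightarrow> 'w \<Rightarrow> ennreal"
  where "overshoot_bound f \<gamma> p t \<omega> = (\<integral>\<^sup>+i. (indicator {..<t} (\<Gamma> i \<omega>) * ennreal ((t - \<Gamma> i \<omega>) powr (-p)))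
    * dtotal (\<lambda>z. L.timew p (fst z) * ennreal (f (snd z) powr \<gamma>)) \<infinity> (C i \<omega>) \<partial>count_space UNIV)"

text \<open>Every cluster that began by time \<open>t\<close> splits into the claims up to \<open>t\<close> and the late ones,
    and a cluster
  that began later has only late ones because delays are nonnegative. A delay \<open>T > r\<close> satisfies
  \<open>1 \<le> r\<^sup>-\<^sup>p T\<^sup>p\<close>.\<close>

lemma overshoot_pointwise:
  assumes f0: "\<And>a. f a \<ge> 0" and fm [measurable]: "f \<in> borel_measurable borel"
    and \<gamma>: "0 < \<gamma>" "\<gamma> \<le> 1" and p: "0 < p"
    and G0: "\<And>i. \<Gamma> i \<omega> \<ge> 0" and Gt: "\<And>i. \<Gamma> i \<omega> \<noteq> t" and fin: "finite (P.pts {..t} (immigrant \<omega>))"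
    and finC: "\<And>i. finite (descendants \<infinity> (C i \<omega>))" and nn: "\<And>i. L.nonneg_times \<infinity> (C i \<omega>)"
  shows "total_claim f \<Gamma> A C t \<omega> \<le> cluster_sum f t \<omega>"
    and "ennreal ((cluster_sum f t \<omega> - total_claim f \<Gamma> A C t \<omega>) powr \<gamma>) \<le> overshoot_bound f \<gamma> p t \<omega>"
proof -
  let ?I = "P.pts {..t} (immigrant \<omega>)"
  define g where "g z = ennreal (f (snd z)) * indicator ({0..t} \<times> UNIV) z" for z :: "real \<times> 's"
  have gm [measurable]: "g \<in> borel_measurable (borel \<Otimes>\<^sub>M borel)" unfolding g_def by measurable
  define clus where "clus i = g (\<Gamma> i \<omega>, A i \<omega>) + dsum (\<lambda>z. g (shift (\<Gamma> i \<omega>) z)) \<infinity> (A i \<omega>) (C i \<omega>)" for i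
  define late where "late i z = f (snd z) * indicator {t - \<Gamma> i \<omega><..} (fst z)" for i and z :: "real \<times> 's"
  define e where "e i = enn2real (dtotal (\<lambda>z. ennreal (late i z)) \<infinity> (C i \<omega>))" for i
  have late0: "late i z \<ge> 0" for i z by (simp add: late_def f0)
  have times: "fst (point u undefined (C i \<omega>)) \<ge> 0" if "u \<in> descendants \<infinity> (C i \<omega>)" for u i
    using nn[of i] that by (simp add: L.nonneg_times_iff)
  have e_eq: "dtotal (\<lambda>z. ennreal (late i z)) \<infinity> (C i \<omega>) = ennreal (e i)" for i
    unfolding e_def using finC[of i] by (simp add: dsum_def nn_integral_count_space_finite
        less_top[symmetric])
  have d_eq: "dtotal (\<lambda>z. ennreal (f (snd z))) \<infinity> (C i \<omega>) = ennreal (L.desc f (C i \<omega>))" for i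
    unfolding L.desc_def using L.dtotal_finite[OF finC[of i], of f] by simp
  have zero: "clus i = 0" if "i \<notin> ?I" for i
  proof -
    have t: "\<Gamma> i \<omega> > t" using that by auto
    have "dsum (\<lambda>z. g (shift (\<Gamma> i \<omega>) z)) \<infinity> undefined (C i \<omega>)
        = (\<integral>\<^sup>+u. 0 \<partial>count_space (descendants \<infinity> (C i \<omega>)))"
      unfolding dsum_def
    proof (rule nn_integral_cong)
      fix u assume "u \<in> space (count_space (descendants \<infinity> (C i \<omega>)))"
      then have "fst (point u undefined (C i \<omega>)) \<ge> 0" using times by simp
      then show "g (shift (\<Gamma> i \<omega>) (point u undefined (C i \<omega>))) = 0"
        using t by (auto simp: g_def shift_def)
    qed
    then show ?thesis using t dsum_indep[of "\<lambda>z. g (shift (\<Gamma> i \<omega>) z)" \<infinity> "A i \<omega>" "C i \<omega>" undefined]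
      by (simp add: clus_def g_def)
  qed
  have pos: "clus i + ennreal (e i) = ennreal (f (A i \<omega>) + L.desc f (C i \<omega>))" if "i \<in> ?I" for i
  proof -
    have t: "\<Gamma> i \<omega> \<le> t" using that by simp
    have "dsum (\<lambda>z. g (shift (\<Gamma> i \<omega>) z)) \<infinity> (A i \<omega>) (C i \<omega>) + ennreal (e i)
        = dtotal (\<lambda>z. g (shift (\<Gamma> i \<omega>) z) + ennreal (late i z)) \<infinity> (C i \<omega>)"
      unfolding dsum_add e_eq dsum_indep[of "\<lambda>z. g (shift (\<Gamma> i \<omega>) z)" \<infinity> "A i \<omega>" "C i \<omega>" undefined] ..
    also have "\<dots> = dtotal (\<lambda>z. ennreal (f (snd z))) \<infinity> (C i \<omega>)"
      unfolding dsum_def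
    proof (rule nn_integral_cong)
      fix u assume "u \<in> space (count_space (descendants \<infinity> (C i \<omega>)))"
      then have "fst (point u undefined (C i \<omega>)) \<ge> 0" using times by simp
      then show "g (shift (\<Gamma> i \<omega>) (point u undefined (C i \<omega>)))
          + ennreal (late i (point u undefined (C i \<omega>)))
          = ennreal (f (snd (point u undefined (C i \<omega>))))"
        using G0[of i] by (auto simp: g_def shift_def late_def split: split_indicator)
    qed
    finally have "dsum (\<lambda>z. g (shift (\<Gamma> i \<omega>) z)) \<infinity> (A i \<omega>) (C i \<omega>) + ennreal (e i)
        = ennreal (L.desc f (C i \<omega>))"
      unfolding d_eq .
    moreover have "g (\<Gamma> i \<omega>, A i \<omega>) = ennreal (f (A i \<omega>))" using t G0 by (simp add: g_def)
    ultimately show ?thesis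
      using f0 by (simp add: clus_def add.assoc ennreal_plus L.desc_def)
  qed
  have clus_fin: "clus i < \<infinity>" if "i \<in> ?I" for i
    using pos[OF that] by (metis ennreal_add_eq_top ennreal_neq_top infinity_ennreal_def less_top)
  have clus_real: "clus i = ennreal (enn2real (clus i))" if "i \<in> ?I" for i
    using clus_fin[OF that] by simp
  have clus_e: "enn2real (clus i) + e i = f (A i \<omega>) + L.desc f (C i \<omega>)" if "i \<in> ?I" for i
  proof -
    have "ennreal (enn2real (clus i) + e i) = ennreal (f (A i \<omega>) + L.desc f (C i \<omega>))"
      using pos[OF that] clus_real[OF that] by (simp add: ennreal_plus e_def)
    then show ?thesis using f0 by (simp add: e_def L.desc_def del: ennreal_plus)
  qed
  have "(\<integral>\<^sup>+z. g z \<partial>hawkes \<Gamma> A C \<omega>) = (\<integral>\<^sup>+i. clus i \<partial>count_space UNIV)"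
    unfolding nn_integral_hawkes[OF gm] clus_def ..
  also have "\<dots> = (\<integral>\<^sup>+i. clus i \<partial>count_space ?I)"
    by (rule nn_integral_count_space_eq) (auto intro: zero)
  also have "\<dots> = (\<Sum>i\<in>?I. clus i)" using fin by (simp only: nn_integral_count_space_finite)
  also have "\<dots> = (\<Sum>i\<in>?I. ennreal (enn2real (clus i)))" by (intro sum.cong refl clus_real)
  also have "\<dots> = ennreal (\<Sum>i\<in>?I. enn2real (clus i))" by (rule sum_ennreal) simp
  finally have S: "total_claim f \<Gamma> A C t \<omega> = (\<Sum>i\<in>?I. enn2real (clus i))"
    unfolding total_claim_def g_def by (simp add: sum_nonneg)
  have "cluster_sum f t \<omega> = (\<Sum>i\<in>?I. enn2real (clus i) + e i)"
    unfolding cluster_sum_def by (intro sum.cong refl clus_e[symmetric])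
  then have diff: "cluster_sum f t \<omega> - total_claim f \<Gamma> A C t \<omega> = (\<Sum>i\<in>?I. e i)"
    unfolding S by (simp add: sum.distrib)
  have e0: "e i \<ge> 0" for i by (simp add: e_def)
  have "(\<Sum>i\<in>?I. e i) \<ge> 0" by (rule sum_nonneg) (rule e0)
  with diff show "total_claim f \<Gamma> A C t \<omega> \<le> cluster_sum f t \<omega>" by linarith
  let ?w = "\<lambda>z. L.timew p (fst z) * ennreal (f (snd z) powr \<gamma>)"
  let ?b = "\<lambda>i. indicator {..<t} (\<Gamma> i \<omega>) * ennreal ((t - \<Gamma> i \<omega>) powr (-p)) * dtotal ?w \<infinity> (C i \<omega>)"
  have ei: "ennreal (e i powr \<gamma>) \<le> ?b i" if "i \<in> ?I" for i
  proof -
    define r where "r = t - \<Gamma> i \<omega>"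
    have r: "r > 0" using that Gt[of i] by (auto simp: r_def less_le)
    have "ennreal (e i powr \<gamma>) \<le> dtotal (\<lambda>z. ennreal (late i z powr \<gamma>)) \<infinity> (C i \<omega>)"
      unfolding e_def by (rule dsum_powr_le[OF finC \<gamma> late0])
    also have "\<dots> \<le> dtotal (\<lambda>z. ennreal (r powr (-p)) * ?w z) \<infinity> (C i \<omega>)"
    proof (rule dsum_mono)
      fix z :: "real \<times> 's"
      show "ennreal (late i z powr \<gamma>) \<le> ennreal (r powr (-p)) * ?w z"
      proof (cases "fst z > r")
        case True
        have "r powr p \<le> fst z powr p" using True r p by (intro powr_mono2) auto
        then have "1 \<le> r powr (-p) * fst z powr p" using r by (simp add: powr_minus field_simps)
        then have "1 * (f (snd z) powr \<gamma>) \<le> (r powr (-p) * fst z powr p) * (f (snd z) powr \<gamma>)"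
          by (rule mult_right_mono) simp
        then have "ennreal (f (snd z) powr \<gamma>) \<le> ennreal (r powr (-p)) * (ennreal (fst z powr p)
            * ennreal (f (snd z) powr \<gamma>))"
          by (simp add: ennreal_mult[symmetric] ennreal_leI mult.assoc)
        moreover have "max 0 (fst z) = fst z" using True r by simp
        ultimately show ?thesis using True by (simp add: late_def r_def[symmetric] L.timew_def)
      qed (simp add: late_def r_def)
    qed
    also have "\<dots> = ?b i" using r by (simp add: dsum_cmult r_def)
    finally show ?thesis .
  qed
  have "(\<Sum>i\<in>?I. e i) powr \<gamma> \<le> (\<Sum>i\<in>?I. e i powr \<gamma>)" by (rule powr_sum_le[OF \<gamma> e0])
  then have "ennreal ((\<Sum>i\<in>?I. e i) powr \<gamma>) \<le> (\<Sum>i\<in>?I. ennreal (e i powr \<gamma>))"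
    by (simp add: sum_ennreal ennreal_leI)
  also have "\<dots> \<le> (\<Sum>i\<in>?I. ?b i)" by (rule sum_mono) (rule ei)
  also have "\<dots> = (\<integral>\<^sup>+i. ?b i \<partial>count_space ?I)" using fin by (simp only: nn_integral_count_space_finite)
  also have "\<dots> \<le> (\<integral>\<^sup>+i. ?b i \<partial>count_space UNIV)"
    by (subst nn_integral_count_space_indicator) (auto intro!: nn_integral_mono split: split_indicator)
  finally show "ennreal ((cluster_sum f t \<omega> - total_claim f \<Gamma> A C t \<omega>) powr \<gamma>)
      \<le> overshoot_bound f \<gamma> p t \<omega>"
    unfolding diff overshoot_bound_def .
qed

text \<open>The power of \<open>t\<close> is the integral of \<open>(t - s)\<^sup>-\<^sup>p\<close> over the arrival times \<open>s\<close> before \<open>t\<close>.\<close>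

lemma mean_overshoot_bound:
  assumes [measurable]: "f \<in> borel_measurable borel" and p: "0 < p" "p < 1" and t: "t > 0"
  shows "(\<integral>\<^sup>+\<omega>. overshoot_bound f \<gamma> p t \<omega> \<partial>M)
    = ennreal (\<nu> * (t powr (1 - p) / (1 - p))) * L.mean_total (\<lambda>z. L.timew p (fst z)
        * ennreal (f (snd z) powr \<gamma>)) \<infinity>"
proof -
  let ?w = "\<lambda>z. L.timew p (fst z) * ennreal (f (snd z) powr \<gamma>)"
  let ?k = "\<lambda>s. indicator {..<t} s * ennreal ((t - s) powr (-p)) :: ennreal"
  have "(\<integral>\<^sup>+\<omega>. overshoot_bound f \<gamma> p t \<omega> \<partial>M)
      = (\<integral>\<^sup>+z. ?k (fst z) * (\<integral>\<^sup>+T. dtotal ?w \<infinity> T \<partial>K (snd z)) \<partial>(arrivals \<Otimes>\<^sub>M Q))"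
    unfolding overshoot_bound_def
    using P.campbell[of "\<lambda>z. ?k (fst z)" "dtotal ?w \<infinity>"] by simp
  also have "\<dots> = (\<integral>\<^sup>+s. \<integral>\<^sup>+b. ?k (fst (s, b)) * (\<integral>\<^sup>+T. dtotal ?w \<infinity> T \<partial>K (snd (s, b))) \<partial>Q \<partial>arrivals)"
  proof (rule L.Q.nn_integral_fst[symmetric])
    have "(\<lambda>a. \<integral>\<^sup>+T. dtotal ?w \<infinity> T \<partial>K a) \<in> borel_measurable borel"
      by (rule L.nn_integral_K_measurable) measurable
    note [measurable] = measurable_compose[OF measurable_snd this]
    show "(\<lambda>z. ?k (fst z) * (\<integral>\<^sup>+T. dtotal ?w \<infinity> T \<partial>K (snd z))) \<in> borel_measurable (arrivals \<Otimes>\<^sub>M Q)"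
      unfolding measurable_cong_sets[OF P.sets_mQ refl] by measurable
  qed
  also have "\<dots> = (\<integral>\<^sup>+s. ?k s \<partial>arrivals) * L.mean_total ?w \<infinity>"
    unfolding L.mean_total_def by (simp add: nn_integral_cmult nn_integral_multc)
  also have "(\<integral>\<^sup>+s. ?k s \<partial>arrivals) = ennreal \<nu> * (\<integral>\<^sup>+s. indicator {0..<t} s
      * ennreal ((t - s) powr (-p)) \<partial>lborel)"
  proof -
    have "(\<integral>\<^sup>+s. ?k s \<partial>arrivals) = (\<integral>\<^sup>+s. ennreal \<nu> * indicator {0..} s * ?k s \<partial>lborel)"
      by (rule nn_integral_arrivals) measurable
    also have "\<dots> = (\<integral>\<^sup>+s. ennreal \<nu> * (indicator {0..<t} s * ennreal ((t - s) powr (-p))) \<partial>lborel)"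
      by (intro nn_integral_cong) (auto split: split_indicator)
    finally show ?thesis by (simp add: nn_integral_cmult)
  qed
  also have "(\<integral>\<^sup>+s. indicator {0..<t} s * ennreal ((t - s) powr (-p)) \<partial>lborel)
      = (\<integral>\<^sup>+x. ennreal (x powr (-p)) * indicator {0..t} x \<partial>lborel)"
  proof -
    have "(\<integral>\<^sup>+s. indicator {0..<t} s * ennreal ((t - s) powr (-p)) \<partial>lborel)
        = ennreal \<bar>- 1\<bar> * (\<integral>\<^sup>+x. indicator {0..<t} (t + (- 1) * x) * ennreal ((t - (t + (- 1)
            * x)) powr (-p)) \<partial>lborel)"
      by (rule nn_integral_real_affine) auto
    also have "\<dots> = (\<integral>\<^sup>+x. ennreal (x powr (-p)) * indicator {0..t} x \<partial>lborel)"
      by (auto intro!: nn_integral_cong split: split_indicator)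
    finally show ?thesis .
  qed
  also have "\<dots> = ennreal (t powr (1 - p) / (1 - p))"
  proof -
    have "((\<lambda>x. x powr (-p)) has_integral (t powr (-p + 1) / (-p + 1))) {0..t}"
      by (rule has_integral_powr_from_0) (use p t in auto)
    from nn_integral_has_integral_lebesgue'[OF _ this] show ?thesis by simp
  qed
  finally show ?thesis using p nu_pos by (simp add: ennreal_mult[symmetric])
qed

lemma overshoot_bound_measurable:
  assumes [measurable]: "f \<in> borel_measurable borel"
  shows "overshoot_bound f \<gamma> p t \<in> borel_measurable M"
  unfolding overshoot_bound_def
  by (rule nn_integral_countable_measurable) auto

lemma AE_overshoot:
  assumes [measurable]: "f \<in> borel_measurable borel" and f0: "\<And>a. f a \<ge> 0"
    and \<gamma>: "0 < \<gamma>" "\<gamma> \<le> 1" and p: "0 < p" and t: "t \<ge> 0"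
  shows "AE \<omega> in M. total_claim f \<Gamma> A C t \<omega> \<le> cluster_sum f t \<omega> \<and>
    ennreal ((cluster_sum f t \<omega> - total_claim f \<Gamma> A C t \<omega>) powr \<gamma>) \<le> overshoot_bound f \<gamma> p t \<omega>"
proof -
  have "AE s in arrivals. s \<ge> 0 \<and> s \<noteq> t"
  proof -
    have "AE s in lborel. s \<noteq> t" by (rule AE_lborel_singleton)
    then show ?thesis unfolding arrivals_def
      by (subst AE_density) (auto elim!: eventually_mono split: split_indicator_asm)
  qed
  then have "AE z in arrivals \<Otimes>\<^sub>M Q. fst z \<ge> 0 \<and> fst z \<noteq> t"
  proof (intro P.mQ.AE_pair_measure)
    have "{z \<in> space (borel \<Otimes>\<^sub>M borel :: (real \<times> 's) measure). fst z \<ge> 0 \<and> fst z \<noteq> t}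
        \<in> sets (borel \<Otimes>\<^sub>M borel)"
      by measurable
    then show "{z \<in> space (arrivals \<Otimes>\<^sub>M Q). fst z \<ge> 0 \<and> fst z \<noteq> t} \<in> sets (arrivals \<Otimes>\<^sub>M Q)"
      unfolding P.sets_mQ sets_eq_imp_space_eq[OF P.sets_mQ] .
  qed simp
  from P.AE_points[OF this]
  have 1: "AE \<omega> in M. \<forall>i. \<Gamma> i \<omega> \<ge> 0 \<and> \<Gamma> i \<omega> \<noteq> t" by simp
  have 2: "AE \<omega> in M. finite (P.pts {..t} (immigrant \<omega>))"
    by (rule P.AE_pts_finite) (use t in \<open>auto simp: arrivals_upto\<close>)
  have 3: "AE \<omega> in M. \<forall>i. finite (descendants \<infinity> (C i \<omega>))"
    using P.AE_marks[OF L.finite_descendants_measurable L.AE_K_finite_descendants] by simp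
  have 4: "AE \<omega> in M. \<forall>i. L.nonneg_times \<infinity> (C i \<omega>)"
    using P.AE_marks[OF L.nonneg_times_measurable L.AE_K_nonneg_times] by simp
  show ?thesis
    using 1 2 3 4
  proof eventually_elim
    case (elim \<omega>)
    show ?case
      by (intro conjI overshoot_pointwise[OF f0 assms(1) \<gamma> p]) (use elim in auto)
  qed
qed

text \<open>Interpolates between \<open>\<bar>1 - exp (i y)\<bar> \<le> \<bar>y\<bar>\<close> and \<open>\<bar>1 - exp (i y)\<bar> \<le> 2\<close> to get the bound
  \<open>2 \<bar>y\<bar>\<^sup>\<gamma>\<close>, whose expectation is controlled.\<close>

lemma char_total_claim_close:
  assumes [measurable]: "f \<in> borel_measurable borel" and f0: "\<And>a. f a \<ge> 0"
    and \<gamma>: "0 < \<gamma>" "\<gamma> \<le> 1" and p: "0 < p" "p < 1"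
    and fin: "L.mean_total (\<lambda>z. L.timew p (fst z) * ennreal (f (snd z) powr \<gamma>)) \<infinity> < \<infinity>"
  obtains c where "c \<ge> 0" "\<And>t v. t > 0 \<Longrightarrow>
    norm ((\<integral>\<omega>. iexp (v * total_claim f \<Gamma> A C t \<omega>) \<partial>M) - (\<integral>\<omega>. iexp (v * cluster_sum f t \<omega>) \<partial>M))
      \<le> c * \<bar>v\<bar> powr \<gamma> * t powr (1 - p)"
proof -
  let ?m = "L.mean_total (\<lambda>z. L.timew p (fst z) * ennreal (f (snd z) powr \<gamma>)) \<infinity>"
  define c where "c = 2 * (\<nu> / (1 - p) * enn2real ?m)"
  have c: "c \<ge> 0" using nu_pos p by (simp add: c_def)
  have m: "?m = ennreal (enn2real ?m)" using fin by simp
  note [measurable] = total_claim_measurable overshoot_bound_measurable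
  have "norm ((\<integral>\<omega>. iexp (v * total_claim f \<Gamma> A C t \<omega>) \<partial>M) - (\<integral>\<omega>. iexp (v * cluster_sum f t \<omega>) \<partial>M))
      \<le> c * \<bar>v\<bar> powr \<gamma> * t powr (1 - p)" if t: "t > 0" for t v
  proof -
    let ?S = "total_claim f \<Gamma> A C t" and ?R = "cluster_sum f t"
    have iS: "integrable M (\<lambda>\<omega>. iexp (v * ?S \<omega>))"
      by (rule integrable_const_bound[of _ 1]) auto
    note iR = integrable_iexp_cluster_sum[OF assms(1), of v t]
    have pt: "AE \<omega> in M. ennreal (norm (iexp (v * ?S \<omega>) - iexp (v * ?R \<omega>)))
        \<le> ennreal (2 * \<bar>v\<bar> powr \<gamma>) * overshoot_bound f \<gamma> p t \<omega>"
      using AE_overshoot[OF assms(1) f0 \<gamma> p(1) less_imp_le[OF t]]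
    proof eventually_elim
      case (elim \<omega>)
      define y where "y = v * (?R \<omega> - ?S \<omega>)"
      have "iexp (v * ?S \<omega>) - iexp (v * ?R \<omega>) = iexp (v * ?S \<omega>) * (1 - iexp y)"
        by (simp add: y_def algebra_simps exp_add[symmetric])
      then have n: "norm (iexp (v * ?S \<omega>) - iexp (v * ?R \<omega>)) = norm (1 - iexp y)"
        by (simp add: norm_mult)
      have "norm (1 - iexp y) \<le> 2 * \<bar>y\<bar> powr \<gamma>"
      proof (cases "\<bar>y\<bar> \<le> 1")
        case True
        have "norm (1 - iexp y) \<le> \<bar>y\<bar> powr 1" using norm_one_minus_iexp(1)[of y] by simp
        also have "\<dots> \<le> \<bar>y\<bar> powr \<gamma>" using True \<gamma> by (intro powr_mono') auto
        finally show ?thesis by (smt (verit) powr_ge_zero)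
      next
        case False
        then have "1 \<le> \<bar>y\<bar> powr \<gamma>" using \<gamma> by (intro ge_one_powr_ge_zero) auto
        then show ?thesis using norm_one_minus_iexp(2)[of y] by linarith
      qed
      also have "\<dots> = 2 * \<bar>v\<bar> powr \<gamma> * (?R \<omega> - ?S \<omega>) powr \<gamma>"
        using elim by (simp add: y_def abs_mult powr_mult)
      finally have "ennreal (norm (1 - iexp y)) \<le> ennreal (2 * \<bar>v\<bar> powr \<gamma>)
          * ennreal ((?R \<omega> - ?S \<omega>) powr \<gamma>)"
        by (simp add: ennreal_mult[symmetric] ennreal_leI)
      also have "\<dots> \<le> ennreal (2 * \<bar>v\<bar> powr \<gamma>) * overshoot_bound f \<gamma> p t \<omega>"
        using elim by (intro mult_left_mono) auto
      finally show ?case unfolding n .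
    qed
    have "norm ((\<integral>\<omega>. iexp (v * ?S \<omega>) \<partial>M) - (\<integral>\<omega>. iexp (v * ?R \<omega>) \<partial>M))
        = norm (\<integral>\<omega>. iexp (v * ?S \<omega>) - iexp (v * ?R \<omega>) \<partial>M)"
      using iS iR by (subst Bochner_Integration.integral_diff) auto
    also have "\<dots> \<le> (\<integral>\<omega>. norm (iexp (v * ?S \<omega>) - iexp (v * ?R \<omega>)) \<partial>M)" by (rule integral_norm_bound)
    finally have "ennreal (norm ((\<integral>\<omega>. iexp (v * ?S \<omega>) \<partial>M) - (\<integral>\<omega>. iexp (v * ?R \<omega>) \<partial>M)))
        \<le> ennreal (\<integral>\<omega>. norm (iexp (v * ?S \<omega>) - iexp (v * ?R \<omega>)) \<partial>M)" by (rule ennreal_leI)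
    also have "\<dots> = (\<integral>\<^sup>+\<omega>. ennreal (norm (iexp (v * ?S \<omega>) - iexp (v * ?R \<omega>))) \<partial>M)"
      by (rule nn_integral_eq_integral[symmetric])
         (intro integrable_norm Bochner_Integration.integrable_diff iS iR, simp)
    also have "\<dots> \<le> (\<integral>\<^sup>+\<omega>. ennreal (2 * \<bar>v\<bar> powr \<gamma>) * overshoot_bound f \<gamma> p t \<omega> \<partial>M)"
      by (rule nn_integral_mono_AE[OF pt])
    also have "\<dots> = ennreal (2 * \<bar>v\<bar> powr \<gamma>) * (ennreal (\<nu> * (t powr (1 - p) / (1 - p))) * ?m)"
      by (simp add: nn_integral_cmult mean_overshoot_bound[OF assms(1) p t])
    also have "\<dots> = ennreal (2 * \<bar>v\<bar> powr \<gamma> * (\<nu> * (t powr (1 - p) / (1 - p)) * enn2real ?m))"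
      by (subst m) (use p nu_pos in \<open>simp add: ennreal_mult[symmetric] del: ennreal_enn2real\<close>)
    also have "2 * \<bar>v\<bar> powr \<gamma> * (\<nu> * (t powr (1 - p) / (1 - p)) * enn2real ?m) = c * \<bar>v\<bar> powr \<gamma>
        * t powr (1 - p)"
      by (simp add: c_def)
    finally show ?thesis using c by (subst (asm) ennreal_le_iff) auto
  qed
  with c show ?thesis by (rule that)
qed

abbreviation rkap :: "'s \<Rightarrow> real"
  where "rkap a \<equiv> enn2real (kappa_mark h a)"

lemma rkap_integrable: "integrable Q rkap" and rkap_integral: "ennreal (\<integral>a. rkap a \<partial>Q) = kappa h Q"
proof -
  have eq: "(\<integral>\<^sup>+a. ennreal (rkap a) \<partial>Q) = kappa h Q"
    unfolding kappa_def by (rule nn_integral_cong_AE) (use L.kap_finite in eventually_elim, simp)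
  show "integrable Q rkap"
    by (rule integrableI_nonneg) (use kappa_less_1 eq in \<open>auto simp: order.strict_trans\<close>)
  then show "ennreal (\<integral>a. rkap a \<partial>Q) = kappa h Q"
    using eq by (subst nn_integral_eq_integral[symmetric]) auto
qed

lemma rkap_less_1: "(\<integral>a. rkap a \<partial>Q) < 1"
  using rkap_integral kappa_less_1 by (metis ennreal_less_one_iff)

text \<open>The centring \<open>i v \<mu>'\<close> in \<open>q\<close> turns \<open>exp (i v f) exp (- \<kappa> (1 - \<phi>))\<close> into
  \<open>exp (i v (f + \<mu>' \<kappa>)) exp (- \<kappa> q)\<close>; this is where \<open>Y\<close> replaces \<open>X\<close> when \<open>\<alpha> > 1\<close>.\<close>

lemma centred_char_fixpoint:
  fixes q :: "real \<Rightarrow> complex"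
  assumes fm [measurable]: "f \<in> borel_measurable borel" and f0: "\<And>a. f a \<ge> 0"
    and mean: "1 < \<alpha> \<Longrightarrow> integrable Q (\<lambda>a. f a + \<mu>' * rkap a) \<and> (\<integral>a. f a + \<mu>' * rkap a \<partial>Q) = \<mu>'"
    and mu0: "\<not> 1 < \<alpha> \<Longrightarrow> \<mu>' = 0"
  defines "q \<equiv> \<lambda>v. 1 - L.char_total f v + \<i> * of_real (v * \<mu>')"
  shows "q v = (\<integral>a. rv_kernel \<alpha> (v * (f a + \<mu>' * rkap a)) \<partial>Q)
    + (\<integral>a. iexp (v * (f a + \<mu>' * rkap a)) * (1 - exp (- (rkap a * q v))) \<partial>Q)"
proof -
  let ?Z = "\<lambda>a. f a + \<mu>' * rkap a"
  have [measurable]: "rkap \<in> borel_measurable borel" by measurable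
  have i1: "integrable Q (\<lambda>a. iexp (v * ?Z a))"
    by (rule L.Q.integrable_const_bound[of _ 1]) auto
  have Re_q: "Re (q v) \<ge> 0"
    using complex_Re_le_cmod[of "L.char_total f v"] L.char_total_le_1[OF fm, of v] by (simp add: q_def)
  have pt: "iexp (v * ?Z a) * exp (- (rkap a * q v)) = iexp (v * f a) * exp (- (rkap a
      * (1 - L.char_total f v)))" for a
    unfolding exp_add[symmetric] q_def by (rule arg_cong[where f=exp]) (simp add: algebra_simps)
  have i2: "integrable Q (\<lambda>a. iexp (v * ?Z a) * exp (- (rkap a * q v)))"
  proof (rule L.Q.integrable_const_bound[of _ 1])
    show "AE a in Q. norm (iexp (v * ?Z a) * exp (- (rkap a * q v))) \<le> 1"
      using Re_q by (intro AE_I2) (auto simp: norm_mult norm_exp_eq_Re simp del: of_real_add of_real_mult)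
  qed measurable
  have "(\<integral>a. iexp (v * ?Z a) * (1 - exp (- (rkap a * q v))) \<partial>Q)
      = (\<integral>a. iexp (v * ?Z a) - iexp (v * ?Z a) * exp (- (rkap a * q v)) \<partial>Q)"
    by (simp only: right_diff_distrib mult_1_right)
  also have "\<dots> = (\<integral>a. iexp (v * ?Z a) \<partial>Q) - (\<integral>a. iexp (v * ?Z a) * exp (- (rkap a * q v)) \<partial>Q)"
    by (rule Bochner_Integration.integral_diff[OF i1 i2])
  also have "(\<integral>a. iexp (v * ?Z a) * exp (- (rkap a * q v)) \<partial>Q) = L.char_total f v"
    unfolding pt by (rule L.char_total_fixpoint[OF fm f0, symmetric])
  finally have B: "(\<integral>a. iexp (v * ?Z a) * (1 - exp (- (rkap a * q v))) \<partial>Q) = (\<integral>a. iexp (v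
      * ?Z a) \<partial>Q) - L.char_total f v" .
  have A: "(\<integral>a. rv_kernel \<alpha> (v * ?Z a) \<partial>Q) = 1 - (\<integral>a. iexp (v * ?Z a) \<partial>Q) + \<i> * of_real (v * \<mu>')"
  proof (cases "1 < \<alpha>")
    case True
    have iZ: "integrable Q ?Z" and mZ: "(\<integral>a. ?Z a \<partial>Q) = \<mu>'" using mean[OF True] by auto
    have i3: "integrable Q (\<lambda>a. \<i> * complex_of_real (v * ?Z a))"
      using iZ by (intro integrable_mult_right integrable_of_real) 
    have "(\<integral>a. rv_kernel \<alpha> (v * ?Z a) \<partial>Q) = (\<integral>a. (1 - iexp (v * ?Z a)) + \<i> * complex_of_real (v
        * ?Z a) \<partial>Q)"
      using True by (simp add: rv_kernel_def)
    also have "\<dots> = (\<integral>a. 1 - iexp (v * ?Z a) \<partial>Q) + (\<integral>a. \<i> * complex_of_real (v * ?Z a) \<partial>Q)"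
      using i1 i3 by (intro Bochner_Integration.integral_add) auto
    also have "(\<integral>a. 1 - iexp (v * ?Z a) \<partial>Q) = 1 - (\<integral>a. iexp (v * ?Z a) \<partial>Q)"
      using i1 L.Q.prob_space by (subst Bochner_Integration.integral_diff) auto
    also have "(\<integral>a. \<i> * complex_of_real (v * ?Z a) \<partial>Q) = \<i> * of_real (v * \<mu>')"
      unfolding integral_mult_right_zero integral_complex_of_real mZ ..
    finally show ?thesis .
  next
    case False
    have "(\<integral>a. rv_kernel \<alpha> (v * ?Z a) \<partial>Q) = (\<integral>a. 1 - iexp (v * ?Z a) \<partial>Q)"
      using False by (simp add: rv_kernel_def)
    also have "\<dots> = 1 - (\<integral>a. iexp (v * ?Z a) \<partial>Q)"
      using i1 L.Q.prob_space by (subst Bochner_Integration.integral_diff) auto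
    finally show ?thesis using mu0[OF False] by simp
  qed
  show ?thesis unfolding A B by (simp add: q_def)
qed

text \<open>Both parts of the theorem, with \<open>\<mu>' = 0\<close> when \<open>\<alpha> < 1\<close>. The condition \<open>(1 - p) \<alpha> < \<gamma>\<close> is what
  makes the overshoot negligible: its \<open>\<gamma>\<close>-th moment is of order \<open>t\<^sup>1\<^sup>-\<^sup>p\<close>, and \<open>a n\<close> grows almost like
  \<open>n\<^sup>1\<^sup>/\<^sup>\<alpha>\<close>.\<close>

lemma total_claim_stable_limit:
  assumes fm [measurable]: "f \<in> borel_measurable borel" and f0: "\<And>a. f a \<ge> 0"
    and \<alpha>: "\<alpha> \<in> {0<..<1} \<union> {1<..<2}"
    and \<gamma>: "0 < \<gamma>" "\<gamma> \<le> 1" and p: "0 < p" "p < 1" and gap: "(1 - p) * \<alpha> < \<gamma>"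
    and fin: "L.mean_total (\<lambda>z. L.timew p (fst z) * ennreal (f (snd z) powr \<gamma>)) \<infinity> < \<infinity>"
    and mu: "\<mu>' \<ge> 0" "\<not> 1 < \<alpha> \<Longrightarrow> \<mu>' = 0"
    and mean: "1 < \<alpha> \<Longrightarrow> integrable Q (\<lambda>a. f a + \<mu>' * rkap a) \<and> (\<integral>a. f a + \<mu>' * rkap a \<partial>Q) = \<mu>'"
    and rv: "rv_tail \<alpha> (\<lambda>x. measure Q {a \<in> space Q. f a + \<mu>' * rkap a > x})"
  shows "\<exists>(a :: nat \<Rightarrow> real) P. filterlim a at_top sequentially \<and> stable_law \<alpha> P \<and>
    conv_in_distr M (\<lambda>t \<omega>. (total_claim f \<Gamma> A C t \<omega> - t * \<nu> * \<mu>') / a (nat \<lfloor>\<nu> * t\<rfloor>)) P"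
proof -
  let ?Z = "\<lambda>a. f a + \<mu>' * rkap a"
  have \<alpha>': "0 < \<alpha>" "\<alpha> \<le> 2" using \<alpha> by auto
  define q :: "real \<Rightarrow> complex" where "q v = 1 - L.char_total f v + \<i> * of_real (v * \<mu>')" for v
  have q0: "q 0 = 0" by (simp add: q_def L.char_total_0)
  have qc: "isCont q v" for v
    unfolding q_def by (intro continuous_intros L.char_total_isCont) simp
  have qcnj: "q (- v) = cnj (q v)" for v by (simp add: q_def L.char_total_minus)
  have qRe: "Re (q v) \<ge> 0" for v
    using complex_Re_le_cmod[of "L.char_total f v"] L.char_total_le_1[OF fm, of v] by (simp add: q_def)
  have fix_eq: "q v = (\<integral>a. rv_kernel \<alpha> (v * ?Z a) \<partial>Q) + (\<integral>a. iexp (v * ?Z a) * (1 - exp (- (rkap a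
      * q v))) \<partial>Q)" for v
    unfolding q_def by (rule centred_char_fixpoint[OF fm f0 mean mu(2)])
  have "\<exists>c. Re c > 0 \<and> ((\<lambda>x. q (1 / x) / measure Q {a \<in> space Q. ?Z a > x}) \<longlongrightarrow> c) at_top"
  proof (rule fixpoint_transfer[where k=rkap and \<alpha>=\<alpha>])
    show "?Z \<in> borel_measurable Q" by measurable
    show "?Z a \<ge> 0" for a using f0 mu by simp
    show "(q \<longlongrightarrow> 0) (at 0)" using qc[of 0] by (simp add: isCont_def q0)
    show "rkap a \<ge> 0" for a by simp
  qed (rule Q_prob rv \<alpha> rkap_integrable rkap_less_1 qRe fix_eq)+
  then obtain c where c: "Re c > 0" "((\<lambda>x. q (1 / x) / measure Q {a \<in> space Q. ?Z a > x}) \<longlongrightarrow> c) at_top"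
    by blast
  obtain a :: "nat \<Rightarrow> real" and C' :: complex where a: "filterlim a at_top sequentially"
      and C': "Re C' > 0"
    and conv: "\<And>u. (\<lambda>n. of_nat n * q (u / a n)) \<longlonglongrightarrow> stable_exponent \<alpha> C' u"
    and growth: "\<And>b g. b \<ge> 0 \<Longrightarrow> b * \<alpha> < g \<Longrightarrow> (\<lambda>n. real n powr b / a n powr g) \<longlonglongrightarrow> 0"
    by (rule normalising_sequence[OF rv \<alpha>'(1) qc q0 qcnj c]) (rule that)
  obtain d where d: "d \<ge> 0" "\<And>t v. t > 0 \<Longrightarrow>
    norm ((\<integral>\<omega>. iexp (v * total_claim f \<Gamma> A C t \<omega>) \<partial>M) - (\<integral>\<omega>. iexp (v * cluster_sum f t \<omega>) \<partial>M))
      \<le> d * \<bar>v\<bar> powr \<gamma> * t powr (1 - p)"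
    by (rule char_total_claim_close[OF fm f0 \<gamma> p fin]) (rule that)
  define n where "n t = nat \<lfloor>\<nu> * t\<rfloor>" for t
  define b where "b t = a (n t)" for t
  have lin: "filterlim (\<lambda>t. \<nu> * t) at_top at_top"
    by (rule filterlim_tendsto_pos_mult_at_top[OF tendsto_const nu_pos filterlim_ident])
  have n_lim: "filterlim n sequentially at_top"
    unfolding n_def
    by (rule filterlim_compose[OF filterlim_nat_sequentially filterlim_compose[OF
        filterlim_floor_sequentially lin]])
  have b_lim: "filterlim b at_top at_top"
    unfolding b_def by (rule filterlim_compose[OF a n_lim])
  have ev: "eventually (\<lambda>t. t > 0 \<and> n t > 0 \<and> b t > 0 \<and> real (n t) \<le> \<nu> * t \<and> \<nu> * t \<le> real (n t)
      + 1) at_top"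
    using eventually_gt_at_top[of 0] filterlim_at_top_dense[THEN iffD1, OF b_lim, rule_format, of 0]
      eventually_compose_filterlim[OF eventually_gt_at_top[of 0] n_lim]
  proof eventually_elim
    case (elim t)
    have "0 \<le> \<nu> * t" using elim nu_pos by simp
    then have "real (n t) \<le> \<nu> * t" "\<nu> * t \<le> real (n t) + 1" unfolding n_def by linarith+
    then show ?case using elim by simp
  qed
  have ratio: "((\<lambda>t. \<nu> * t / real (n t)) \<longlongrightarrow> 1) at_top"
  proof (rule tendsto_sandwich)
    show "eventually (\<lambda>t. 1 \<le> \<nu> * t / real (n t)) at_top"
      using ev by eventually_elim (simp add: field_simps)
    show "eventually (\<lambda>t. \<nu> * t / real (n t) \<le> 1 + 1 / real (n t)) at_top"
      using ev by eventually_elim (simp add: field_simps)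
    have "((\<lambda>t. 1 / real (n t)) \<longlongrightarrow> 0) at_top"
      by (rule filterlim_compose[OF lim_1_over_n n_lim])
    from tendsto_add[OF tendsto_const[of 1] this]
    show "((\<lambda>t. 1 + 1 / real (n t)) \<longlongrightarrow> 1) at_top" by simp
  qed simp
  have lim: "((\<lambda>t. \<integral>\<omega>. iexp (u * ((total_claim f \<Gamma> A C t \<omega> - t * \<nu> * \<mu>') / b t)) \<partial>M)
      \<longlongrightarrow> exp (- stable_exponent \<alpha> C' u)) at_top" for u
  proof -
    let ?ch = "\<lambda>t. \<integral>\<omega>. iexp (u * ((total_claim f \<Gamma> A C t \<omega> - t * \<nu> * \<mu>') / b t)) \<partial>M"
    let ?w = "\<lambda>t. iexp (- (u / b t * (t * \<nu> * \<mu>')))"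
    have ch: "?ch t = ?w t * (\<integral>\<omega>. iexp (u / b t * total_claim f \<Gamma> A C t \<omega>) \<partial>M)" for t
    proof -
      have "iexp (u * ((x - y) / b t)) = iexp (- (u / b t * y)) * iexp (u / b t * x)" for x y
        unfolding exp_add[symmetric] by (rule arg_cong[where f=exp]) (simp add: diff_divide_distrib
            algebra_simps)
      then show ?thesis by (simp only: integral_mult_right_zero)
    qed
    have main: "((\<lambda>t. ?w t * (\<integral>\<omega>. iexp (u / b t * cluster_sum f t \<omega>) \<partial>M))
        \<longlongrightarrow> exp (- stable_exponent \<alpha> C' u)) at_top"
    proof (rule Lim_transform_eventually)
      have "((\<lambda>t. of_nat (n t) * q (u / b t)) \<longlongrightarrow> stable_exponent \<alpha> C' u) at_top"
        unfolding b_def by (rule filterlim_compose[OF conv n_lim])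
      from tendsto_mult[OF tendsto_of_real[OF ratio] this]
      have "((\<lambda>t. of_real (\<nu> * t / real (n t)) * (of_nat (n t) * q (u / b t)))
          \<longlongrightarrow> stable_exponent \<alpha> C' u) at_top"
        by simp
      then show "((\<lambda>t. exp (- (of_real (\<nu> * t / real (n t)) * (of_nat (n t) * q (u / b t)))))
          \<longlongrightarrow> exp (- stable_exponent \<alpha> C' u)) at_top"
        by (intro tendsto_exp tendsto_minus)
      show "eventually (\<lambda>t. exp (- (of_real (\<nu> * t / real (n t)) * (of_nat (n t) * q (u / b t))))
          = ?w t * (\<integral>\<omega>. iexp (u / b t * cluster_sum f t \<omega>) \<partial>M)) at_top"
        using ev
      proof eventually_elim
        case (elim t)
        have "of_real (\<nu> * t / real (n t)) * (of_nat (n t) * q (u / b t)) = of_real (\<nu> * t) * q (u / b t)"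
          using elim by simp
        moreover have "(\<integral>\<omega>. iexp (u / b t * cluster_sum f t \<omega>) \<partial>M) = exp (- (of_real (\<nu> * t)
            * (1 - L.char_total f (u / b t))))"
          by (rule char_cluster_sum[OF fm]) (use elim in simp)
        ultimately show ?case
          unfolding q_def by (simp only: exp_add[symmetric]) (rule arg_cong[where f=exp], simp add:
              algebra_simps)
      qed
    qed
    let ?B = "\<lambda>t. d * \<bar>u\<bar> powr \<gamma> * (2 / \<nu>) powr (1 - p) * (real (n t) powr (1 - p) / b t powr \<gamma>)"
    have small: "((\<lambda>t. d * \<bar>u / b t\<bar> powr \<gamma> * t powr (1 - p)) \<longlongrightarrow> 0) at_top"
    proof (rule tendsto_sandwich[where f="\<lambda>_. 0" and h="?B"])
      have "((\<lambda>t. real (n t) powr (1 - p) / b t powr \<gamma>) \<longlongrightarrow> 0) at_top"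
        unfolding b_def by (rule filterlim_compose[OF growth n_lim]) (use p gap in auto)
      from tendsto_mult_left[OF this, of "d * \<bar>u\<bar> powr \<gamma> * (2 / \<nu>) powr (1 - p)"]
      show "(?B \<longlongrightarrow> 0) at_top" by simp
      show "eventually (\<lambda>t. d * \<bar>u / b t\<bar> powr \<gamma> * t powr (1 - p) \<le> ?B t) at_top"
        using ev
      proof eventually_elim
        case (elim t)
        have "\<nu> * t \<le> 2 * real (n t)" using elim by linarith
        then have "t \<le> 2 / \<nu> * real (n t)" using nu_pos by (simp add: field_simps)
        then have "t powr (1 - p) \<le> (2 / \<nu> * real (n t)) powr (1 - p)"
          using elim p by (intro powr_mono2) auto
        also have "\<dots> = (2 / \<nu>) powr (1 - p) * real (n t) powr (1 - p)" by (rule powr_mult)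
        finally have t: "t powr (1 - p) \<le> (2 / \<nu>) powr (1 - p) * real (n t) powr (1 - p)" .
        have "\<bar>u / b t\<bar> powr \<gamma> = \<bar>u\<bar> powr \<gamma> / b t powr \<gamma>"
          using elim by (simp add: powr_divide)
        then have "d * \<bar>u / b t\<bar> powr \<gamma> * t powr (1 - p) = d * (\<bar>u\<bar> powr \<gamma> / b t powr \<gamma>)
            * t powr (1 - p)" by simp
        also have "\<dots> \<le> d * (\<bar>u\<bar> powr \<gamma> / b t powr \<gamma>) * ((2 / \<nu>) powr (1 - p) * real (n t) powr (1 - p))"
          using d(1) by (intro mult_left_mono t mult_nonneg_nonneg) auto
        also have "\<dots> = ?B t" by (simp add: field_simps)
        finally show ?case .
      qed
    qed (use d(1) in auto)
    have "((\<lambda>t. ?ch t - ?w t * (\<integral>\<omega>. iexp (u / b t * cluster_sum f t \<omega>) \<partial>M)) \<longlongrightarrow> 0) at_top"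
    proof (rule Lim_null_comparison[OF _ small])
      show "eventually (\<lambda>t. norm (?ch t - ?w t * (\<integral>\<omega>. iexp (u / b t * cluster_sum f t \<omega>) \<partial>M))
          \<le> d * \<bar>u / b t\<bar> powr \<gamma> * t powr (1 - p)) at_top"
        using eventually_gt_at_top[of 0]
      proof eventually_elim
        case (elim t)
        have w: "norm (?w t) = 1" by (rule norm_exp_i_times)
        show ?case
          unfolding ch right_diff_distrib[symmetric] norm_mult w mult_1 by (rule d(2)[OF elim])
      qed
    qed
    from tendsto_add[OF this main] show ?thesis by simp
  qed
  have "\<exists>P. stable_law \<alpha> P \<and> conv_in_distr M (\<lambda>t \<omega>. (total_claim f \<Gamma> A C t \<omega> - t * \<nu> * \<mu>') / b t) P"
  proof (rule stable_limit_of_char[OF prob_space_axioms _ \<alpha>' C' lim])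
    show "(\<lambda>\<omega>. (total_claim f \<Gamma> A C t \<omega> - t * \<nu> * \<mu>') / b t) \<in> borel_measurable M" for t
      using total_claim_measurable[OF fm, of t] by measurable
  qed
  then show ?thesis using a unfolding b_def n_def by blast
qed

end

section \<open>The stable limit of the total claim amount\<close>

theorem theorem5p3:
  fixes M :: "'w measure"
    and Q :: "'s::polish_space measure"
    and h :: "real \<Rightarrow> 's \<Rightarrow> real"
    and f :: "'s \<Rightarrow> real"
    and \<nu> \<alpha> :: real
  assumes hawkes: "marked_hawkes M Q \<nu> h K \<Gamma> A C"
    and f_measurable: "f \<in> borel_measurable borel"
    and f_nonneg: "\<And>a. f a \<ge> 0"
    and subcritical: "kappa h Q < 1"
    and alpha: "\<alpha> \<in> {0<..<1} \<union> {1<..<2}"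
    and X_rv: "regularly_varying_rv Q (\<lambda>a. ennreal (f a)) \<alpha>"
    and Y_rv: "1 < \<alpha> \<Longrightarrow>
      regularly_varying_rv Q (\<lambda>a. ennreal (f a) + kappa_mark h a * mu_D M f A C) \<alpha>"
  shows "(\<alpha> < 1 \<and> (\<exists>\<delta>>0. ((\<lambda>t. ennreal (t powr \<delta>) * mean_tail h Q t) \<longlongrightarrow> 0) at_top) \<longrightarrow>
      (\<exists>(a :: nat \<Rightarrow> real) P. filterlim a at_top sequentially \<and> stable_law \<alpha> P \<and>
        conv_in_distr M (\<lambda>t \<omega>. total_claim f \<Gamma> A C t \<omega> / a (nat \<lfloor>\<nu> * t\<rfloor>)) P))
    \<and> (1 < \<alpha> \<and> (\<exists>\<delta>>0. ((\<lambda>t. ennreal (t powr (1 + \<delta> - 1 / \<alpha>)) * mean_tail h Q t) \<longlongrightarrow> 0) at_top) \<longrightarrow>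
      (\<exists>(a :: nat \<Rightarrow> real) P. filterlim a at_top sequentially \<and> stable_law \<alpha> P \<and>
        conv_in_distr M (\<lambda>t \<omega>.
          (total_claim f \<Gamma> A C t \<omega> - t * \<nu> * enn2real (mu_D M f A C)) / a (nat \<lfloor>\<nu> * t\<rfloor>)) P))"
proof -
  interpret marked_hawkes M Q \<nu> h K \<Gamma> A C by (rule hawkes)
  interpret subcritical_hawkes M Q \<nu> h K \<Gamma> A C by unfold_locales (rule subcritical)
  note [measurable] = f_measurable
  have fQ [measurable]: "f \<in> borel_measurable Q" by measurable
  have X: "rv_tail \<alpha> (\<lambda>x. measure Q {a \<in> space Q. f a > x})"
    by (rule rv_tail_cong[OF _ rv_tail_of_regularly_varying[OF Q_prob X_rv]]) (simp add: ennreal_less_iff)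
  have moment: "(\<integral>\<^sup>+a. ennreal (f a powr \<gamma>) \<partial>Q) < \<infinity>" if "0 < \<gamma>" "\<gamma> < \<alpha>" for \<gamma>
    using rv_moment[OF Q_prob fQ f_nonneg X that] by (simp add: integrable_iff_bounded)
  have timed: "L.mean_total (\<lambda>z. L.timew p (fst z) * ennreal (f (snd z) powr \<gamma>)) \<infinity> < \<infinity>"
    if "0 < p" "p < 1" "0 < \<gamma>" "\<gamma> < \<alpha>" "p < q" "((\<lambda>t. ennreal (t powr q) * mean_tail h Q t)
        \<longlongrightarrow> 0) at_top" for p q \<gamma>
    using that moment[of \<gamma>] L.kap_moment_finite[of q p]
    by (intro L.mean_timed_finite[where v="\<lambda>b. ennreal (f b powr \<gamma>)"]) auto
  show ?thesis
  proof (intro conjI impI)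
    assume "\<alpha> < 1 \<and> (\<exists>\<delta>>0. ((\<lambda>t. ennreal (t powr \<delta>) * mean_tail h Q t) \<longlongrightarrow> 0) at_top)"
    then obtain \<delta> where \<alpha>1: "\<alpha> < 1" and \<delta>: "\<delta> > 0" "((\<lambda>t. ennreal (t powr \<delta>) * mean_tail h Q t)
        \<longlongrightarrow> 0) at_top"
      by blast
    have \<alpha>0: "0 < \<alpha>" using alpha by auto
    \<comment> \<open>The choice of \<open>p < \<delta>\<close> gives a finite moment of the displacements; \<open>\<gamma>\<close> lies between \<open>(1 - p)
        \<alpha>\<close> and \<open>\<alpha>\<close>.\<close>
    define p where "p = min (\<delta> / 2) (1 / 2)"
    have p: "0 < p" "p < 1" "p < \<delta>" using \<delta>(1) by (auto simp: p_def min_def)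
    define \<gamma> where "\<gamma> = (1 - p / 2) * \<alpha>"
    have \<gamma>: "0 < \<gamma>" "\<gamma> < \<alpha>" "(1 - p) * \<alpha> < \<gamma>"
      using p \<alpha>0 by (auto simp: \<gamma>_def)
    have "\<exists>(a :: nat \<Rightarrow> real) P. filterlim a at_top sequentially \<and> stable_law \<alpha> P \<and>
        conv_in_distr M (\<lambda>t \<omega>. (total_claim f \<Gamma> A C t \<omega> - t * \<nu> * 0) / a (nat \<lfloor>\<nu> * t\<rfloor>)) P"
    proof (rule total_claim_stable_limit[OF f_measurable f_nonneg alpha \<gamma>(1) _ p(1,2) \<gamma>(3)])
      show "L.mean_total (\<lambda>z. L.timew p (fst z) * ennreal (f (snd z) powr \<gamma>)) \<infinity> < \<infinity>"
        by (rule timed[OF p(1,2) \<gamma>(1,2) p(3) \<delta>(2)])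
    qed (use \<alpha>1 \<gamma> X in auto)
    then show "\<exists>(a :: nat \<Rightarrow> real) P. filterlim a at_top sequentially \<and> stable_law \<alpha> P \<and>
        conv_in_distr M (\<lambda>t \<omega>. total_claim f \<Gamma> A C t \<omega> / a (nat \<lfloor>\<nu> * t\<rfloor>)) P"
      by simp
  next
    assume "1 < \<alpha> \<and> (\<exists>\<delta>>0. ((\<lambda>t. ennreal (t powr (1 + \<delta> - 1 / \<alpha>)) * mean_tail h Q t) \<longlongrightarrow> 0) at_top)"
    then obtain \<delta> where \<alpha>1: "1 < \<alpha>" and \<delta>: "\<delta> > 0" "((\<lambda>t. ennreal (t powr (1 + \<delta> - 1 / \<alpha>))
        * mean_tail h Q t) \<longlongrightarrow> 0) at_top"
      by blast
    \<comment> \<open>With a finite mean claim, \<open>\<gamma> = 1\<close> is possible, and \<open>p\<close> may be taken slightly above \<open>1 - 1 / \<alpha>\<close>.\<close>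
    define e where "e = min (\<delta> / 2) (1 / (2 * \<alpha>))"
    have e: "0 < e" "e < \<delta>" "e < 1 / \<alpha>"
    proof -
      show "0 < e" using \<delta>(1) \<alpha>1 by (simp add: e_def)
      have "e \<le> \<delta> / 2" "e \<le> 1 / (2 * \<alpha>)" unfolding e_def by (rule min.cobounded1, rule min.cobounded2)
      moreover have "\<delta> / 2 < \<delta>" "1 / (2 * \<alpha>) < 1 / \<alpha>" using \<delta>(1) \<alpha>1 by (auto simp: field_simps)
      ultimately show "e < \<delta>" "e < 1 / \<alpha>" by (auto intro: order.strict_trans1)
    qed
    define p where "p = 1 - 1 / \<alpha> + e"
    have inv: "1 / \<alpha> < 1" using \<alpha>1 by simp
    have p: "0 < p" "p < 1" "p < 1 + \<delta> - 1 / \<alpha>" using e inv by (auto simp: p_def)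
    have gap: "(1 - p) * \<alpha> < 1"
    proof -
      have "(1 - p) * \<alpha> = 1 - e * \<alpha>" using \<alpha>1 by (simp add: p_def field_simps)
      moreover have "e * \<alpha> > 0" using e \<alpha>1 by simp
      ultimately show ?thesis by simp
    qed
    define D where "D = mu_D M f A C"
    have intf: "integrable Q f" using rv_moment[OF Q_prob fQ f_nonneg X, of 1] \<alpha>1 f_nonneg by simp
    have meanf: "(\<integral>\<^sup>+a. ennreal (f a) \<partial>Q) < \<infinity>" using moment[of 1] \<alpha>1 f_nonneg by simp
    have mt: "L.mean_total (\<lambda>z. ennreal (f (snd z))) \<infinity> < \<infinity>"
      by (rule L.mean_marks_finite[OF _ meanf]) simp
    have D_eq: "D = (\<integral>\<^sup>+a. ennreal (f a) \<partial>Q) + L.mean_total (\<lambda>z. ennreal (f (snd z))) \<infinity>"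
      unfolding D_def by (rule mu_D_eq[OF f_measurable])
    have "L.mean_total (\<lambda>z. ennreal (f (snd z))) \<infinity> = kappa h Q * D"
      unfolding D_eq using L.mean_marks_rec[of "\<lambda>b. ennreal (f b)" \<infinity>] by simp
    then have D_fix: "D = (\<integral>\<^sup>+a. ennreal (f a) \<partial>Q) + kappa h Q * D" using D_eq by simp
    have D_fin: "D < \<infinity>" unfolding D_eq using meanf mt by (simp add: less_top[symmetric])
    define \<mu>' where "\<mu>' = enn2real D"
    have \<mu>': "\<mu>' \<ge> 0" "D = ennreal \<mu>'" using D_fin by (auto simp: \<mu>'_def)
    \<comment> \<open>In the equation \<open>\<mu>\<^sub>D = E X + \<kappa> \<mu>\<^sub>D\<close> all terms are finite; it says that \<open>Y\<close> has mean \<open>\<mu>\<^sub>D\<close>.\<close>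
    have real_fix: "\<mu>' = (\<integral>a. f a \<partial>Q) + (\<integral>a. rkap a \<partial>Q) * \<mu>'"
    proof -
      have nn: "0 \<le> (\<integral>a. f a \<partial>Q)" "0 \<le> (\<integral>a. rkap a \<partial>Q)" using f_nonneg
          by (auto intro!: integral_nonneg_AE)
      have "ennreal \<mu>' = ennreal (\<integral>a. f a \<partial>Q) + ennreal (\<integral>a. rkap a \<partial>Q) * ennreal \<mu>'"
        using D_fix unfolding \<mu>'(2) rkap_integral using intf f_nonneg
            by (simp add: nn_integral_eq_integral)
      also have "\<dots> = ennreal ((\<integral>a. f a \<partial>Q) + (\<integral>a. rkap a \<partial>Q) * \<mu>')"
        using nn \<mu>'(1) by (simp add: ennreal_mult ennreal_plus)
      finally show ?thesis using nn \<mu>'(1) by (subst (asm) ennreal_inj) auto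
    qed
    have Zint: "integrable Q (\<lambda>a. f a + \<mu>' * rkap a) \<and> (\<integral>a. f a + \<mu>' * rkap a \<partial>Q) = \<mu>'"
      using intf rkap_integrable real_fix by (simp add: mult.commute)
    have Y: "rv_tail \<alpha> (\<lambda>x. measure Q {a \<in> space Q. f a + \<mu>' * rkap a > x})"
    proof (rule rv_tail_cong[OF _ rv_tail_of_regularly_varying[OF Q_prob Y_rv[OF \<alpha>1]]])
      fix x :: real assume x: "x > 0"
      have [measurable]: "kappa_mark h \<in> borel_measurable Q" by measurable
      show "measure Q {a \<in> space Q. ennreal x < ennreal (f a) + kappa_mark h a * mu_D M f A C}
          = measure Q {a \<in> space Q. x < f a + \<mu>' * rkap a}"
      proof (rule measure_eq_AE)
        show "AE a in Q. a \<in> {a \<in> space Q. ennreal x < ennreal (f a) + kappa_mark h a * mu_D M f A C}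
            \<longleftrightarrow> a \<in> {a \<in> space Q. x < f a + \<mu>' * rkap a}"
          using L.kap_finite
        proof eventually_elim
          case (elim a)
          have "kappa_mark h a = ennreal (rkap a)" using elim by simp
          then have "ennreal (f a) + kappa_mark h a * mu_D M f A C = ennreal (f a)
              + ennreal (rkap a) * ennreal \<mu>'"
            unfolding D_def[symmetric] \<mu>'(2) by simp
          also have "\<dots> = ennreal (f a + \<mu>' * rkap a)"
            using f_nonneg \<mu>'(1) by (simp add: ennreal_plus ennreal_mult mult.commute)
          finally have eq: "ennreal (f a) + kappa_mark h a * mu_D M f A C = ennreal (f a + \<mu>' * rkap a)" .
          show ?case unfolding eq mem_Collect_eq using x by (subst ennreal_less_iff) auto
        qed
      qed measurable
    qed
    have "\<exists>(a :: nat \<Rightarrow> real) P. filterlim a at_top sequentially \<and> stable_law \<alpha> P \<and>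
        conv_in_distr M (\<lambda>t \<omega>. (total_claim f \<Gamma> A C t \<omega> - t * \<nu> * \<mu>') / a (nat \<lfloor>\<nu> * t\<rfloor>)) P"
    proof (rule total_claim_stable_limit[OF f_measurable f_nonneg alpha _ _ p(1,2) gap])
      show "L.mean_total (\<lambda>z. L.timew p (fst z) * ennreal (f (snd z) powr 1)) \<infinity> < \<infinity>"
        by (rule timed[OF p(1,2) _ \<alpha>1 p(3) \<delta>(2)]) simp
      show "\<mu>' \<ge> 0" "rv_tail \<alpha> (\<lambda>x. measure Q {a \<in> space Q. f a + \<mu>' * rkap a > x})"
        by (rule \<mu>'(1), rule Y)
      show "\<mu>' = 0" if "\<not> 1 < \<alpha>" using that \<alpha>1 by contradiction
      show "integrable Q (\<lambda>a. f a + \<mu>' * rkap a) \<and> (\<integral>a. f a + \<mu>' * rkap a \<partial>Q) = \<mu>'" by (rule Zint)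
    qed simp_all
    then show "\<exists>(a :: nat \<Rightarrow> real) P. filterlim a at_top sequentially \<and> stable_law \<alpha> P \<and>
        conv_in_distr M (\<lambda>t \<omega>.
          (total_claim f \<Gamma> A C t \<omega> - t * \<nu> * enn2real (mu_D M f A C)) / a (nat \<lfloor>\<nu> * t\<rfloor>)) P"
      unfolding \<mu>'_def D_def .
  qed
qed

end
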